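(* Let $a\in\mathbb C\setminus\{0,1\}$, let $\delta,\alpha_1,\alpha_2,\alpha_3\in\mathbb C$ with $2\delta,2\alpha_1,2\alpha_2,2\alpha_3\notin\mathbb Z$, and let the graph $\gamma$ and the matrices $M_j,E_j$ $(j=1,2,3)$, $M_\infty$ be as in the context. Suppose the Riemann–Hilbert problem stated in the context has a solution $\Psi(\lambda)$. Then $\Psi$ determines a fundamental system of solutions, with the prescribed monodromy properties, of the general Heun equation $$u''+\Big(\frac{1-2\alpha_1}{\lambda}+\frac{1-2\alpha_2}{\lambda-a}+\frac{1-2\alpha_3}{\lambda-1}\Big)u'+\frac{\mu\lambda+\nu}{\lambda(\lambda-a)(\lambda-1)}u=0,$$ where $$\mu=(\alpha_1+\alpha_2+\alpha_3-\delta)(\alpha_1+\alpha_2+\alpha_3+\delta-2),$$ $$\nu=\alpha_1+\alpha_2-(\alpha_1+\alpha_2)^2+\alpha_3^2-\delta^2+a\big(\alpha_1+\alpha_3-(\alpha_1+\alpha_3)^2+\alpha_2^2-\delta^2\big)+b_3(2\delta-1),$$ $$b_3=\delta(a+1)-d_1,\qquad d_1=\lim_{\lambda\to\infty}\lambda\big(\Psi(\lambda)\lambda^{\delta\sigma_3}-I\big)_{11}.$$ Namely, the functions $u_k(\lambda)=\lambda^{\alpha_1}(\lambda-a)^{\alpha_2}(\lambda-1)^{\alpha_3}\Psi_{1k}(\lambda)$, $k=1,2$, considered in $D_\infty$, form a fundamental system of solutions of this equation, and the analytic continuation of the row $(u_1,u_2)$ from $D_\infty$ along a small counterclockwise loop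 around $\lambda_j$ encircling the disc $D_j$ and crossing $\gamma$ only once, at the arc $\ell_j$, is $e^{2\pi i\alpha_j}(u_1,u_2)M_j$, $j=1,2,3$.
   Context: Notation: $\sigma_3=\operatorname{diag}(1,-1)$; $\lambda_1=0$, $\lambda_2=a$, $\lambda_3=1$. Graph. Let $\lambda_0\in\mathbb C\setminus\{0,1,a\}$ be a base point, and let $\ell_1,\ell_2,\ell_3,\ell_\infty$ be simple smooth arcs joining $\lambda_0$ to $\lambda_1,\lambda_2,\lambda_3,\infty$ respectively (straight segments/rays $[\lambda_0,\lambda_j]$, $[\lambda_0,\infty)$ whenever possible), pairwise disjoint except at $\lambda_0$ and leaving $\lambda_0$ in the counterclockwise cyclic order $\ell_1,\ell_2,\ell_3,\ell_\infty$. Let $\mathcal C_j$ be small disjoint circles around $\lambda_j$ ($j=1,2,3$), not enclosing $\lambda_0$, not meeting the other arcs, and meeting $\ell_j$ once; $D_j$ is the open disc bounded by $\mathcal C_j$. Put $\gamma=\ell_1\cup\ell_2\cup\ell_3\cup\ell_\infty\cup\mathcal C_1\cup\mathcal C_2\cup\mathcal C_3$ and $D_\infty=\mathbb C\setminus(\gamma\cup D_1\cup D_2\cup D_3)$. Orientation: $\ell_j$ from $\lambda_0$ to $\lambda_j$ ($j=1,2,3$), $\ell_\infty$ from $\infty$ to $\lambda_0$, $\mathcal C_j$ counterclockwise. The $+$ side is the left side. Jump data. $E_j\in SL(2,\mathbb C)$, $M_j=E_je^{2\pi i\alpha_j\sigma_3}E_j^{-1}$ ($j=1,2,3$), $M_\infty=e^{-2\pi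 i\delta\sigma_3}$, with $M_1M_2M_3=M_\infty$. The piecewise constant matrix $G$ on $\gamma$ is: $G=M_j$ on the part of $\ell_j$ outside $D_j$; $G=e^{2\pi i\alpha_j\sigma_3}$ on the part of $\ell_j$ inside $D_j$; $G=E_j$ on $\mathcal C_j$; $G=M_\infty$ on $\ell_\infty$. Branches: near $\infty$, $\lambda^{\delta}$ is cut along $\ell_\infty$ with $\arg\lambda\to\pi$ as $\lambda\to-\infty$ ($\ell_\infty$ is assumed to go to infinity away from the negative real axis); in $D_j$, $(\lambda-\lambda_j)^{\alpha_j}$ is a branch cut along $\ell_j\cap D_j$; in $D_\infty$, the product $\lambda^{\alpha_1}(\lambda-a)^{\alpha_2}(\lambda-1)^{\alpha_3}$ is any fixed analytic branch. Riemann–Hilbert problem. Find a $2\times2$ matrix function $\Psi(\lambda)$, holomorphic in $\mathbb C\setminus\gamma$, such that: (1) $\|\Psi(\lambda)\lambda^{\delta\sigma_3}-I\|\le C|\lambda|^{-1}$ as $\lambda\to\infty$, with a constant $C$; (2) $\lim_{\lambda\to\infty}\lambda\big(\Psi(\lambda)\lambda^{\delta\sigma_3}-I\big)_{12}=0$; (3) $\|\Psi(\lambda)(\lambda-\lambda_j)^{-\alpha_j\sigma_3}\|\le C_j$ as $\lambda\to\lambda_j$, with constants $C_j$, $j=1,2,3$; (4) $\|\Psi(\lambda)\|\le C_0$, with a constant $C_0$, as $\lambda$ approaches any nodal point of $\gamma$ (the point $\lambda_0$ and the points $\ell_j\cap\mathcal C_j$); (5) $\Psi_+(\lambda)=\Psi_-(\lambda)G(\lambda)$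 for $\lambda\in\gamma$, where $\Psi_\pm$ are the continuous limits from the left/right side.
   Formalization: Linear independence of u_1, u_2 is claimed only if Ψ_12 is not identically zero on D_∞; otherwise u_2=0, which can occur (α_j=1/5, δ=-3/5, E_j=I, diagonal Ψ). The Heun equation, the existence of d_1 and the monodromy are proved unconditionally. *)

theory Defs
  imports "HOL-Complex_Analysis.Complex_Analysis"
begin

subsection \<open>The graph\<close>

text \<open>
  The index type 3 has the elements 1, 2 and 3 (where 3 = 0); the singular points
  are \<open>\<lambda>\<^sub>1 = 0\<close>, \<open>\<lambda>\<^sub>2 = a\<close>, \<open>\<lambda>\<^sub>3 = 1\<close>.
\<close>

definition sing :: "complex \<Rightarrow> 3 \<Rightarrow> complex" where
  "sing a j = (if j = 1 then 0 else if j = 2 then a else 1)"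

text \<open>
  All arcs are parametrized in the direction of their orientation: \<open>ell j\<close> on \<open>[0,1]\<close>, from the
  base point to \<open>sing a j\<close>; \<open>ell_inf\<close> on \<open>(-\<infinity>,0]\<close>, from infinity to the base point.
  \<open>rad j\<close> is the radius of the circle around \<open>sing a j\<close>.
\<close>

record graph_data =
  base :: complex
  ell :: "3 \<Rightarrow> real \<Rightarrow> complex"
  ell_inf :: "real \<Rightarrow> complex"
  rad :: "3 \<Rightarrow> real"

definition ell_img :: "graph_data \<Rightarrow> 3 \<Rightarrow> complex set" where
  "ell_img \<Gamma> j = ell \<Gamma> j ` {0..1}"

definition ell_inf_img :: "graph_data \<Rightarrow> complex set" where
  "ell_inf_img \<Gamma> = ell_inf \<Gamma> ` {..0}"

definition circ :: "complex \<Rightarrow> graph_data \<Rightarrow> 3 \<Rightarrow> complex set" where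
  "circ a \<Gamma> j = sphere (sing a j) (rad \<Gamma> j)"

definition disc :: "complex \<Rightarrow> graph_data \<Rightarrow> 3 \<Rightarrow> complex set" where
  "disc a \<Gamma> j = ball (sing a j) (rad \<Gamma> j)"

definition gamma :: "complex \<Rightarrow> graph_data \<Rightarrow> complex set" where
  "gamma a \<Gamma> = (\<Union>j. ell_img \<Gamma> j) \<union> ell_inf_img \<Gamma> \<union> (\<Union>j. circ a \<Gamma> j)"

definition D_inf :: "complex \<Rightarrow> graph_data \<Rightarrow> complex set" where
  "D_inf a \<Gamma> = - (gamma a \<Gamma> \<union> (\<Union>j. disc a \<Gamma> j))"

text \<open>
  Smooth means continuously differentiable with non-vanishing derivative, one-sided at the end
  points; this covers arcs of any higher regularity.
\<close>

definition simple_smooth_on :: "real set \<Rightarrow> (real \<Rightarrow> complex) \<Rightarrow> bool" where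
  "simple_smooth_on I p \<longleftrightarrow> inj_on p I \<and>
     (\<exists>p'. continuous_on I p' \<and>
        (\<forall>t\<in>I. (p has_vector_derivative p' t) (at t within I) \<and> p' t \<noteq> 0))"

text \<open>
  The sets \<open>A\<close>, \<open>B\<close>, \<open>C\<close>, \<open>D\<close> will be smooth arcs issuing from \<open>z\<close>. Such an arc meets every
  sufficiently small circle around \<open>z\<close> in exactly one point, so that their cyclic order at \<open>z\<close>
  is the order of these points on the circle. The arcs may have equal tangents at \<open>z\<close>.
\<close>

definition counterclockwise_at ::
    "complex \<Rightarrow> complex set \<Rightarrow> complex set \<Rightarrow> complex set \<Rightarrow> complex set \<Rightarrow> bool" where
  "counterclockwise_at z A B C D \<longleftrightarrow>
     (\<forall>\<^sub>F r in at_right 0.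
        \<forall>w\<^sub>1\<in>A \<inter> sphere z r. \<forall>w\<^sub>2\<in>B \<inter> sphere z r. \<forall>w\<^sub>3\<in>C \<inter> sphere z r. \<forall>w\<^sub>4\<in>D \<inter> sphere z r.
          \<exists>t\<^sub>1 t\<^sub>2 t\<^sub>3 t\<^sub>4. t\<^sub>1 < t\<^sub>2 \<and> t\<^sub>2 < t\<^sub>3 \<and> t\<^sub>3 < t\<^sub>4 \<and> t\<^sub>4 < t\<^sub>1 + 2 * pi \<and>
            w\<^sub>1 = z + rcis r t\<^sub>1 \<and> w\<^sub>2 = z + rcis r t\<^sub>2 \<and> w\<^sub>3 = z + rcis r t\<^sub>3 \<and> w\<^sub>4 = z + rcis r t\<^sub>4)"

definition rh_graph :: "complex \<Rightarrow> graph_data \<Rightarrow> bool" where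
  "rh_graph a \<Gamma> \<longleftrightarrow>
     base \<Gamma> \<notin> {0, 1, a} \<and>
     (\<forall>j. simple_smooth_on {0..1} (ell \<Gamma> j) \<and> ell \<Gamma> j 0 = base \<Gamma> \<and> ell \<Gamma> j 1 = sing a j) \<and>
     simple_smooth_on {..0} (ell_inf \<Gamma>) \<and> ell_inf \<Gamma> 0 = base \<Gamma> \<and>
     filterlim (ell_inf \<Gamma>) at_infinity at_bot \<and>
     (\<exists>R. \<forall>z\<in>ell_inf_img \<Gamma>. cmod z > R \<longrightarrow> z \<notin> \<real>\<^sub>\<le>\<^sub>0) \<and>
     (\<forall>j k. j \<noteq> k \<longrightarrow> ell_img \<Gamma> j \<inter> ell_img \<Gamma> k = {base \<Gamma>}) \<and>
     (\<forall>j. ell_img \<Gamma> j \<inter> ell_inf_img \<Gamma> = {base \<Gamma>}) \<and>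
     counterclockwise_at (base \<Gamma>)
       (ell_img \<Gamma> 1) (ell_img \<Gamma> 2) (ell_img \<Gamma> 3) (ell_inf_img \<Gamma>) \<and>
     (\<forall>j. rad \<Gamma> j > 0 \<and> base \<Gamma> \<notin> cball (sing a j) (rad \<Gamma> j)) \<and>
     (\<forall>j k. j \<noteq> k \<longrightarrow> cball (sing a j) (rad \<Gamma> j) \<inter> cball (sing a k) (rad \<Gamma> k) = {}) \<and>
     (\<forall>j k. j \<noteq> k \<longrightarrow> circ a \<Gamma> j \<inter> ell_img \<Gamma> k = {}) \<and>
     (\<forall>j. circ a \<Gamma> j \<inter> ell_inf_img \<Gamma> = {}) \<and>
     (\<forall>j. \<exists>!z. z \<in> circ a \<Gamma> j \<inter> ell_img \<Gamma> j)"

definition nodes :: "complex \<Rightarrow> graph_data \<Rightarrow> complex set" where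
  "nodes a \<Gamma> = {base \<Gamma>} \<union> (\<Union>j. ell_img \<Gamma> j \<inter> circ a \<Gamma> j)"


subsection \<open>Boundary values\<close>

text \<open>
  For a curve \<open>p\<close> that is continuously differentiable near \<open>t\<close> with \<open>p'(t) \<noteq> 0\<close>, the map
  \<open>(s,h) \<mapsto> p(s) + i h p'(t)\<close> is a local diffeomorphism at \<open>(t,0)\<close> taking \<open>h > 0\<close> to the left side
  of \<open>p\<close> and \<open>h < 0\<close> to the right side. Hence a limit along the following filters is the
  unrestricted (not only non-tangential) limit at \<open>p(t)\<close> from the left or right side, and if it
  exists for all \<open>t\<close> of an interval then it depends continuously on \<open>t\<close>.
\<close>

definition left_side :: "(real \<Rightarrow> complex) \<Rightarrow> real \<Rightarrow> complex filter" where
  "left_side p t =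
     filtermap (\<lambda>(s, h). p s + \<i> * of_real h * vector_derivative p (at t)) (nhds t \<times>\<^sub>F at_right 0)"

definition right_side :: "(real \<Rightarrow> complex) \<Rightarrow> real \<Rightarrow> complex filter" where
  "right_side p t =
     filtermap (\<lambda>(s, h). p s - \<i> * of_real h * vector_derivative p (at t)) (nhds t \<times>\<^sub>F at_right 0)"

definition has_jump ::
    "(complex \<Rightarrow> complex^2^2) \<Rightarrow> (real \<Rightarrow> complex) \<Rightarrow> real \<Rightarrow> complex^2^2 \<Rightarrow> bool" where
  "has_jump \<Psi> p t G \<longleftrightarrow>
     (\<exists>\<Psi>p \<Psi>m. (\<Psi> \<longlongrightarrow> \<Psi>p) (left_side p t) \<and> (\<Psi> \<longlongrightarrow> \<Psi>m) (right_side p t) \<and> \<Psi>p = \<Psi>m ** G)"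


subsection \<open>Branches and jump matrices\<close>

definition log_branch :: "complex set \<Rightarrow> complex \<Rightarrow> (complex \<Rightarrow> complex) \<Rightarrow> bool" where
  "log_branch S c L \<longleftrightarrow> L holomorphic_on S \<and> (\<forall>z\<in>S. exp (L z) = z - c)"

definition log_branch_at_infinity :: "graph_data \<Rightarrow> (complex \<Rightarrow> complex) \<Rightarrow> bool" where
  "log_branch_at_infinity \<Gamma> L \<longleftrightarrow>
     (\<exists>R. log_branch ({z. cmod z > R} - ell_inf_img \<Gamma>) 0 L) \<and>
     ((\<lambda>x. Im (L (of_real x))) \<longlongrightarrow> pi) at_bot"

text \<open>The matrix \<open>exp (c \<sigma>\<^sub>3)\<close>; thus \<open>z\<close> to the power \<open>\<alpha> \<sigma>\<^sub>3\<close> is \<open>exp_sigma3 (\<alpha> * L z)\<close>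
  for a branch \<open>L\<close> of the logarithm.\<close>

definition exp_sigma3 :: "complex \<Rightarrow> complex^2^2" where
  "exp_sigma3 c = (\<chi> i k. if i \<noteq> k then 0 else if i = 1 then exp c else exp (- c))"

definition M_mat :: "(3 \<Rightarrow> complex) \<Rightarrow> (3 \<Rightarrow> complex^2^2) \<Rightarrow> 3 \<Rightarrow> complex^2^2" where
  "M_mat \<alpha> E j = E j ** exp_sigma3 (2 * of_real pi * \<i> * \<alpha> j) ** matrix_inv (E j)"

definition M_inf :: "complex \<Rightarrow> complex^2^2" where
  "M_inf \<delta> = exp_sigma3 (- 2 * of_real pi * \<i> * \<delta>)"


subsection \<open>The Riemann--Hilbert problem\<close>

definition infinity_off :: "complex \<Rightarrow> graph_data \<Rightarrow> complex filter" where
  "infinity_off a \<Gamma> = inf at_infinity (principal (- gamma a \<Gamma>))"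

text \<open>The matrix in the normalization at infinity, with the power formed from the branch
  \<open>L\<close> of the logarithm near infinity.\<close>

definition infinity_defect ::
    "complex \<Rightarrow> (complex \<Rightarrow> complex) \<Rightarrow> (complex \<Rightarrow> complex^2^2) \<Rightarrow> complex \<Rightarrow> complex^2^2" where
  "infinity_defect \<delta> L \<Psi> z = \<Psi> z ** exp_sigma3 (\<delta> * L z) - mat 1"

text \<open>
  The local branch at \<open>sing a j\<close> is unique up to a constant factor of the power, so the
  boundedness condition there does not depend on it.
\<close>

definition rh_solution ::
    "complex \<Rightarrow> graph_data \<Rightarrow> (3 \<Rightarrow> complex) \<Rightarrow> complex \<Rightarrow> (3 \<Rightarrow> complex^2^2) \<Rightarrow>
     (complex \<Rightarrow> complex) \<Rightarrow> (complex \<Rightarrow> complex^2^2) \<Rightarrow> bool" where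
  "rh_solution a \<Gamma> \<alpha> \<delta> E L \<Psi> \<longleftrightarrow>
     (\<forall>i k. (\<lambda>z. \<Psi> z $ i $ k) holomorphic_on - gamma a \<Gamma>) \<and>
     (\<exists>C. \<forall>\<^sub>F z in infinity_off a \<Gamma>. norm (infinity_defect \<delta> L \<Psi> z) \<le> C / cmod z) \<and>
     ((\<lambda>z. z * infinity_defect \<delta> L \<Psi> z $ 1 $ 2) \<longlongrightarrow> 0) (infinity_off a \<Gamma>) \<and>
     (\<forall>j. \<exists>Lj C. log_branch (disc a \<Gamma> j - ell_img \<Gamma> j) (sing a j) Lj \<and>
        (\<forall>\<^sub>F z in at (sing a j) within - gamma a \<Gamma>.
           norm (\<Psi> z ** exp_sigma3 (- \<alpha> j * Lj z)) \<le> C)) \<and>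
     (\<exists>C. \<forall>w\<in>nodes a \<Gamma>. \<forall>\<^sub>F z in at w within - gamma a \<Gamma>. norm (\<Psi> z) \<le> C) \<and>
     (\<forall>j. \<forall>t\<in>{0<..<1}. ell \<Gamma> j t \<notin> cball (sing a j) (rad \<Gamma> j) \<longrightarrow>
        has_jump \<Psi> (ell \<Gamma> j) t (M_mat \<alpha> E j)) \<and>
     (\<forall>j. \<forall>t\<in>{0<..<1}. ell \<Gamma> j t \<in> disc a \<Gamma> j \<longrightarrow>
        has_jump \<Psi> (ell \<Gamma> j) t (exp_sigma3 (2 * of_real pi * \<i> * \<alpha> j))) \<and>
     (\<forall>j t. sing a j + rcis (rad \<Gamma> j) t \<notin> ell_img \<Gamma> j \<longrightarrow>
        has_jump \<Psi> (\<lambda>s. sing a j + rcis (rad \<Gamma> j) s) t (E j)) \<and>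
     (\<forall>t<0. has_jump \<Psi> (ell_inf \<Gamma>) t (M_inf \<delta>))"


subsection \<open>The Heun equation\<close>

definition heun_mu :: "(3 \<Rightarrow> complex) \<Rightarrow> complex \<Rightarrow> complex" where
  "heun_mu \<alpha> \<delta> = (\<alpha> 1 + \<alpha> 2 + \<alpha> 3 - \<delta>) * (\<alpha> 1 + \<alpha> 2 + \<alpha> 3 + \<delta> - 2)"

definition heun_nu :: "complex \<Rightarrow> (3 \<Rightarrow> complex) \<Rightarrow> complex \<Rightarrow> complex \<Rightarrow> complex" where
  "heun_nu a \<alpha> \<delta> b\<^sub>3 =
     \<alpha> 1 + \<alpha> 2 - (\<alpha> 1 + \<alpha> 2)\<^sup>2 + (\<alpha> 3)\<^sup>2 - \<delta>\<^sup>2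
     + a * (\<alpha> 1 + \<alpha> 3 - (\<alpha> 1 + \<alpha> 3)\<^sup>2 + (\<alpha> 2)\<^sup>2 - \<delta>\<^sup>2) + b\<^sub>3 * (2 * \<delta> - 1)"

definition heun_solution ::
    "complex \<Rightarrow> (3 \<Rightarrow> complex) \<Rightarrow> complex \<Rightarrow> complex \<Rightarrow> complex set \<Rightarrow> (complex \<Rightarrow> complex) \<Rightarrow> bool" where
  "heun_solution a \<alpha> \<mu> \<nu> S u \<longleftrightarrow> u holomorphic_on S \<and>
     (\<forall>z\<in>S. deriv (deriv u) z
        + ((1 - 2 * \<alpha> 1) / z + (1 - 2 * \<alpha> 2) / (z - a) + (1 - 2 * \<alpha> 3) / (z - 1)) * deriv u z
        + (\<mu> * z + \<nu>) / (z * (z - a) * (z - 1)) * u z = 0)"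

definition heun_fundamental_system ::
    "complex \<Rightarrow> (3 \<Rightarrow> complex) \<Rightarrow> complex \<Rightarrow> complex \<Rightarrow> complex set \<Rightarrow>
     (complex \<Rightarrow> complex) \<Rightarrow> (complex \<Rightarrow> complex) \<Rightarrow> bool" where
  "heun_fundamental_system a \<alpha> \<mu> \<nu> S u v \<longleftrightarrow>
     heun_solution a \<alpha> \<mu> \<nu> S u \<and> heun_solution a \<alpha> \<mu> \<nu> S v \<and>
     (\<forall>c d. (\<forall>z\<in>S. c * u z + d * v z = 0) \<longrightarrow> c = 0 \<and> d = 0)"

text \<open>
  The powers are formed with the branches \<open>K j\<close> of the logarithm of \<open>z - sing a j\<close>.
  Pitfall: the second function vanishes identically if \<open>\<Psi>\<^sub>1\<^sub>2\<close> does, which the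
  Riemann--Hilbert problem does not exclude: if \<open>\<alpha> 1 + \<alpha> 2 + \<alpha> 3 = - \<delta>\<close> and all \<open>E j\<close> are the
  identity, then the diagonal matrix with entries \<open>p\<close> and \<open>1/p\<close> solves it, where \<open>p\<close> is the
  suitably normalized product of the powers (cut along the arcs). So the two functions can only
  be linearly independent if \<open>\<Psi>\<^sub>1\<^sub>2\<close> is not identically zero.
\<close>

definition u_fun ::
    "(3 \<Rightarrow> complex) \<Rightarrow> (3 \<Rightarrow> complex \<Rightarrow> complex) \<Rightarrow> (complex \<Rightarrow> complex^2^2) \<Rightarrow> 2 \<Rightarrow> complex \<Rightarrow> complex" where
  "u_fun \<alpha> K \<Psi> k z = exp (\<alpha> 1 * K 1 z) * exp (\<alpha> 2 * K 2 z) * exp (\<alpha> 3 * K 3 z) * \<Psi> z $ 1 $ k"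


subsection \<open>Analytic continuation along a path\<close>

text \<open>
  Continuing the germ of \<open>f\<close> at \<open>g 0\<close> along \<open>g\<close> is possible and leads to the germ of \<open>h\<close> at
  \<open>g 1\<close>; \<open>F t\<close> represents the germ at \<open>g t\<close>.
\<close>

definition continues_along ::
    "(real \<Rightarrow> complex) \<Rightarrow> (complex \<Rightarrow> complex) \<Rightarrow> (complex \<Rightarrow> complex) \<Rightarrow> bool" where
  "continues_along g f h \<longleftrightarrow>
     (\<exists>F. (\<forall>t\<in>{0..1}. F t analytic_on {g t}) \<and>
        (\<forall>\<^sub>F z in nhds (g 0). F 0 z = f z) \<and>
        (\<forall>t\<in>{0..1}. \<forall>\<^sub>F s in at t within {0..1}. \<forall>\<^sub>F z in nhds (g s). F s z = F t z) \<and>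
        (\<forall>\<^sub>F z in nhds (g 1). F 1 z = h z))"

text \<open>
  A loop based in \<open>D_inf\<close> that goes once counterclockwise around the disc and meets the graph
  at only one parameter, in a point of \<open>ell j\<close> outside the closed disc. It does not wind around the
  other singular points, since these are joined to infinity by arcs of the graph that it avoids.
\<close>

definition loop_around :: "complex \<Rightarrow> graph_data \<Rightarrow> 3 \<Rightarrow> (real \<Rightarrow> complex) \<Rightarrow> bool" where
  "loop_around a \<Gamma> j g \<longleftrightarrow>
     path g \<and> pathfinish g = pathstart g \<and>
     (\<exists>t\<in>{0<..<1}. g t \<in> ell_img \<Gamma> j - ({base \<Gamma>} \<union> cball (sing a j) (rad \<Gamma> j)) \<and>
        (\<forall>s\<in>{0..1} - {t}. g s \<in> D_inf a \<Gamma>)) \<and>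
     (\<forall>z\<in>disc a \<Gamma> j. winding_number g z = 1)"

end

theory Submission
  imports Defs "HOL-Homology.Invariance_of_Domain"
begin

text \<open>
  The determinant of \<open>\<Psi>\<close> and its logarithmic derivative \<open>\<Psi>' \<Psi>\<^sup>-\<^sup>1\<close> have no jumps on the
  graph. At the base point the product of the four jump matrices is the identity by the cyclic
  relation, so that \<open>\<Psi>\<close> becomes single-valued after multiplication by suitable constants in the
  four sectors, and the singularity is removable. By Liouville's theorem \<open>det \<Psi> = 1\<close>, and \<open>\<Psi>' \<Psi>\<^sup>-\<^sup>1\<close>
  is a rational function with simple poles in the points \<open>\<lambda>\<^sub>j\<close>, whose numerators are found from the
  expansion at infinity: the (1,2) entry is a constant over \<open>\<lambda>(\<lambda>-a)(\<lambda>-1)\<close> by the vanishing of the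
  (1,2) limit, hence the first row of \<open>\<Psi>\<close> satisfies a scalar equation without apparent
  singularity. The local exponents fix the remaining coefficients. The monodromy is read off from
  the jump on the only arc that a loop crosses; the branch of the powers changes there by the
  winding number.
\<close>

text \<open>Boundary values are prescribed only as limits from either side of arcs that are merely
  C1. So everything rests on a Morera argument: across such an arc a continuous function that is
  holomorphic on both sides is holomorphic. It is carried out in coordinates straightened in one
  fixed direction, where a primitive is built by integrating along the arc and then across it. The
  second obstacle is to know on which side of which arc a point lies. Sectors are not described as
  sets; instead, 2 pi i times the winding number of an arc is a logarithm with jump exactly 2 pi i
  across the arc, and integer combinations with trivial exponential are locally constant functions
  that number the sectors. Comparison with such logarithms also gives the jumps of the branches at
  the singular points. At infinity the jump of the branch is forced by the normalization, as both
  boundary values tend to the identity. Linear independence has a degenerate case, a zero (1,2)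
  numerator; there the condition on 2 \<delta> makes \<open>\<Psi>\<^sub>1\<^sub>2\<close> vanish
  near infinity, where \<open>\<Psi>\<^sub>1\<^sub>1\<close> does not.\<close>

section \<open>Chord estimates and straightened coordinates along a C1 arc\<close>

lemma C1_chord_bound:
  fixes p :: "real \<Rightarrow> complex"
  assumes "convex I" "t \<in> I" and der: "\<And>s. s \<in> I \<Longrightarrow> (p has_vector_derivative p' s) (at s within I)"
    and "continuous_on I p'" "e > 0"
  obtains d where "d > 0" "\<And>x. x \<in> I \<Longrightarrow> \<bar>x - t\<bar> < d \<Longrightarrow> norm (p' x - p' t) \<le> e"
    "\<And>x y. x \<in> I \<Longrightarrow> y \<in> I \<Longrightarrow> \<bar>x - t\<bar> < d \<Longrightarrow> \<bar>y - t\<bar> < d \<Longrightarrow>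
        norm (p x - p y - of_real (x - y) * p' t) \<le> e * \<bar>x - y\<bar>"
proof -
  have "continuous (at t within I) p'"
    using assms continuous_on_eq_continuous_within by blast
  then obtain d where d: "d > 0" "\<And>x. x \<in> I \<Longrightarrow> dist x t < d \<Longrightarrow> dist (p' x) (p' t) < e"
    using \<open>e > 0\<close> unfolding continuous_within_eps_delta by blast
  have near: "norm (p' x - p' t) \<le> e" if "x \<in> I" "\<bar>x - t\<bar> < d" for x
    using d(2)[of x] that by (auto simp: dist_norm less_imp_le)
  have "norm (p x - p y - of_real (x - y) * p' t) \<le> e * \<bar>x - y\<bar>"
    if x: "x \<in> I" "\<bar>x - t\<bar> < d" and y: "y \<in> I" "\<bar>y - t\<bar> < d" for x y
  proof -
    let ?S = "I \<inter> ball t d"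
    \<comment> \<open>Mean value inequality for \<open>p\<close> minus its linear part at
      \<open>t\<close>, whose derivative is small near \<open>t\<close> by continuity of
      \<open>p'\<close>. Both end points of the chord may vary, which differentiability at
      \<open>t\<close> alone would not give.\<close>
    have "norm ((p x - x *\<^sub>R p' t) - (p y - y *\<^sub>R p' t)) \<le> e * norm (x - y)"
    proof (rule differentiable_bound[where S = ?S and f' = "\<lambda>s h. h *\<^sub>R (p' s - p' t)"])
      show "convex ?S" using \<open>convex I\<close> by (simp add: convex_Int)
      fix s assume s: "s \<in> ?S"
      have "(p has_vector_derivative p' s) (at s within ?S)"
        using der s by (meson Int_iff Int_lower1 has_vector_derivative_within_subset)
      then show "((\<lambda>s. p s - s *\<^sub>R p' t) has_derivative (\<lambda>h. h *\<^sub>R (p' s - p' t))) (at s within ?S)"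
        unfolding has_vector_derivative_def
        by (auto intro!: derivative_eq_intros simp: algebra_simps)
      show "onorm (\<lambda>h. h *\<^sub>R (p' s - p' t)) \<le> e"
        using near[of s] s by (intro onorm_le) (auto simp: dist_norm abs_minus_commute mult.commute[of e] intro!: mult_left_mono)
    qed (use x y in \<open>auto simp: dist_norm abs_minus_commute\<close>)
    then show ?thesis by (simp add: scaleR_conv_of_real algebra_simps)
  qed
  with d near that show ?thesis by blast
qed

text \<open>One vector \<open>v\<close> serves for all chords and all tangents of the piece. The
  slack of a quarter is small enough for the errors of a chord and of a normal direction to compound
  without changing a sign.\<close>

locale flat_arc =
  fixes p p' :: "real \<Rightarrow> complex" and t d :: real and v :: complex
  assumes d_pos: "0 < d" and v_nz: "v \<noteq> 0"
    and deriv: "\<And>s. s \<in> {t-d<..<t+d} \<Longrightarrow> (p has_vector_derivative p' s) (at s)"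
    and cont: "continuous_on {t-d<..<t+d} p'"
    and near: "\<And>s. s \<in> {t-d<..<t+d} \<Longrightarrow> norm (p' s - v) \<le> norm v / 4"
    and chord: "\<And>x y. x \<in> {t-d<..<t+d} \<Longrightarrow> y \<in> {t-d<..<t+d} \<Longrightarrow>
                  norm (p x - p y - of_real (x - y) * v) \<le> norm v / 4 * \<bar>x - y\<bar>"
begin

abbreviation "J \<equiv> {t-d<..<t+d}"

text \<open>The transversal direction is the constant \<open>\<i> * v\<close>, not the normal
  \<open>\<i> * p' s\<close> of each point: with \<open>p\<close> only C1 the moving normal would be
  merely continuous in \<open>s\<close>, whereas here every level is a translate of the arc with the
  same derivative \<open>p'\<close>.\<close>

definition Q :: "real \<times> real \<Rightarrow> complex" where "Q = (\<lambda>(s, h). p s + \<i> * of_real h * v)"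

lemma cont_p: "continuous_on J p"
  by (meson deriv continuous_at_imp_continuous_on has_vector_derivative_continuous)

lemma chord_quot:
  assumes "x \<in> J" "y \<in> J"
  shows "\<bar>Re ((p x - p y) / v) - (x - y)\<bar> \<le> \<bar>x - y\<bar> / 4" "\<bar>Im ((p x - p y) / v)\<bar> \<le> \<bar>x - y\<bar> / 4"
proof -
  have "norm ((p x - p y) / v - of_real (x - y)) = norm (p x - p y - of_real (x - y) * v) / norm v"
    using v_nz by (simp flip: norm_divide add: field_simps)
  also have "\<dots> \<le> (norm v / 4 * \<bar>x - y\<bar>) / norm v"
    by (intro divide_right_mono chord assms) auto
  also have "\<dots> = \<bar>x - y\<bar> / 4" using v_nz by simp
  finally have *: "norm ((p x - p y) / v - of_real (x - y)) \<le> \<bar>x - y\<bar> / 4" .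
  show "\<bar>Re ((p x - p y) / v) - (x - y)\<bar> \<le> \<bar>x - y\<bar> / 4"
    using abs_Re_le_cmod[of "(p x - p y) / v - of_real (x - y)"] * by simp
  show "\<bar>Im ((p x - p y) / v)\<bar> \<le> \<bar>x - y\<bar> / 4"
    using abs_Im_le_cmod[of "(p x - p y) / v - of_real (x - y)"] * by simp
qed

text \<open>Divided by \<open>v\<close>, the real part of the equation bounds
  \<open>\<bar>x - y\<bar>\<close> by \<open>\<bar>k\<bar> / 3\<close>, and then the imaginary part
  leaves \<open>h\<close> within \<open>\<bar>k\<bar> / 3\<close> of \<open>k\<close>. So the side
  on which a point lies does not depend on the foot point or the direction \<open>w\<close> from
  which it is reached; this links the moving normals of the boundary filters with the fixed
  coordinates \<open>Q\<close>.\<close>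

lemma transversal_sgn:
  assumes x: "x \<in> J" and y: "y \<in> J" and w: "norm (w - v) \<le> norm v / 4"
    and eq: "p x + \<i> * of_real h * v = p y + \<i> * of_real k * w"
  shows "sgn h = sgn k" "k = 0 \<Longrightarrow> x = y"
proof -
  define e where "e = w / v - 1"
  have "norm e = norm (w - v) / norm v"
    using v_nz by (simp flip: norm_divide add: e_def field_simps)
  also have "\<dots> \<le> (norm v / 4) / norm v" by (intro divide_right_mono w) auto
  finally have e: "norm e \<le> 1/4" using v_nz by simp
  have "(p x - p y) / v = \<i> * (of_real k * (1 + e) - of_real h)"
    using eq v_nz by (simp add: e_def field_simps)
  then have re: "Re ((p x - p y) / v) = - (k * Im e)" and im: "Im ((p x - p y) / v) = k * (1 + Re e) - h"
    by auto
  have 1: "\<bar>k * Im e\<bar> \<le> \<bar>k\<bar> / 4" "\<bar>k * Re e\<bar> \<le> \<bar>k\<bar> / 4"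
    using mult_left_mono[of "\<bar>Im e\<bar>" "1/4" "\<bar>k\<bar>"] mult_left_mono[of "\<bar>Re e\<bar>" "1/4" "\<bar>k\<bar>"]
      abs_Im_le_cmod[of e] abs_Re_le_cmod[of e] e by (auto simp: abs_mult)
  note 2 = chord_quot[OF x y, unfolded re im]
  have 3: "\<bar>x - y\<bar> \<le> \<bar>k\<bar> / 3" proof -
    have "\<bar>x - y\<bar> \<le> \<bar>k * Im e\<bar> + \<bar>- (k * Im e) - (x - y)\<bar>" by linarith
    with 2(1) 1(1) show ?thesis using [[linarith_split_limit = 0]] by linarith
  qed
  have 4: "\<bar>k + k * Re e - h\<bar> \<le> \<bar>k\<bar> / 12" using 2(2) 3 by (simp add: algebra_simps)
  show "sgn h = sgn k" using 4 1(2) by (auto simp: sgn_if abs_if split: if_splits)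
  show "x = y" if "k = 0" using 3 that by simp
qed

text \<open>Two representations of a point differ by a chord of the form just treated, with
  \<open>h = 0\<close> and height \<open>l - k\<close>.\<close>

lemma transversal_inj:
  assumes w: "norm (w - v) \<le> norm v / 4"
  shows "inj_on (\<lambda>(x, k). p x + \<i> * of_real k * w) (J \<times> UNIV)"
proof (rule inj_onI, clarify)
  fix x k y l assume xy: "x \<in> J" "y \<in> J" and eq: "p x + \<i> * of_real k * w = p y + \<i> * of_real l * w"
  have "p x + \<i> * of_real 0 * v = p y + \<i> * of_real (l - k) * w"
    using eq by (simp add: algebra_simps)
  from transversal_sgn[OF xy w this] show "x = y \<and> k = l"
    by (auto simp: sgn_if split: if_splits)
qed

lemma Q_inj: "inj_on Q (J \<times> UNIV)"
  unfolding Q_def using transversal_inj[of v] by simp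

lemma transversal_continuous: "continuous_on (J \<times> UNIV) (\<lambda>(x, k). p x + \<i> * of_real k * w)"
  unfolding case_prod_beta
  by (intro continuous_intros continuous_on_compose2[OF cont_p]) auto

lemma Q_continuous: "continuous_on (J \<times> UNIV) Q"
  unfolding Q_def by (rule transversal_continuous)

text \<open>Openness comes from injectivity and continuity by invariance of domain.\<close>

lemma transversal_open:
  assumes "norm (w - v) \<le> norm v / 4" "open B" "B \<subseteq> J \<times> UNIV"
  shows "open ((\<lambda>(x, k). p x + \<i> * of_real k * w) ` B)"
  by (rule invariance_of_domain_gen)
     (use assms transversal_inj transversal_continuous in \<open>auto intro: continuous_on_subset inj_on_subset\<close>)

lemma Q_open: "open B \<Longrightarrow> B \<subseteq> J \<times> UNIV \<Longrightarrow> open (Q ` B)"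
  unfolding Q_def by (rule transversal_open) auto

text \<open>With \<open>\<sigma> = 1\<close> and \<open>\<sigma> = -1\<close> this is the left and the right side.\<close>

lemma side_filter_eq:
  fixes \<sigma> :: real
  assumes \<sigma>: "\<bar>\<sigma>\<bar> = 1" and e: "0 < e" and \<eta>: "0 < \<eta>" and I: "open I" "I \<subseteq> J" "s \<in> I"
  shows "filtermap (\<lambda>(x, h). p x + \<i> * of_real (\<sigma> * h) * p' s) (nhds s \<times>\<^sub>F at_right 0) =
         at (p s) within Q ` (I \<times> {h. 0 < \<sigma> * h \<and> \<bar>h\<bar> < \<eta>})" (is "?F = at _ within ?X")
proof (rule antisym)
  have sJ: "s \<in> J" using I by auto
  have sg: "0 < \<sigma> * h \<longleftrightarrow> sgn h = \<sigma>" for h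
    using \<sigma> by (auto simp: sgn_if abs_if split: if_splits)
  have sg1: "sgn \<sigma> = \<sigma>" using \<sigma> by (auto simp: sgn_if abs_if split: if_splits)
  have notin: "p s \<notin> ?X"
  proof
    assume "p s \<in> ?X"
    then obtain x h where xh: "x \<in> I" "0 < \<sigma> * h" "p s = Q (x, h)" by auto
    have "Q (s, 0) = Q (x, h)" using xh by (simp add: Q_def)
    then have "h = 0" using inj_onD[OF Q_inj, of "(s,0)" "(x,h)"] xh sJ I by auto
    with xh show False by simp
  qed
  have "isCont p s" using deriv[OF sJ] has_vector_derivative_continuous by blast
  then have pt: "(p \<longlongrightarrow> p s) (nhds s)" by (simp add: isCont_def tendsto_nhds_iff)
  have lim: "((\<lambda>(x, h). p x + \<i> * of_real (\<sigma> * h) * p' s) \<longlongrightarrow> p s) (nhds s \<times>\<^sub>F at_right 0)"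
  proof -
    have "((\<lambda>z. p (fst z) + \<i> * of_real (\<sigma> * snd z) * p' s) \<longlongrightarrow> p s + \<i> * of_real (\<sigma> * 0) * p' s)
            (nhds s \<times>\<^sub>F at_right 0)"
    proof (intro tendsto_intros filterlim_compose[OF pt] filterlim_fst)
      show "(snd \<longlongrightarrow> 0) (nhds s \<times>\<^sub>F at_right (0::real))"
        by (rule filterlim_mono[OF filterlim_snd[of "at_right 0"]]) (auto simp: at_within_def)
    qed
    then show ?thesis unfolding case_prod_beta by simp
  qed
  have open1: "open (Q ` (I \<times> {-\<eta><..<\<eta>}))" using I by (intro Q_open open_Times) auto
  have "p s = Q (s, 0)" by (simp add: Q_def)
  then have "p s \<in> Q ` (I \<times> {-\<eta><..<\<eta>})" using I \<eta> by (metis SigmaI greaterThanLessThan_iff imageI neg_less_0_iff_less)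
  then have ev1: "eventually (\<lambda>(x, h). p x + \<i> * of_real (\<sigma> * h) * p' s \<in> Q ` (I \<times> {-\<eta><..<\<eta>})) (nhds s \<times>\<^sub>F at_right 0)"
    using topological_tendstoD[OF lim open1] unfolding case_prod_beta by simp
  have ev2: "eventually (\<lambda>(x, h). x \<in> J \<and> 0 < h) (nhds s \<times>\<^sub>F at_right (0::real))"
  proof -
    have "eventually (\<lambda>x. x \<in> J) (nhds s)" using sJ by (intro eventually_nhds_in_open) auto
    moreover have "eventually (\<lambda>h. 0 < h) (at_right (0::real))" by (simp add: eventually_at_right_less)
    ultimately show ?thesis unfolding case_prod_beta by (rule eventually_prodI)
  qed
  \<comment> \<open>The filter uses the normal \<open>\<i> * p' s\<close>, the set \<open>?X\<close>
    the direction \<open>\<i> * v\<close>. A point of the first kind lies in the open strip, so it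
    has coordinates \<open>(y, k)\<close>, and \<open>transversal_sgn\<close> gives \<open>k\<close>
    the sign \<open>\<sigma>\<close>.\<close>
  have "eventually (\<lambda>(x, h). p x + \<i> * of_real (\<sigma> * h) * p' s \<in> ?X) (nhds s \<times>\<^sub>F at_right 0)"
    using ev1 ev2
  proof eventually_elim
    case (elim z)
    obtain x h where z: "z = (x, h)" by force
    from elim z obtain y k where yk: "y \<in> I" "-\<eta> < k" "k < \<eta>" "p x + \<i> * of_real (\<sigma> * h) * p' s = Q (y, k)"
      and xh: "x \<in> J" "0 < h" by auto
    have "p y + \<i> * of_real k * v = p x + \<i> * of_real (\<sigma> * h) * p' s"
      using yk by (simp add: Q_def)
    from transversal_sgn(1)[OF _ xh(1) near[OF sJ] this] have "sgn k = sgn (\<sigma> * h)"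
      using yk(1) I by blast
    then have "0 < \<sigma> * k" using xh(2) sg1 by (simp add: sgn_mult sg)
    moreover have "\<bar>k\<bar> < \<eta>" using yk by linarith
    ultimately have "Q (y, k) \<in> ?X" using yk(1) by blast
    then show ?case using yk(4) z by simp
  qed
  then have "?F \<le> principal ?X"
    unfolding le_principal eventually_filtermap case_prod_beta by simp
  moreover have "?F \<le> nhds (p s)" using lim by (simp add: filterlim_def)
  ultimately show "?F \<le> at (p s) within ?X"
    using notin by (simp add: at_within_def)
  show "at (p s) within ?X \<le> ?F"
  proof (rule filter_leI)
    fix P assume "eventually P ?F"
    then obtain Pf Pg where Pf: "eventually Pf (nhds s)" and Pg: "eventually Pg (at_right 0)"
      and P: "\<And>x h. Pf x \<Longrightarrow> Pg h \<Longrightarrow> P (p x + \<i> * of_real (\<sigma> * h) * p' s)"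
      unfolding eventually_filtermap eventually_prod_filter prod.case by blast
    obtain S where S: "open S" "s \<in> S" "\<And>x. x \<in> S \<Longrightarrow> Pf x" using Pf eventually_nhds by metis
    obtain b where b: "0 < b" "\<And>h. 0 < h \<Longrightarrow> h < b \<Longrightarrow> Pg h"
      using Pg unfolding eventually_at_right_field by blast
    let ?B = "(S \<inter> J) \<times> {-b<..<b}"
    let ?g = "\<lambda>(x, k). p x + \<i> * of_real k * p' s"
    \<comment> \<open>Conversely, the frame with the normal at \<open>s\<close> is itself an open
      map, so points close to \<open>p s\<close> have small coordinates in it.\<close>
    have op: "open (?g ` ?B)"
      using S(1) near[OF sJ] by (intro transversal_open open_Times) auto
    have mem: "p s \<in> ?g ` ?B"
      by (rule image_eqI[of _ _ "(s, 0)"]) (use S sJ b in auto)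
    have "eventually (\<lambda>z. z \<in> ?g ` ?B) (at (p s) within ?X)"
      by (rule filter_leD[OF at_le[OF subset_UNIV] eventually_at_in_open'[OF op mem]])
    moreover have "eventually (\<lambda>z. z \<in> ?X) (at (p s) within ?X)"
      by (simp add: eventually_at_filter)
    ultimately show "eventually P (at (p s) within ?X)"
    proof eventually_elim
      case (elim z)
      from elim(1) obtain x k where xk: "x \<in> S" "x \<in> J" "-b < k" "k < b" "z = p x + \<i> * of_real k * p' s"
        by (elim imageE SigmaE) (rule that, auto)
      from elim(2) obtain y h where yh: "y \<in> I" "0 < \<sigma> * h" "z = p y + \<i> * of_real h * v"
        unfolding Q_def by (elim imageE SigmaE) (rule that, auto)
      have yJ: "y \<in> J" using yh(1) I(2) by blast
      have "p y + \<i> * of_real h * v = p x + \<i> * of_real k * p' s"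
        using yh(3) xk(5) by (rule trans[OF sym])
      then have "sgn h = sgn k" by (rule transversal_sgn(1)[OF yJ xk(2) near[OF sJ]])
      with yh(2) have k: "sgn k = \<sigma>" unfolding sg by simp
      define l where "l = \<bar>k\<bar>"
      have kl: "k = \<sigma> * l" unfolding l_def using k mult_sgn_abs[of k] by metis
      have "0 < l" unfolding l_def using k \<sigma> by (metis abs_0 sgn_0 zero_less_abs_iff zero_neq_one)
      moreover have "l < b" unfolding l_def using xk(3,4) by linarith
      ultimately have "P (p x + \<i> * of_real (\<sigma> * l) * p' s)"
        using xk(1) by (intro P S(3) b(2))
      then show "P z" unfolding xk(5) kl .
    qed
  qed
qed

end

section \<open>Removability of C1 arcs for continuous functions\<close>

lemma norm_integral_diff_le:
  fixes \<phi> :: "real \<Rightarrow> complex"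
  assumes cont: "continuous_on {a..b} \<phi>" and x: "x \<in> {a..b}" and y: "y \<in> {a..b}"
    and B: "\<And>u. u \<in> closed_segment x y \<Longrightarrow> norm (\<phi> u) \<le> B"
  shows "norm (integral {a..x} \<phi> - integral {a..y} \<phi>) \<le> B * \<bar>x - y\<bar>"
proof -
  have *: "norm (integral {a..x} \<phi> - integral {a..y} \<phi>) \<le> B * (x - y)"
    if xy: "a \<le> y" "y \<le> x" "x \<le> b" and B: "\<And>u. u \<in> {y..x} \<Longrightarrow> norm (\<phi> u) \<le> B" for x y
  proof -
    have c: "continuous_on {a..x} \<phi>" "continuous_on {y..x} \<phi>"
      using xy by (auto intro: continuous_on_subset[OF cont])
    have "integral {a..y} \<phi> + integral {y..x} \<phi> = integral {a..x} \<phi>"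
      using xy by (intro Henstock_Kurzweil_Integration.integral_combine integrable_continuous_interval c) auto
    then have "norm (integral {a..x} \<phi> - integral {a..y} \<phi>) = norm (integral {y..x} \<phi>)"
      by (metis add_diff_cancel_left')
    also have "\<dots> \<le> B * (x - y)" using xy B c by (intro integral_bound) auto
    finally show ?thesis .
  qed
  show ?thesis
  proof (cases "y \<le> x")
    case True then show ?thesis using *[of y x] x y B by (auto simp: closed_segment_eq_real_ivl)
  next
    case False
    then show ?thesis using *[of x y] x y B
      by (auto simp: closed_segment_eq_real_ivl norm_minus_commute)
  qed
qed

context flat_arc
begin

text \<open>The inverse of \<open>Q\<close> is Lipschitz at points of the arc: a chord loses at most
  a quarter of its length in the real part, whence the factor 4/3.\<close>

lemma Q_chord_bounds:
  assumes "x \<in> J" "y \<in> J"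
  shows "\<bar>x - y\<bar> * norm v \<le> 4/3 * norm (Q (x, h) - Q (y, 0))"
    "\<bar>h\<bar> * norm v \<le> 4/3 * norm (Q (x, h) - Q (y, 0))"
proof -
  define z where "z = (Q (x, h) - Q (y, 0)) / v"
  have z: "z = (p x - p y) / v + \<i> * of_real h" using v_nz by (simp add: z_def Q_def field_simps)
  note 1 = chord_quot[OF assms]
  have re: "Re z = Re ((p x - p y) / v)" and im: "Im z = Im ((p x - p y) / v) + h" by (simp_all add: z)
  have 2: "\<bar>Re z\<bar> \<le> norm z" "\<bar>Im z\<bar> \<le> norm z" by (rule abs_Re_le_cmod abs_Im_le_cmod)+
  have "norm (Q (x, h) - Q (y, 0)) = norm z * norm v" using v_nz by (simp add: z_def norm_divide)
  moreover have "\<bar>x - y\<bar> \<le> 4/3 * norm z" 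
  proof -
    have "\<bar>x - y\<bar> \<le> \<bar>Re z\<bar> + \<bar>Re z - (x - y)\<bar>" by linarith
    with 1(1) 2(1) show ?thesis using [[linarith_split_limit = 0]] unfolding re[symmetric] by linarith
  qed
  moreover have "\<bar>h\<bar> \<le> 4/3 * norm z"
  proof -
    have "\<bar>h\<bar> \<le> \<bar>Im z\<bar> + \<bar>x - y\<bar> / 4" using 1(2) im by linarith
    then show ?thesis using 2(2) \<open>\<bar>x - y\<bar> \<le> 4/3 * norm z\<close> [[linarith_split_limit = 0]]
      by linarith
  qed
  ultimately show "\<bar>x - y\<bar> * norm v \<le> 4/3 * norm (Q (x, h) - Q (y, 0))"
    "\<bar>h\<bar> * norm v \<le> 4/3 * norm (Q (x, h) - Q (y, 0))"
    using mult_right_mono[of _ "4/3 * norm z" "norm v"] by (simp_all add: mult.assoc)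
qed

text \<open>The primitive of \<open>f\<close> obtained by integrating first along the arc and then transversally to it.\<close>

context
  fixes a b k \<eta> :: real and I :: "real set" and f :: "complex \<Rightarrow> complex"
  assumes I: "open I" "convex I" "I \<subseteq> J" "{a..b} \<subseteq> I" and k: "0 < k" "k < \<eta>"
    and f: "continuous_on (Q ` (I \<times> {-\<eta><..<\<eta>})) f"
begin

definition arc_prim :: "real \<Rightarrow> complex" where "arc_prim x = integral {a..x} (\<lambda>u. f (Q (u, 0)) * p' u)"
text \<open>Integration starts at \<open>-k\<close> because the integral over \<open>{0..h}\<close>
  would be 0 for negative \<open>h\<close>; \<open>prim\<close> subtracts the value at height 0 and
  so gets the oriented integral for both signs.\<close>

definition vert_prim :: "real \<Rightarrow> real \<Rightarrow> complex" where
  "vert_prim x h = integral {-k..h} (\<lambda>y. f (Q (x, y)) * (\<i> * v))"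
definition prim :: "real \<times> real \<Rightarrow> complex" where
  "prim = (\<lambda>(x, h). arc_prim x + vert_prim x h - vert_prim x 0)"

lemma fQ_cont: "continuous_on (I \<times> {-\<eta><..<\<eta>}) (\<lambda>z. f (Q z))"
  using I by (intro continuous_on_compose2[OF f] continuous_on_subset[OF Q_continuous]) auto

lemma fQ_cont_vert: "x \<in> I \<Longrightarrow> continuous_on {-\<eta><..<\<eta>} (\<lambda>y. f (Q (x, y)))"
  by (rule continuous_on_compose2[OF fQ_cont]) (auto intro!: continuous_intros)

lemma fQ_cont_hor: "\<bar>h\<bar> < \<eta> \<Longrightarrow> continuous_on I (\<lambda>u. f (Q (u, h)))"
  by (rule continuous_on_compose2[OF fQ_cont]) (auto intro!: continuous_intros)

lemma p'_cont: "continuous_on I p'"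
  using cont I continuous_on_subset by blast

text \<open>All levels are translates of the arc, so the same \<open>p'\<close> occurs in each
  integral. Continuity at level 0 carries information from a side, where a primitive exists, to the
  arc itself.\<close>

lemma arc_prim_levels: "x \<in> {a..b} \<Longrightarrow> continuous_on {-k..k} (\<lambda>h. integral {a..x} (\<lambda>u. f (Q (u, h)) * p' u))"
proof -
  assume x: "x \<in> {a..b}"
  have "continuous_on ({-k..k} \<times> cbox a x) (\<lambda>(h, u). f (Q (u, h)) * p' u)"
    unfolding case_prod_beta
    using x I k by (intro continuous_intros continuous_on_compose2[OF fQ_cont] continuous_on_compose2[OF p'_cont]) auto
  then show ?thesis using integral_continuous_on_param by fastforce
qed

lemma vert_prim_cont: "x \<in> I \<Longrightarrow> continuous_on {-k..k} (vert_prim x)"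
  unfolding vert_prim_def using k
  by (intro indefinite_integral_continuous_1 integrable_continuous_interval continuous_intros
      continuous_on_subset[OF fQ_cont_vert]) auto

lemma vert_prim_diff:
  assumes x: "x \<in> I" and h: "-k \<le> h" "h \<le> h'" "h' \<le> k"
    and der: "\<And>y. y \<in> {h..h'} \<Longrightarrow> (F has_field_derivative f (Q (x, y))) (at (Q (x, y)))"
  shows "F (Q (x, h')) - F (Q (x, h)) = vert_prim x h' - vert_prim x h"
proof -
  have c: "continuous_on {-k..h'} (\<lambda>y. f (Q (x, y)) * (\<i> * v))"
    using x h k by (intro continuous_intros continuous_on_subset[OF fQ_cont_vert]) auto
  have "vert_prim x h + integral {h..h'} (\<lambda>y. f (Q (x, y)) * (\<i> * v)) = vert_prim x h'"
    unfolding vert_prim_def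
    using h by (intro Henstock_Kurzweil_Integration.integral_combine integrable_continuous_interval c) auto
  moreover have "((\<lambda>y. f (Q (x, y)) * (\<i> * v)) has_integral (F (Q (x, h')) - F (Q (x, h)))) {h..h'}"
  proof (rule fundamental_theorem_of_calculus)
    fix y assume y: "y \<in> {h..h'}"
    have "((\<lambda>y. Q (x, y)) has_vector_derivative \<i> * v) (at y)"
      unfolding Q_def has_vector_derivative_def
      by (auto intro!: derivative_eq_intros simp: scaleR_conv_of_real)
    from field_vector_diff_chain_at[OF this der[OF y]]
    show "((\<lambda>y. F (Q (x, y))) has_vector_derivative f (Q (x, y)) * (\<i> * v)) (at y within {h..h'})"
      by (simp add: o_def mult.commute has_vector_derivative_at_within)
  qed (use h in auto)
  ultimately show ?thesis by (metis add_diff_cancel_left' integral_unique)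
qed

lemma arc_prim_diff:
  assumes x: "x \<in> {a..b}"
    and der: "\<And>u. u \<in> {a..x} \<Longrightarrow> (F has_field_derivative f (Q (u, h))) (at (Q (u, h)))"
  shows "F (Q (x, h)) - F (Q (a, h)) = integral {a..x} (\<lambda>u. f (Q (u, h)) * p' u)"
proof -
  have "((\<lambda>u. f (Q (u, h)) * p' u) has_integral (F (Q (x, h)) - F (Q (a, h)))) {a..x}"
  proof (rule fundamental_theorem_of_calculus)
    fix u assume u: "u \<in> {a..x}"
    have "(p has_vector_derivative p' u) (at u)" 
    proof (rule deriv)
      have "u \<in> {a..b}" using u x by auto
      then show "u \<in> J" using I by blast
    qed
    then have "((\<lambda>u. Q (u, h)) has_vector_derivative p' u) (at u)"
      unfolding Q_def by (auto intro!: derivative_eq_intros)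
    from field_vector_diff_chain_at[OF this der[OF u]]
    show "((\<lambda>u. F (Q (u, h))) has_vector_derivative f (Q (u, h)) * p' u) (at u within {a..x})"
      by (simp add: o_def mult.commute has_vector_derivative_at_within)
  qed (use x in auto)
  then show ?thesis by (simp add: integral_unique)
qed

text \<open>The image of a convex half box is simply connected, so \<open>f\<close> has a primitive
  \<open>F\<close> there. Going from \<open>(a, h')\<close> along the level \<open>h'\<close> to
  \<open>x\<close>, then transversally to \<open>h\<close>, and letting \<open>h'\<close> tend to 0
  shows that \<open>F (Q (x, h)) - prim (x, h)\<close> is the limit of \<open>F (Q (a, h'))\<close>,
  which does not depend on \<open>(x, h)\<close>.\<close>

lemma prim_side:
  assumes S: "open S" "convex S" "S \<subseteq> {-\<eta><..<\<eta>}" "S \<noteq> {}" "0 \<in> closure (S \<inter> {-k..k})" "0 \<notin> S"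
    and hol: "f holomorphic_on Q ` (I \<times> S)"
  obtains F L where "\<And>z. z \<in> Q ` (I \<times> S) \<Longrightarrow> (F has_field_derivative f z) (at z)"
    "\<And>x h. x \<in> {a..b} \<Longrightarrow> h \<in> S \<inter> {-k..k} \<Longrightarrow> prim (x, h) = F (Q (x, h)) - L"
proof -
  let ?X = "Q ` (I \<times> S)"
  let ?S = "S \<inter> {-k..k}"
  have sub: "I \<times> S \<subseteq> J \<times> UNIV" using I by auto
  have op: "open ?X" by (intro Q_open open_Times I S sub)
  have "(I \<times> S) homeomorphic ?X"
    by (intro invariance_of_domain_homeomorphic open_Times continuous_on_subset[OF Q_continuous sub]
        inj_on_subset[OF Q_inj sub] I S(1)) auto
  moreover have "simply_connected (I \<times> S)"
    by (intro convex_imp_simply_connected convex_Times I S)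
  ultimately have "simply_connected ?X" by (rule homeomorphic_simply_connected)
  from conjunct2[OF iffD1[OF simply_connected_eq_global_primitive[OF op] this], rule_format, OF hol]
  obtain F where F: "\<And>z. z \<in> ?X \<Longrightarrow> (F has_field_derivative f z) (at z)" by blast
  have nb: "at 0 within ?S \<noteq> bot"
    using S(5,6) by (simp add: trivial_limit_within islimpt_in_closure)
  have lim: "((\<lambda>h'. F (Q (a, h'))) \<longlongrightarrow> F (Q (x, h)) - prim (x, h)) (at 0 within ?S)"
    if x: "x \<in> {a..b}" and h: "h \<in> ?S" for x h
  proof -
    have xI: "x \<in> I" using x I by auto
    have *: "F (Q (a, h')) = F (Q (x, h)) - vert_prim x h + vert_prim x h' - integral {a..x} (\<lambda>u. f (Q (u, h')) * p' u)"
      if h': "h' \<in> ?S" for h'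
    proof -
      have "closed_segment h h' \<subseteq> S" using h h' S(2) by (intro closed_segment_subset) blast+
      then have seg: "(F has_field_derivative f (Q (x, y))) (at (Q (x, y)))" if "y \<in> closed_segment h h'" for y
        using that xI by (intro F) blast
      have "F (Q (x, h)) - F (Q (x, h')) = vert_prim x h - vert_prim x h'"
      proof (cases "h \<le> h'")
        case True
        then have "F (Q (x, h')) - F (Q (x, h)) = vert_prim x h' - vert_prim x h"
          using h h' by (intro vert_prim_diff[OF xI] seg) (auto simp: closed_segment_eq_real_ivl)
        then show ?thesis by (simp add: algebra_simps)
      next
        case False
        then show ?thesis
          using h h' by (intro vert_prim_diff[OF xI] seg) (auto simp: closed_segment_eq_real_ivl)
      qed
      moreover have "F (Q (x, h')) - F (Q (a, h')) = integral {a..x} (\<lambda>u. f (Q (u, h')) * p' u)"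
      proof (intro arc_prim_diff F x)
        fix u assume "u \<in> {a..x}"
        then have "u \<in> {a..b}" using x by auto
        then show "Q (u, h') \<in> ?X" using h' I by blast
      qed
      ultimately show ?thesis by (simp add: algebra_simps)
    qed
    have "((\<lambda>h'. F (Q (x, h)) - vert_prim x h + vert_prim x h' - integral {a..x} (\<lambda>u. f (Q (u, h')) * p' u))
           \<longlongrightarrow> F (Q (x, h)) - vert_prim x h + vert_prim x 0 - arc_prim x) (at 0 within ?S)"
    proof (intro tendsto_intros)
      show "(vert_prim x \<longlongrightarrow> vert_prim x 0) (at 0 within ?S)"
        using vert_prim_cont[OF xI] k unfolding continuous_on_def
        by (intro tendsto_within_subset[OF _ Int_lower2]) simp
      show "((\<lambda>h'. integral {a..x} (\<lambda>u. f (Q (u, h')) * p' u)) \<longlongrightarrow> arc_prim x) (at 0 within ?S)"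
        using arc_prim_levels[OF x] k unfolding arc_prim_def continuous_on_def
        by (intro tendsto_within_subset[OF _ Int_lower2]) simp
    qed
    then have "((\<lambda>h'. F (Q (a, h'))) \<longlongrightarrow> F (Q (x, h)) - vert_prim x h + vert_prim x 0 - arc_prim x) (at 0 within ?S)"
    proof (rule Lim_transform_eventually)
      show "\<forall>\<^sub>F h' in at 0 within ?S. F (Q (x, h)) - vert_prim x h + vert_prim x h' - integral {a..x} (\<lambda>u. f (Q (u, h')) * p' u) = F (Q (a, h'))"
        unfolding eventually_at_filter by (rule always_eventually) (blast intro: *[symmetric])
    qed
    then show ?thesis unfolding prim_def prod.case by (simp add: algebra_simps)
  qed
  show ?thesis
  proof (cases "a \<le> b \<and> ?S \<noteq> {}")
    case True
    then obtain h0 where h0: "h0 \<in> ?S" by blast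
    show ?thesis
    proof (rule that[of F "F (Q (a, h0)) - prim (a, h0)"])
      fix x h assume xh: "x \<in> {a..b}" "h \<in> ?S"
      have "a \<in> {a..b}" using True by simp
      then have "F (Q (x, h)) - prim (x, h) = F (Q (a, h0)) - prim (a, h0)"
        by (intro tendsto_unique[OF nb lim[OF xh] lim] h0)
      then show "prim (x, h) = F (Q (x, h)) - (F (Q (a, h0)) - prim (a, h0))" by (simp add: algebra_simps)
    qed (use F in auto)
  next
    case False
    have no: "\<not> (x \<in> {a..b} \<and> h \<in> ?S)" for x h
    proof
      assume "x \<in> {a..b} \<and> h \<in> ?S"
      then have "a \<le> b" "?S \<noteq> {}" by (auto simp del: Int_iff)
      with False show False by blast
    qed
    show ?thesis by (rule that[of F 0]) (use F no in \<open>blast+\<close>)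
  qed
qed

text \<open>Along the two legs of the path the constant \<open>c = f (Q (x0, 0))\<close> integrates
  exactly to \<open>c\<close> times the increment of \<open>Q\<close>. What remains are integrals of
  \<open>f - c\<close> over short paths.\<close>

lemma prim_deriv_on_arc:
  assumes x0: "a < x0" "x0 < b" and G: "\<And>x h. x \<in> {a..b} \<Longrightarrow> \<bar>h\<bar> \<le> k \<Longrightarrow> G (Q (x, h)) = prim (x, h)"
  shows "(G has_field_derivative f (Q (x0, 0))) (at (Q (x0, 0)))"
  unfolding has_field_derivative_def has_derivative_within_alt
proof (intro conjI allI impI bounded_linear_mult_right)
  fix e :: real assume e: "e > 0"
  define c where "c = f (Q (x0, 0))"
  have x0I: "x0 \<in> I" using x0 I by auto
  have "continuous_on (I \<times> {-\<eta><..<\<eta>}) (\<lambda>z. f (Q z))" by (rule fQ_cont)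
  moreover have "(x0, 0) \<in> I \<times> {-\<eta><..<\<eta>}" using x0I k by auto
  moreover have "open (I \<times> {-\<eta><..<\<eta>})" using I by (intro open_Times) auto
  ultimately have "isCont (\<lambda>z. f (Q z)) (x0, 0)" using continuous_on_eq_continuous_at by blast
  then obtain \<delta>0 where \<delta>0: "\<delta>0 > 0" "\<And>z. dist z (x0, 0) < \<delta>0 \<Longrightarrow> dist (f (Q z)) c < e / 3"
    unfolding continuous_at_eps_delta c_def using e by (meson divide_pos_pos zero_less_numeral)
  define \<delta> where "\<delta> = min (\<delta>0 / 2) (min k (min (x0 - a) (b - x0)))"
  have \<delta>: "\<delta> > 0" "\<delta> \<le> k" "\<delta> \<le> x0 - a" "\<delta> \<le> b - x0" using \<delta>0 k x0 by (auto simp: \<delta>_def)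
  have near_c: "norm (f (Q (x, h)) - c) \<le> e / 3" if "\<bar>x - x0\<bar> < \<delta>" "\<bar>h\<bar> < \<delta>" for x h
  proof -
    have "dist (x, h) (x0, 0) \<le> \<bar>x - x0\<bar> + \<bar>h\<bar>"
      using sqrt_sum_squares_le_sum_abs[of "x - x0" h] by (simp add: dist_Pair_Pair dist_real_def)
    also have "\<dots> < \<delta>0" using that by (simp add: \<delta>_def)
    finally show ?thesis using \<delta>0(2)[of "(x, h)"] unfolding dist_norm by simp
  qed
  have "open (Q ` ({x0-\<delta><..<x0+\<delta>} \<times> {-\<delta><..<\<delta>}))"
  proof (intro Q_open open_Times)
    have "{x0-\<delta><..<x0+\<delta>} \<subseteq> {a..b}" using \<delta> by auto
    then show "{x0-\<delta><..<x0+\<delta>} \<times> {-\<delta><..<\<delta>} \<subseteq> J \<times> UNIV" using I by blast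
  qed auto
  moreover have "Q (x0, 0) \<in> Q ` ({x0-\<delta><..<x0+\<delta>} \<times> {-\<delta><..<\<delta>})" using \<delta> by auto
  ultimately obtain r where r: "r > 0" "ball (Q (x0, 0)) r \<subseteq> Q ` ({x0-\<delta><..<x0+\<delta>} \<times> {-\<delta><..<\<delta>})"
    using open_contains_ball by blast
  show "\<exists>r>0. \<forall>z\<in>UNIV. norm (z - Q (x0, 0)) < r \<longrightarrow>
          norm (G z - G (Q (x0, 0)) - f (Q (x0, 0)) * (z - Q (x0, 0))) \<le> e * norm (z - Q (x0, 0))"
  proof (intro exI[of _ r] conjI r ballI impI)
    fix z assume "norm (z - Q (x0, 0)) < r"
    then obtain x h where xh: "\<bar>x - x0\<bar> < \<delta>" "\<bar>h\<bar> < \<delta>" and z: "z = Q (x, h)"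

    proof -
      have "z \<in> ball (Q (x0, 0)) r"
        using \<open>norm (z - Q (x0, 0)) < r\<close> by (simp add: dist_norm norm_minus_commute)
      then have "z \<in> Q ` ({x0-\<delta><..<x0+\<delta>} \<times> {-\<delta><..<\<delta>})" using r(2) by blast
      then show ?thesis
      proof (elim imageE SigmaE)
        fix q x h assume "z = Q q" "q = (x, h)" "x \<in> {x0-\<delta><..<x0+\<delta>}" "h \<in> {-\<delta><..<\<delta>}"
        then show thesis by (intro that[of x h]) (auto simp: abs_less_iff)
      qed
    qed
    have xab: "x \<in> {a..b}" using xh \<delta> by auto
    have xI: "x \<in> I" using xab I by auto
    have xJ: "x \<in> J" "x0 \<in> J" using xI x0I I by auto
    have abI: "{a..b} \<subseteq> J" using I by auto
    let ?\<phi> = "\<lambda>u. (f (Q (u, 0)) - c) * p' u"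
    let ?\<psi> = "\<lambda>y. (f (Q (x, y)) - c) * (\<i> * v)"
    have c0: "continuous_on {a..b} (\<lambda>u. f (Q (u, 0)))" "continuous_on {a..b} p'"
      "continuous_on {-k..k} (\<lambda>y. f (Q (x, y)))"
      by (intro continuous_on_subset[OF fQ_cont_hor] continuous_on_subset[OF p'_cont] I
          continuous_on_subset[OF fQ_cont_vert[OF xI]]; use k in \<open>force\<close>)+
    have cA: "continuous_on {a..b} (\<lambda>u. f (Q (u, 0)) * p' u)" and c\<phi>: "continuous_on {a..b} ?\<phi>"
      and cB: "continuous_on {-k..k} (\<lambda>y. f (Q (x, y)) * (\<i> * v))" and c\<psi>: "continuous_on {-k..k} ?\<psi>"
      by (intro continuous_intros c0)+
    have A: "integral {a..y} ?\<phi> = arc_prim y - c * (p y - p a)" if y: "y \<in> {a..b}" for y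
    proof -
      have "(p' has_integral (p y - p a)) {a..y}"
      proof (rule fundamental_theorem_of_calculus)
        fix u assume "u \<in> {a..y}"
        then have "u \<in> {a..b}" using y by auto
        then have "u \<in> J" using abI by blast
        then show "(p has_vector_derivative p' u) (at u within {a..y})"
          by (rule has_vector_derivative_at_within[OF deriv])
      qed (use y in auto)
      then have "((\<lambda>u. c * p' u) has_integral (c * (p y - p a))) {a..y}"
        by (rule has_integral_mult_right)
      moreover have "((\<lambda>u. f (Q (u, 0)) * p' u) has_integral (arc_prim y)) {a..y}"
        unfolding arc_prim_def
        by (intro integrable_integral integrable_continuous_interval continuous_on_subset[OF cA(1)]) (use y in auto)
      ultimately have "((\<lambda>u. f (Q (u, 0)) * p' u - c * p' u) has_integral (arc_prim y - c * (p y - p a))) {a..y}"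
        by (intro has_integral_diff)
      then show ?thesis unfolding left_diff_distrib by (rule integral_unique)
    qed
    have Bv: "integral {-k..y} ?\<psi> = vert_prim x y - c * (\<i> * v) * (y + k)" if y: "y \<in> {-k..k}" for y
    proof -
      have "((\<lambda>u. f (Q (x, u)) * (\<i> * v)) has_integral (vert_prim x y)) {-k..y}"
        unfolding vert_prim_def
        by (intro integrable_integral integrable_continuous_interval continuous_on_subset[OF cB(1)]) (use y in auto)
      moreover have "((\<lambda>u. c * (\<i> * v)) has_integral ((y - (-k)) *\<^sub>R (c * (\<i> * v)))) {-k..y}"
        using has_integral_const_real[of "c * (\<i> * v)" "-k" y] y by simp
      ultimately have "((\<lambda>u. f (Q (x, u)) * (\<i> * v) - c * (\<i> * v)) has_integral
          (vert_prim x y - (y - (-k)) *\<^sub>R (c * (\<i> * v)))) {-k..y}"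
        by (intro has_integral_diff)
      then have "integral {-k..y} ?\<psi> = vert_prim x y - (y - (-k)) *\<^sub>R (c * (\<i> * v))"
        unfolding left_diff_distrib by (rule integral_unique)
      then show ?thesis by (simp add: scaleR_conv_of_real)
    qed
    have "norm (integral {a..x} ?\<phi> - integral {a..x0} ?\<phi>) \<le> (e / 3 * (5/4 * norm v)) * \<bar>x - x0\<bar>"
    proof (rule norm_integral_diff_le[OF c\<phi>])
      fix u assume u: "u \<in> closed_segment x x0"
      then have "\<bar>u - x0\<bar> < \<delta>" using xh by (auto simp: closed_segment_eq_real_ivl split: if_splits)
      then have 1: "norm (f (Q (u, 0)) - c) \<le> e / 3" using near_c[of u 0] \<delta> by simp
      have "u \<in> J" using \<open>\<bar>u - x0\<bar> < \<delta>\<close> \<delta> abI by (auto simp: subset_iff abs_less_iff)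
      from near[OF this] have "norm (p' u) \<le> 5/4 * norm v"
        using norm_triangle_sub[of "p' u" v] by linarith
      with 1 show "norm (?\<phi> u) \<le> e / 3 * (5/4 * norm v)"
        unfolding norm_mult by (intro mult_mono) (use e in auto)
    qed (use xab x0 in auto)
    moreover have "norm (integral {-k..h} ?\<psi> - integral {-k..0} ?\<psi>) \<le> (e / 3 * norm v) * \<bar>h - 0\<bar>"
    proof (rule norm_integral_diff_le[OF c\<psi>])
      fix u assume u: "u \<in> closed_segment h 0"
      then have "\<bar>u\<bar> < \<delta>" using xh by (auto simp: closed_segment_eq_real_ivl split: if_splits)
      then have 1: "norm (f (Q (x, u)) - c) \<le> e / 3" using near_c[of x u] xh by simp
      then show "norm (?\<psi> u) \<le> e / 3 * norm v"
        unfolding norm_mult using mult_right_mono[OF 1 norm_ge_zero[of v]] by simp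
    qed (use xh \<delta> in auto)
    moreover have "G z - G (Q (x0, 0)) - c * (z - Q (x0, 0)) =
        (integral {a..x} ?\<phi> - integral {a..x0} ?\<phi>) + (integral {-k..h} ?\<psi> - integral {-k..0} ?\<psi>)"
    proof -
      have m: "x0 \<in> {a..b}" "h \<in> {-k..k}" "0 \<in> {-k..k}" using x0 xh(2) \<delta> k by auto
      have gz: "G z = prim (x, h)" unfolding z using m by (intro G xab) auto
      have g0: "G (Q (x0, 0)) = prim (x0, 0)" using m by (intro G) auto
      have zz: "z - Q (x0, 0) = p x - p x0 + \<i> * of_real h * v" unfolding z by (simp add: Q_def)
      show ?thesis
        unfolding gz g0 zz A[OF xab] A[OF m(1)] Bv[OF m(2)] Bv[OF m(3)] prim_def prod.case
        by (simp add: algebra_simps)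
    qed
    ultimately have "norm (G z - G (Q (x0, 0)) - c * (z - Q (x0, 0))) \<le>
        (e / 3 * (5/4 * norm v)) * \<bar>x - x0\<bar> + (e / 3 * norm v) * \<bar>h\<bar>"
      by (smt (verit) norm_triangle_ineq)
    \<comment> \<open>The norm of \<open>p'\<close> is at most 5/4 of that of \<open>v\<close>; by
      \<open>Q_chord_bounds\<close> the bracket is at most \<open>5/4 * 4/3 + 4/3 = 3\<close> times
      the distance.\<close>
    also have "\<dots> = e / 3 * (5/4 * (\<bar>x - x0\<bar> * norm v) + \<bar>h\<bar> * norm v)" by (simp add: algebra_simps)
    also have "\<dots> \<le> e / 3 * (3 * norm (z - Q (x0, 0)))"
      using Q_chord_bounds[OF xJ, of h] e unfolding z by (intro mult_left_mono) auto
    finally show "norm (G z - G (Q (x0, 0)) - f (Q (x0, 0)) * (z - Q (x0, 0))) \<le> e * norm (z - Q (x0, 0))"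
      by (simp add: c_def)
  qed
qed

end

text \<open>The primitive by path integrals has derivative \<open>f\<close> off the arc, because it
  differs there from a genuine primitive by a constant, and on the arc by the direct estimate. So it
  is holomorphic, and so is its derivative \<open>f\<close>.\<close>

lemma removable_arc:
  assumes I: "open I" "convex I" "I \<subseteq> J" and \<eta>: "0 < \<eta>"
    and f: "continuous_on (Q ` (I \<times> {-\<eta><..<\<eta>})) f"
    and up: "f holomorphic_on Q ` (I \<times> {0<..<\<eta>})" and low: "f holomorphic_on Q ` (I \<times> {-\<eta><..<0})"
  shows "f holomorphic_on Q ` (I \<times> {-\<eta><..<\<eta>})"
proof -
  have sub: "I \<times> S \<subseteq> J \<times> UNIV" for S :: "real set" using I by auto
  have op: "open (Q ` (I \<times> S))" if "open S" for S
    using I that sub by (intro Q_open open_Times)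
  have "f field_differentiable at (Q (x0, h0))" if x0: "x0 \<in> I" and h0: "-\<eta> < h0" "h0 < \<eta>" for x0 h0
  proof (cases "h0 = 0")
    case False
    then consider "0 < h0" | "h0 < 0" by linarith
    then show ?thesis
    proof cases
      case 1 then show ?thesis using up op[of "{0<..<\<eta>}"] x0 h0
        by (intro holomorphic_on_imp_differentiable_at[OF up]) auto
    next
      case 2 then show ?thesis using low op[of "{-\<eta><..<0}"] x0 h0
        by (intro holomorphic_on_imp_differentiable_at[OF low]) auto
    qed
  next
    case True
    \<comment> \<open>A compact parameter interval inside \<open>I\<close>; the primitive is
      integrated from its left end.\<close>
    obtain r where r: "r > 0" "cball x0 r \<subseteq> I" using I(1) x0 open_contains_cball by blast
    define a b k where "a = x0 - r" and "b = x0 + r" and "k = \<eta> / 2"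
    have ab: "{a..b} \<subseteq> I" using r by (auto simp: a_def b_def cball_eq_atLeastAtMost)
    have k: "0 < k" "k < \<eta>" using \<eta> by (auto simp: k_def)
    note ctx = I(1,2,3) ab k f
    define G where "G = (\<lambda>z. prim a k f (inv_into (J \<times> UNIV) Q z))"
    have G: "G (Q (x, h)) = prim a k f (x, h)" if "x \<in> {a..b}" for x h
      using that ab I Q_inj by (auto simp: G_def inv_into_f_f subset_iff)
    let ?W = "Q ` ({a<..<b} \<times> {-k<..<k})"
    have abJ: "{a<..<b} \<times> S \<subseteq> J \<times> UNIV" for S :: "real set"
    proof -
      have "{a<..<b} \<subseteq> {a..b}" by auto
      then show ?thesis using ab I by blast
    qed
    have opW: "open ?W" by (intro Q_open open_Times abJ) auto
    obtain F1 L1 where F1: "\<And>z. z \<in> Q ` (I \<times> {0<..<\<eta>}) \<Longrightarrow> (F1 has_field_derivative f z) (at z)"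
      and L1: "\<And>x h. x \<in> {a..b} \<Longrightarrow> h \<in> {0<..<\<eta>} \<inter> {-k..k} \<Longrightarrow> prim a k f (x, h) = F1 (Q (x, h)) - L1"
    proof (rule prim_side[OF ctx _ _ _ _ _ _ up])
      have "{0<..<\<eta>} \<inter> {-k..k} = {0<..k}" using k by auto
      then show "0 \<in> closure ({0<..<\<eta>} \<inter> {-k..k})" using k by (simp add: closure_greaterThanAtMost)
    qed (use \<eta> in auto)
    obtain F2 L2 where F2: "\<And>z. z \<in> Q ` (I \<times> {-\<eta><..<0}) \<Longrightarrow> (F2 has_field_derivative f z) (at z)"
      and L2: "\<And>x h. x \<in> {a..b} \<Longrightarrow> h \<in> {-\<eta><..<0} \<inter> {-k..k} \<Longrightarrow> prim a k f (x, h) = F2 (Q (x, h)) - L2"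
    proof (rule prim_side[OF ctx _ _ _ _ _ _ low])
      have "{-\<eta><..<0} \<inter> {-k..k} = {-k..<0}" using k by auto
      then show "0 \<in> closure ({-\<eta><..<0} \<inter> {-k..k})" using k by (simp add: closure_atLeastLessThan)
    qed (use \<eta> in auto)
    have der: "(G has_field_derivative f z) (at z)" if "z \<in> ?W" for z
    proof -
      from that obtain x h where xh: "x \<in> {a<..<b}" "h \<in> {-k<..<k}" "z = Q (x, h)" by auto
      have xI: "x \<in> I" using xh(1) ab by (meson greaterThanLessThan_subseteq_atLeastAtMost_iff order_refl subsetD)
      consider "h = 0" | "0 < h" | "h < 0" by linarith
      then show ?thesis
      proof cases
        case 1
        then show ?thesis using prim_deriv_on_arc[OF ctx, of x G] G xh by auto
      next
        case 2
        let ?V = "Q ` ({a<..<b} \<times> {0<..<k})"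
        have 1: "open ?V" by (intro Q_open open_Times abJ) auto
        have 2: "z \<in> ?V" using xh \<open>0 < h\<close> by auto
        have 3: "F1 w - L1 = G w" if "w \<in> ?V" for w using that k by (auto simp: G L1)
        have 4: "((\<lambda>w. F1 w - L1) has_field_derivative f z) (at z)"
          using F1[of z] xh(2,3) xI \<open>0 < h\<close> k by (auto intro!: derivative_eq_intros)
        show ?thesis by (rule has_field_derivative_transform_within_open[OF 4 1 2 3])
      next
        case 3
        let ?V = "Q ` ({a<..<b} \<times> {-k<..<0})"
        have 1: "open ?V" by (intro Q_open open_Times abJ) auto
        have 2: "z \<in> ?V" using xh \<open>h < 0\<close> by auto
        have 3: "F2 w - L2 = G w" if "w \<in> ?V" for w using that k by (auto simp: G L2)
        have 4: "((\<lambda>w. F2 w - L2) has_field_derivative f z) (at z)"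
          using F2[of z] xh(2,3) xI \<open>h < 0\<close> k by (auto intro!: derivative_eq_intros)
        show ?thesis by (rule has_field_derivative_transform_within_open[OF 4 1 2 3])
      qed
    qed
    have "G holomorphic_on ?W" unfolding holomorphic_on_open[OF opW] using der by blast
    then have "deriv G holomorphic_on ?W" using opW holomorphic_deriv by blast
    then have "f holomorphic_on ?W"
      by (rule holomorphic_transform) (rule DERIV_imp_deriv[OF der])
    moreover have "Q (x0, 0) \<in> ?W" using r k by (auto simp: a_def b_def)
    ultimately show ?thesis using True opW holomorphic_on_imp_differentiable_at by blast
  qed
  then have "\<forall>z\<in>I \<times> {-\<eta><..<\<eta>}. f field_differentiable at (Q z)" by auto
  then show ?thesis
    unfolding holomorphic_on_def by (metis (no_types, lifting) field_differentiable_at_within imageE)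
qed

end

subsection \<open>Two-sided boxes along an arc\<close>

text \<open>The coordinates are hidden. Apart from the topology of the sides, two facts are kept:
  the boundary filters are limits within open sides, at every point of the arc in the box and not
  only at \<open>t\<close>; and continuous functions have no singularities along the arc.\<close>

definition arc_box ::
    "(real \<Rightarrow> complex) \<Rightarrow> real \<Rightarrow> real \<Rightarrow> complex set \<Rightarrow> complex set \<Rightarrow> complex set \<Rightarrow> bool" where
  "arc_box p t \<epsilon> U Up Um \<longleftrightarrow> 0 < \<epsilon> \<and> open U \<and> open Up \<and> open Um \<and> connected Up \<and> connected Um \<and>
     Up \<inter> Um = {} \<and> U = Up \<union> Um \<union> p ` {t-\<epsilon><..<t+\<epsilon>} \<and> (Up \<union> Um) \<inter> p ` {t-\<epsilon><..<t+\<epsilon>} = {} \<and>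
     (\<forall>s\<in>{t-\<epsilon><..<t+\<epsilon>}. left_side p s = at (p s) within Up \<and> right_side p s = at (p s) within Um) \<and>
     (\<forall>f. continuous_on U f \<longrightarrow> f holomorphic_on Up \<longrightarrow> f holomorphic_on Um \<longrightarrow> f holomorphic_on U)"

lemma left_side_neq_bot [simp]: "left_side p t \<noteq> bot"
  and right_side_neq_bot [simp]: "right_side p t \<noteq> bot"
  unfolding left_side_def right_side_def by (simp_all add: filtermap_bot_iff prod_filter_eq_bot)

text \<open>The last equation says that the box meets the flat piece only in its own middle part; it
  is what later identifies the trace of the whole graph on the box.\<close>

lemma (in flat_arc) arc_box_exists:
  assumes V: "open V" "p t \<in> V" and e: "0 < e"
  obtains \<epsilon> U Up Um where "arc_box p t \<epsilon> U Up Um" "\<epsilon> < e" "\<epsilon> < d" "U \<subseteq> V"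
    "U \<inter> p ` {t-d<..<t+d} = p ` {t-\<epsilon><..<t+\<epsilon>}"
proof -
  have tJ: "t \<in> J" using d_pos by simp
  define N where "N = J \<times> UNIV \<inter> Q -` V"
  have N: "open N" "(t, 0) \<in> N" "\<And>z. z \<in> N \<Longrightarrow> Q z \<in> V"
    using continuous_open_preimage[OF Q_continuous _ V(1)] V tJ by (auto simp: N_def open_Times Q_def)
  from N(1,2) obtain r where r: "0 < r" "ball (t, 0) r \<subseteq> N" using open_contains_ball by blast
  \<comment> \<open>Half of \<open>r\<close>, since in coordinates a point of the box has distance
    at most \<open>\<bar>x - t\<bar> + \<bar>h\<bar>\<close> from the centre; below
    \<open>d\<close>, so that the box stays over the flat piece.\<close>
  define \<epsilon> where "\<epsilon> = min (r/2) (min (e/2) (d/2))"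
  have \<epsilon>: "0 < \<epsilon>" "\<epsilon> < e" "\<epsilon> < d" "\<epsilon> \<le> r/2" using r e d_pos by (auto simp: \<epsilon>_def)
  define I where "I = {t-\<epsilon><..<t+\<epsilon>}"
  have I: "open I" "convex I" "I \<subseteq> J" using \<epsilon> by (auto simp: I_def)
  have sub: "I \<times> S \<subseteq> J \<times> UNIV" for S :: "real set" using I by auto
  define U Up Um where "U = Q ` (I \<times> {-\<epsilon><..<\<epsilon>})" and "Up = Q ` (I \<times> {0<..<\<epsilon>})"
    and "Um = Q ` (I \<times> {-\<epsilon><..<0})"
  have arc: "p ` S = Q ` (S \<times> {0})" for S by (auto simp: Q_def image_def)
  have split: "I \<times> {-\<epsilon><..<\<epsilon>} = I \<times> {0<..<\<epsilon>} \<union> I \<times> {-\<epsilon><..<0} \<union> I \<times> {0}"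
    using \<epsilon> by (auto simp: set_eq_iff)
  have disj: "Q ` A \<inter> Q ` B = Q ` (A \<inter> B)" if "A \<subseteq> J \<times> UNIV" "B \<subseteq> J \<times> UNIV" for A B
    using inj_on_image_Int[OF Q_inj that] by simp
  have op: "open U" "open Up" "open Um"
    unfolding U_def Up_def Um_def by (intro Q_open open_Times I sub open_greaterThanLessThan)+
  have conn: "connected Up" "connected Um"
    unfolding U_def Up_def Um_def
    by (intro connected_continuous_image continuous_on_subset[OF Q_continuous sub] connected_Times
        convex_connected I(2) convex_real_interval)+
  have side: "left_side p s = at (p s) within Up" "right_side p s = at (p s) within Um" if s: "s \<in> I" for s
  proof -
    have vd: "vector_derivative p (at s) = p' s"
      using s I deriv by (intro vector_derivative_at) auto
    have 1: "{h. 0 < 1 * h \<and> \<bar>h\<bar> < \<epsilon>} = {0<..<\<epsilon>}" "{h. 0 < (-1) * h \<and> \<bar>h\<bar> < \<epsilon>} = {-\<epsilon><..<0}" by auto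
    show "left_side p s = at (p s) within Up"
      using side_filter_eq[OF _ \<epsilon>(1) \<epsilon>(1) I(1,3) s, of 1] unfolding left_side_def vd Up_def 1 by simp
    show "right_side p s = at (p s) within Um"
      using side_filter_eq[OF _ \<epsilon>(1) \<epsilon>(1) I(1,3) s, of "-1"] unfolding right_side_def vd Um_def 1 by simp
  qed
  have rem: "f holomorphic_on U" if "continuous_on U f" "f holomorphic_on Up" "f holomorphic_on Um" for f
    using removable_arc[OF I \<epsilon>(1)] that unfolding U_def Up_def Um_def by blast
  have "arc_box p t \<epsilon> U Up Um"
    unfolding arc_box_def I_def[symmetric]
  proof (intro conjI ballI allI impI \<epsilon>(1) op conn side rem)
    show "Up \<inter> Um = {}" unfolding Up_def Um_def disj[OF sub sub] by auto
    show "U = Up \<union> Um \<union> p ` I" unfolding U_def Up_def Um_def arc split by (simp add: image_Un)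
    have "Up \<inter> p ` I = {}" "Um \<inter> p ` I = {}"
      unfolding Up_def Um_def arc disj[OF sub sub] by auto
    then show "(Up \<union> Um) \<inter> p ` I = {}" by blast
  qed
  moreover have "U \<subseteq> V"
  proof
    fix z assume "z \<in> U"
    then obtain x h where xh: "z = Q (x, h)" "\<bar>x - t\<bar> < \<epsilon>" "\<bar>h\<bar> < \<epsilon>"
      unfolding U_def I_def by (auto simp: abs_less_iff)
    have "dist (t, 0) (x, h) \<le> \<bar>x - t\<bar> + \<bar>h\<bar>"
      using sqrt_sum_squares_le_sum_abs[of "t - x" "-h"] by (simp add: dist_Pair_Pair dist_real_def abs_minus_commute)
    also have "\<dots> < r" using xh \<epsilon> by simp
    finally show "z \<in> V" using r N xh by auto
  qed
  moreover have "U \<inter> p ` J = p ` I"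
  proof -
    have "(I \<times> {-\<epsilon><..<\<epsilon>}) \<inter> (J \<times> {0}) = I \<times> {0}" using I(3) \<epsilon> by auto
    moreover have "J \<times> {0} \<subseteq> J \<times> (UNIV :: real set)" by auto
    ultimately show ?thesis unfolding U_def arc using disj[OF sub] by metis
  qed
  ultimately show ?thesis using that \<epsilon> unfolding I_def by blast
qed

lemma flat_arc_exists:
  assumes d0: "0 < d0" and der: "\<And>s. s \<in> {t-d0<..<t+d0} \<Longrightarrow> (p has_vector_derivative p' s) (at s)"
    and cont: "continuous_on {t-d0<..<t+d0} p'" and nz: "p' t \<noteq> 0"
  obtains d where "0 < d" "d \<le> d0" "flat_arc p p' t d (p' t)"
proof -
  let ?I = "{t-d0<..<t+d0}"
  obtain d where d: "d > 0" "\<And>x. x \<in> ?I \<Longrightarrow> \<bar>x - t\<bar> < d \<Longrightarrow> norm (p' x - p' t) \<le> norm (p' t) / 4"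
    "\<And>x y. x \<in> ?I \<Longrightarrow> y \<in> ?I \<Longrightarrow> \<bar>x - t\<bar> < d \<Longrightarrow> \<bar>y - t\<bar> < d \<Longrightarrow>
        norm (p x - p y - of_real (x - y) * p' t) \<le> norm (p' t) / 4 * \<bar>x - y\<bar>"
    by (rule C1_chord_bound[of ?I t p p' "norm (p' t) / 4"])
       (use d0 der cont nz in \<open>auto intro: has_vector_derivative_at_within\<close>)
  define d1 where "d1 = min d d0"
  have sub: "{t-d1<..<t+d1} \<subseteq> ?I" by (auto simp: d1_def)
  have ab: "\<bar>x - t\<bar> < d" if "x \<in> {t-d1<..<t+d1}" for x using that by (auto simp: d1_def abs_less_iff)
  have "flat_arc p p' t d1 (p' t)"
  proof
    show "0 < d1" using d d0 by (simp add: d1_def)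
    show "continuous_on {t-d1<..<t+d1} p'" using cont sub continuous_on_subset by blast
  qed (use nz der d sub ab in blast)+
  moreover have "0 < d1" "d1 \<le> d0" using d d0 by (auto simp: d1_def)
  ultimately show ?thesis using that by blast
qed

section \<open>The jump of the winding number across an arc\<close>

text \<open>Up to the factor \<open>\<i> * \<sigma> / v\<close> the function \<open>?g\<close> is
  \<open>w - z\<close>, rotated so that the slit of \<open>Ln\<close> starts at \<open>z\<close> and
  points away from the arc: on the piece \<open>?g\<close> is real only at \<open>p t\<close>, where
  its value is \<open>h > 0\<close>. So the logarithm of \<open>?g\<close> is a primitive of
  \<open>1 / (w - z)\<close> along the piece.\<close>

lemma (in flat_arc) winding_number_middle:
  assumes q: "valid_path p" "\<And>s. s \<in> {t-r..t+r} \<Longrightarrow> s \<in> {0..1}" and r: "0 < r" "r < d" and \<sigma>: "\<bar>\<sigma>\<bar> = 1" and h: "0 < h"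
  defines "m \<equiv> subpath (t-r) (t+r) p" and "z \<equiv> p t + \<i> * of_real (\<sigma> * h) * v"
  shows "2 * of_real pi * \<i> * winding_number m z =
      Ln (of_real h + \<i> * of_real \<sigma> * ((p (t+r) - p t) / v)) - Ln (of_real h + \<i> * of_real \<sigma> * ((p (t-r) - p t) / v))"
proof -
  let ?g = "\<lambda>w. of_real h + \<i> * of_real \<sigma> * ((w - p t) / v)"
  let ?S = "{w. ?g w \<notin> \<real>\<^sub>\<le>\<^sub>0}"
  have 1: "t - r \<in> {0..1}" "t + r \<in> {0..1}" using q(2)[of "t - r"] q(2)[of "t + r"] r by simp_all
  have vp: "valid_path m" unfolding m_def by (intro valid_path_subpath q(1) 1)
  have pi: "path_image m = p ` {t-r..t+r}" unfolding m_def using r by (simp add: path_image_subpath)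
  have im: "path_image m \<subseteq> ?S"
  proof -
    have "?g (p s) \<notin> \<real>\<^sub>\<le>\<^sub>0" if s: "s \<in> {t-r..t+r}" for s
    proof
      assume np: "?g (p s) \<in> \<real>\<^sub>\<le>\<^sub>0"
      have sJ: "s \<in> J" "t \<in> J" using s r by auto
      define D where "D = (p s - p t) / v"
      have "of_real h + \<i> * of_real \<sigma> * D \<in> \<real>\<^sub>\<le>\<^sub>0" using np by (simp only: D_def)
      then have "\<sigma> * Re D = 0" by (simp add: complex_nonpos_Reals_iff)
      then have "Re ((p s - p t) / v) = 0" using \<sigma> unfolding D_def by auto
      then have "s = t" using chord_quot(1)[OF sJ] by (simp add: abs_minus_commute)
      then show False using np h by (simp add: complex_nonpos_Reals_iff)
    qed
    then show ?thesis unfolding pi by blast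
  qed
  have \<sigma>2: "of_real \<sigma> * of_real \<sigma> = (1::complex)"
    using \<sigma> by (auto simp: abs_if split: if_splits)
  have quot: "\<i> * of_real \<sigma> / v / ?g w = 1 / (w - z)" for w
  proof -
    have "?g w = \<i> * of_real \<sigma> / v * (w - z)"
      using v_nz \<sigma>2 by (simp add: z_def field_simps)
    moreover have "\<i> * of_real \<sigma> / v \<noteq> 0" using v_nz \<sigma> by auto
    ultimately show ?thesis by (metis (no_types, lifting) divide_divide_eq_left div_by_1 nonzero_divide_mult_cancel_left times_divide_eq_right mult.right_neutral)
  qed
  have zn: "z \<notin> path_image m"
  proof
    assume "z \<in> path_image m"
    then have "?g z \<notin> \<real>\<^sub>\<le>\<^sub>0" using im by blast
    moreover have "?g z = 0" using v_nz \<sigma>2 by (simp add: z_def field_simps)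
    ultimately show False by simp
  qed
  have "((\<lambda>w. 1 / (w - z)) has_contour_integral (Ln (?g (pathfinish m)) - Ln (?g (pathstart m)))) m"
  proof (rule contour_integral_primitive[OF _ vp im])
    fix w assume "w \<in> ?S"
    then have "((\<lambda>w. Ln (?g w)) has_field_derivative \<i> * of_real \<sigma> / v / ?g w) (at w)"
      using v_nz by (auto intro!: derivative_eq_intros simp: divide_simps)
    then show "((\<lambda>w. Ln (?g w)) has_field_derivative 1 / (w - z)) (at w within ?S)"
      unfolding quot by (rule has_field_derivative_at_within)
  qed
  then have "contour_integral m (\<lambda>w. 1 / (w - z)) = Ln (?g (pathfinish m)) - Ln (?g (pathstart m))"
    by (rule contour_integral_unique)
  moreover have "winding_number m z = 1 / (2 * of_real pi * \<i>) * contour_integral m (\<lambda>w. 1 / (w - z))"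
    using winding_number_valid_path[OF vp zn] by simp
  ultimately show ?thesis by (simp add: m_def)
qed

text \<open>The two end pieces do not contain \<open>p t\<close>, so their winding numbers are
  continuous there and contribute nothing. For the middle piece the four limits of \<open>Ln\<close>
  have imaginary parts strictly between 0 and pi or between -pi and 0, hence
  \<open>0 < Re c < 2\<close>; the exact value follows later from integrality.\<close>

lemma (in flat_arc) winding_number_jump:
  assumes q: "valid_path p" "inj_on p {0..1}" and t: "t \<in> {0<..<1}"
  obtains c where "((\<lambda>h. winding_number p (p t + \<i> * of_real h * v) - winding_number p (p t - \<i> * of_real h * v)) \<longlongrightarrow> c) (at_right 0)"
    "0 < Re c" "Re c < 2"
proof -
  define r where "r = min (d/2) (min (t/2) ((1-t)/2))"
  have r: "0 < r" "r < d" "0 < t - r" "t + r < 1" using t d_pos by (auto simp: r_def min_def field_simps)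
  have sub: "\<And>s. s \<in> {t-r..t+r} \<Longrightarrow> s \<in> {0..1}" using r by auto
  define D1 D0 where "D1 = (p (t+r) - p t) / v" and "D0 = (p (t-r) - p t) / v"
  have tJ: "t + r \<in> J" "t - r \<in> J" "t \<in> J" using r d_pos by auto
  have "\<bar>Re D1 - r\<bar> \<le> r / 4" "\<bar>Re D0 + r\<bar> \<le> r / 4"
    using chord_quot(1)[OF tJ(1,3)] chord_quot(1)[OF tJ(2,3)] r(1) unfolding D1_def D0_def by simp_all
  then have D: "0 < Re D1" "Re D0 < 0" using r(1) by linarith+
  \<comment> \<open>The limit for \<open>\<sigma> = 1\<close> minus the one for
    \<open>\<sigma> = -1\<close>.\<close>
  define c where "c = (Ln (\<i> * D1) - Ln (\<i> * D0) - (Ln (- \<i> * D1) - Ln (- \<i> * D0))) / (2 * of_real pi * \<i>)"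
  have path: "path p" using q valid_path_imp_path by blast
  define A B m where "A = subpath 0 (t-r) p" and "B = subpath (t+r) 1 p" and "m = subpath (t-r) (t+r) p"
  have AB: "path A" "path B" unfolding A_def B_def by (rule path_subpath; use path r in simp)+
  have nA: "p t \<notin> path_image A"
  proof
    assume "p t \<in> path_image A"
    then obtain s where "s \<in> {0..t-r}" "p t = p s" unfolding A_def using r by (auto simp: path_image_subpath)
    then show False using inj_onD[OF q(2), of t s] t r by auto
  qed
  have nB: "p t \<notin> path_image B"
  proof
    assume "p t \<in> path_image B"
    then obtain s where "s \<in> {t+r..1}" "p t = p s" unfolding B_def using r by (auto simp: path_image_subpath)
    then show False using inj_onD[OF q(2), of t s] t r by auto
  qed
  have lim: "((\<lambda>h. p t + \<i> * of_real (\<sigma> * h) * v) \<longlongrightarrow> p t) (at_right 0)" for \<sigma> :: real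
  proof -
    have "((\<lambda>h. p t + \<i> * of_real (\<sigma> * h) * v) \<longlongrightarrow> p t + \<i> * of_real (\<sigma> * 0) * v) (at_right 0)"
      by (intro tendsto_intros)
    then show ?thesis by simp
  qed
  have wA: "((\<lambda>h. winding_number A (p t + \<i> * of_real (\<sigma> * h) * v)) \<longlongrightarrow> winding_number A (p t)) (at_right 0)" for \<sigma>
    using isCont_tendsto_compose[OF continuous_at_winding_number[OF AB(1) nA] lim] .
  have wB: "((\<lambda>h. winding_number B (p t + \<i> * of_real (\<sigma> * h) * v)) \<longlongrightarrow> winding_number B (p t)) (at_right 0)" for \<sigma>
    using isCont_tendsto_compose[OF continuous_at_winding_number[OF AB(2) nB] lim] .
  define Z where "Z = (\<lambda>\<sigma> h. p t + \<i> * of_real (\<sigma> * h) * v)"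
  have off: "\<forall>\<^sub>F h in at_right 0. Z \<sigma> h \<notin> path_image p" if "\<bar>\<sigma>\<bar> = 1" for \<sigma>
  proof -
    have "open (- (path_image A \<union> path_image B))"
      using AB closed_path_image by (intro open_Compl closed_Un) auto
    then have "\<forall>\<^sub>F h in at_right 0. Z \<sigma> h \<in> - (path_image A \<union> path_image B)"
      unfolding Z_def using nA nB by (intro topological_tendstoD[OF lim]) auto
    moreover have "\<forall>\<^sub>F h in at_right (0::real). 0 < h" by (simp add: eventually_at_right_less)
    ultimately show ?thesis
    proof eventually_elim
      case (elim h)
      show ?case
      proof
        assume "Z \<sigma> h \<in> path_image p"
        then obtain s where s: "s \<in> {0..1}" "Z \<sigma> h = p s" by (auto simp: path_image_def)
        have "s \<in> {t-r..t+r}"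
        proof (rule ccontr)
          assume "s \<notin> {t-r..t+r}"
          then have "s \<in> {0..t-r} \<or> s \<in> {t+r..1}" using s by auto
          then show False using elim s unfolding A_def B_def using r
            by (auto simp: path_image_subpath)
        qed
        then have sJ: "s \<in> J" using r by auto
        have "Q (t, \<sigma> * h) = Q (s, 0)" using s(2) unfolding Z_def Q_def by simp
        then have "\<sigma> * h = 0" using inj_onD[OF Q_inj, of "(t, \<sigma> * h)" "(s, 0)"] sJ tJ by auto
        then show False using elim that by auto
      qed
    qed
  qed
  have split: "winding_number p z = winding_number A z + winding_number m z + winding_number B z"
    if "z \<notin> path_image p" for z
  proof -
    have "winding_number (subpath 0 (t-r) p) z + winding_number (subpath (t-r) (t+r) p) z = winding_number (subpath 0 (t+r) p) z"
      using r by (intro winding_number_subpath_combine[OF path that]) auto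
    moreover have "winding_number (subpath 0 (t+r) p) z + winding_number (subpath (t+r) 1 p) z = winding_number (subpath 0 1 p) z"
      using r by (intro winding_number_subpath_combine[OF path that]) auto
    ultimately show ?thesis by (simp add: A_def B_def m_def)
  qed
  have wm: "((\<lambda>h. winding_number m (Z \<sigma> h)) \<longlongrightarrow>
      (Ln (\<i> * of_real \<sigma> * D1) - Ln (\<i> * of_real \<sigma> * D0)) / (2 * of_real pi * \<i>)) (at_right 0)"
    if \<sigma>: "\<bar>\<sigma>\<bar> = 1" for \<sigma>
  proof (rule Lim_transform_eventually)
    have np: "\<i> * of_real \<sigma> * D1 \<notin> \<real>\<^sub>\<le>\<^sub>0" "\<i> * of_real \<sigma> * D0 \<notin> \<real>\<^sub>\<le>\<^sub>0"
      using D \<sigma> by (auto simp: complex_nonpos_Reals_iff)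
    have of0: "((\<lambda>h. complex_of_real h) \<longlongrightarrow> 0) (at_right 0)"
      using tendsto_of_real[OF tendsto_ident_at, of 0 "{0<..}"] by simp
    have "((\<lambda>h. (Ln (of_real h + \<i> * of_real \<sigma> * D1) - Ln (of_real h + \<i> * of_real \<sigma> * D0)) / (2 * of_real pi * \<i>)) \<longlongrightarrow>
      (Ln (0 + \<i> * of_real \<sigma> * D1) - Ln (0 + \<i> * of_real \<sigma> * D0)) / (2 * of_real pi * \<i>)) (at_right 0)"
      using np by (intro tendsto_intros of0) auto
    then show "((\<lambda>h. (Ln (of_real h + \<i> * of_real \<sigma> * D1) - Ln (of_real h + \<i> * of_real \<sigma> * D0)) / (2 * of_real pi * \<i>)) \<longlongrightarrow>
      (Ln (\<i> * of_real \<sigma> * D1) - Ln (\<i> * of_real \<sigma> * D0)) / (2 * of_real pi * \<i>)) (at_right 0)" by simp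
    have "\<forall>\<^sub>F h in at_right (0::real). 0 < h" by (simp add: eventually_at_right_less)
    then show "\<forall>\<^sub>F h in at_right 0. (Ln (of_real h + \<i> * of_real \<sigma> * D1) - Ln (of_real h + \<i> * of_real \<sigma> * D0)) / (2 * of_real pi * \<i>) = winding_number m (Z \<sigma> h)"
    proof eventually_elim
      case (elim h)
      have "2 * of_real pi * \<i> * winding_number m (Z \<sigma> h) =
          Ln (of_real h + \<i> * of_real \<sigma> * D1) - Ln (of_real h + \<i> * of_real \<sigma> * D0)"
        unfolding D1_def D0_def Z_def m_def by (rule winding_number_middle[OF q(1) sub r(1,2) \<sigma> elim])
      from this[symmetric] show ?case by (simp only:) simp
    qed
  qed
  have w: "((\<lambda>h. winding_number p (Z \<sigma> h)) \<longlongrightarrow> winding_number A (p t) +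
      (Ln (\<i> * of_real \<sigma> * D1) - Ln (\<i> * of_real \<sigma> * D0)) / (2 * of_real pi * \<i>) + winding_number B (p t)) (at_right 0)"
    if \<sigma>: "\<bar>\<sigma>\<bar> = 1" for \<sigma>
    by (rule Lim_transform_eventually[OF tendsto_add[OF tendsto_add[OF wA[of \<sigma>] wm[OF \<sigma>]] wB[of \<sigma>]]])
       (use off[OF \<sigma>] split in \<open>auto simp: Z_def elim!: eventually_mono\<close>)
  have "((\<lambda>h. winding_number p (Z 1 h) - winding_number p (Z (-1) h)) \<longlongrightarrow> c) (at_right 0)"
    using tendsto_diff[OF w[of 1] w[of "-1"]] by (simp add: c_def diff_divide_distrib)
  moreover have "0 < Re c" "Re c < 2"
  proof -
    have im: "0 < Im (Ln w) \<and> Im (Ln w) < pi" if "0 < Im w" for w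
      using that Im_Ln_pos_lt_imp by blast
    have im': "- pi < Im (Ln w) \<and> Im (Ln w) < 0" if "Im w < 0" for w
    proof -
      have "w \<noteq> 0" using that by auto
      then show ?thesis using that Im_Ln_pos_le[of w] mpi_less_Im_Ln[of w] Im_Ln_le_pi[of w] by force
    qed
    have b: "0 < Im (Ln (\<i> * D1))" "Im (Ln (\<i> * D1)) < pi" "- pi < Im (Ln (\<i> * D0))" "Im (Ln (\<i> * D0)) < 0"
        "- pi < Im (Ln (- \<i> * D1))" "Im (Ln (- \<i> * D1)) < 0" "0 < Im (Ln (- \<i> * D0))" "Im (Ln (- \<i> * D0)) < pi"
      using im[of "\<i> * D1"] im'[of "\<i> * D0"] im'[of "- \<i> * D1"] im[of "- \<i> * D0"] D by auto
    have "Re (x / (2 * of_real pi * \<i>)) = Im x / (2 * pi)" for x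
      by (simp add: Re_divide power2_eq_square)
    then have *: "Re c = (Im (Ln (\<i> * D1)) - Im (Ln (\<i> * D0)) - (Im (Ln (- \<i> * D1)) - Im (Ln (- \<i> * D0)))) / (2 * pi)"
      unfolding c_def by simp
    show "0 < Re c" unfolding * using b pi_gt_zero by (intro divide_pos_pos) linarith+
    show "Re c < 2" unfolding * using b pi_gt_zero by (subst pos_divide_less_eq) linarith+
  qed
  ultimately show ?thesis using that[of c] by (simp add: Z_def)
qed

no_notation fps_nth (infixl "$" 75)

section \<open>Small circles around the end point of an arc\<close>

text \<open>On an initial piece the distance to \<open>q 0\<close> increases strictly: the
  increments \<open>A\<close> up to \<open>s\<close> and \<open>B\<close> from \<open>s\<close> to
  \<open>x\<close> have nonnegative inner product, so \<open>norm (A + B)\<close> exceeds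
  \<open>norm A\<close>. The rest of the arc keeps at least the distance \<open>m\<close>, so
  smaller circles are hit once.\<close>

lemma small_circles_meet_arc_once:
  fixes q q' :: "real \<Rightarrow> complex"
  assumes inj: "inj_on q {0..1}" and der: "\<And>s. s \<in> {0..1} \<Longrightarrow> (q has_vector_derivative q' s) (at s within {0..1})"
    and cont: "continuous_on {0..1} q'" and nz: "q' 0 \<noteq> 0"
  obtains r0 where "0 < r0" "\<And>r. 0 < r \<Longrightarrow> r < r0 \<Longrightarrow> \<exists>w. q ` {0..1} \<inter> sphere (q 0) r = {w}"
proof -
  define v where "v = q' 0"
  have v: "v \<noteq> 0" using nz by (simp add: v_def)
  have cq: "continuous_on {0..1} q"
    unfolding continuous_on_eq_continuous_within using has_vector_derivative_continuous[OF der] by blast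
  obtain d where d: "d > 0" "\<And>x y. x \<in> {0..1} \<Longrightarrow> y \<in> {0..1} \<Longrightarrow> \<bar>x - 0\<bar> < d \<Longrightarrow> \<bar>y - 0\<bar> < d \<Longrightarrow>
        norm (q x - q y - of_real (x - y) * v) \<le> norm v / 4 * \<bar>x - y\<bar>"
    unfolding v_def by (rule C1_chord_bound[of "{0..1}" 0 q q' "norm (q' 0) / 4"])
      (use der cont nz in auto)
  define \<delta> where "\<delta> = min (d/2) 1"
  have \<delta>: "0 < \<delta>" "\<delta> < d" "\<delta> \<le> 1" using d(1) by (auto simp: \<delta>_def)
  have quot: "Re ((q x - q y) / v) \<ge> 3/4 * (x - y) \<and> \<bar>Im ((q x - q y) / v)\<bar> \<le> (x - y) / 4"
    if "0 \<le> y" "y \<le> x" "x \<le> \<delta>" for x y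
  proof -
    have "norm ((q x - q y) / v - of_real (x - y)) = norm (q x - q y - of_real (x - y) * v) / norm v"
      using v by (simp flip: norm_divide add: field_simps)
    also have "\<dots> \<le> (norm v / 4 * \<bar>x - y\<bar>) / norm v"
      using that \<delta> by (intro divide_right_mono d(2)) auto
    also have "\<dots> = (x - y) / 4" using v that by simp
    finally have *: "norm ((q x - q y) / v - of_real (x - y)) \<le> (x - y) / 4" .
    have "\<bar>Re ((q x - q y) / v) - (x - y)\<bar> \<le> (x - y) / 4"
      using abs_Re_le_cmod[of "(q x - q y) / v - of_real (x - y)"] * by simp
    moreover have "\<bar>Im ((q x - q y) / v)\<bar> \<le> (x - y) / 4"
      using abs_Im_le_cmod[of "(q x - q y) / v - of_real (x - y)"] * by simp
    moreover define D where "D = (q x - q y) / v"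
    moreover define c where "c = x - y"
    ultimately have "\<bar>Re D - c\<bar> \<le> c / 4" "\<bar>Im D\<bar> \<le> c / 4" by (simp_all only: D_def c_def)
    then have "3/4 * c \<le> Re D" "\<bar>Im D\<bar> \<le> c / 4" by linarith+
    then show ?thesis unfolding D_def[symmetric] c_def[symmetric] by blast
  qed
  have mono: "norm (q s - q 0) < norm (q x - q 0)" if s: "0 \<le> s" "s < x" "x \<le> \<delta>" for s x
  proof -
    define A B where "A = (q s - q 0) / v" and "B = (q x - q s) / v"
    have A: "Re A \<ge> 3/4 * s" "\<bar>Im A\<bar> \<le> s / 4" using quot[of 0 s] s unfolding A_def by auto
    have B: "Re B \<ge> 3/4 * (x - s)" "\<bar>Im B\<bar> \<le> (x - s) / 4" using quot[of s x] s unfolding B_def by auto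
    have "(3/4 * s) * (3/4 * (x - s)) \<le> Re A * Re B"
      using A(1) B(1) s by (intro mult_mono) auto
    moreover have "\<bar>Im A * Im B\<bar> \<le> (s / 4) * ((x - s) / 4)"
      unfolding abs_mult using A(2) B(2) s by (intro mult_mono) auto
    moreover have "0 \<le> s * (x - s)" using s by simp
    ultimately have AB: "0 \<le> Re A * Re B + Im A * Im B" by (simp add: field_simps abs_le_iff)
    have "0 < 3/4 * (x - s)" using s by simp
    then have "0 < Re B" using B(1) by (rule less_le_trans)
    then have "0 < (Re B)\<^sup>2" by simp
    then have "0 < (Re B)\<^sup>2 + (Im B)\<^sup>2 + 2 * (Re A * Re B + Im A * Im B)"
      using AB by (intro add_pos_nonneg) simp_all
    then have "(Re A)\<^sup>2 + (Im A)\<^sup>2 < (Re A + Re B)\<^sup>2 + (Im A + Im B)\<^sup>2"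
      by (simp add: power2_eq_square algebra_simps)
    then have "(norm A)\<^sup>2 < (norm (A + B))\<^sup>2" by (simp add: cmod_power2)
    then have "norm A < norm (A + B)" by (rule power2_less_imp_less) simp
    then have "norm A * norm v < norm (A + B) * norm v" using v by simp
    moreover have "norm A * norm v = norm (q s - q 0)" using v by (simp add: A_def norm_divide)
    moreover have "norm (A + B) * norm v = norm (q x - q 0)"
      using v by (simp add: A_def B_def norm_divide flip: add_divide_distrib)
    ultimately show ?thesis by simp
  qed
  have "\<exists>x\<in>{\<delta>..1}. \<forall>y\<in>{\<delta>..1}. norm (q x - q 0) \<le> norm (q y - q 0)"
    using \<delta> by (intro continuous_attains_inf continuous_intros continuous_on_subset[OF cq]) auto
  then obtain x0 where x0: "x0 \<in> {\<delta>..1}" "\<And>y. y \<in> {\<delta>..1} \<Longrightarrow> norm (q x0 - q 0) \<le> norm (q y - q 0)" by blast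
  define m where "m = norm (q x0 - q 0)"
  have "q x0 \<noteq> q 0" using inj_onD[OF inj, of x0 0] x0(1) \<delta> by auto
  then have m: "0 < m" by (simp add: m_def)
  show ?thesis
  proof (rule that[OF m])
    fix r assume r: "0 < r" "r < m"
    have "\<exists>s\<ge>0. s \<le> \<delta> \<and> norm (q s - q 0) = r"
    proof (rule IVT')
      show "norm (q 0 - q 0) \<le> r" using r by simp
      show "r \<le> norm (q \<delta> - q 0)" using x0(2)[of \<delta>] r \<delta> by (simp add: m_def)
      show "continuous_on {0..\<delta>} (\<lambda>s. norm (q s - q 0))"
        using \<delta> by (intro continuous_intros continuous_on_subset[OF cq]) auto
    qed (use \<delta> in auto)
    then obtain s where s: "0 \<le> s" "s \<le> \<delta>" "norm (q s - q 0) = r" by auto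
    have "q ` {0..1} \<inter> sphere (q 0) r = {q s}"
    proof (intro equalityI subsetI)
      fix w assume "w \<in> q ` {0..1} \<inter> sphere (q 0) r"
      then obtain x where x: "x \<in> {0..1}" "w = q x" "norm (q x - q 0) = r"
        by (auto simp: dist_norm norm_minus_commute)
      have "x \<le> \<delta>"
      proof (rule ccontr)
        assume "\<not> x \<le> \<delta>"
        then have "m \<le> r" using x0(2)[of x] x unfolding m_def by simp
        then show False using r by simp
      qed
      then have "x = s" using mono[of x s] mono[of s x] s x by (cases x s rule: linorder_cases) auto
      then show "w \<in> {q s}" using x by simp
    qed (use s \<delta> in \<open>auto simp: dist_norm norm_minus_commute\<close>)
    then show "\<exists>w. q ` {0..1} \<inter> sphere (q 0) r = {w}" by blast
  qed
qed

section \<open>Comparison of branches of logarithms\<close>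

text \<open>The values lie in one coset of the integer multiples of 2 pi i, which is discrete. This
  is how branches of logarithms are compared throughout.\<close>

lemma continuous_exp_constant:
  fixes f :: "'a :: topological_space \<Rightarrow> complex"
  assumes "connected S" "continuous_on S f" and exp: "\<And>x. x \<in> S \<Longrightarrow> exp (f x) = k"
  obtains c where "\<And>x. x \<in> S \<Longrightarrow> f x = c"
proof -
  have "f constant_on S"
  proof (rule continuous_discrete_range_constant[OF assms(1,2)])
    fix x assume x: "x \<in> S"
    show "\<exists>e>0. \<forall>y. y \<in> S \<and> f y \<noteq> f x \<longrightarrow> e \<le> norm (f y - f x)"
    proof (intro exI[of _ "2 * pi"] conjI allI impI)
      fix y assume y: "y \<in> S \<and> f y \<noteq> f x"
      then have "exp (f y) = exp (f x)" using exp x by metis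
      then obtain n :: int where n: "f y = f x + (of_int (2 * n) * pi) * \<i>" using exp_eq by blast
      then have "n \<noteq> 0" using y by auto
      then have "1 \<le> \<bar>real_of_int n\<bar>" by linarith
      then show "2 * pi \<le> norm (f y - f x)" by (simp add: n norm_mult abs_mult)
    qed simp
  qed
  then show ?thesis using that unfolding constant_on_def by blast
qed

lemma log_on_circle:
  assumes r: "0 < r" and cont: "continuous_on (sphere b r - {b + rcis r \<theta>0}) h"
    and exp: "\<And>\<theta>. b + rcis r \<theta> \<noteq> b + rcis r \<theta>0 \<Longrightarrow> exp (h (b + rcis r \<theta>)) = K * exp (\<i> * of_real (\<sigma> * \<theta>))"
  obtains C where "\<And>\<theta>. \<theta>0 < \<theta> \<Longrightarrow> \<theta> < \<theta>0 + 2 * pi \<Longrightarrow> h (b + rcis r \<theta>) = C + \<i> * of_real (\<sigma> * \<theta>)"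
proof -
  let ?S = "{\<theta>0<..<\<theta>0 + 2 * pi}"
  have ne: "b + rcis r \<theta> \<noteq> b + rcis r \<theta>0" if "\<theta> \<in> ?S" for \<theta>
  proof
    assume "b + rcis r \<theta> = b + rcis r \<theta>0"
    then have "cis \<theta> = cis \<theta>0" using r by (simp add: rcis_def)
    then have "exp (\<i> * of_real \<theta>) = exp (\<i> * of_real \<theta>0)" by (simp add: cis_conv_exp)
    then obtain n :: int where "\<i> * of_real \<theta> = \<i> * of_real \<theta>0 + (of_int (2 * n) * pi) * \<i>" using exp_eq by blast
    then have n: "\<theta> = \<theta>0 + 2 * of_int n * pi" by (auto simp: complex_eq_iff)
    with that have 1: "0 < real_of_int n * pi" "real_of_int n * pi < 1 * pi" by (auto simp: mult.commute)
    then have "0 < real_of_int n" "real_of_int n < 1"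
      using pi_gt_zero by (auto simp: zero_less_mult_iff mult_less_cancel_right)
    then have "0 < n" "n < 1" by simp_all
    then show False by linarith
  qed
  have "continuous_on ?S (\<lambda>\<theta>. h (b + rcis r \<theta>))"
  proof (rule continuous_on_compose2[OF cont])
    show "continuous_on ?S (\<lambda>\<theta>. b + rcis r \<theta>)" unfolding rcis_def cis_conv_exp by (intro continuous_intros)
    show "(\<lambda>\<theta>. b + rcis r \<theta>) ` ?S \<subseteq> sphere b r - {b + rcis r \<theta>0}"
      using ne r by (auto simp: dist_norm)
  qed
  then have c: "continuous_on ?S (\<lambda>\<theta>. h (b + rcis r \<theta>) - \<i> * of_real (\<sigma> * \<theta>))"
    by (intro continuous_intros)
  have "exp (h (b + rcis r \<theta>) - \<i> * of_real (\<sigma> * \<theta>)) = K" if "\<theta> \<in> ?S" for \<theta>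
    using exp[OF ne[OF that]] by (simp add: exp_diff)
  from continuous_exp_constant[OF _ c this]
  obtain C where "\<And>\<theta>. \<theta> \<in> ?S \<Longrightarrow> h (b + rcis r \<theta>) - \<i> * of_real (\<sigma> * \<theta>) = C" by auto
  then show ?thesis using that[of C] by (fastforce simp: algebra_simps)
qed

section \<open>Holomorphic extension across a set without interior\<close>

text \<open>Equality is asked only off \<open>C\<close>, since on the graph itself the values of a
  solution are arbitrary.\<close>

definition ext_at :: "complex set \<Rightarrow> (complex \<Rightarrow> complex) \<Rightarrow> complex \<Rightarrow> bool" where
  "ext_at C f w \<longleftrightarrow> (\<exists>U g. open U \<and> w \<in> U \<and> g holomorphic_on U \<and> (\<forall>z\<in>U - C. f z = g z))"

text \<open>The set where two continuous functions differ is open; contained in \<open>C\<close>, it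
  would lie in the empty interior.\<close>

lemma continuous_eq_off:
  fixes f g :: "complex \<Rightarrow> complex"
  assumes "interior C = {}" "open D" "continuous_on D f" "continuous_on D g" "\<And>z. z \<in> D - C \<Longrightarrow> f z = g z" "w \<in> D"
  shows "f w = g w"
proof (rule ccontr)
  assume ne: "f w \<noteq> g w"
  let ?E = "D \<inter> (\<lambda>z. f z - g z) -` (- {0})"
  have "open ?E" using assms by (intro continuous_open_preimage continuous_intros) auto
  moreover have "?E \<subseteq> C" using assms(5) by auto
  ultimately have "?E \<subseteq> interior C" by (rule interior_maximal[rotated])
  then show False using assms(1,6) ne by auto
qed

text \<open>Local extensions agree on overlaps by density of the complement of \<open>C\<close>. So
  the diagonal choice \<open>G w w\<close> locally equals any one of them and is
  holomorphic.\<close>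

lemma ext_glue:
  assumes C: "interior C = {}" and W: "open W" and ext: "\<And>w. w \<in> W \<Longrightarrow> ext_at C f w"
  obtains g where "g holomorphic_on W" "\<And>z. z \<in> W - C \<Longrightarrow> g z = f z"
proof -
  obtain U G where UG: "\<And>w. w \<in> W \<Longrightarrow> open (U w) \<and> w \<in> U w \<and> G w holomorphic_on U w \<and> (\<forall>z\<in>U w - C. f z = G w z)"
    using ext unfolding ext_at_def by metis
  define g where "g = (\<lambda>w. G w w)"
  have eq: "g z = G w z" if "w \<in> W" "z \<in> U w" "z \<in> W" for w z
    unfolding g_def
  proof (rule continuous_eq_off[OF C, where D = "U z \<inter> U w" and f = "G z" and g = "G w" and w = z])
    show "open (U z \<inter> U w)" using UG that by auto
    show "continuous_on (U z \<inter> U w) (G z)" "continuous_on (U z \<inter> U w) (G w)"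
      using UG[OF that(1)] UG[OF that(3)] holomorphic_on_imp_continuous_on continuous_on_subset by (metis inf_le1 inf_le2)+
    show "G z x = G w x" if "x \<in> U z \<inter> U w - C" for x
      using UG[OF \<open>w \<in> W\<close>] UG[OF \<open>z \<in> W\<close>] that by (metis DiffD1 DiffD2 DiffI IntD1 IntD2)
    show "z \<in> U z \<inter> U w" using UG that by auto
  qed
  have "g field_differentiable at w" if w: "w \<in> W" for w
  proof -
    have o: "open (U w \<inter> W)" "w \<in> U w \<inter> W" using UG[OF w] W w by auto
    have "G w holomorphic_on U w \<inter> W" using UG[OF w] by (blast intro: holomorphic_on_subset)
    then have "g holomorphic_on U w \<inter> W"
      by (rule holomorphic_transform) (use eq w in auto)
    then show ?thesis using o holomorphic_on_imp_differentiable_at by blast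
  qed
  then have "g holomorphic_on W" unfolding holomorphic_on_def by (simp add: field_differentiable_at_within)
  moreover have "g z = f z" if "z \<in> W - C" for z using UG[of z] that by (simp add: g_def)
  ultimately show ?thesis using that by blast
qed

text \<open>The bound is given only off \<open>C\<close>. By continuity of the glued extension it
  holds on \<open>C\<close> as well, and then Riemann's theorem applies at \<open>w\<close>.\<close>

lemma ext_at_removable:
  assumes C: "interior C = {}" "w \<in> C" and V: "open V" "w \<in> V" and ext: "\<And>z. z \<in> V - {w} \<Longrightarrow> ext_at C f z"
    and bd: "\<forall>\<^sub>F z in at w within - C. norm (f z) \<le> B"
  shows "ext_at C f w"
proof -
  obtain g where g: "g holomorphic_on V - {w}" "\<And>z. z \<in> V - {w} - C \<Longrightarrow> g z = f z"
    using ext_glue[OF C(1) open_delete[OF V(1)] ext] by blast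
  obtain N where N: "open N" "w \<in> N" "\<And>z. z \<in> N \<Longrightarrow> z \<noteq> w \<Longrightarrow> z \<notin> C \<Longrightarrow> norm (f z) \<le> B"
    using bd unfolding eventually_at_topological by auto
  let ?D = "(N \<inter> V) - {w}"
  have oD: "open ?D" using N V by (intro open_delete) auto
  have gD: "continuous_on ?D g" using g(1) holomorphic_on_imp_continuous_on continuous_on_subset
    by (metis Diff_mono inf_le2 order_refl)
  have "norm (g z) \<le> B" if z: "z \<in> ?D" for z
  proof (rule ccontr)
    assume gz: "\<not> norm (g z) \<le> B"
    let ?E = "?D \<inter> (\<lambda>z. norm (g z)) -` {B<..}"
    have "open ?E" by (intro continuous_open_preimage continuous_on_norm gD oD open_greaterThan)
    moreover have "?E \<subseteq> C"
    proof
      fix x assume x: "x \<in> ?E"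
      show "x \<in> C"
      proof (rule ccontr)
        assume "x \<notin> C"
        then have "norm (g x) \<le> B" using g(2)[of x] N(3)[of x] x by auto
        then show False using x by auto
      qed
    qed
    ultimately have "?E \<subseteq> interior C" by (rule interior_maximal[rotated])
    then show False using C(1) gz z by auto
  qed
  then have "\<forall>\<^sub>F z in at w. norm (g z) \<le> B"
    unfolding eventually_at_topological using N V by (intro exI[of _ "N \<inter> V"]) auto
  moreover have "w \<in> interior V" using V by (simp add: interior_open)
  ultimately obtain h where h: "h holomorphic_on V" "\<forall>z\<in>V - {w}. h z = g z"
    using holomorphic_on_extend_bounded[OF g(1)] by blast
  show ?thesis unfolding ext_at_def
  proof (intro exI conjI ballI)
    fix z assume z: "z \<in> V - C"
    then have "z \<noteq> w" using C(2) by auto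
    then show "f z = h z" using z g(2)[of z] h(2) by auto
  qed (use V h in auto)
qed

text \<open>Limits at every point make the limit function continuous: a bound valid for
  \<open>f\<close> near \<open>w\<close> passes to the limits at all nearby points. As the limits
  from the two sides agree, the removability clause of the box applies.\<close>

lemma arc_box_extension:
  assumes box: "arc_box p t \<epsilon> U Up Um" and f: "f holomorphic_on Up" "f holomorphic_on Um"
    and lim: "\<And>s. s \<in> {t-\<epsilon><..<t+\<epsilon>} \<Longrightarrow> \<exists>l. (f \<longlongrightarrow> l) (left_side p s) \<and> (f \<longlongrightarrow> l) (right_side p s)"
  obtains g where "g holomorphic_on U" "\<And>z. z \<in> Up \<union> Um \<Longrightarrow> g z = f z"
proof -
  let ?X = "Up \<union> Um"
  note b = box[unfolded arc_box_def]
  have oX: "open ?X" using b by auto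
  have fX: "continuous_on ?X f"
    using b f by (intro continuous_on_open_Un holomorphic_on_imp_continuous_on) auto
  define g where "g = (\<lambda>z. if z \<in> ?X then f z else Lim (at z within ?X) f)"
  have lim: "(f \<longlongrightarrow> g w) (at w within ?X) \<and> at w within ?X \<noteq> bot" if w: "w \<in> U" for w
  proof (cases "w \<in> ?X")
    case True
    then have "(f \<longlongrightarrow> f w) (at w within ?X)" using fX unfolding continuous_on_def by blast
    moreover have "at w within ?X \<noteq> bot" by (simp add: at_within_open[OF True oX])
    ultimately show ?thesis using True by (simp add: g_def)
  next
    case False
    then obtain s where s: "s \<in> {t-\<epsilon><..<t+\<epsilon>}" "w = p s" using w b by auto
    have sides: "left_side p s = at w within Up" "right_side p s = at w within Um" using b s by auto
    obtain l where l: "(f \<longlongrightarrow> l) (left_side p s)" "(f \<longlongrightarrow> l) (right_side p s)" using lim[OF s(1)] by blast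
    have 1: "(f \<longlongrightarrow> l) (at w within ?X)"
      using l unfolding sides at_within_union by (rule filterlim_sup)
    have 2: "at w within ?X \<noteq> bot"
      unfolding at_within_union using left_side_neq_bot[of p s] unfolding sides
      by (metis bot.extremum_uniqueI sup_ge1)
    show ?thesis using 1 2 False tendsto_Lim[OF 2 1] by (simp add: g_def)
  qed
  have "continuous_on U g"
    unfolding continuous_on_iff
  proof (intro ballI allI impI)
    fix w and e :: real assume w: "w \<in> U" and e: "0 < e"
    have "\<forall>\<^sub>F z in at w within ?X. dist (f z) (g w) < e/2"
      using lim[OF w] e by (intro tendstoD) auto
    then obtain \<delta> where \<delta>: "\<delta> > 0" "\<And>z. z \<in> ?X \<Longrightarrow> z \<noteq> w \<Longrightarrow> dist z w < \<delta> \<Longrightarrow> dist (f z) (g w) < e/2"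
      unfolding eventually_at by auto
    show "\<exists>d>0. \<forall>x'\<in>U. dist x' w < d \<longrightarrow> dist (g x') (g w) < e"
    proof (intro exI[of _ \<delta>] conjI ballI impI \<delta>(1))
      fix x assume x: "x \<in> U" "dist x w < \<delta>"
      show "dist (g x) (g w) < e"
      proof (cases "x = w")
        case True then show ?thesis using e by simp
      next
        case False
        have "open (ball w \<delta> - {w})" by (intro open_delete open_ball)
        moreover have "x \<in> ball w \<delta> - {w}" using x False by (simp add: dist_commute)
        ultimately have "\<forall>\<^sub>F z in at x within ?X. z \<in> ball w \<delta> - {w}"
          by (intro eventually_at_in_open' filter_leD[OF at_le[OF subset_UNIV]])
        moreover have "\<forall>\<^sub>F z in at x within ?X. z \<in> ?X" by (simp add: eventually_at_filter)
        ultimately have ev: "\<forall>\<^sub>F z in at x within ?X. dist (f z) (g w) \<le> e/2"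
          by eventually_elim (use \<delta>(2) in \<open>force simp: dist_commute less_imp_le\<close>)
        have "((\<lambda>z. dist (f z) (g w)) \<longlongrightarrow> dist (g x) (g w)) (at x within ?X)"
          by (intro tendsto_dist tendsto_const conjunct1[OF lim[OF x(1)]])
        then have "dist (g x) (g w) \<le> e/2"
          by (rule tendsto_upperbound[OF _ ev conjunct2[OF lim[OF x(1)]]])
        then show ?thesis using e by linarith
      qed
    qed
  qed
  moreover have "g holomorphic_on Up" "g holomorphic_on Um"
    by (rule holomorphic_transform[OF f(1)], simp add: g_def) (rule holomorphic_transform[OF f(2)], simp add: g_def)
  ultimately have "g holomorphic_on U" using b by blast
  then show ?thesis by (rule that) (simp add: g_def)
qed

section \<open>Two-by-two matrices, their extension and logarithmic derivative\<close>

lemma mm2: "(A ** B) $ i $ k = A $ i $ 1 * B $ 1 $ k + A $ i $ 2 * B $ 2 $ (k::2)"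
  for A B :: "complex^2^2"
  by (simp add: matrix_matrix_mult_def sum_2)

lemma mat2_eq_iff: "A = B \<longleftrightarrow> A$1$1 = B$1$1 \<and> A$1$2 = B$1$2 \<and> A$2$1 = B$2$1 \<and> A$2$2 = B$2$2"
  for A B :: "complex^2^2"
  by (auto simp: vec_eq_iff forall_2)

lemma mat1_2 [simp]: "(mat 1 :: complex^2^2)$1$1 = 1" "(mat 1 :: complex^2^2)$1$2 = 0"
  "(mat 1 :: complex^2^2)$2$1 = 0" "(mat 1 :: complex^2^2)$2$2 = 1"
  by (simp_all add: mat_def)

lemma exp_sigma3_nth [simp]: "exp_sigma3 c $ 1 $ 1 = exp c" "exp_sigma3 c $ 1 $ 2 = 0"
  "exp_sigma3 c $ 2 $ 1 = 0" "exp_sigma3 c $ 2 $ 2 = exp (- c)"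
  by (simp_all add: exp_sigma3_def)

lemma exp_sigma3_add: "exp_sigma3 a ** exp_sigma3 b = exp_sigma3 (a + b)"
  by (simp add: mat2_eq_iff mm2 flip: exp_add)

lemma exp_sigma3_0 [simp]: "exp_sigma3 0 = mat 1"
  by (simp add: mat2_eq_iff)

lemma det_exp_sigma3 [simp]: "det (exp_sigma3 c) = 1"
  by (simp add: det_2 flip: exp_add)

text \<open>The adjugate. Being polynomial in the entries it is holomorphic without any condition on
  the determinant, and it is the inverse when the determinant is 1.\<close>

definition adj2 :: "complex^2^2 \<Rightarrow> complex^2^2" where
  "adj2 A = (\<chi> i k. if i = 1 then (if k = 1 then A$2$2 else - A$1$2) else (if k = 1 then - A$2$1 else A$1$1))"

lemma adj2_nth [simp]: "adj2 A $ 1 $ 1 = A$2$2" "adj2 A $ 1 $ 2 = - A$1$2"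
  "adj2 A $ 2 $ 1 = - A$2$1" "adj2 A $ 2 $ 2 = A$1$1"
  by (simp_all add: adj2_def)

lemma adj2_inverse: assumes "det A = 1" shows "A ** adj2 A = mat 1" "adj2 A ** A = mat 1"
  using assms by (simp_all add: mat2_eq_iff mm2 det_2 algebra_simps)

lemma adj2_mult: "adj2 (A ** B) = adj2 B ** adj2 A"
  by (simp add: mat2_eq_iff mm2 algebra_simps)

lemma det_adj2 [simp]: "det (adj2 A) = det A"
  by (simp add: det_2)

definition mholo :: "complex set \<Rightarrow> (complex \<Rightarrow> complex^2^2) \<Rightarrow> bool" where
  "mholo S \<Phi> \<longleftrightarrow> (\<forall>i k. (\<lambda>z. \<Phi> z $ i $ k) holomorphic_on S)"

lemma mholo_const: "mholo S (\<lambda>z. A)" by (simp add: mholo_def)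

lemma mholo_mult: "mholo S A \<Longrightarrow> mholo S B \<Longrightarrow> mholo S (\<lambda>z. A z ** B z)"
  unfolding mholo_def mm2 by (intro allI holomorphic_intros) auto

lemma mholo_subset: "mholo S A \<Longrightarrow> T \<subseteq> S \<Longrightarrow> mholo T A"
  unfolding mholo_def using holomorphic_on_subset by blast

lemma mholo_cong: "(\<And>z. z \<in> S \<Longrightarrow> A z = B z) \<Longrightarrow> mholo S A \<longleftrightarrow> mholo S B"
  unfolding mholo_def by (metis (mono_tags, lifting) holomorphic_cong)

lemma mholo_exp_sigma3: "f holomorphic_on S \<Longrightarrow> mholo S (\<lambda>z. exp_sigma3 (f z))"
  unfolding mholo_def forall_2 exp_sigma3_nth by (intro conjI holomorphic_intros)

lemma tendsto_mm:
  fixes A B :: "_ \<Rightarrow> complex^2^2"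
  shows "(A \<longlongrightarrow> a) F \<Longrightarrow> (B \<longlongrightarrow> b) F \<Longrightarrow> ((\<lambda>z. A z ** B z :: complex^2^2) \<longlongrightarrow> a ** b) F"
  by (intro vec_tendstoI) (unfold mm2, intro tendsto_intros)

lemma mholo_tendsto: "mholo S A \<Longrightarrow> open S \<Longrightarrow> w \<in> S \<Longrightarrow> (A \<longlongrightarrow> A w) (nhds w)"
  unfolding mholo_def
  by (intro vec_tendstoI) (metis holomorphic_on_imp_continuous_on continuous_on_eq_continuous_at isCont_def tendsto_nhds_iff)

definition mext_at :: "complex set \<Rightarrow> (complex \<Rightarrow> complex^2^2) \<Rightarrow> complex \<Rightarrow> bool" where
  "mext_at C \<Phi> w \<longleftrightarrow> (\<exists>U A. open U \<and> w \<in> U \<and> mholo U A \<and> (\<forall>z\<in>U - C. \<Phi> z = A z))"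

lemma mext_at_iff: "mext_at C \<Phi> w \<longleftrightarrow> (\<forall>i k. ext_at C (\<lambda>z. \<Phi> z $ i $ k) w)"
proof
  assume "mext_at C \<Phi> w"
  then show "\<forall>i k. ext_at C (\<lambda>z. \<Phi> z $ i $ k) w" unfolding mext_at_def ext_at_def mholo_def by metis
next
  assume "\<forall>i k. ext_at C (\<lambda>z. \<Phi> z $ i $ k) w"
  then obtain U g where Ug: "\<And>i k. open (U i k) \<and> w \<in> U i k \<and> g i k holomorphic_on U i k \<and> (\<forall>z\<in>U i k - C. \<Phi> z $ i $ k = g i k z)"
    unfolding ext_at_def by metis
  let ?U = "\<Inter>i. \<Inter>k. U i k"
  have "open ?U" using Ug by (intro open_INT ballI) auto
  moreover have "w \<in> ?U" using Ug by auto
  moreover have "mholo ?U (\<lambda>z. \<chi> i k. g i k z)"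
    unfolding mholo_def using Ug by (auto intro: holomorphic_on_subset)
  moreover have "\<forall>z\<in>?U - C. \<Phi> z = (\<chi> i k. g i k z)" using Ug by (auto simp: vec_eq_iff)
  ultimately show "mext_at C \<Phi> w" unfolding mext_at_def by blast
qed

text \<open>The condition \<open>G ** Np = Nm\<close> on the arc makes the boundary values agree:
  \<open>Lp ** Np = Lm ** G ** Np = Lm ** Nm\<close>. The factors may be functions rather than
  constants, as the powers at the singular points and at infinity require.\<close>

lemma arc_box_jump_extension:
  assumes box: "arc_box p t \<epsilon> U Up Um" and \<Psi>: "mholo Up \<Psi>" "mholo Um \<Psi>"
    and jump: "\<And>s. s \<in> {t-\<epsilon><..<t+\<epsilon>} \<Longrightarrow> has_jump \<Psi> p s G"
    and N: "mholo U Np" "mholo U Nm" "\<And>z. z \<in> Up \<Longrightarrow> N z = Np z" "\<And>z. z \<in> Um \<Longrightarrow> N z = Nm z"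
    and GN: "\<And>s. s \<in> {t-\<epsilon><..<t+\<epsilon>} \<Longrightarrow> G ** Np (p s) = Nm (p s)"
  obtains A where "mholo U A" "\<And>z. z \<in> Up \<union> Um \<Longrightarrow> \<Psi> z ** N z = A z"
proof -
  note b = box[unfolded arc_box_def]
  have "mholo Up (\<lambda>z. \<Psi> z ** Np z)" "mholo Um (\<lambda>z. \<Psi> z ** Nm z)"
    using \<Psi> N(1,2) b by (auto intro!: mholo_mult elim: mholo_subset)
  then have hol: "mholo Up (\<lambda>z. \<Psi> z ** N z)" "mholo Um (\<lambda>z. \<Psi> z ** N z)"
    by (subst mholo_cong[of _ _ "\<lambda>z. \<Psi> z ** Np z"], simp_all add: N)
       (subst mholo_cong[of _ _ "\<lambda>z. \<Psi> z ** Nm z"], simp_all add: N)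
  have lim: "\<exists>l. ((\<lambda>z. \<Psi> z ** N z) \<longlongrightarrow> l) (left_side p s) \<and> ((\<lambda>z. \<Psi> z ** N z) \<longlongrightarrow> l) (right_side p s)"
    if s: "s \<in> {t-\<epsilon><..<t+\<epsilon>}" for s
  proof -
    have sides: "left_side p s = at (p s) within Up" "right_side p s = at (p s) within Um" using b s by auto
    have psU: "p s \<in> U" "open U" using b s by auto
    obtain Lp Lm where L: "(\<Psi> \<longlongrightarrow> Lp) (left_side p s)" "(\<Psi> \<longlongrightarrow> Lm) (right_side p s)" "Lp = Lm ** G"
      using jump[OF s] unfolding has_jump_def by blast
    have "(Np \<longlongrightarrow> Np (p s)) (at (p s) within Up)" "(Nm \<longlongrightarrow> Nm (p s)) (at (p s) within Um)"
      using mholo_tendsto[OF N(1) psU(2,1)] mholo_tendsto[OF N(2) psU(2,1)]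
      by (simp_all add: tendsto_mono[OF at_within_le_nhds])
    then have n: "(N \<longlongrightarrow> Np (p s)) (at (p s) within Up)" "(N \<longlongrightarrow> Nm (p s)) (at (p s) within Um)"
    proof -
      assume *: "(Np \<longlongrightarrow> Np (p s)) (at (p s) within Up)" "(Nm \<longlongrightarrow> Nm (p s)) (at (p s) within Um)"
      show "(N \<longlongrightarrow> Np (p s)) (at (p s) within Up)"
        by (rule Lim_transform_eventually[OF *(1)]) (simp add: eventually_at_filter N)
      show "(N \<longlongrightarrow> Nm (p s)) (at (p s) within Um)"
        by (rule Lim_transform_eventually[OF *(2)]) (simp add: eventually_at_filter N)
    qed
    have "((\<lambda>z. \<Psi> z ** N z) \<longlongrightarrow> Lp ** Np (p s)) (left_side p s)"
      using L n unfolding sides by (intro tendsto_mm)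
    moreover have "((\<lambda>z. \<Psi> z ** N z) \<longlongrightarrow> Lm ** Nm (p s)) (right_side p s)"
      using L n unfolding sides by (intro tendsto_mm)
    moreover have "Lp ** Np (p s) = Lm ** Nm (p s)"
      using L(3) GN[OF s] by (simp add: matrix_mul_assoc[symmetric])
    ultimately show ?thesis by (intro exI[of _ "Lm ** Nm (p s)"]) simp
  qed
  have "\<exists>g. g holomorphic_on U \<and> (\<forall>z\<in>Up \<union> Um. g z = (\<Psi> z ** N z) $ i $ k)" for i k
  proof -
    have "\<exists>l. ((\<lambda>z. (\<Psi> z ** N z) $ i $ k) \<longlongrightarrow> l) (left_side p s) \<and> ((\<lambda>z. (\<Psi> z ** N z) $ i $ k) \<longlongrightarrow> l) (right_side p s)"
      if s: "s \<in> {t-\<epsilon><..<t+\<epsilon>}" for s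
    proof -
      obtain l where "((\<lambda>z. \<Psi> z ** N z) \<longlongrightarrow> l) (left_side p s)" "((\<lambda>z. \<Psi> z ** N z) \<longlongrightarrow> l) (right_side p s)"
        using lim[OF s] by blast
      then show ?thesis by (intro exI[of _ "l $ i $ k"] conjI tendsto_vec_nth)
    qed
    from arc_box_extension[OF box _ _ this] hol show ?thesis unfolding mholo_def by metis
  qed
  then obtain g where g: "\<And>i k. g i k holomorphic_on U \<and> (\<forall>z\<in>Up \<union> Um. g i k z = (\<Psi> z ** N z) $ i $ k)" by metis
  show ?thesis
  proof (rule that[of "\<lambda>z. \<chi> i k. g i k z"])
    show "mholo U (\<lambda>z. \<chi> i k. g i k z)" using g by (simp add: mholo_def)
    show "\<Psi> z ** N z = (\<chi> i k. g i k z)" if "z \<in> Up \<union> Um" for z using g that by (simp add: vec_eq_iff)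
  qed
qed

text \<open>For determinant 1 this is \<open>\<Phi>' \<Phi>\<^sup>-\<^sup>1\<close>; the adjugate
  makes it meaningful and holomorphic before the determinant is known to be 1.\<close>

definition logder :: "(complex \<Rightarrow> complex^2^2) \<Rightarrow> complex \<Rightarrow> complex^2^2" where
  "logder \<Phi> z = (\<chi> i k. deriv (\<lambda>z. \<Phi> z $ i $ k) z) ** adj2 (\<Phi> z)"

lemma deriv_mult_const:
  fixes \<Phi> :: "complex \<Rightarrow> complex^2^2"
  assumes "mholo S A" "open S" "z \<in> S" "\<forall>\<^sub>F y in nhds z. \<Phi> y = A y ** N"
  shows "deriv (\<lambda>z. \<Phi> z $ i $ k) z = ((\<chi> i k. deriv (\<lambda>z. A z $ i $ k) z) ** N) $ i $ k"
proof -
  have d: "(\<lambda>z. A z $ i $ k) field_differentiable at z" for i k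
    using assms holomorphic_on_imp_differentiable_at unfolding mholo_def by blast
  have "\<forall>\<^sub>F y in nhds z. \<Phi> y $ i $ k = A y $ i $ 1 * N $ 1 $ k + A y $ i $ 2 * N $ 2 $ k"
    using assms(4) by eventually_elim (simp add: mm2)
  then have "deriv (\<lambda>z. \<Phi> z $ i $ k) z = deriv (\<lambda>y. A y $ i $ 1 * N $ 1 $ k + A y $ i $ 2 * N $ 2 $ k) z"
    by (rule deriv_cong_ev) simp
  also have "\<dots> = deriv (\<lambda>y. A y $ i $ 1) z * N $ 1 $ k + deriv (\<lambda>y. A y $ i $ 2) z * N $ 2 $ k"
    by (intro DERIV_imp_deriv derivative_eq_intros refl)
       (use d in \<open>auto simp: field_differentiable_derivI\<close>)
  finally show ?thesis by (simp add: mm2)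
qed

text \<open>Jump matrices act from the right, and a constant right factor \<open>N\<close> cancels
  against \<open>adj2 N\<close>.\<close>

lemma logder_mult_const:
  fixes \<Phi> :: "complex \<Rightarrow> complex^2^2"
  assumes "mholo S A" "open S" "z \<in> S" "\<forall>\<^sub>F y in nhds z. \<Phi> y = A y ** N" "det N = 1"
  shows "logder \<Phi> z = logder A z"
proof -
  have "\<Phi> z = A z ** N" using assms(4) by (rule eventually_nhds_x_imp_x)
  moreover have "(\<chi> i k. deriv (\<lambda>z. \<Phi> z $ i $ k) z) = (\<chi> i k. deriv (\<lambda>z. A z $ i $ k) z) ** N"
    using deriv_mult_const[OF assms(1-4)] by (simp add: vec_eq_iff)
  ultimately have "logder \<Phi> z = (\<chi> i k. deriv (\<lambda>z. A z $ i $ k) z) ** (N ** adj2 N) ** adj2 (A z)"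
    unfolding logder_def by (simp add: adj2_mult matrix_mul_assoc)
  then show ?thesis by (simp add: adj2_inverse(1)[OF assms(5)] logder_def)
qed

lemma mholo_logder: "mholo S A \<Longrightarrow> open S \<Longrightarrow> mholo S (logder A)"
  unfolding mholo_def logder_def mm2 forall_2
  by (simp, intro conjI holomorphic_intros holomorphic_deriv; simp)

text \<open>At a jump \<open>\<Psi>\<close> itself does not extend. A locally constant factor of
  determinant 1 that repairs it changes neither the determinant nor the logarithmic derivative, so
  these two inherit the extension.\<close>

lemma regular_extension:
  assumes C: "closed C" and \<Psi>: "mholo (- C) \<Psi>" and V: "open V" "w \<in> V"
    and N: "\<And>z. z \<in> V - C \<Longrightarrow> \<forall>\<^sub>F y in nhds z. N y = N z" "\<And>z. z \<in> V - C \<Longrightarrow> det (N z) = 1"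
    and ext: "mext_at C (\<lambda>z. \<Psi> z ** N z) w"
  shows "ext_at C (\<lambda>z. det (\<Psi> z)) w" "mext_at C (logder \<Psi>) w"
proof -
  obtain U A where U: "open U" "w \<in> U" "mholo U A" "\<And>z. z \<in> U - C \<Longrightarrow> \<Psi> z ** N z = A z"
    using ext unfolding mext_at_def by blast
  let ?W = "U \<inter> V"
  have W: "open ?W" "w \<in> ?W" "mholo ?W A" using U V by (auto elim: mholo_subset)
  have "det (\<Psi> z) = det (A z)" if "z \<in> ?W - C" for z
    using U(4)[of z] N(2)[of z] that by (metis DiffD1 DiffD2 DiffI IntD1 IntD2 det_mul mult.right_neutral)
  moreover have "(\<lambda>z. det (A z)) holomorphic_on ?W"
    using W(3) unfolding mholo_def det_2 by (intro holomorphic_intros) auto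
  ultimately show "ext_at C (\<lambda>z. det (\<Psi> z)) w" using W unfolding ext_at_def by blast
  have "logder \<Psi> z = logder A z" if z: "z \<in> ?W - C" for z
  proof (rule logder_mult_const[OF W(3,1)])
    have o: "open (?W - C)" using W C by (intro open_Diff)
    have "\<forall>\<^sub>F y in nhds z. y \<in> ?W - C" using o z by (intro eventually_nhds_in_open)
    moreover have "\<forall>\<^sub>F y in nhds z. N y = N z" using N(1) z by auto
    ultimately show "\<forall>\<^sub>F y in nhds z. \<Psi> y = A y ** adj2 (N z)"
    proof eventually_elim
      case (elim y)
      then have "A y = \<Psi> y ** N z" using U(4)[of y] by auto
      then have "A y ** adj2 (N z) = \<Psi> y ** (N z ** adj2 (N z))" by (simp add: matrix_mul_assoc)
      then show ?case using adj2_inverse(1)[of "N z"] N(2)[of z] z by auto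
    qed
  qed (use z N(2) in auto)
  then show "mext_at C (logder \<Psi>) w"
    unfolding mext_at_def using W mholo_logder[OF W(3,1)] by blast
qed

lemma log_branches_differ:
  fixes g h :: "'a :: topological_space \<Rightarrow> complex"
  assumes "connected S" "continuous_on S h" "continuous_on S g" "\<And>z. z \<in> S \<Longrightarrow> exp (h z) = exp (g z)"
  obtains n :: int where "\<And>z. z \<in> S \<Longrightarrow> h z = g z + 2 * of_real pi * \<i> * of_int n"
proof (cases "S = {}")
  case False
  then obtain z0 where z0: "z0 \<in> S" by blast
  have "continuous_on S (\<lambda>z. h z - g z)" by (intro continuous_intros assms)
  then obtain c where c: "\<And>z. z \<in> S \<Longrightarrow> h z - g z = c"
    using continuous_exp_constant[OF assms(1), of "\<lambda>z. h z - g z" 1] assms(4) by (metis exp_diff divide_self exp_not_eq_zero)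
  have "exp c = exp 0" using c[OF z0] assms(4)[OF z0] by (metis exp_diff divide_self exp_not_eq_zero exp_zero)
  then obtain n :: int where n: "c = 0 + (of_int (2 * n) * pi) * \<i>" using exp_eq by blast
  show ?thesis
  proof (rule that[of n])
    fix z assume "z \<in> S"
    then have "h z = g z + c" using c[of z] by (simp add: algebra_simps)
    then show "h z = g z + 2 * of_real pi * \<i> * of_int n" by (simp add: n)
  qed
qed (use that in blast)

lemma log_on_ball:
  assumes "f holomorphic_on ball w r" "\<And>z. z \<in> ball w r \<Longrightarrow> f z \<noteq> (0::complex)"
  obtains g where "g holomorphic_on ball w r" "\<And>z. z \<in> ball w r \<Longrightarrow> exp (g z) = f z"
proof -
  have "simply_connected (ball w r)" by (intro convex_imp_simply_connected convex_ball)
  from conjunct2[OF iffD1[OF simply_connected_eq_holomorphic_log[OF open_ball] this]] assms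
  show ?thesis using that by metis
qed

text \<open>The exponential of 2 pi i times the difference of winding numbers is a quotient of two
  values of the continuous function \<open>R\<close>, taken at points that both tend to
  \<open>p t\<close>; so it tends to 1. Hence the limit is an integer, and the bounds leave only
  1.\<close>

lemma (in flat_arc) winding_number_jump_1:
  assumes q: "valid_path p" "inj_on p {0..1}" and t: "t \<in> {0<..<1}"
  shows "((\<lambda>h. winding_number p (p t + \<i> * of_real h * v) - winding_number p (p t - \<i> * of_real h * v)) \<longlongrightarrow> 1) (at_right 0)"
proof -
  obtain c where c: "((\<lambda>h. winding_number p (p t + \<i> * of_real h * v) - winding_number p (p t - \<i> * of_real h * v)) \<longlongrightarrow> c) (at_right 0)"
    "0 < Re c" "Re c < 2" using winding_number_jump[OF assms] .
  have path: "path p" using q valid_path_imp_path by blast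
  have ne: "p 1 - p t \<noteq> 0" "p 0 - p t \<noteq> 0"
    using inj_onD[OF q(2), of 1 t] inj_onD[OF q(2), of 0 t] t by auto
  have lim: "((\<lambda>h. p t + \<i> * of_real h * v) \<longlongrightarrow> p t) (at_right 0)" "((\<lambda>h. p t - \<i> * of_real h * v) \<longlongrightarrow> p t) (at_right 0)"
  proof -
    have "((\<lambda>h. p t + \<i> * of_real h * v) \<longlongrightarrow> p t + \<i> * of_real 0 * v) (at_right 0)"
      "((\<lambda>h. p t - \<i> * of_real h * v) \<longlongrightarrow> p t - \<i> * of_real 0 * v) (at_right 0)"
      by (intro tendsto_intros)+
    then show "((\<lambda>h. p t + \<i> * of_real h * v) \<longlongrightarrow> p t) (at_right 0)" "((\<lambda>h. p t - \<i> * of_real h * v) \<longlongrightarrow> p t) (at_right 0)"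
      by simp_all
  qed
  define R where "R = (\<lambda>z. (p 1 - z) / (p 0 - z))"
  have Rlim: "((\<lambda>h. R (p t + \<i> * of_real h * v) / R (p t - \<i> * of_real h * v)) \<longlongrightarrow> R (p t) / R (p t)) (at_right 0)"
    unfolding R_def using ne by (intro tendsto_divide tendsto_diff tendsto_const lim) auto
  have ev: "\<forall>\<^sub>F h in at_right 0. h \<in> {0<..<d}"
    using eventually_at_right_real[OF d_pos] by simp
  have off: "p t + \<i> * of_real h * v \<notin> path_image p" if h: "0 < \<bar>h\<bar>" "\<forall>s\<in>{0..1} - {t-d<..<t+d}. p t + \<i> * of_real h * v \<noteq> p s" for h
  proof
    assume "p t + \<i> * of_real h * v \<in> path_image p"
    then obtain s where s: "s \<in> {0..1}" "p t + \<i> * of_real h * v = p s" by (auto simp: path_image_def)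
    then have "s \<in> J" using h by auto
    moreover have "Q (t, h) = Q (s, 0)" using s by (simp add: Q_def)
    ultimately show False using inj_onD[OF Q_inj, of "(t, h)" "(s, 0)"] d_pos h by auto
  qed
  have cp: "closed (p ` ({0..1} - {t-d<..<t+d}))"
  proof (intro compact_imp_closed compact_continuous_image)
    have "{0..1} - {t-d<..<t+d} = {0..1} \<inter> - {t-d<..<t+d}" by auto
    then show "compact ({0..1} - {t-d<..<t+d})"
      by (simp only:) (intro compact_Int_closed compact_Icc closed_Compl open_greaterThanLessThan)
  qed (use path in \<open>auto simp: path_def intro: continuous_on_subset\<close>)
  have nin: "p t \<in> - p ` ({0..1} - {t-d<..<t+d})"
  proof
    assume "p t \<in> p ` ({0..1} - {t-d<..<t+d})"
    then obtain s where "s \<in> {0..1} - {t-d<..<t+d}" "p t = p s" by blast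
    then show False using inj_onD[OF q(2), of t s] t d_pos by auto
  qed
  have e1: "\<forall>\<^sub>F h in at_right 0. p t + \<i> * of_real h * v \<in> - p ` ({0..1} - {t-d<..<t+d})"
    "\<forall>\<^sub>F h in at_right 0. p t - \<i> * of_real h * v \<in> - p ` ({0..1} - {t-d<..<t+d})"
    using topological_tendstoD[OF lim(1) open_Compl[OF cp] nin] topological_tendstoD[OF lim(2) open_Compl[OF cp] nin] by blast+
  have evR: "\<forall>\<^sub>F h in at_right 0. R (p t + \<i> * of_real h * v) / R (p t - \<i> * of_real h * v) =
      exp (2 * of_real pi * \<i> * (winding_number p (p t + \<i> * of_real h * v) - winding_number p (p t - \<i> * of_real h * v)))"
    using ev e1
  proof eventually_elim
    case (elim h)
    have z: "p t + \<i> * of_real h * v \<notin> path_image p" using elim by (intro off) auto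
    have z': "p t - \<i> * of_real h * v \<notin> path_image p"
      using off[of "-h"] elim by auto
    have R: "R z = exp (2 * of_real pi * \<i> * winding_number p z)" if "z \<notin> path_image p" for z
    proof -
      have "p 0 \<in> path_image p" by (auto simp: path_image_def)
      then have "p 0 - z \<noteq> 0" using that by auto
      then show ?thesis using winding_number_exp_2pi[OF path that] unfolding R_def pathstart_def pathfinish_def
        by (simp add: field_simps)
    qed
    show ?case unfolding R[OF z] R[OF z'] by (simp add: exp_diff[symmetric] right_diff_distrib)
  qed
  have "((\<lambda>h. exp (2 * of_real pi * \<i> * (winding_number p (p t + \<i> * of_real h * v) - winding_number p (p t - \<i> * of_real h * v)))) \<longlongrightarrow> R (p t) / R (p t)) (at_right 0)"
    by (rule Lim_transform_eventually[OF Rlim evR])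
  moreover have "((\<lambda>h. exp (2 * of_real pi * \<i> * (winding_number p (p t + \<i> * of_real h * v) - winding_number p (p t - \<i> * of_real h * v)))) \<longlongrightarrow> exp (2 * of_real pi * \<i> * c)) (at_right 0)"
    by (intro tendsto_exp tendsto_mult tendsto_const c(1))
  ultimately have "exp (2 * of_real pi * \<i> * c) = R (p t) / R (p t)"
    by (rule tendsto_unique[OF trivial_limit_at_right_real, rotated])
  also have "\<dots> = exp 0" using ne by (simp add: R_def)
  finally obtain n :: int where "2 * of_real pi * \<i> * c = 0 + (of_int (2 * n) * pi) * \<i>" using exp_eq by blast
  then have cn: "c = of_int n" by simp
  then have "n = 1" using c(2,3) by auto
  then show ?thesis using c(1) cn by simp
qed

section \<open>Regular points of a graph\<close>

lemma arc_box_normal: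
  assumes box: "arc_box p t0 \<epsilon> U Up Um" and t: "t \<in> {t0-\<epsilon><..<t0+\<epsilon>}" and v: "vector_derivative p (at t) = v"
  shows "\<forall>\<^sub>F h in at_right 0. p t + \<i> * of_real h * v \<in> Up" "\<forall>\<^sub>F h in at_right 0. p t - \<i> * of_real h * v \<in> Um"
proof -
  have sides: "left_side p t = at (p t) within Up" "right_side p t = at (p t) within Um"
    using box t by (auto simp: arc_box_def)
  have "\<forall>\<^sub>F z in left_side p t. z \<in> Up" "\<forall>\<^sub>F z in right_side p t. z \<in> Um"
    unfolding sides by (simp_all add: eventually_at_filter)
  then have *: "\<forall>\<^sub>F z in nhds t \<times>\<^sub>F at_right 0. p (fst z) + \<i> * of_real (snd z) * v \<in> Up"
    "\<forall>\<^sub>F z in nhds t \<times>\<^sub>F at_right 0. p (fst z) - \<i> * of_real (snd z) * v \<in> Um"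
    unfolding left_side_def right_side_def eventually_filtermap case_prod_beta v by simp_all
  show "\<forall>\<^sub>F h in at_right 0. p t + \<i> * of_real h * v \<in> Up"
  proof -
    obtain Pf Pg where "eventually Pf (nhds t)" "eventually Pg (at_right 0)"
      "\<forall>x y. Pf x \<longrightarrow> Pg y \<longrightarrow> p (fst (x, y)) + \<i> * of_real (snd (x, y)) * v \<in> Up"
      using *(1) unfolding eventually_prod_filter by blast
    then show ?thesis by (metis (mono_tags, lifting) eventually_mono eventually_nhds_x_imp_x fst_conv snd_conv)
  qed
  show "\<forall>\<^sub>F h in at_right 0. p t - \<i> * of_real h * v \<in> Um"
  proof -
    obtain Pf Pg where "eventually Pf (nhds t)" "eventually Pg (at_right 0)"
      "\<forall>x y. Pf x \<longrightarrow> Pg y \<longrightarrow> p (fst (x, y)) - \<i> * of_real (snd (x, y)) * v \<in> Um"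
      using *(2) unfolding eventually_prod_filter by blast
    then show ?thesis by (metis (mono_tags, lifting) eventually_mono eventually_nhds_x_imp_x fst_conv snd_conv)
  qed
qed

lemmas arc_box_c0 = arc_box_def[THEN iffD1]
lemmas arc_box_c1 = arc_box_c0[THEN conjunct2]
lemmas arc_box_c2 = arc_box_c1[THEN conjunct2]
lemmas arc_box_c3 = arc_box_c2[THEN conjunct2]
lemmas arc_box_c4 = arc_box_c3[THEN conjunct2]
lemmas arc_box_c5 = arc_box_c4[THEN conjunct2]
lemmas arc_box_c6 = arc_box_c5[THEN conjunct2]
lemmas arc_box_c7 = arc_box_c6[THEN conjunct2]
lemmas arc_box_c8 = arc_box_c7[THEN conjunct2]
lemmas arc_box_c9 = arc_box_c8[THEN conjunct2]

lemmas arc_boxD = arc_box_c0[THEN conjunct1] arc_box_c1[THEN conjunct1] arc_box_c2[THEN conjunct1] arc_box_c3[THEN conjunct1] arc_box_c4[THEN conjunct1] arc_box_c5[THEN conjunct1] arc_box_c6[THEN conjunct1] arc_box_c7[THEN conjunct1] arc_box_c8[THEN conjunct1]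
lemmas arc_box_sides = arc_box_c9[THEN conjunct1, THEN bspec, THEN conjunct1] arc_box_c9[THEN conjunct1, THEN bspec, THEN conjunct2]

text \<open>Boxes exist inside any prescribed neighbourhood, so they can be shrunk into a region
  where the jump matrix is known or a logarithm exists.\<close>

definition arc_at :: "complex set \<Rightarrow> (real \<Rightarrow> complex) \<Rightarrow> real \<Rightarrow> bool" where
  "arc_at C p t \<longleftrightarrow> (\<forall>V e. open V \<longrightarrow> p t \<in> V \<longrightarrow> 0 < e \<longrightarrow>
     (\<exists>\<epsilon> U Up Um. arc_box p t \<epsilon> U Up Um \<and> \<epsilon> < e \<and> U \<subseteq> V \<and> U - C = Up \<union> Um \<and> U \<inter> C = p ` {t-\<epsilon><..<t+\<epsilon>}))"

text \<open>The sets \<open>W\<close> exclude other parts of \<open>C\<close>, including returns of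
  the same curve, so that near \<open>p t\<close> only the flat piece is left.\<close>

lemma arc_atI:
  assumes d0: "0 < d0" and der: "\<And>s. s \<in> {t-d0<..<t+d0} \<Longrightarrow> (p has_vector_derivative p' s) (at s)"
    and cont: "continuous_on {t-d0<..<t+d0} p'" and nz: "p' t \<noteq> 0"
    and C: "p ` {t-d0<..<t+d0} \<subseteq> C" and W: "\<And>e. 0 < e \<Longrightarrow> \<exists>W. open W \<and> p t \<in> W \<and> W \<inter> C \<subseteq> p ` {t-e<..<t+e}"
  shows "arc_at C p t"
  unfolding arc_at_def
proof (intro allI impI)
  fix V and e :: real assume V: "open V" "p t \<in> V" and e: "0 < e"
  obtain d where d: "0 < d" "d \<le> d0" "flat_arc p p' t d (p' t)"
    using flat_arc_exists[OF d0 der cont nz] .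
  interpret flat_arc p p' t d "p' t" by (rule d(3))
  obtain W where W: "open W" "p t \<in> W" "W \<inter> C \<subseteq> p ` {t-d<..<t+d}" using W[OF d(1)] by blast
  obtain \<epsilon> U Up Um where box: "arc_box p t \<epsilon> U Up Um" "\<epsilon> < e" "\<epsilon> < d" "U \<subseteq> V \<inter> W"
    "U \<inter> p ` {t-d<..<t+d} = p ` {t-\<epsilon><..<t+\<epsilon>}"
    using arc_box_exists[OF open_Int[OF V(1) W(1)] IntI[OF V(2) W(2)] e] .
  have sub: "p ` {t-d<..<t+d} \<subseteq> C"
  proof -
    have "{t-d<..<t+d} \<subseteq> {t-d0<..<t+d0}" using d by auto
    then show ?thesis using C by blast
  qed
  have UC: "U \<inter> C = p ` {t-\<epsilon><..<t+\<epsilon>}" 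
  proof -
    have "U \<inter> C \<subseteq> p ` {t-d<..<t+d}" using box(4) W(3) by blast
    then have "U \<inter> C = U \<inter> p ` {t-d<..<t+d}" using sub by blast
    then show ?thesis using box(5) by simp
  qed
  moreover have "U - C = Up \<union> Um"
    using arc_boxD(8,9)[OF box(1)] UC by blast
  ultimately show "\<exists>\<epsilon> U Up Um. arc_box p t \<epsilon> U Up Um \<and> \<epsilon> < e \<and> U \<subseteq> V \<and> U - C = Up \<union> Um \<and> U \<inter> C = p ` {t-\<epsilon><..<t+\<epsilon>}"
    using box by blast
qed

text \<open>At \<open>p s\<close> both boxes have the same boundary filters, so equally named sides
  meet. A connected side of the small box lies in the union of the two disjoint open sides of the
  large one and is thus contained in the one it meets.\<close>

lemma sub_box:
  assumes box: "arc_box p t \<epsilon> U Up Um" and box': "arc_box p s \<epsilon>' U' Up' Um'"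
    and s: "s \<in> {t-\<epsilon><..<t+\<epsilon>}" and sub: "U' \<subseteq> U" "(Up' \<union> Um') \<inter> p ` {t-\<epsilon><..<t+\<epsilon>} = {}"
  shows "Up' \<subseteq> Up" "Um' \<subseteq> Um"
proof -
  have s': "s \<in> {s-\<epsilon>'<..<s+\<epsilon>'}" using arc_boxD(1)[OF box'] by simp
  have side: "left_side p s = at (p s) within Up" "right_side p s = at (p s) within Um"
    and side': "left_side p s = at (p s) within Up'" "right_side p s = at (p s) within Um'" 
    by (rule arc_box_sides[OF box s] arc_box_sides[OF box' s'])+
  have ev: "\<forall>\<^sub>F z in left_side p s. z \<in> Up" "\<forall>\<^sub>F z in left_side p s. z \<in> Up'"
    "\<forall>\<^sub>F z in right_side p s. z \<in> Um" "\<forall>\<^sub>F z in right_side p s. z \<in> Um'"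
    using side side' by (metis (mono_tags, lifting) eventually_at_filter eventuallyI)+
  have ne: "Up \<inter> Up' \<noteq> {}" "Um \<inter> Um' \<noteq> {}"
    using eventually_happens'[OF left_side_neq_bot eventually_conj[OF ev(1,2)]]
      eventually_happens'[OF right_side_neq_bot eventually_conj[OF ev(3,4)]] by auto
  have sub': "Up' \<subseteq> Up \<union> Um" "Um' \<subseteq> Up \<union> Um" 
    using arc_boxD(8)[OF box] arc_boxD(8)[OF box'] sub by blast+
  have o: "open Up" "open Um" "Up \<inter> Um = {}" and c: "connected Up'" "connected Um'"
    by (rule arc_boxD[OF box] arc_boxD[OF box'])+
  show "Up' \<subseteq> Up" using connectedD[OF c(1) o(1,2)] o(3) sub'(1) ne(1) by blast
  show "Um' \<subseteq> Um" using connectedD[OF c(2) o(1,2)] o(3) sub'(2) ne(2) by blast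
qed

section \<open>Topology of the graph and its regular points\<close>

locale heun_graph =
  fixes a :: complex and \<Gamma> :: graph_data
  assumes a: "a \<notin> {0, 1}" and graph: "rh_graph a \<Gamma>"
begin

abbreviation "C \<equiv> gamma a \<Gamma>"
abbreviation "b0 \<equiv> base \<Gamma>"

lemmas graph1 = graph[unfolded rh_graph_def, THEN conjunct2]
lemmas graph2 = graph1[THEN conjunct2]
lemmas graph3 = graph2[THEN conjunct2]
lemmas graph4 = graph3[THEN conjunct2]
lemmas graph5 = graph4[THEN conjunct2]
lemmas graph6 = graph5[THEN conjunct2]
lemmas graph7 = graph6[THEN conjunct2]
lemmas graph8 = graph7[THEN conjunct2]
lemmas graph9 = graph8[THEN conjunct2]
lemmas graph10 = graph9[THEN conjunct2]
lemmas graph11 = graph10[THEN conjunct2]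
lemmas graph12 = graph11[THEN conjunct2]

lemmas ell_smooth = graph1[THEN conjunct1, rule_format, THEN conjunct1]
lemmas ell_0 = graph1[THEN conjunct1, rule_format, THEN conjunct2, THEN conjunct1]
lemmas ell_1 = graph1[THEN conjunct1, rule_format, THEN conjunct2, THEN conjunct2]
lemmas inf_smooth = graph2[THEN conjunct1]
lemmas inf_0 = graph3[THEN conjunct1]
lemmas inf_lim = graph4[THEN conjunct1]
lemmas ell_Int = graph6[THEN conjunct1, rule_format]
lemmas ell_inf_Int = graph7[THEN conjunct1, rule_format]
lemmas ccw = graph8[THEN conjunct1]
lemmas rad_pos = graph9[THEN conjunct1, rule_format, THEN conjunct1]
lemmas base_cball = graph9[THEN conjunct1, rule_format, THEN conjunct2]
lemmas cball_Int = graph10[THEN conjunct1, rule_format]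
lemmas circ_ell = graph11[THEN conjunct1, rule_format]
lemmas circ_inf = graph12[THEN conjunct1, rule_format]
lemmas node = graph12[THEN conjunct2, rule_format]

lemma ell_inj: "inj_on (ell \<Gamma> j) {0..1}" and inf_inj: "inj_on (ell_inf \<Gamma>) {..0}"
  using ell_smooth inf_smooth unfolding simple_smooth_on_def by blast+

lemma ell_deriv: obtains p' where "continuous_on {0..1} p'"
  "\<And>t. t \<in> {0..1} \<Longrightarrow> (ell \<Gamma> j has_vector_derivative p' t) (at t within {0..1})" "\<And>t. t \<in> {0..1} \<Longrightarrow> p' t \<noteq> 0"
  using ell_smooth[of j] unfolding simple_smooth_on_def by blast

lemma inf_deriv: obtains p' where "continuous_on {..0} p'"
  "\<And>t. t \<in> {..0} \<Longrightarrow> (ell_inf \<Gamma> has_vector_derivative p' t) (at t within {..0})" "\<And>t. t \<in> {..0} \<Longrightarrow> p' t \<noteq> 0"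
  using inf_smooth unfolding simple_smooth_on_def by blast

lemma ell_cont: "continuous_on {0..1} (ell \<Gamma> j)"
proof -
  obtain p' where "\<And>t. t \<in> {0..1} \<Longrightarrow> (ell \<Gamma> j has_vector_derivative p' t) (at t within {0..1})" using ell_deriv by metis
  then show ?thesis unfolding continuous_on_eq_continuous_within using has_vector_derivative_continuous by blast
qed

lemma inf_cont: "continuous_on {..0} (ell_inf \<Gamma>)"
proof -
  obtain p' where "\<And>t. t \<in> {..0} \<Longrightarrow> (ell_inf \<Gamma> has_vector_derivative p' t) (at t within {..0})" using inf_deriv by metis
  then show ?thesis unfolding continuous_on_eq_continuous_within using has_vector_derivative_continuous by blast
qed

lemma ell_path: "path (ell \<Gamma> j)" "path_image (ell \<Gamma> j) = ell_img \<Gamma> j" "pathstart (ell \<Gamma> j) = b0" "pathfinish (ell \<Gamma> j) = sing a j"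
  using ell_cont by (auto simp: path_def path_image_def ell_img_def pathstart_def pathfinish_def ell_0 ell_1)

text \<open>The end points are put into the exceptional set, as only one-sided derivatives are given
  there.\<close>

lemma valid_pathI_C1:
  assumes "continuous_on {0..1} p'" "\<And>t. t \<in> {0..1} \<Longrightarrow> (p has_vector_derivative p' t) (at t within {0..1})"
  shows "valid_path p"
  unfolding valid_path_def piecewise_C1_differentiable_on_def C1_differentiable_on_def
proof (intro conjI exI[of _ "{0,1}"] exI[of _ p'] ballI)
  show "continuous_on {0..1} p"
    unfolding continuous_on_eq_continuous_within using has_vector_derivative_continuous[OF assms(2)] by blast
  fix x :: real assume "x \<in> {0..1} - {0, 1}"
  then have x: "0 < x" "x < 1" by auto
  then show "(p has_vector_derivative p' x) (at x)" using assms(2)[of x] by (simp add: at_within_Icc_at)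
qed (use assms in \<open>auto intro: continuous_on_subset\<close>)

lemma ell_valid: "valid_path (ell \<Gamma> j)"
  using ell_deriv[of j] valid_pathI_C1 by metis

lemma compact_ell: "compact (ell_img \<Gamma> j)"
  unfolding ell_img_def by (intro compact_continuous_image ell_cont) simp

lemma inf_escapes: obtains T where "\<And>t. t \<le> T \<Longrightarrow> r < norm (ell_inf \<Gamma> t)"
proof -
  have "\<forall>\<^sub>F t in at_bot. r + 1 \<le> norm (ell_inf \<Gamma> t)"
    using filterlim_at_infinity_imp_norm_at_top[OF inf_lim] unfolding filterlim_at_top by blast
  then obtain T where "\<And>t. t \<le> T \<Longrightarrow> r + 1 \<le> norm (ell_inf \<Gamma> t)" unfolding eventually_at_bot_linorder by blast
  then show ?thesis by (intro that[of T]) (simp add: less_le_trans[OF less_add_one])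
qed

lemma closed_ell: "closed (ell_img \<Gamma> j)"
  using compact_ell by (rule compact_imp_closed)

text \<open>The arc is proper: near a given point only a compact portion of the parameter interval
  matters.\<close>

lemma closed_inf_image:
  assumes I: "closed I" "I \<subseteq> {..0}" shows "closed (ell_inf \<Gamma> ` I)"
proof -
  have "\<exists>e>0. ball x e \<subseteq> - ell_inf \<Gamma> ` I" if x: "x \<in> - ell_inf \<Gamma> ` I" for x
  proof -
    obtain T where T: "\<And>t. t \<le> T \<Longrightarrow> norm x + 1 < norm (ell_inf \<Gamma> t)" by (rule inf_escapes[of "norm x + 1"]) blast
    have "compact (ell_inf \<Gamma> ` (I \<inter> {T..0}))"
      using I by (intro compact_continuous_image continuous_on_subset[OF inf_cont] closed_Int_compact) auto
    then have "open (- ell_inf \<Gamma> ` (I \<inter> {T..0}))" by (intro open_Compl compact_imp_closed)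
    moreover have "x \<in> - ell_inf \<Gamma> ` (I \<inter> {T..0})" using x by auto
    ultimately obtain e where e: "e > 0" "ball x e \<subseteq> - ell_inf \<Gamma> ` (I \<inter> {T..0})" using open_contains_ball by blast
    have "ball x (min e 1) \<subseteq> - ell_inf \<Gamma> ` I"
    proof
      fix y assume y: "y \<in> ball x (min e 1)"
      show "y \<in> - ell_inf \<Gamma> ` I"
      proof
        assume "y \<in> ell_inf \<Gamma> ` I"
        then obtain t where t: "t \<in> I" "y = ell_inf \<Gamma> t" by blast
        have "y \<in> ball x e" using y by simp
        then have "t \<notin> {T..0}" using e(2) t by blast
        then have "t \<le> T" using t I by force
        then have "norm x + 1 < norm y" using T t by blast
        moreover have "norm y \<le> norm x + dist x y" using norm_triangle_ineq2[of y x] by (simp add: dist_norm norm_minus_commute)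
        ultimately show False using y by simp
      qed
    qed
    then show ?thesis using e(1) by (intro exI[of _ "min e 1"]) auto
  qed
  then have "open (- ell_inf \<Gamma> ` I)" unfolding open_contains_ball by blast
  then show ?thesis by (simp add: closed_def)
qed

lemma closed_inf: "closed (ell_inf_img \<Gamma>)"
  unfolding ell_inf_img_def by (intro closed_inf_image) auto

lemma closed_circ: "closed (circ a \<Gamma> j)" unfolding circ_def by simp

lemma closed_C: "closed C"
  unfolding gamma_def by (intro closed_Un closed_UN closed_ell closed_inf closed_circ) (auto simp: closed_ell closed_circ)

text \<open>Differentiable images of intervals and circles are null sets in the plane.\<close>

lemma interior_C: "interior C = {}"
proof -
  have "negligible (ell_img \<Gamma> j)" for j
  proof -
    obtain p' where "\<And>t. t \<in> {0..1} \<Longrightarrow> (ell \<Gamma> j has_vector_derivative p' t) (at t within {0..1})" using ell_deriv by metis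
    then have "ell \<Gamma> j differentiable_on {0..1}"
      unfolding differentiable_on_def using vector_derivative_works differentiableI_vector by blast
    then show ?thesis unfolding ell_img_def by (intro negligible_differentiable_image_lowdim) auto
  qed
  moreover have "negligible (ell_inf_img \<Gamma>)"
  proof -
    obtain p' where "\<And>t. t \<in> {..0} \<Longrightarrow> (ell_inf \<Gamma> has_vector_derivative p' t) (at t within {..0})" using inf_deriv by metis
    then have "ell_inf \<Gamma> differentiable_on {..0}"
      unfolding differentiable_on_def using vector_derivative_works differentiableI_vector by blast
    then show ?thesis unfolding ell_inf_img_def by (intro negligible_differentiable_image_lowdim) auto
  qed
  moreover have "negligible (circ a \<Gamma> j)" for j unfolding circ_def by (rule negligible_sphere)
  ultimately have "negligible C"
    unfolding gamma_def by (intro negligible_Un negligible_Union) auto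
  then have "negligible (interior C)" using negligible_subset interior_subset by blast
  then show ?thesis using open_not_negligible[OF open_interior] by blast
qed

lemma base_in_ell: "b0 \<in> ell_img \<Gamma> j" unfolding ell_img_def using ell_0 by (metis atLeastAtMost_iff imageI order_refl zero_le_one)
lemma sing_in_ell: "sing a j \<in> ell_img \<Gamma> j" unfolding ell_img_def using ell_1 by (metis atLeastAtMost_iff imageI order_refl zero_le_one)
lemma base_in_inf: "b0 \<in> ell_inf_img \<Gamma>" unfolding ell_inf_img_def using inf_0 by (metis atMost_iff imageI order_refl)

lemma ell_param:
  assumes "t \<in> {0<..<1}"
  shows "ell \<Gamma> j t \<noteq> b0" "ell \<Gamma> j t \<noteq> sing a j" "ell \<Gamma> j t \<in> ell_img \<Gamma> j"
    "k \<noteq> j \<Longrightarrow> ell \<Gamma> j t \<notin> ell_img \<Gamma> k" "ell \<Gamma> j t \<notin> ell_inf_img \<Gamma>" "k \<noteq> j \<Longrightarrow> ell \<Gamma> j t \<notin> circ a \<Gamma> k"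
proof -
  show 1: "ell \<Gamma> j t \<noteq> b0" using inj_onD[OF ell_inj[of j], of t 0] assms ell_0 by auto
  show "ell \<Gamma> j t \<noteq> sing a j" using inj_onD[OF ell_inj[of j], of t 1] assms ell_1 by auto
  show 2: "ell \<Gamma> j t \<in> ell_img \<Gamma> j" using assms by (auto simp: ell_img_def)
  show "k \<noteq> j \<Longrightarrow> ell \<Gamma> j t \<notin> ell_img \<Gamma> k" using ell_Int[of j k] 1 2 by auto
  show "ell \<Gamma> j t \<notin> ell_inf_img \<Gamma>" using ell_inf_Int[of j] 1 2 by auto
  show "k \<noteq> j \<Longrightarrow> ell \<Gamma> j t \<notin> circ a \<Gamma> k" using circ_ell[of k j] 2 by auto
qed

lemma inf_param:
  assumes "t < 0"
  shows "ell_inf \<Gamma> t \<noteq> b0" "ell_inf \<Gamma> t \<in> ell_inf_img \<Gamma>" "ell_inf \<Gamma> t \<notin> ell_img \<Gamma> k" "ell_inf \<Gamma> t \<notin> circ a \<Gamma> k"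
proof -
  show 1: "ell_inf \<Gamma> t \<noteq> b0" using inj_onD[OF inf_inj, of t 0] assms inf_0 by auto
  show 2: "ell_inf \<Gamma> t \<in> ell_inf_img \<Gamma>" using assms by (auto simp: ell_inf_img_def)
  show "ell_inf \<Gamma> t \<notin> ell_img \<Gamma> k" using ell_inf_Int[of k] 1 2 by auto
  show "ell_inf \<Gamma> t \<notin> circ a \<Gamma> k" using circ_inf[of k] 2 by auto
qed

text \<open>A connected set that contains the base point could enter the closed disc only through
  the boundary circle.\<close>

lemma not_in_cball:
  assumes "connected S" "b0 \<in> S" "S \<inter> circ a \<Gamma> j = {}" shows "S \<inter> cball (sing a j) (rad \<Gamma> j) = {}"
proof (rule ccontr)
  assume "S \<inter> cball (sing a j) (rad \<Gamma> j) \<noteq> {}"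
  moreover have "S - cball (sing a j) (rad \<Gamma> j) \<noteq> {}" using assms(2) base_cball by blast
  ultimately have "S \<inter> frontier (cball (sing a j) (rad \<Gamma> j)) \<noteq> {}" using connected_Int_frontier[OF assms(1)] by blast
  then show False using assms(3) rad_pos[of j] by (simp add: circ_def frontier_cball)
qed

lemma circ_Int: "j \<noteq> k \<Longrightarrow> circ a \<Gamma> j \<inter> circ a \<Gamma> k = {}"
proof -
  assume "j \<noteq> k"
  from cball_Int[OF this] show ?thesis unfolding circ_def
    using sphere_cball[of "sing a j" "rad \<Gamma> j"] sphere_cball[of "sing a k" "rad \<Gamma> k"] by blast
qed

lemma ell_not_in_cball: "j \<noteq> k \<Longrightarrow> ell_img \<Gamma> k \<inter> cball (sing a j) (rad \<Gamma> j) = {}"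
  using circ_ell[of j k] unfolding ell_img_def[of _ k]
  by (intro not_in_cball connected_continuous_image ell_cont base_in_ell[unfolded ell_img_def] convex_connected[OF convex_real_interval(5)]) auto

lemma inf_not_in_cball: "ell_inf_img \<Gamma> \<inter> cball (sing a j) (rad \<Gamma> j) = {}"
  using circ_inf[of j] unfolding ell_inf_img_def
  by (intro not_in_cball connected_continuous_image inf_cont base_in_inf[unfolded ell_inf_img_def] convex_connected[OF convex_real_interval(2)]) auto

lemma open_D_inf: "open (D_inf a \<Gamma>)"
proof -
  have "C \<union> (\<Union>j. disc a \<Gamma> j) = C \<union> (\<Union>j. cball (sing a j) (rad \<Gamma> j))"
    unfolding gamma_def circ_def disc_def using sphere_cball ball_subset_cball by (fastforce simp: less_le dist_commute)
  moreover have "closed (C \<union> (\<Union>j. cball (sing a j) (rad \<Gamma> j)))" using closed_C by (intro closed_Un closed_UN) auto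
  ultimately show ?thesis unfolding D_inf_def by (simp add: closed_def)
qed

lemma D_inf_subset: "D_inf a \<Gamma> \<subseteq> - C" unfolding D_inf_def by auto

lemma in_C_cases:
  assumes "w \<in> C"
  obtains "w = b0" | j where "w = sing a j" | j t where "t \<in> {0<..<1}" "w = ell \<Gamma> j t" "w \<notin> circ a \<Gamma> j"
    | j t where "t \<in> {0<..<1}" "w = ell \<Gamma> j t" "w \<in> circ a \<Gamma> j" | t where "t < 0" "w = ell_inf \<Gamma> t"
    | j where "w \<in> circ a \<Gamma> j" "w \<notin> ell_img \<Gamma> j"
proof -
  consider j where "w \<in> ell_img \<Gamma> j" | "w \<in> ell_inf_img \<Gamma>" | j where "w \<in> circ a \<Gamma> j" "w \<notin> ell_img \<Gamma> j"
    using assms unfolding gamma_def by blast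
  then show ?thesis
  proof cases
    case (1 j)
    then obtain t where t: "t \<in> {0..1}" "w = ell \<Gamma> j t" by (auto simp: ell_img_def)
    consider "t = 0" | "t = 1" | "t \<in> {0<..<1}" using t by fastforce
    then show ?thesis
    proof cases
      case 1 then show ?thesis using that(1) t ell_0 by simp
    next
      case 2 then show ?thesis using that(2)[of j] t ell_1 by simp
    next
      case 3 then show ?thesis using that(3)[of t j] that(4)[of t j] t by blast
    qed
  next
    case 2
    then obtain t where t: "t \<le> 0" "w = ell_inf \<Gamma> t" by (auto simp: ell_inf_img_def)
    then show ?thesis using that(1) that(5)[of t] inf_0 by (cases "t = 0") auto
  next
    case (3 j) then show ?thesis using that(6) by blast
  qed
qed

lemma compact_ell_minus: "compact (ell \<Gamma> j ` ({0..1} - {t-e<..<t+e}))"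
proof -
  have "{0..1} - {t-e<..<t+e} = {0..1} \<inter> - {t-e<..<t+e}" by auto
  then have "compact ({0..1} - {t-e<..<t+e})"
    by (simp only:) (intro compact_Int_closed compact_Icc closed_Compl open_greaterThanLessThan)
  then show ?thesis by (intro compact_continuous_image continuous_on_subset[OF ell_cont]) auto
qed

lemma ell_deriv_at: obtains p' where "continuous_on {0<..<1} p'"
  "\<And>t. t \<in> {0<..<1} \<Longrightarrow> (ell \<Gamma> j has_vector_derivative p' t) (at t)" "\<And>t. t \<in> {0<..<1} \<Longrightarrow> p' t \<noteq> 0"
proof -
  obtain p' where p': "continuous_on {0..1} p'"
    "\<And>t. t \<in> {0..1} \<Longrightarrow> (ell \<Gamma> j has_vector_derivative p' t) (at t within {0..1})" "\<And>t. t \<in> {0..1} \<Longrightarrow> p' t \<noteq> 0"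
    by (rule ell_deriv[of j]) blast
  show ?thesis
  proof (rule that[of p'])
    show "continuous_on {0<..<1} p'" by (rule continuous_on_subset[OF p'(1)]) auto
    show "(ell \<Gamma> j has_vector_derivative p' t) (at t)" if "t \<in> {0<..<1}" for t
      using p'(2)[of t] that by (simp add: at_within_Icc_at)
    show "p' t \<noteq> 0" if "t \<in> {0<..<1}" for t using p'(3)[of t] that by simp
  qed
qed

lemma inf_deriv_at: obtains p' where "continuous_on {..<0} p'"
  "\<And>t. t < 0 \<Longrightarrow> (ell_inf \<Gamma> has_vector_derivative p' t) (at t)" "\<And>t. t < 0 \<Longrightarrow> p' t \<noteq> 0"
proof -
  obtain p' where p': "continuous_on {..0} p'"
    "\<And>t. t \<in> {..0} \<Longrightarrow> (ell_inf \<Gamma> has_vector_derivative p' t) (at t within {..0})" "\<And>t. t \<in> {..0} \<Longrightarrow> p' t \<noteq> 0"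
    by (rule inf_deriv) blast
  show ?thesis
  proof (rule that[of p'])
    show "continuous_on {..<0} p'" by (rule continuous_on_subset[OF p'(1)]) auto
    show "(ell_inf \<Gamma> has_vector_derivative p' t) (at t)" if "t < 0" for t
    proof -
      have "at t within {..0} = at t" by (intro at_within_interior interiorI[of "{..<0}"]) (use that in auto)
      then show ?thesis using p'(2)[of t] that by simp
    qed
    show "p' t \<noteq> 0" if "t < 0" for t using p'(3)[of t] that by simp
  qed
qed

lemma arc_at_ell:
  assumes t: "t \<in> {0<..<1}" and nc: "ell \<Gamma> j t \<notin> circ a \<Gamma> j"
  shows "arc_at C (ell \<Gamma> j) t"
proof -
  define d0 where "d0 = min t (1 - t)"
  have d0: "0 < d0" "{t-d0<..<t+d0} \<subseteq> {0<..<1}" using t by (auto simp: d0_def)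
  obtain p' where p': "continuous_on {0<..<1} p'"
    "\<And>t. t \<in> {0<..<1} \<Longrightarrow> (ell \<Gamma> j has_vector_derivative p' t) (at t)" "\<And>t. t \<in> {0<..<1} \<Longrightarrow> p' t \<noteq> 0"
    by (rule ell_deriv_at[of j]) blast
  show ?thesis
  proof (rule arc_atI[OF d0(1), where p = "ell \<Gamma> j" and p' = p'])
    show "(ell \<Gamma> j has_vector_derivative p' s) (at s)" if "s \<in> {t-d0<..<t+d0}" for s using p'(2) d0 that by blast
    show "continuous_on {t-d0<..<t+d0} p'" using p'(1) d0 continuous_on_subset by blast
    show "p' t \<noteq> 0" using p'(3) t by blast
    have "{0<..<1} \<subseteq> {0..1::real}" by auto
    then have "ell \<Gamma> j ` {t-d0<..<t+d0} \<subseteq> ell_img \<Gamma> j" using d0(2) unfolding ell_img_def by blast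
    then show "ell \<Gamma> j ` {t-d0<..<t+d0} \<subseteq> C" unfolding gamma_def by blast
    fix e :: real assume e: "0 < e"
    \<comment> \<open>All of the graph except the part of this arc with parameter near
      \<open>t\<close>: a closed set whose complement is the wanted neighbourhood.\<close>
    let ?R = "ell \<Gamma> j ` ({0..1} - {t-e<..<t+e}) \<union> (\<Union>k\<in>-{j}. ell_img \<Gamma> k) \<union> ell_inf_img \<Gamma> \<union> (\<Union>k. circ a \<Gamma> k)"
    have "closed ?R"
      by (intro closed_Un closed_UN compact_imp_closed[OF compact_ell_minus] closed_ell closed_inf closed_circ) (auto simp: closed_ell closed_circ)
    then have "open (- ?R)" by (rule open_Compl)
    moreover have "ell \<Gamma> j t \<in> - ?R"
    proof -
      have "ell \<Gamma> j t \<notin> ell \<Gamma> j ` ({0..1} - {t-e<..<t+e})"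
      proof
        assume "ell \<Gamma> j t \<in> ell \<Gamma> j ` ({0..1} - {t-e<..<t+e})"
        then obtain s where "s \<in> {0..1} - {t-e<..<t+e}" "ell \<Gamma> j t = ell \<Gamma> j s" by blast
        then show False using inj_onD[OF ell_inj, of j t s] t e by auto
      qed
      moreover have "ell \<Gamma> j t \<notin> circ a \<Gamma> k" for k using ell_param(6)[OF t, of k j] nc by (cases "k = j") auto
      ultimately show ?thesis using ell_param(4,5)[OF t, where j = j] by blast
    qed
    moreover have "- ?R \<inter> C \<subseteq> ell \<Gamma> j ` {t-e<..<t+e}"
      unfolding gamma_def ell_img_def[of _ j] by (auto simp: ell_img_def)
    ultimately show "\<exists>W. open W \<and> ell \<Gamma> j t \<in> W \<and> W \<inter> C \<subseteq> ell \<Gamma> j ` {t-e<..<t+e}" by blast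
  qed
qed

lemma arc_at_inf:
  assumes t: "t < 0"
  shows "arc_at C (ell_inf \<Gamma>) t"
proof -
  define d0 where "d0 = - t"
  have d0: "0 < d0" "{t-d0<..<t+d0} \<subseteq> {..<0}" using t by (auto simp: d0_def)
  obtain p' where p': "continuous_on {..<0} p'"
    "\<And>t. t < 0 \<Longrightarrow> (ell_inf \<Gamma> has_vector_derivative p' t) (at t)" "\<And>t. t < 0 \<Longrightarrow> p' t \<noteq> 0"
    by (rule inf_deriv_at) blast
  show ?thesis
  proof (rule arc_atI[OF d0(1), where p = "ell_inf \<Gamma>" and p' = p'])
    show "(ell_inf \<Gamma> has_vector_derivative p' s) (at s)" if "s \<in> {t-d0<..<t+d0}" for s using p'(2) d0 that by blast
    show "continuous_on {t-d0<..<t+d0} p'" using p'(1) d0 continuous_on_subset by blast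
    show "p' t \<noteq> 0" using p'(3) t by blast
    have "{..<0} \<subseteq> {..0::real}" by auto
    then have "ell_inf \<Gamma> ` {t-d0<..<t+d0} \<subseteq> ell_inf_img \<Gamma>" using d0(2) unfolding ell_inf_img_def by blast
    then show "ell_inf \<Gamma> ` {t-d0<..<t+d0} \<subseteq> C" unfolding gamma_def by blast
    fix e :: real assume e: "0 < e"
    let ?R = "ell_inf \<Gamma> ` ({..0} - {t-e<..<t+e}) \<union> (\<Union>k. ell_img \<Gamma> k) \<union> (\<Union>k. circ a \<Gamma> k)"
    have "closed (ell_inf \<Gamma> ` ({..0} - {t-e<..<t+e}))" by (intro closed_inf_image closed_Diff) auto
    then have "closed ?R" by (intro closed_Un closed_UN closed_ell closed_circ) (auto simp: closed_ell closed_circ)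
    then have "open (- ?R)" by (rule open_Compl)
    moreover have "ell_inf \<Gamma> t \<in> - ?R"
    proof -
      have "ell_inf \<Gamma> t \<notin> ell_inf \<Gamma> ` ({..0} - {t-e<..<t+e})"
      proof
        assume "ell_inf \<Gamma> t \<in> ell_inf \<Gamma> ` ({..0} - {t-e<..<t+e})"
        then obtain s where "s \<in> {..0} - {t-e<..<t+e}" "ell_inf \<Gamma> t = ell_inf \<Gamma> s" by blast
        then show False using inj_onD[OF inf_inj, of t s] t e by auto
      qed
      then show ?thesis using inf_param(3,4)[OF t] by blast
    qed
    moreover have "- ?R \<inter> C \<subseteq> ell_inf \<Gamma> ` {t-e<..<t+e}"
      unfolding gamma_def ell_inf_img_def by auto
    ultimately show "\<exists>W. open W \<and> ell_inf \<Gamma> t \<in> W \<and> W \<inter> C \<subseteq> ell_inf \<Gamma> ` {t-e<..<t+e}" by blast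
  qed
qed

definition circ_curve :: "3 \<Rightarrow> real \<Rightarrow> complex" where
  "circ_curve j = (\<lambda>s. sing a j + rcis (rad \<Gamma> j) s)"

lemma circ_curve_deriv: "(circ_curve j has_vector_derivative \<i> * rcis (rad \<Gamma> j) s) (at s)"
proof -
  have "((\<lambda>z. sing a j + of_real (rad \<Gamma> j) * exp (\<i> * z)) has_field_derivative
      \<i> * (of_real (rad \<Gamma> j) * exp (\<i> * of_real s))) (at (of_real s))"
    by (auto intro!: derivative_eq_intros)
  from has_vector_derivative_real_field[OF this] show ?thesis
    unfolding circ_curve_def rcis_def cis_conv_exp .
qed

lemma circ_curve_in: "circ_curve j s \<in> circ a \<Gamma> j"
  using rad_pos[of j] by (simp add: circ_curve_def circ_def dist_norm)

lemma arc_at_circ: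
  assumes "circ_curve j t \<notin> ell_img \<Gamma> j"
  shows "arc_at C (circ_curve j) t"
proof (rule arc_atI[of 1 _ _ "\<lambda>s. \<i> * rcis (rad \<Gamma> j) s"])
  let ?r = "rad \<Gamma> j"
  have r: "?r > 0" by (rule rad_pos)
  show "(circ_curve j has_vector_derivative \<i> * rcis ?r s) (at s)" for s by (rule circ_curve_deriv)
  show "continuous_on {t-1<..<t+1} (\<lambda>s. \<i> * rcis ?r s)" unfolding rcis_def cis_conv_exp by (intro continuous_intros)
  show "\<i> * rcis ?r t \<noteq> 0" using r by (simp add: rcis_def)
  show "circ_curve j ` {t-1<..<t+1} \<subseteq> C" using circ_curve_in unfolding gamma_def by blast
  fix e0 :: real assume "0 < e0"
  \<comment> \<open>The cap 3 keeps \<open>e\<close> below pi, so that the cosine is injective on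
    the angles concerned; the half plane \<open>?H\<close> then cuts out of the circle the angles
    closer than \<open>e\<close> to \<open>t\<close>.\<close>
  define e where "e = min e0 3"
  have e: "0 < e" "e < pi" "e \<le> e0" using \<open>0 < e0\<close> pi_gt3 by (auto simp: e_def)
  let ?R = "(\<Union>k. ell_img \<Gamma> k) \<union> ell_inf_img \<Gamma> \<union> (\<Union>k\<in>-{j}. circ a \<Gamma> k)"
  let ?H = "{z. ?r * cos e < Re ((z - sing a j) * cis (- t))}"
  have cR: "closed ?R" by (intro closed_Un closed_UN closed_ell closed_inf closed_circ) (auto simp: closed_ell closed_circ)
  have "open (?H \<inter> - ?R)" by (intro open_Int open_Compl[OF cR] open_Collect_less continuous_intros)
  moreover have "circ_curve j t \<in> ?H"
  proof -
    have 1: "(circ_curve j t - sing a j) * cis (- t) = of_real ?r" by (simp add: circ_curve_def rcis_def cis_mult)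
    have "cos e < 1" using cos_monotone_0_pi[of 0 e] e by simp
    have "Re ((circ_curve j t - sing a j) * cis (- t)) = ?r" unfolding 1 by (rule Re_complex_of_real)
    with \<open>cos e < 1\<close> show ?thesis using r unfolding mem_Collect_eq by (simp only:) simp
  qed
  moreover have "circ_curve j t \<notin> ?R"
  proof -
    have "circ_curve j t \<notin> ell_img \<Gamma> k" for k
      using assms circ_curve_in[of j t] circ_ell[of j k] by (cases "k = j") auto
    moreover have "circ_curve j t \<notin> ell_inf_img \<Gamma>" using circ_curve_in[of j t] circ_inf[of j] by auto
    moreover have "circ_curve j t \<notin> circ a \<Gamma> k" if "k \<noteq> j" for k
      using circ_curve_in[of j t] circ_Int[of j k] that by auto
    ultimately show ?thesis by blast
  qed
  moreover have "(?H \<inter> - ?R) \<inter> C \<subseteq> circ_curve j ` {t-e0<..<t+e0}"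
  proof
    fix z assume z: "z \<in> (?H \<inter> - ?R) \<inter> C"
    then have "z \<in> circ a \<Gamma> j" unfolding gamma_def by auto
    then have nz: "norm (z - sing a j) = ?r" by (simp add: circ_def dist_norm norm_minus_commute)
    define u where "u = (z - sing a j) * cis (- t)"
    define \<phi> where "\<phi> = Arg u"
    have nu: "norm u = ?r" by (simp add: u_def norm_mult nz)
    have u: "u = rcis ?r \<phi>" using rcis_cmod_Arg[of u] unfolding \<phi>_def nu by simp
    have "?r * cos e < Re u" using z unfolding u_def by blast
    moreover have "Re u = ?r * cos \<phi>" using arg_cong[OF u, of Re] by (simp add: rcis_def)
    ultimately have "?r * cos e < ?r * cos \<phi>" by (simp only:)
    then have "cos e < cos \<phi>" using r by simp
    then have ce: "cos e < cos \<bar>\<phi>\<bar>" by simp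
    have ph: "\<bar>\<phi>\<bar> \<le> pi" using Arg_bounded[of u] unfolding \<phi>_def by linarith
    have "\<bar>\<phi>\<bar> < e"
    proof (rule ccontr)
      assume "\<not> \<bar>\<phi>\<bar> < e"
      then have "cos \<bar>\<phi>\<bar> \<le> cos e" using e ph by (intro cos_monotone_0_pi_le) auto
      then show False using ce by linarith
    qed
    then have "t + \<phi> \<in> {t-e0<..<t+e0}" using e by (simp add: abs_less_iff)
    moreover have "z = circ_curve j (t + \<phi>)"
    proof -
      have "u * cis t = z - sing a j" by (simp add: u_def mult.assoc cis_mult)
      then have "z = sing a j + rcis ?r \<phi> * cis t" using u by simp
      then show ?thesis by (simp add: circ_curve_def rcis_def mult.assoc cis_mult add.commute)
    qed
    ultimately show "z \<in> circ_curve j ` {t-e0<..<t+e0}" by blast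
  qed
  ultimately show "\<exists>W. open W \<and> circ_curve j t \<in> W \<and> W \<inter> C \<subseteq> circ_curve j ` {t-e0<..<t+e0}" by blast
qed auto

lemma circ_param: "w \<in> circ a \<Gamma> j \<Longrightarrow> \<exists>t. w = circ_curve j t"
proof -
  assume "w \<in> circ a \<Gamma> j"
  then have "norm (w - sing a j) = rad \<Gamma> j" by (simp add: circ_def dist_norm norm_minus_commute)
  then have "w - sing a j = rcis (rad \<Gamma> j) (Arg (w - sing a j))" using rcis_cmod_Arg[of "w - sing a j"] by simp
  then show ?thesis unfolding circ_curve_def by (intro exI[of _ "Arg (w - sing a j)"]) (simp add: algebra_simps)
qed

text \<open>The circle is counterclockwise, so the left normal points to the centre. A side is
  connected and avoids the circle, hence one point of it decides.\<close>

lemma circ_box_sides: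
  assumes box: "arc_box (circ_curve j) t \<epsilon> U Up Um" and off: "U - C = Up \<union> Um"
  shows "Up \<subseteq> disc a \<Gamma> j" "Um \<subseteq> - cball (sing a j) (rad \<Gamma> j)"
proof -
  let ?r = "rad \<Gamma> j" let ?l = "sing a j"
  have r: "?r > 0" by (rule rad_pos)
  have v: "vector_derivative (circ_curve j) (at t) = \<i> * rcis ?r t" by (rule vector_derivative_at[OF circ_curve_deriv])
  have pt: "circ_curve j t + \<i> * of_real h * (\<i> * rcis ?r t) = ?l + of_real (1 - h) * rcis ?r t"
    "circ_curve j t - \<i> * of_real h * (\<i> * rcis ?r t) = ?l + of_real (1 + h) * rcis ?r t" for h
    by (simp_all add: circ_curve_def algebra_simps)
  have t: "t \<in> {t-\<epsilon><..<t+\<epsilon>}" using arc_boxD(1)[OF box] by simp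
  have ev: "\<forall>\<^sub>F h in at_right 0. h \<in> {0<..<1::real}" using eventually_at_right_real[of 0 1] by simp
  have nrm: "norm (of_real x * rcis ?r t) = \<bar>x\<bar> * ?r" for x using r by (simp add: norm_mult)
  have e1: "\<exists>z. z \<in> Up \<and> z \<in> ball ?l ?r"
  proof -
    obtain h where "?l + of_real (1 - h) * rcis ?r t \<in> Up" "h \<in> {0<..<1}"
      using eventually_happens'[OF _ eventually_conj[OF arc_box_normal(1)[OF box t v, unfolded pt] ev]] by auto
    then show ?thesis using nrm[of "1 - h"] r by (intro exI[of _ "?l + of_real (1 - h) * rcis ?r t"]) (auto simp: dist_norm)
  qed
  have e2: "\<exists>z. z \<in> Um \<and> z \<in> - cball ?l ?r"
  proof -
    obtain h where "?l + of_real (1 + h) * rcis ?r t \<in> Um" "h \<in> {0<..<1}"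
      using eventually_happens'[OF _ eventually_conj[OF arc_box_normal(2)[OF box t v, unfolded pt] ev]] by auto
    then show ?thesis using nrm[of "1 + h"] r by (intro exI[of _ "?l + of_real (1 + h) * rcis ?r t"]) (auto simp: dist_norm)
  qed
  have "(Up \<union> Um) \<inter> C = {}" using off by blast
  then have ns: "(Up \<union> Um) \<inter> sphere ?l ?r = {}" unfolding gamma_def circ_def by blast
  have split: "z \<in> ball ?l ?r \<or> z \<in> - cball ?l ?r" if "z \<in> Up \<union> Um" for z
    using ns that by (cases "dist ?l z" ?r rule: linorder_cases) auto
  have o: "open (ball ?l ?r)" "open (- cball ?l ?r)" "ball ?l ?r \<inter> - cball ?l ?r = {}" by auto
  have c: "connected Up" "connected Um" using box by (auto simp: arc_box_def)
  show "Up \<subseteq> disc a \<Gamma> j" unfolding disc_def using connectedD[OF c(1) o(1,2)] o(3) split e1 by blast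
  show "Um \<subseteq> - cball ?l ?r" using connectedD[OF c(2) o(1,2)] o(3) split e2 by blast
qed

end

section \<open>Regularity at the arcs, the circles and the nodes\<close>

locale heun_rh = heun_graph a \<Gamma> for a \<Gamma> +
  fixes \<delta> :: complex and \<alpha> :: "3 \<Rightarrow> complex" and E :: "3 \<Rightarrow> complex^2^2"
    and L :: "complex \<Rightarrow> complex" and \<Psi> :: "complex \<Rightarrow> complex^2^2"
  assumes det_E: "\<And>j. det (E j) = 1"
    and cyclic: "M_mat \<alpha> E 1 ** M_mat \<alpha> E 2 ** M_mat \<alpha> E 3 = M_inf \<delta>"
    and L: "log_branch_at_infinity \<Gamma> L"
    and rh: "rh_solution a \<Gamma> \<alpha> \<delta> E L \<Psi>"
begin

abbreviation "M \<equiv> M_mat \<alpha> E"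
abbreviation eM :: "3 \<Rightarrow> complex^2^2" where "eM j \<equiv> exp_sigma3 (2 * of_real pi * \<i> * \<alpha> j)"

lemmas rh_c0 = rh[unfolded rh_solution_def]
lemmas rh_c1 = rh_c0[THEN conjunct2]
lemmas rh_c2 = rh_c1[THEN conjunct2]
lemmas rh_c3 = rh_c2[THEN conjunct2]
lemmas rh_c4 = rh_c3[THEN conjunct2]
lemmas rh_c5 = rh_c4[THEN conjunct2]
lemmas rh_c6 = rh_c5[THEN conjunct2]
lemmas rh_c7 = rh_c6[THEN conjunct2]
lemmas rh_holo = rh_c0[THEN conjunct1, rule_format]
lemmas rh_inf = rh_c1[THEN conjunct1]
lemmas rh_inf12 = rh_c2[THEN conjunct1]
lemmas rh_sing = rh_c3[THEN conjunct1, rule_format]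
lemmas rh_nodes = rh_c4[THEN conjunct1]
lemmas jump_outer = rh_c5[THEN conjunct1, rule_format]
lemmas jump_inner = rh_c6[THEN conjunct1, rule_format]
lemmas jump_circ = rh_c7[THEN conjunct1, rule_format]
lemmas jump_inf = rh_c7[THEN conjunct2, rule_format]

lemma mholo_\<Psi>: "mholo (- C) \<Psi>" unfolding mholo_def using rh_holo by blast

lemma matrix_inv_E: "matrix_inv (E j) = adj2 (E j)"
proof -
  have "E j ** matrix_inv (E j) = mat 1 \<and> matrix_inv (E j) ** E j = mat 1"
    unfolding matrix_inv_def by (rule someI[of _ "adj2 (E j)"]) (simp add: adj2_inverse det_E)
  then have "matrix_inv (E j) ** E j = mat 1" by blast
  then have "matrix_inv (E j) ** E j ** adj2 (E j) = adj2 (E j)" by simp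
  then show ?thesis unfolding matrix_mul_assoc[symmetric] adj2_inverse(1)[OF det_E] by simp
qed

lemma M_eq: "M j = E j ** eM j ** adj2 (E j)" unfolding M_mat_def matrix_inv_E ..

lemma det_M: "det (M j) = 1" by (simp add: M_eq det_mul det_E)

text \<open>The compatibility of the jumps meeting at a node: \<open>E j\<close> diagonalizes
  \<open>M j\<close>.\<close>

lemma adj_E_M: "adj2 (E j) ** M j = eM j ** adj2 (E j)"
  unfolding M_eq matrix_mul_assoc adj2_inverse(2)[OF det_E] by simp

definition reg :: "complex \<Rightarrow> bool" where
  "reg w \<longleftrightarrow> ext_at C (\<lambda>z. det (\<Psi> z)) w \<and> mext_at C (logder \<Psi>) w"

lemma mext_const:
  assumes "z \<notin> C" "\<forall>\<^sub>F y in nhds z. N y = N z" shows "mext_at C (\<lambda>z. \<Psi> z ** N z) z"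
proof -
  obtain S where S: "open S" "z \<in> S" "\<And>y. y \<in> S \<Longrightarrow> N y = N z"
    using assms(2) unfolding eventually_nhds by blast
  have 1: "mholo (S \<inter> - C) (\<lambda>y. \<Psi> y ** N z)"
    by (intro mholo_mult mholo_const mholo_subset[OF mholo_\<Psi>]) simp
  show ?thesis unfolding mext_at_def
  proof (rule exI[of _ "S \<inter> - C"], rule exI[of _ "\<lambda>y. \<Psi> y ** N z"], intro conjI ballI 1)
    show "open (S \<inter> - C)" by (rule open_Int[OF S(1) open_Compl[OF closed_C]])
    show "z \<in> S \<inter> - C" using S(2) assms(1) by blast
    fix y assume "y \<in> S \<inter> - C - C"
    then have "N y = N z" using S(3) by blast
    then show "\<Psi> y ** N y = \<Psi> y ** N z" by (rule arg_cong)
  qed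
qed

lemma reg_off: assumes "w \<notin> C" shows "reg w"
proof -
  have "mext_at C (\<lambda>z. \<Psi> z ** mat 1) w" using mext_const[OF assms, of "\<lambda>_. mat 1"] by simp
  from regular_extension[OF closed_C mholo_\<Psi> open_UNIV UNIV_I _ _ this] show ?thesis
    unfolding reg_def by simp
qed

lemma box_holo:
  assumes "U - C = Up \<union> Um" shows "mholo Up \<Psi>" "mholo Um \<Psi>"
  using assms by (auto intro: mholo_subset[OF mholo_\<Psi>])

text \<open>Here the factor \<open>N\<close> is given beforehand and may vary with the point, for
  use near a node, the base point, a singular point and infinity. Since the box is chosen only
  inside the proof, the condition on \<open>N\<close> is posed for every box.\<close>

lemma arc_mext:
  assumes arc: "arc_at C p t" "0 < e0" "open V" "p t \<in> V"
    and jump: "\<And>s. \<bar>s - t\<bar> < e0 \<Longrightarrow> p s \<in> V \<Longrightarrow> has_jump \<Psi> p s G"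
    and N: "\<And>\<epsilon> U Up Um. arc_box p t \<epsilon> U Up Um \<Longrightarrow> U \<subseteq> V \<Longrightarrow> U - C = Up \<union> Um \<Longrightarrow> U \<inter> C = p ` {t-\<epsilon><..<t+\<epsilon>} \<Longrightarrow>
       \<exists>Np Nm. mholo U Np \<and> mholo U Nm \<and> (\<forall>z\<in>Up. N z = Np z) \<and> (\<forall>z\<in>Um. N z = Nm z) \<and> (\<forall>z\<in>U. G ** Np z = Nm z)"
  shows "mext_at C (\<lambda>z. \<Psi> z ** N z) (p t)"
proof -
  obtain \<epsilon> U Up Um where b: "arc_box p t \<epsilon> U Up Um" "\<epsilon> < e0" "U \<subseteq> V" "U - C = Up \<union> Um" "U \<inter> C = p ` {t-\<epsilon><..<t+\<epsilon>}"
    using arc unfolding arc_at_def by meson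
  obtain Np Nm where n: "mholo U Np" "mholo U Nm" "\<And>z. z \<in> Up \<Longrightarrow> N z = Np z" "\<And>z. z \<in> Um \<Longrightarrow> N z = Nm z"
    "\<And>z. z \<in> U \<Longrightarrow> G ** Np z = Nm z" using N[OF b(1,3,4,5)] by blast
  have I: "p s \<in> U" "\<bar>s - t\<bar> < e0" if "s \<in> {t-\<epsilon><..<t+\<epsilon>}" for s
    using that arc_boxD(8)[OF b(1)] b(2) by (auto simp: abs_less_iff)
  have j: "has_jump \<Psi> p s G" if "s \<in> {t-\<epsilon><..<t+\<epsilon>}" for s using I[OF that] b(3) by (intro jump) auto
  obtain A where A: "mholo U A" "\<And>z. z \<in> Up \<union> Um \<Longrightarrow> \<Psi> z ** N z = A z"
    by (rule arc_box_jump_extension[OF b(1) box_holo[OF b(4)] j n(1-4) n(5)[OF I(1)]]) blast+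
  have "p t \<in> U" using I(1)[of t] arc_boxD(1)[OF b(1)] by simp
  then show ?thesis unfolding mext_at_def using A arc_boxD(2)[OF b(1)] b(4) by blast
qed

text \<open>At a regular point the factor can be read off from the box: the identity on the left
  side and \<open>G\<close> on the right side.\<close>

lemma arc_reg:
  assumes arc: "arc_at C p t" "0 < e0" "open V" "p t \<in> V"
    and jump: "\<And>s. \<bar>s - t\<bar> < e0 \<Longrightarrow> p s \<in> V \<Longrightarrow> has_jump \<Psi> p s G" and G: "det G = 1"
  shows "reg (p t)"
proof -
  obtain \<epsilon> U Up Um where b: "arc_box p t \<epsilon> U Up Um" "\<epsilon> < e0" "U \<subseteq> V" "U - C = Up \<union> Um" "U \<inter> C = p ` {t-\<epsilon><..<t+\<epsilon>}"
    using arc unfolding arc_at_def by meson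
  define N where "N = (\<lambda>z. if z \<in> Up then mat 1 else G)"
  have dj: "z \<notin> Up" if "z \<in> Um" for z using arc_boxD(7)[OF b(1)] that by blast
  have I: "p s \<in> U" "\<bar>s - t\<bar> < e0" if "s \<in> {t-\<epsilon><..<t+\<epsilon>}" for s
    using that arc_boxD(8)[OF b(1)] b(2) by (auto simp: abs_less_iff)
  have j: "has_jump \<Psi> p s G" if "s \<in> {t-\<epsilon><..<t+\<epsilon>}" for s using I[OF that] b(3) by (intro jump) auto
  have n: "N z = mat 1" if "z \<in> Up" for z using that by (simp add: N_def)
  have n': "N z = G" if "z \<in> Um" for z using dj[OF that] by (simp add: N_def)
  obtain A where A: "mholo U A" "\<And>z. z \<in> Up \<union> Um \<Longrightarrow> \<Psi> z ** N z = A z"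
    by (rule arc_box_jump_extension[OF b(1) box_holo[OF b(4)] j mholo_const[of U "mat 1"] mholo_const[of U G] n n']) auto
  have pU: "p t \<in> U" using I(1)[of t] arc_boxD(1)[OF b(1)] by simp
  then have ext: "mext_at C (\<lambda>z. \<Psi> z ** N z) (p t)" unfolding mext_at_def using A arc_boxD(2)[OF b(1)] b(4) by blast
  have lc: "\<forall>\<^sub>F y in nhds z. N y = N z" if z: "z \<in> U - C" for z
  proof -
    consider "z \<in> Up" | "z \<in> Um" using z b(4) by blast
    then show ?thesis
    proof cases
      case 1
      then have "\<forall>\<^sub>F y in nhds z. y \<in> Up" using arc_boxD(3)[OF b(1)] by (intro eventually_nhds_in_open)
      then show ?thesis by eventually_elim (use 1 n in simp)
    next
      case 2
      then have "\<forall>\<^sub>F y in nhds z. y \<in> Um" using arc_boxD(4)[OF b(1)] by (intro eventually_nhds_in_open)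
      then show ?thesis by eventually_elim (use 2 n' in simp)
    qed
  qed
  have "det (N z) = 1" for z by (simp add: N_def G)
  from regular_extension[OF closed_C mholo_\<Psi> arc_boxD(2)[OF b(1)] pU lc this ext]
  show ?thesis unfolding reg_def by blast
qed

text \<open>Away from the circle the jump matrix of the arc is constant on an open set, the disc or
  the exterior of the closed disc, so boxes inside \<open>V\<close> see only one matrix.\<close>

lemma jump_ell_arc:
  assumes t: "t \<in> {0<..<1}" and nc: "ell \<Gamma> j t \<notin> circ a \<Gamma> j"
  defines "V \<equiv> if ell \<Gamma> j t \<in> disc a \<Gamma> j then disc a \<Gamma> j else - cball (sing a j) (rad \<Gamma> j)"
    and "G \<equiv> if ell \<Gamma> j t \<in> disc a \<Gamma> j then eM j else M j"
  shows "open V" "ell \<Gamma> j t \<in> V" "\<And>s. \<bar>s - t\<bar> < min t (1 - t) \<Longrightarrow> ell \<Gamma> j s \<in> V \<Longrightarrow> has_jump \<Psi> (ell \<Gamma> j) s G"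
proof -
  show "open V" unfolding V_def disc_def by auto
  show "ell \<Gamma> j t \<in> V" using nc unfolding V_def disc_def circ_def by auto
  fix s assume s: "\<bar>s - t\<bar> < min t (1 - t)" "ell \<Gamma> j s \<in> V"
  then have s01: "s \<in> {0<..<1}" using t by (auto simp: abs_less_iff)
  show "has_jump \<Psi> (ell \<Gamma> j) s G"
    using s(2) jump_outer[OF s01, of j] jump_inner[OF s01, of j] unfolding V_def G_def by (auto split: if_splits)
qed

lemma reg_ell:
  assumes t: "t \<in> {0<..<1}" and nc: "ell \<Gamma> j t \<notin> circ a \<Gamma> j" shows "reg (ell \<Gamma> j t)"
proof (rule arc_reg[OF arc_at_ell[OF t nc] _ jump_ell_arc[OF t nc]])
  show "0 < min t (1 - t)" using t by auto
qed (simp_all add: det_M)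

lemma reg_inf: assumes t: "t < 0" shows "reg (ell_inf \<Gamma> t)"
proof (rule arc_reg[OF arc_at_inf[OF t], of "-t" UNIV])
  show "has_jump \<Psi> (ell_inf \<Gamma>) s (M_inf \<delta>)" if "\<bar>s - t\<bar> < - t" for s
    using that by (intro jump_inf) (simp add: abs_less_iff)
  show "det (M_inf \<delta>) = 1" by (simp add: M_inf_def)
qed (use t in auto)

lemma jump_circ_arc: "circ_curve j s \<in> - ell_img \<Gamma> j \<Longrightarrow> has_jump \<Psi> (circ_curve j) s (E j)"
  using jump_circ[of j s] unfolding circ_curve_def by auto

lemma reg_circ: assumes "w \<in> circ a \<Gamma> j" "w \<notin> ell_img \<Gamma> j" shows "reg w"
proof -
  obtain t where t: "w = circ_curve j t" using circ_param[OF assms(1)] by blast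
  have "reg (circ_curve j t)"
    by (rule arc_reg[OF arc_at_circ, of j t 1 "- ell_img \<Gamma> j" "E j"])
       (use assms t jump_circ_arc det_E closed_ell in \<open>auto\<close>)
  then show ?thesis using t by simp
qed

text \<open>As \<open>N\<close> has finitely many values, the repaired function inherits the bound
  on \<open>\<Psi>\<close> near the node, and the isolated singularity that is left is
  removable.\<close>

lemma node_reg:
  assumes w: "w \<in> nodes a \<Gamma>" and V: "open V" "w \<in> V" and fin: "finite (range N)"
    and lc: "\<And>z. z \<in> V - C \<Longrightarrow> \<forall>\<^sub>F y in nhds z. N y = N z" and det: "\<And>z. z \<in> V - C \<Longrightarrow> det (N z) = 1"
    and ext: "\<And>z. z \<in> V \<Longrightarrow> z \<noteq> w \<Longrightarrow> mext_at C (\<lambda>z. \<Psi> z ** N z) z"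
  shows "reg w"
proof -
  have "ell_img \<Gamma> j \<subseteq> C" for j unfolding gamma_def by blast
  then have wC: "w \<in> C" using w base_in_ell unfolding nodes_def by blast
  obtain C0 where C0: "\<forall>\<^sub>F z in at w within - C. norm (\<Psi> z) \<le> C0" using rh_nodes w by blast
  obtain B where B: "\<And>z. norm (N z) \<le> B" using finite_imp_bounded[OF fin] unfolding bounded_iff by blast
  have nn: "norm (A $ i $ k) \<le> norm A" for A :: "complex^2^2" and i k
    using order_trans[OF Finite_Cartesian_Product.norm_nth_le Finite_Cartesian_Product.norm_nth_le] .
  have "ext_at C (\<lambda>z. (\<Psi> z ** N z) $ i $ k) w" for i k
  proof (rule ext_at_removable[OF interior_C wC V])
    fix z assume "z \<in> V - {w}"
    then show "ext_at C (\<lambda>z. (\<Psi> z ** N z) $ i $ k) z" using ext[of z] unfolding mext_at_iff by blast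
  next
    show "\<forall>\<^sub>F z in at w within - C. norm ((\<Psi> z ** N z) $ i $ k) \<le> C0 * B + C0 * B"
      using C0
    proof eventually_elim
      case (elim z)
      have "norm (\<Psi> z $ i $ l) \<le> C0" "norm (N z $ l $ k) \<le> B" for l
        using order_trans[OF nn elim] order_trans[OF nn B] by blast+
      moreover have "0 \<le> C0" using order_trans[OF norm_ge_zero elim] .
      ultimately have "norm (\<Psi> z $ i $ l * N z $ l $ k) \<le> C0 * B" for l
        unfolding norm_mult by (intro mult_mono) auto
      then show ?case unfolding mm2 by (intro order_trans[OF norm_triangle_ineq] add_mono)
    qed
  qed
  then have "mext_at C (\<lambda>z. \<Psi> z ** N z) w" unfolding mext_at_iff by blast
  from regular_extension[OF closed_C mholo_\<Psi> V lc det this] show ?thesis unfolding reg_def by blast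
qed

text \<open>Four sectors meet here, separated by the arc and the circle. The repairing factor is the
  product of a choice by inside or outside and a choice by left or right. It fits the circle by
  construction; that it fits the arc inside the disc is the identity \<open>adj_E_M\<close>.\<close>

lemma reg_node:
  assumes t0: "t0 \<in> {0<..<1}" and wc: "ell \<Gamma> j t0 \<in> circ a \<Gamma> j" shows "reg (ell \<Gamma> j t0)"
proof -
  let ?p = "ell \<Gamma> j" let ?w = "ell \<Gamma> j t0"
  let ?b = "disc a \<Gamma> j" let ?o = "- cball (sing a j) (rad \<Gamma> j)"
  define d0 where "d0 = min t0 (1 - t0)"
  have d0: "0 < d0" "{t0-d0<..<t0+d0} \<subseteq> {0<..<1}" using t0 by (auto simp: d0_def)
  obtain p' where p': "continuous_on {0<..<1} p'"
    "\<And>t. t \<in> {0<..<1} \<Longrightarrow> (ell \<Gamma> j has_vector_derivative p' t) (at t)" "\<And>t. t \<in> {0<..<1} \<Longrightarrow> p' t \<noteq> 0"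
    by (rule ell_deriv_at[of j]) blast
  obtain d where d: "0 < d" "d \<le> d0" "flat_arc ?p p' t0 d (p' t0)"
    using flat_arc_exists[OF d0(1) p'(2)[OF subsetD[OF d0(2)]] continuous_on_subset[OF p'(1) d0(2)] p'(3)[OF t0]] .
  interpret flat_arc ?p p' t0 d "p' t0" by (rule d(3))
  let ?R = "?p ` ({0..1} - {t0-d<..<t0+d}) \<union> (\<Union>k\<in>-{j}. ell_img \<Gamma> k) \<union> ell_inf_img \<Gamma> \<union> (\<Union>k\<in>-{j}. circ a \<Gamma> k)"
  have cR: "closed ?R"
    by (intro closed_Un closed_UN compact_imp_closed[OF compact_ell_minus] closed_ell closed_inf closed_circ) (auto simp: closed_ell closed_circ)
  have wR: "?w \<in> - ?R"
  proof -
    have "?w \<notin> ?p ` ({0..1} - {t0-d<..<t0+d})"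
    proof
      assume "?w \<in> ?p ` ({0..1} - {t0-d<..<t0+d})"
      then obtain s where "s \<in> {0..1} - {t0-d<..<t0+d}" "?p t0 = ?p s" by blast
      then show False using inj_onD[OF ell_inj, of j t0 s] t0 d by auto
    qed
    then show ?thesis using ell_param(4,5,6)[OF t0, where j = j] by blast
  qed
  obtain \<epsilon> U Up Um where b: "arc_box ?p t0 \<epsilon> U Up Um" "\<epsilon> < 1" "\<epsilon> < d" "U \<subseteq> - ?R"
    "U \<inter> ?p ` {t0-d<..<t0+d} = ?p ` {t0-\<epsilon><..<t0+\<epsilon>}"
    using arc_box_exists[OF open_Compl[OF cR] wR zero_less_one] .
  let ?I = "{t0-\<epsilon><..<t0+\<epsilon>}"
  have I01: "?I \<subseteq> {0<..<1}"
  proof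
    fix x assume "x \<in> ?I"
    then have "x \<in> {t0-d0<..<t0+d0}" using b(3) d(2) by auto
    then show "x \<in> {0<..<1}" using d0(2) by blast
  qed
  have Ue: "U \<inter> ell_img \<Gamma> j = ?p ` ?I"
  proof -
    have 1: "U \<inter> ell_img \<Gamma> j \<subseteq> ?p ` {t0-d<..<t0+d}" using b(4) unfolding ell_img_def[of _ j] by blast
    have "{t0-d<..<t0+d} \<subseteq> {0..1}"
    proof
      fix x assume "x \<in> {t0-d<..<t0+d}"
      then have "x \<in> {t0-d0<..<t0+d0}" using d(2) by auto
      then have "x \<in> {0<..<1}" using d0(2) by blast
      then show "x \<in> {0..1}" by auto
    qed
    then have "?p ` {t0-d<..<t0+d} \<subseteq> ell_img \<Gamma> j" unfolding ell_img_def by (rule image_mono)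
    with 1 have "U \<inter> ell_img \<Gamma> j = U \<inter> ?p ` {t0-d<..<t0+d}" by blast
    then show ?thesis using b(5) by (rule trans)
  qed
  have UC: "U \<inter> C \<subseteq> ?p ` ?I \<union> circ a \<Gamma> j"
  proof
    fix z assume z: "z \<in> U \<inter> C"
    then have zR: "z \<notin> ?R" using b(4) by blast
    consider k where "z \<in> ell_img \<Gamma> k" | "z \<in> ell_inf_img \<Gamma>" | k where "z \<in> circ a \<Gamma> k"
      using z unfolding gamma_def by blast
    then show "z \<in> ?p ` ?I \<union> circ a \<Gamma> j"
    proof cases
      case (1 k)
      then have "k = j" using zR by blast
      then show ?thesis using 1 z Ue by blast
    next
      case 2 then show ?thesis using zR by blast
    next
      case (3 k)
      then have "k = j" using zR by blast
      then show ?thesis using 3 by blast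
    qed
  qed
  have pC: "?p ` ?I \<subseteq> C" using Ue unfolding gamma_def by blast
  have cC: "circ a \<Gamma> j \<subseteq> C" unfolding gamma_def by blast
  note B = arc_boxD[OF b(1)]
  have wU: "?w \<in> U" using B(1,8) by auto
  define N where "N = (\<lambda>z. (if z \<in> ?b then adj2 (E j) else mat 1) ** (if z \<in> Up then mat 1 else M j))"
  have fin: "finite (range N)"
    by (rule finite_subset[of _ "{adj2 (E j) ** mat 1, adj2 (E j) ** M j, mat 1 ** mat 1, mat 1 ** M j}"]) (auto simp: N_def)
  have det: "det (N z) = 1" for z by (simp add: N_def det_mul det_E det_M)
  have bo: "?b \<inter> ?o = {}" "open ?b" "open ?o" unfolding disc_def by auto
  have split: "z \<in> ?b \<or> z \<in> ?o" if "z \<notin> circ a \<Gamma> j" for z using that unfolding disc_def circ_def by auto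
  have sides: "z \<in> Up \<or> z \<in> Um" if "z \<in> U" "z \<notin> ?p ` ?I" for z using that B(8) by blast
  have UpUm: "z \<notin> Up" if "z \<in> Um" for z using that B(7) by blast
  have lc: "\<forall>\<^sub>F y in nhds z. N y = N z" if z: "z \<in> U - C" for z
  proof -
    define A1 where "A1 = (if z \<in> ?b then ?b else ?o)"
    define A2 where "A2 = (if z \<in> Up then Up else Um)"
    have "z \<in> A1" "z \<in> A2" using z split[of z] sides[of z] cC pC by (auto simp: A1_def A2_def)
    moreover have "open A1" "open A2" using bo B(3,4) by (auto simp: A1_def A2_def)
    ultimately have "\<forall>\<^sub>F y in nhds z. y \<in> A1" "\<forall>\<^sub>F y in nhds z. y \<in> A2" by (auto intro: eventually_nhds_in_open)
    then show ?thesis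
    proof eventually_elim
      case (elim y)
      have "y \<in> ?b \<longleftrightarrow> z \<in> ?b" using elim(1) bo(1) unfolding A1_def by (auto split: if_splits)
      moreover have "y \<in> Up \<longleftrightarrow> z \<in> Up" using elim(2) UpUm unfolding A2_def by (auto split: if_splits)
      ultimately show ?case by (simp add: N_def)
    qed
  qed
  have ext: "mext_at C (\<lambda>z. \<Psi> z ** N z) z" if z: "z \<in> U" "z \<noteq> ?w" for z
  proof -
    consider "z \<notin> C" | s where "s \<in> ?I" "z = ?p s" | "z \<in> circ a \<Gamma> j" "z \<notin> ?p ` ?I" using z UC by blast
    then show ?thesis
    proof cases
      case 1 then show ?thesis using lc z by (intro mext_const) auto
    next
      case (2 s)
      have s01: "s \<in> {0<..<1}" using 2 I01 by blast
      \<comment> \<open>The arc and the circle have exactly one common point, and that is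
        \<open>?w\<close>.\<close>
      have zc: "?p s \<notin> circ a \<Gamma> j"
        using node[of j] wc ell_param(3)[OF t0, of j] ell_param(3)[OF s01, of j] z(2) 2(2) by blast
      note J = jump_ell_arc[OF s01 zc]
      let ?V = "if ?p s \<in> ?b then ?b else ?o" let ?G = "if ?p s \<in> ?b then eM j else M j"
      have "mext_at C (\<lambda>z. \<Psi> z ** N z) (?p s)"
      proof (rule arc_mext[OF arc_at_ell[OF s01 zc], of "min s (1 - s)" "?V \<inter> U" ?G])
        show "0 < min s (1 - s)" using s01 by auto
        show "open (?V \<inter> U)" using J(1) B(2) by auto
        show "?p s \<in> ?V \<inter> U" using J(2) z 2 by auto
        show "has_jump \<Psi> ?p s' ?G" if "\<bar>s' - s\<bar> < min s (1 - s)" "?p s' \<in> ?V \<inter> U" for s'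
          using J(3) that by blast
        fix \<epsilon>' U' Up' Um' assume b': "arc_box ?p s \<epsilon>' U' Up' Um'" "U' \<subseteq> ?V \<inter> U" "U' - C = Up' \<union> Um'"
        \<comment> \<open>The small box lies in the large one, so its sides are on the same sides of
          the arc, as the definition of \<open>N\<close> by \<open>Up\<close> requires.\<close>
        have sb: "Up' \<subseteq> Up" "Um' \<subseteq> Um"
          using sub_box[OF b(1) b'(1) 2(1)] b'(2,3) pC by blast+
        have in_b: "z \<in> ?b \<longleftrightarrow> ?p s \<in> ?b" if "z \<in> U'" for z using that b'(2) bo(1) by (auto split: if_splits)
        have U': "Up' \<subseteq> U'" "Um' \<subseteq> U'" using b'(3) by auto
        define X where "X = (if ?p s \<in> ?b then adj2 (E j) else mat 1)"
        have "\<forall>z\<in>Up'. N z = X" using sb(1) U' in_b unfolding N_def X_def by auto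
        moreover have "\<forall>z\<in>Um'. N z = X ** M j" using sb(2) U' in_b UpUm unfolding N_def X_def by (auto simp: subset_iff)
        moreover have "?G ** X = X ** M j" by (simp add: X_def adj_E_M)
        ultimately show "\<exists>Np Nm. mholo U' Np \<and> mholo U' Nm \<and> (\<forall>z\<in>Up'. N z = Np z) \<and> (\<forall>z\<in>Um'. N z = Nm z) \<and> (\<forall>z\<in>U'. ?G ** Np z = Nm z)"
          by (intro exI[of _ "\<lambda>_. X"] exI[of _ "\<lambda>_. X ** M j"] conjI mholo_const) auto
      qed
      then show ?thesis using 2 by simp
    next
      case 3
      obtain \<theta> where \<theta>: "z = circ_curve j \<theta>" using circ_param[OF 3(1)] by blast
      have zl: "circ_curve j \<theta> \<notin> ell_img \<Gamma> j" using 3(2) z(1) Ue \<theta> by blast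
      define V where "V = (if z \<in> Up then Up else Um)"
      have V: "open V" "z \<in> V" "V \<subseteq> U" using B(3,4,8) sides[OF z(1) 3(2)] by (auto simp: V_def)
      have "V \<subseteq> Up \<union> Um" by (simp add: V_def)
      moreover have "V \<inter> ell_img \<Gamma> j \<subseteq> ?p ` ?I" using V(3) Ue by blast
      ultimately have Vl: "V \<subseteq> - ell_img \<Gamma> j" using B(9) by blast
      have "mext_at C (\<lambda>z. \<Psi> z ** N z) (circ_curve j \<theta>)"
      proof (rule arc_mext[OF arc_at_circ[OF zl], of 1 V "E j"])
        show "circ_curve j \<theta> \<in> V" using V \<theta> by simp
        show "has_jump \<Psi> (circ_curve j) s (E j)" if "circ_curve j s \<in> V" for s
          using that Vl by (intro jump_circ_arc) blast
        fix \<epsilon>' U' Up' Um' assume b': "arc_box (circ_curve j) \<theta> \<epsilon>' U' Up' Um'" "U' \<subseteq> V" "U' - C = Up' \<union> Um'"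
        note cs = circ_box_sides[OF b'(1,3)]
        have U': "Up' \<subseteq> V" "Um' \<subseteq> V" using b'(2,3) by auto
        have inV: "y \<in> Up \<longleftrightarrow> z \<in> Up" if "y \<in> V" for y using that UpUm by (auto simp: V_def split: if_splits)
        define X where "X = (if z \<in> Up then mat 1 else M j)"
        have "\<forall>y\<in>Up'. N y = adj2 (E j) ** X" using cs(1) U' inV unfolding N_def X_def by (auto simp: subset_iff)
        moreover have "\<forall>y\<in>Um'. N y = X" using cs(2) U' inV bo(1) unfolding N_def X_def by (auto simp: subset_iff)
        moreover have "E j ** (adj2 (E j) ** X) = X" by (simp add: matrix_mul_assoc adj2_inverse(1)[OF det_E])
        ultimately show "\<exists>Np Nm. mholo U' Np \<and> mholo U' Nm \<and> (\<forall>z\<in>Up'. N z = Np z) \<and> (\<forall>z\<in>Um'. N z = Nm z) \<and> (\<forall>z\<in>U'. E j ** Np z = Nm z)"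
          by (intro exI[of _ "\<lambda>_. adj2 (E j) ** X"] exI[of _ "\<lambda>_. X"] conjI mholo_const) auto
      qed (use V in auto)
      then show ?thesis using \<theta> by simp
    qed
  qed
  have "?w \<in> nodes a \<Gamma>" using wc ell_param(3)[OF t0] unfolding nodes_def by blast
  then show ?thesis by (rule node_reg[OF _ B(2) wU fin lc det ext])
qed

end

section \<open>Logarithms on circles around a point and jumps along normals\<close>

lemma rcis_neq:
  assumes "0 < r" "\<theta>0 < \<theta>" "\<theta> < \<theta>0 + 2 * pi"
  shows "b + rcis r \<theta> \<noteq> b + rcis r \<theta>0"
proof
  assume "b + rcis r \<theta> = b + rcis r \<theta>0"
  then have "cis \<theta> = cis \<theta>0" using assms(1) by (simp add: rcis_def)
  then have "exp (\<i> * of_real \<theta>) = exp (\<i> * of_real \<theta>0)" by (simp add: cis_conv_exp)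
  then obtain n :: int where "\<i> * of_real \<theta> = \<i> * of_real \<theta>0 + (of_int (2 * n) * pi) * \<i>" using exp_eq by blast
  then have n: "\<theta> = \<theta>0 + 2 * of_int n * pi" by (auto simp: complex_eq_iff)
  with assms have 1: "0 < real_of_int n * pi" "real_of_int n * pi < 1 * pi" by (auto simp: mult.commute)
  then have "0 < real_of_int n" "real_of_int n < 1"
    using pi_gt_zero by (auto simp: zero_less_mult_iff mult_less_cancel_right)
  then have "0 < n" "n < 1" by simp_all
  then show False by linarith
qed

lemma rcis_param:
  assumes "z \<in> sphere b r"
  obtains \<theta> where "t \<le> \<theta>" "\<theta> < t + 2 * pi" "z = b + rcis r \<theta>"
proof -
  define u where "u = (z - b) * cis (- t)"
  have nu: "norm u = r" using assms by (simp add: u_def norm_mult dist_norm norm_minus_commute)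
  have A: "0 \<le> Arg2pi u" "Arg2pi u < 2 * pi" "u = of_real r * exp (\<i> * of_real (Arg2pi u))"
    using Arg2pi[of u] unfolding is_Arg_def nu by auto
  have "u * cis t = z - b" by (simp add: u_def mult.assoc cis_mult)
  then have "z - b = of_real r * (cis (Arg2pi u) * cis t)"
    using A(3) by (metis (no_types) cis_conv_exp mult.assoc)
  then have "z = b + rcis r (t + Arg2pi u)" by (simp add: rcis_def cis_mult algebra_simps)
  then show ?thesis using A(1,2) by (intro that[of "t + Arg2pi u"]) auto
qed

lemma rcis_shift: "rcis r (\<theta> + 2 * pi) = rcis r \<theta>"
  by (simp add: rcis_def complex_eq_iff)

text \<open>Since \<open>\<sigma>\<close> is an integer, the exponential does not depend on the
  choice of the argument; \<open>Arg\<close> can be replaced by the angle that runs once around from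
  the slit at \<open>w\<close>.\<close>

lemma log_on_sphere:
  assumes r: "0 < r" and cont: "continuous_on (sphere b r - {w}) h" and w: "w = b + rcis r t"
    and exp: "\<And>z. z \<in> sphere b r - {w} \<Longrightarrow> exp (h z) = k * exp (\<i> * of_real \<sigma> * of_real (Arg (z - b)))"
    and \<sigma>: "\<sigma> \<in> \<int>"
  obtains c where "\<And>\<theta>. t < \<theta> \<Longrightarrow> \<theta> < t + 2 * pi \<Longrightarrow> h (b + rcis r \<theta>) = c + \<i> * of_real (\<sigma> * \<theta>)"
proof -
  obtain n :: int where n: "\<sigma> = of_int n" using \<sigma> Ints_cases by blast
  have "exp (h (b + rcis r \<theta>)) = k * exp (\<i> * of_real (\<sigma> * \<theta>))" if "b + rcis r \<theta> \<noteq> b + rcis r t" for \<theta>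
  proof -
    have "b + rcis r \<theta> \<in> sphere b r - {w}" using that r w by (auto simp: dist_norm)
    from exp[OF this] have "exp (h (b + rcis r \<theta>)) = k * exp (\<i> * of_real \<sigma> * of_real (Arg (rcis r \<theta>)))" by simp
    moreover have "exp (\<i> * of_real \<sigma> * of_real (Arg (rcis r \<theta>))) = exp (\<i> * of_real (Arg (rcis r \<theta>))) powi n"
      by (simp add: n exp_power_int mult_ac)
    moreover have "exp (\<i> * of_real (Arg (rcis r \<theta>))) = cis \<theta>"
    proof -
      have "rcis r (Arg (rcis r \<theta>)) = rcis r \<theta>" using rcis_cmod_Arg[of "rcis r \<theta>"] r by simp
      then show ?thesis using r by (simp add: rcis_def flip: cis_conv_exp)
    qed
    moreover have "cis \<theta> powi n = exp (\<i> * of_real (\<sigma> * \<theta>))" by (simp add: n cis_conv_exp exp_power_int mult_ac)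
    ultimately show ?thesis by simp
  qed
  from log_on_circle[OF r cont[unfolded w] this] show ?thesis using that by blast
qed

text \<open>\<open>F\<close> is locally constant off \<open>C\<close>. A point moved radially a
  little keeps its value, so every value on one circle persists on nearby circles; with the same
  finite number of values on all circles, the set of values is locally constant in the
  radius.\<close>

lemma sphere_values_const:
  fixes F :: "complex \<Rightarrow> complex"
  assumes C: "closed C" and cont: "continuous_on (ball b R - C - {b}) F"
    and exp: "\<And>z. z \<in> ball b R - C - {b} \<Longrightarrow> exp (F z) = 1"
    and V: "\<And>r. r \<in> {0<..<R} \<Longrightarrow> finite (F ` (sphere b r - C)) \<and> card (F ` (sphere b r - C)) = n"
    and r: "r \<in> {0<..<R}" "r' \<in> {0<..<R}"
  shows "F ` (sphere b r - C) = F ` (sphere b r' - C)"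
proof (rule connected_local_const[of "{0<..<R}"])
  show "connected {0<..<R}" by (intro convex_connected convex_real_interval)
  show "\<forall>r\<in>{0<..<R}. \<forall>\<^sub>F r' in at r within {0<..<R}. F ` (sphere b r - C) = F ` (sphere b r' - C)"
  proof
    fix r assume r: "r \<in> {0<..<R}"
    let ?W = "ball b R - C - {b}"
    have oW: "open ?W" using C by (intro open_delete open_Diff open_ball)
    have "\<forall>v\<in>F ` (sphere b r - C). \<forall>\<^sub>F r' in at r within {0<..<R}. v \<in> F ` (sphere b r' - C)"
    proof
      fix v assume "v \<in> F ` (sphere b r - C)"
      then obtain z where z: "z \<in> sphere b r - C" "v = F z" by blast
      then have zW: "z \<in> ?W" using r by auto
      then obtain e where e: "e > 0" "ball z e \<subseteq> ?W" using oW open_contains_ball by blast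
      obtain c where c: "\<And>x. x \<in> ball z e \<Longrightarrow> F x = c"
        using continuous_exp_constant[OF connected_ball continuous_on_subset[OF cont e(2)] exp[OF subsetD[OF e(2)]]] by blast
      have cv: "c = v" using c[of z] e z by simp
      have "((\<lambda>r'. b + of_real (r' / r) * (z - b)) \<longlongrightarrow> b + of_real (r / r) * (z - b)) (at r within {0<..<R})"
        using r by (intro tendsto_intros) auto
      then have "((\<lambda>r'. b + of_real (r' / r) * (z - b)) \<longlongrightarrow> z) (at r within {0<..<R})" using r by simp
      then have "\<forall>\<^sub>F r' in at r within {0<..<R}. b + of_real (r' / r) * (z - b) \<in> ball z e"
        using e(1) by (intro topological_tendstoD) auto
      moreover have "\<forall>\<^sub>F r' in at r within {0<..<R}. r' \<in> {0<..<R}" by (simp add: eventually_at_filter)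
      ultimately show "\<forall>\<^sub>F r' in at r within {0<..<R}. v \<in> F ` (sphere b r' - C)"
      proof eventually_elim
        case (elim r')
        let ?z = "b + of_real (r' / r) * (z - b)"
        have nz: "norm (z - b) = r" using z(1) by (simp add: dist_norm norm_minus_commute)
        have "norm (?z - b) = r'" using elim(2) r nz by (simp add: norm_mult norm_divide)
        then have "?z \<in> sphere b r'" by (simp add: dist_norm norm_minus_commute)
        moreover have "?z \<notin> C" using elim(1) e(2) by blast
        moreover have "F ?z = v" using c[OF elim(1)] cv by simp
        ultimately show ?case by (metis DiffI image_eqI)
      qed
    qed
    then have "\<forall>\<^sub>F r' in at r within {0<..<R}. \<forall>v\<in>F ` (sphere b r - C). v \<in> F ` (sphere b r' - C)"
      using V[OF r] by (intro eventually_ball_finite) auto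
    moreover have "\<forall>\<^sub>F r' in at r within {0<..<R}. r' \<in> {0<..<R}" by (simp add: eventually_at_filter)
    ultimately show "\<forall>\<^sub>F r' in at r within {0<..<R}. F ` (sphere b r - C) = F ` (sphere b r' - C)"
    proof eventually_elim
      case (elim r')
      show ?case using elim(1) V[OF r] V[OF elim(2)] by (intro card_subset_eq) auto
    qed
  qed
qed (use r in auto)

text \<open>A jump measured along one normal only, as the limit of a difference. It is additive,
  vanishes for continuous functions and detects the difference of constants on the two sides, which
  is all that comparing branches takes.\<close>

definition normal_jump :: "complex \<Rightarrow> complex \<Rightarrow> (complex \<Rightarrow> complex) \<Rightarrow> complex \<Rightarrow> bool" where
  "normal_jump w v f c \<longleftrightarrow> ((\<lambda>h. f (w + \<i> * of_real h * v) - f (w - \<i> * of_real h * v)) \<longlongrightarrow> c) (at_right 0)"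

lemma normal_jump_add: "normal_jump w v f c \<Longrightarrow> normal_jump w v g d \<Longrightarrow> normal_jump w v (\<lambda>z. f z + g z) (c + d)"
  unfolding normal_jump_def by (drule(1) tendsto_add) (simp add: algebra_simps)

lemma normal_jump_mult: "normal_jump w v f c \<Longrightarrow> normal_jump w v (\<lambda>z. k * f z) (k * c)"
  unfolding normal_jump_def by (drule tendsto_mult_left[of _ _ _ k]) (simp add: algebra_simps)

lemma normal_lim:
  "((\<lambda>h. w + \<i> * of_real h * v) \<longlongrightarrow> w) (at_right 0)" "((\<lambda>h. w - \<i> * of_real h * v) \<longlongrightarrow> w) (at_right 0)"
proof -
  have "((\<lambda>h. w + \<i> * of_real h * v) \<longlongrightarrow> w + \<i> * of_real 0 * v) (at_right 0)"
    "((\<lambda>h. w - \<i> * of_real h * v) \<longlongrightarrow> w - \<i> * of_real 0 * v) (at_right 0)"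
    by (intro tendsto_intros)+
  then show "((\<lambda>h. w + \<i> * of_real h * v) \<longlongrightarrow> w) (at_right 0)" "((\<lambda>h. w - \<i> * of_real h * v) \<longlongrightarrow> w) (at_right 0)"
    by simp_all
qed

lemma normal_jump_cont: assumes "isCont f w" shows "normal_jump w v f 0"
  unfolding normal_jump_def
  using tendsto_diff[OF isCont_tendsto_compose[OF assms normal_lim(1)] isCont_tendsto_compose[OF assms normal_lim(2)]] by simp

lemma normal_jump_unique: "normal_jump w v f c \<Longrightarrow> normal_jump w v f d \<Longrightarrow> c = d"
  unfolding normal_jump_def by (rule tendsto_unique[OF trivial_limit_at_right_real])

lemma normal_jump_box:
  assumes box: "arc_box p t0 \<epsilon> U Up Um" and t: "t \<in> {t0-\<epsilon><..<t0+\<epsilon>}" and g: "isCont g (p t)"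
    and c: "\<And>z. z \<in> Up \<Longrightarrow> f z = g z + c" and d: "\<And>z. z \<in> Um \<Longrightarrow> f z = g z + d"
  shows "normal_jump (p t) (vector_derivative p (at t)) f (c - d)"
proof -
  let ?v = "vector_derivative p (at t)"
  have "((\<lambda>h. (g (p t + \<i> * of_real h * ?v) - g (p t - \<i> * of_real h * ?v)) + (c - d)) \<longlongrightarrow> 0 + (c - d)) (at_right 0)"
    using normal_jump_cont[OF g] unfolding normal_jump_def by (intro tendsto_add tendsto_const)
  moreover have "\<forall>\<^sub>F h in at_right 0. (g (p t + \<i> * of_real h * ?v) - g (p t - \<i> * of_real h * ?v)) + (c - d) =
      f (p t + \<i> * of_real h * ?v) - f (p t - \<i> * of_real h * ?v)"
    using arc_box_normal[OF box t refl] by eventually_elim (simp add: c d)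
  ultimately show ?thesis unfolding normal_jump_def by (simp add: Lim_transform_eventually)
qed

section \<open>Logarithms cut along the arcs of the graph\<close>

context heun_graph
begin

text \<open>A branch of the logarithm of \<open>(sing a j - z) / (b0 - z)\<close>, defined on the
  whole complement of the arc.\<close>

definition \<Lambda> :: "3 \<Rightarrow> complex \<Rightarrow> complex" where
  "\<Lambda> j z = 2 * of_real pi * \<i> * winding_number (ell \<Gamma> j) z"

text \<open>The last piece of \<open>ell_inf\<close>, reparametrized by the unit interval: a compact
  path, as winding numbers require, that agrees with the arc near the base point.\<close>

definition inf_arc :: "real \<Rightarrow> complex" where "inf_arc = (\<lambda>x. ell_inf \<Gamma> (x - 1))"

definition \<Lambda>i :: "complex \<Rightarrow> complex" where
  "\<Lambda>i z = 2 * of_real pi * \<i> * winding_number inf_arc z"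

abbreviation "inf_end \<equiv> ell_inf \<Gamma> (- 1)"

lemma inf_arc_C1: obtains p' where "continuous_on {0..1} p'"
  "\<And>t. t \<in> {0..1} \<Longrightarrow> (inf_arc has_vector_derivative p' t) (at t within {0..1})"
  "\<And>t. t \<in> {0..1} \<Longrightarrow> p' t \<noteq> 0"
proof -
  obtain p' where p': "continuous_on {..0} p'"
    "\<And>t. t \<in> {..0} \<Longrightarrow> (ell_inf \<Gamma> has_vector_derivative p' t) (at t within {..0})" "\<And>t. t \<in> {..0} \<Longrightarrow> p' t \<noteq> 0"
    by (rule inf_deriv) blast
  show ?thesis
  proof (rule that[of "\<lambda>t. p' (t - 1)"])
    show "continuous_on {0..1} (\<lambda>t. p' (t - 1))"
      by (intro continuous_on_compose2[OF p'(1)] continuous_intros) auto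
    fix t :: real assume t: "t \<in> {0..1}"
    have "((\<lambda>t. t - 1) has_vector_derivative 1) (at t within {0..1})" by (auto intro!: derivative_eq_intros)
    moreover have "(ell_inf \<Gamma> has_vector_derivative p' (t - 1)) (at (t - 1) within (\<lambda>t. t - 1) ` {0..1})"
      using t by (intro has_vector_derivative_within_subset[OF p'(2)]) auto
    ultimately show "(inf_arc has_vector_derivative p' (t - 1)) (at t within {0..1})"
      using vector_diff_chain_within unfolding inf_arc_def o_def by fastforce
    show "p' (t - 1) \<noteq> 0" using t p'(3) by auto
  qed
qed

lemma inf_arc_valid: "valid_path inf_arc"
  by (rule inf_arc_C1) (rule valid_pathI_C1)

lemma inf_arc_inj: "inj_on inf_arc {0..1}"
  unfolding inf_arc_def by (rule inj_onI) (use inj_onD[OF inf_inj] in fastforce)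

lemma inf_arc_image: "path_image inf_arc = ell_inf \<Gamma> ` {-1..0}"
proof -
  have "(\<lambda>x. x - 1) ` {0..1} = {-1..0::real}"
  proof (intro equalityI subsetI)
    fix x :: real assume "x \<in> {-1..0}" then show "x \<in> (\<lambda>x. x - 1) ` {0..1}" by (intro image_eqI[of _ _ "x + 1"]) auto
  qed auto
  then show ?thesis unfolding path_image_def inf_arc_def by (metis image_image)
qed

lemma inf_arc_sub: "path_image inf_arc \<subseteq> ell_inf_img \<Gamma>"
  unfolding inf_arc_image ell_inf_img_def by (intro image_mono) auto

lemma exp_\<Lambda>: "z \<notin> ell_img \<Gamma> j \<Longrightarrow> exp (\<Lambda> j z) = (sing a j - z) / (b0 - z)"
proof -
  assume z: "z \<notin> ell_img \<Gamma> j"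
  then have "b0 - z \<noteq> 0" using base_in_ell by auto
  then show ?thesis using winding_number_exp_2pi[OF ell_path(1), of z j] z unfolding ell_path \<Lambda>_def by (simp add: field_simps)
qed

lemma exp_\<Lambda>i: "z \<notin> ell_inf_img \<Gamma> \<Longrightarrow> exp (\<Lambda>i z) = (b0 - z) / (inf_end - z)"
proof -
  assume z: "z \<notin> ell_inf_img \<Gamma>"
  then have 1: "z \<notin> path_image inf_arc" using inf_arc_sub by blast
  have "inf_end \<in> ell_inf_img \<Gamma>" by (simp add: ell_inf_img_def)
  then have "inf_end - z \<noteq> 0" using z by auto
  moreover have "pathfinish inf_arc = b0" "pathstart inf_arc = inf_end"
    by (simp_all add: inf_arc_def pathfinish_def pathstart_def inf_0)
  ultimately show ?thesis using winding_number_exp_2pi[OF valid_path_imp_path[OF inf_arc_valid] 1] unfolding \<Lambda>i_def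
    by (simp add: field_simps)
qed

lemma cont_\<Lambda>: "continuous_on (- ell_img \<Gamma> j) (\<Lambda> j)"
  unfolding \<Lambda>_def using continuous_on_winding_number[OF ell_path(1), of j] unfolding ell_path by (intro continuous_intros)

lemma cont_\<Lambda>i: "continuous_on (- path_image inf_arc) \<Lambda>i"
  unfolding \<Lambda>i_def using continuous_on_winding_number[OF valid_path_imp_path[OF inf_arc_valid]] by (intro continuous_intros)

lemma isCont_\<Lambda>: "w \<notin> ell_img \<Gamma> j \<Longrightarrow> isCont (\<Lambda> j) w"
  using cont_\<Lambda>[of j] open_Compl[OF closed_ell[of j]] by (simp add: continuous_on_eq_continuous_at)

lemma isCont_\<Lambda>i: "w \<notin> ell_inf_img \<Gamma> \<Longrightarrow> isCont \<Lambda>i w"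
  using cont_\<Lambda>i open_Compl[OF closed_path_image[OF valid_path_imp_path[OF inf_arc_valid]]] inf_arc_sub
  by (auto simp: continuous_on_eq_continuous_at)

lemma winding_jump:
  assumes q: "valid_path q" "inj_on q {0..1}" and t: "t \<in> {0<..<1}"
    and p': "continuous_on {0<..<1} p'" "\<And>s. s \<in> {0<..<1} \<Longrightarrow> (q has_vector_derivative p' s) (at s)" "p' t \<noteq> 0"
  shows "normal_jump (q t) (p' t) (\<lambda>z. 2 * of_real pi * \<i> * winding_number q z) (2 * of_real pi * \<i>)"
proof -
  define d0 where "d0 = min t (1 - t)"
  have d0: "0 < d0" "{t-d0<..<t+d0} \<subseteq> {0<..<1}" using t by (auto simp: d0_def)
  obtain d where d: "0 < d" "d \<le> d0" "flat_arc q p' t d (p' t)"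
    using flat_arc_exists[OF d0(1) p'(2)[OF subsetD[OF d0(2)]] continuous_on_subset[OF p'(1) d0(2)] p'(3)] .
  have "normal_jump (q t) (p' t) (winding_number q) 1"
    unfolding normal_jump_def by (rule flat_arc.winding_number_jump_1[OF d(3) q t])
  from normal_jump_mult[OF this, of "2 * of_real pi * \<i>"] show ?thesis by simp
qed

lemma \<Lambda>_jump:
  assumes t: "t \<in> {0<..<1}"
  shows "normal_jump (ell \<Gamma> j t) (vector_derivative (ell \<Gamma> j) (at t)) (\<Lambda> j) (2 * of_real pi * \<i>)"
proof -
  obtain p' where p': "continuous_on {0<..<1} p'"
    "\<And>t. t \<in> {0<..<1} \<Longrightarrow> (ell \<Gamma> j has_vector_derivative p' t) (at t)" "\<And>t. t \<in> {0<..<1} \<Longrightarrow> p' t \<noteq> 0"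
    by (rule ell_deriv_at[of j]) blast
  show ?thesis
    using winding_jump[OF ell_valid ell_inj t p'(1,2) p'(3)[OF t]] unfolding vector_derivative_at[OF p'(2)[OF t]] \<Lambda>_def[abs_def] .
qed

lemma \<Lambda>i_jump:
  assumes t: "t \<in> {-1<..<0}"
  shows "normal_jump (ell_inf \<Gamma> t) (vector_derivative (ell_inf \<Gamma>) (at t)) \<Lambda>i (2 * of_real pi * \<i>)"
proof -
  obtain q' where q': "continuous_on {..<0} q'"
    "\<And>t. t < 0 \<Longrightarrow> (ell_inf \<Gamma> has_vector_derivative q' t) (at t)" "\<And>t. t < 0 \<Longrightarrow> q' t \<noteq> 0"
    by (rule inf_deriv_at) blast
  define p' where "p' = (\<lambda>s. q' (s - 1))"
  have t1: "t + 1 \<in> {0<..<1}" using t by auto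
  have "continuous_on {0<..<1} p'" unfolding p'_def by (intro continuous_on_compose2[OF q'(1)] continuous_intros) auto
  moreover have "(inf_arc has_vector_derivative p' s) (at s)" if s: "s \<in> {0<..<1}" for s
  proof -
    have "((\<lambda>t. t - 1) has_vector_derivative 1) (at s)" by (auto intro!: derivative_eq_intros)
    moreover have "(ell_inf \<Gamma> has_vector_derivative p' s) (at (s - 1))" unfolding p'_def using s by (intro q'(2)) auto
    ultimately have "(ell_inf \<Gamma> \<circ> (\<lambda>t. t - 1) has_vector_derivative 1 *\<^sub>R p' s) (at s)" by (rule vector_diff_chain_at)
    then show ?thesis unfolding inf_arc_def o_def by simp
  qed
  moreover have "p' (t + 1) \<noteq> 0" unfolding p'_def using q'(3)[of t] t by simp
  ultimately have "normal_jump (inf_arc (t + 1)) (p' (t + 1)) \<Lambda>i (2 * of_real pi * \<i>)"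
    unfolding \<Lambda>i_def[abs_def] by (intro winding_jump[OF inf_arc_valid inf_arc_inj t1])
  moreover have "vector_derivative (ell_inf \<Gamma>) (at t) = q' t" using t by (intro vector_derivative_at q'(2)) auto
  ultimately show ?thesis by (simp add: inf_arc_def p'_def)
qed

lemma ell_sphere_base: obtains r0 where "0 < r0" "\<And>r. 0 < r \<Longrightarrow> r < r0 \<Longrightarrow> \<exists>w. ell_img \<Gamma> j \<inter> sphere b0 r = {w}"
proof -
  obtain p' where p': "continuous_on {0..1} p'"
    "\<And>t. t \<in> {0..1} \<Longrightarrow> (ell \<Gamma> j has_vector_derivative p' t) (at t within {0..1})" "\<And>t. t \<in> {0..1} \<Longrightarrow> p' t \<noteq> 0"
    by (rule ell_deriv[of j]) blast
  obtain r0 where "0 < r0" "\<And>r. 0 < r \<Longrightarrow> r < r0 \<Longrightarrow> \<exists>w. ell \<Gamma> j ` {0..1} \<inter> sphere (ell \<Gamma> j 0) r = {w}"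
    by (rule small_circles_meet_arc_once[OF ell_inj p'(2,1) p'(3)[of 0]]) auto
  then show ?thesis using that unfolding ell_0 ell_img_def by blast
qed

text \<open>Reversal turns the final point into the starting point, for which small circles have
  been treated.\<close>

lemma reverse_C1:
  assumes p': "continuous_on {0..1} p'" "\<And>t. t \<in> {0..1} \<Longrightarrow> (p has_vector_derivative p' t) (at t within {0..1})"
    "\<And>t. t \<in> {0..1} \<Longrightarrow> p' t \<noteq> (0::complex)" and inj: "inj_on p {0..1}"
  shows "\<exists>r0>0. \<forall>r. 0 < r \<and> r < r0 \<longrightarrow> (\<exists>w. p ` {0..1} \<inter> sphere (p 1) r = {w})"
proof -
  have im: "(\<lambda>s. 1 - s) ` {0..1} = {0..1::real}"
  proof (intro equalityI subsetI)
    fix x :: real assume "x \<in> {0..1}" then show "x \<in> (\<lambda>s. 1 - s) ` {0..1}" by (intro image_eqI[of _ _ "1 - x"]) auto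
  qed auto
  have "((\<lambda>s. p (1 - s)) has_vector_derivative - p' (1 - s)) (at s within {0..1})" if s: "s \<in> {0..1}" for s
  proof -
    have "((\<lambda>s. 1 - s) has_vector_derivative (-1)) (at s within {0..1})" by (auto intro!: derivative_eq_intros)
    moreover have "(p has_vector_derivative p' (1 - s)) (at (1 - s) within (\<lambda>s. 1 - s) ` {0..1})"
      unfolding im using s by (intro p'(2)) auto
    ultimately have "(p \<circ> (\<lambda>s. 1 - s) has_vector_derivative (-1) *\<^sub>R p' (1 - s)) (at s within {0..1})"
      by (rule vector_diff_chain_within)
    then show ?thesis unfolding o_def by simp
  qed
  moreover have "continuous_on {0..1} (\<lambda>s. - p' (1 - s))"
    by (intro continuous_intros continuous_on_compose2[OF p'(1)]) auto
  moreover have "inj_on (\<lambda>s. p (1 - s)) {0..1}"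
    by (rule inj_onI) (use inj_onD[OF inj] in fastforce)
  moreover have "- p' (1 - 0) \<noteq> 0" using p'(3)[of 1] by simp
  ultimately obtain r0 where "0 < r0" "\<And>r. 0 < r \<Longrightarrow> r < r0 \<Longrightarrow> \<exists>w. (\<lambda>s. p (1 - s)) ` {0..1} \<inter> sphere (p (1 - 0)) r = {w}"
    using small_circles_meet_arc_once[of "\<lambda>s. p (1 - s)" "\<lambda>s. - p' (1 - s)"] by blast
  moreover have "(\<lambda>s. p (1 - s)) ` {0..1} = p ` {0..1}" using im by (metis image_image)
  ultimately show ?thesis by (intro exI[of _ r0]) simp
qed

lemma ell_sphere_sing: obtains r0 where "0 < r0" "\<And>r. 0 < r \<Longrightarrow> r < r0 \<Longrightarrow> \<exists>w. ell_img \<Gamma> j \<inter> sphere (sing a j) r = {w}"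
proof -
  obtain p' where p': "continuous_on {0..1} p'"
    "\<And>t. t \<in> {0..1} \<Longrightarrow> (ell \<Gamma> j has_vector_derivative p' t) (at t within {0..1})" "\<And>t. t \<in> {0..1} \<Longrightarrow> p' t \<noteq> 0"
    by (rule ell_deriv[of j]) blast
  show ?thesis using reverse_C1[OF p' ell_inj] that unfolding ell_1 ell_img_def by blast
qed

text \<open>The portion of the arc with parameters up to -1 is closed and misses the base point, so
  close to it only the compact piece counts.\<close>

lemma inf_sphere_base: obtains r0 where "0 < r0" "\<And>r. 0 < r \<Longrightarrow> r < r0 \<Longrightarrow> \<exists>w. ell_inf_img \<Gamma> \<inter> sphere b0 r = {w}"
  "ball b0 r0 \<inter> ell_inf \<Gamma> ` {..-1} = {}"
proof -
  obtain p' where p': "continuous_on {0..1} p'"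
    "\<And>t. t \<in> {0..1} \<Longrightarrow> (inf_arc has_vector_derivative p' t) (at t within {0..1})"
    "\<And>t. t \<in> {0..1} \<Longrightarrow> p' t \<noteq> 0" by (rule inf_arc_C1) blast
  obtain r0 where r0: "0 < r0" "\<And>r. 0 < r \<Longrightarrow> r < r0 \<Longrightarrow> \<exists>w. inf_arc ` {0..1} \<inter> sphere (inf_arc 1) r = {w}"
    using reverse_C1[OF p' inf_arc_inj] by blast
  have b: "inf_arc 1 = b0" by (simp add: inf_arc_def inf_0)
  have "open (- ell_inf \<Gamma> ` {..-1})" by (intro open_Compl closed_inf_image) auto
  moreover have "b0 \<in> - ell_inf \<Gamma> ` {..-1}"
  proof
    assume "b0 \<in> ell_inf \<Gamma> ` {..-1}"
    then obtain t where "t \<le> -1" "ell_inf \<Gamma> 0 = ell_inf \<Gamma> t" using inf_0 by auto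
    then show False using inj_onD[OF inf_inj, of 0 t] by auto
  qed
  ultimately obtain e where e: "e > 0" "ball b0 e \<subseteq> - ell_inf \<Gamma> ` {..-1}" using open_contains_ball by blast
  have im: "ell_inf_img \<Gamma> = inf_arc ` {0..1} \<union> ell_inf \<Gamma> ` {..-1}"
  proof -
    have "{..0} = {-1..0} \<union> {..-1::real}" by auto
    then show ?thesis using inf_arc_image unfolding path_image_def ell_inf_img_def by (metis image_Un)
  qed
  show ?thesis
  proof (rule that[of "min r0 e"])
    fix r assume r: "0 < r" "r < min r0 e"
    then have "sphere b0 r \<subseteq> ball b0 e" by auto
    then have "ell_inf_img \<Gamma> \<inter> sphere b0 r = inf_arc ` {0..1} \<inter> sphere b0 r" using e(2) unfolding im by blast
    then show "\<exists>w. ell_inf_img \<Gamma> \<inter> sphere b0 r = {w}" using r0(2)[of r] r unfolding b by simp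
  next
    have "ball b0 (min r0 e) \<subseteq> ball b0 e" by (rule subset_ball) simp
    then show "ball b0 (min r0 e) \<inter> ell_inf \<Gamma> ` {..-1} = {}" using e(2) by blast
  qed (use r0 e in auto)
qed

end

subsection \<open>The base point\<close>

lemma box_points:
  assumes "arc_box p t \<epsilon> U Up Um" shows "Up \<noteq> {}" "Um \<noteq> {}"
proof -
  have t: "t \<in> {t-\<epsilon><..<t+\<epsilon>}" using arc_boxD(1)[OF assms] by simp
  show "Up \<noteq> {}" using eventually_happens'[OF _ arc_box_normal(1)[OF assms t refl]] by auto
  show "Um \<noteq> {}" using eventually_happens'[OF _ arc_box_normal(2)[OF assms t refl]] by auto
qed

lemma exp_of_nat_power: "exp (of_nat n * x) = exp (x::complex) ^ n"
  by (rule exp_of_nat_mult)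

context heun_graph
begin

lemma C_disc: "disc a \<Gamma> j \<inter> C \<subseteq> ell_img \<Gamma> j"
proof
  fix z assume z: "z \<in> disc a \<Gamma> j \<inter> C"
  then have zc: "z \<in> cball (sing a j) (rad \<Gamma> j)" unfolding disc_def by auto
  have zn: "z \<notin> circ a \<Gamma> j" using z unfolding disc_def circ_def by auto
  consider k where "z \<in> ell_img \<Gamma> k" | "z \<in> ell_inf_img \<Gamma>" | k where "z \<in> circ a \<Gamma> k" using z unfolding gamma_def by blast
  then show "z \<in> ell_img \<Gamma> j"
  proof cases
    case (1 k)
    then show ?thesis using ell_not_in_cball[of j k] zc by (cases "j = k") auto
  next
    case 2 then show ?thesis using inf_not_in_cball[of j] zc by auto
  next
    case (3 k)
    then have "z \<in> cball (sing a k) (rad \<Gamma> k)" unfolding circ_def by auto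
    then show ?thesis using cball_Int[of j k] zc zn 3 by (cases "j = k") auto
  qed
qed

lemma circ_sub_cball: "circ a \<Gamma> j \<subseteq> cball (sing a j) (rad \<Gamma> j)" unfolding circ_def by auto

lemma b0_in_C: "b0 \<in> C" using base_in_inf unfolding gamma_def by blast

end

context heun_rh
begin

text \<open>The sectors are numbered by the locally constant function \<open>F\<close>: up to a
  constant and in units of 2 pi i, its values are 0, 1, 3, 7 in counterclockwise order starting
  behind \<open>ell_inf\<close>. The repairing factor in a sector is the inverse of the product of
  the jumps met on the way from sector 0; the cyclic relation closes the circle across
  \<open>ell_inf\<close>.\<close>

lemma reg_base: "reg b0"
proof -
  have "\<forall>j. \<exists>r0>0. \<forall>r. 0 < r \<and> r < r0 \<longrightarrow> (\<exists>w. ell_img \<Gamma> j \<inter> sphere b0 r = {w})"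
  proof
    fix j show "\<exists>r0>0. \<forall>r. 0 < r \<and> r < r0 \<longrightarrow> (\<exists>w. ell_img \<Gamma> j \<inter> sphere b0 r = {w})"
      by (rule ell_sphere_base[of j]) blast
  qed
  then obtain rr where rr: "\<And>j. 0 < rr j" "\<And>j r. 0 < r \<Longrightarrow> r < rr j \<Longrightarrow> \<exists>w. ell_img \<Gamma> j \<inter> sphere b0 r = {w}" by metis
  have "\<exists>r0>0. (\<forall>r. 0 < r \<and> r < r0 \<longrightarrow> (\<exists>w. ell_inf_img \<Gamma> \<inter> sphere b0 r = {w})) \<and> ball b0 r0 \<inter> ell_inf \<Gamma> ` {..-1} = {}"
    by (rule inf_sphere_base) blast
  then obtain ri where ri: "0 < ri" "\<And>r. 0 < r \<Longrightarrow> r < ri \<Longrightarrow> \<exists>w. ell_inf_img \<Gamma> \<inter> sphere b0 r = {w}"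
    "ball b0 ri \<inter> ell_inf \<Gamma> ` {..-1} = {}" by metis
  obtain rc where rc: "0 < rc" "\<forall>r>0. r < rc \<longrightarrow> (\<forall>w\<^sub>1\<in>ell_img \<Gamma> 1 \<inter> sphere b0 r. \<forall>w\<^sub>2\<in>ell_img \<Gamma> 2 \<inter> sphere b0 r.
        \<forall>w\<^sub>3\<in>ell_img \<Gamma> 3 \<inter> sphere b0 r. \<forall>w\<^sub>4\<in>ell_inf_img \<Gamma> \<inter> sphere b0 r.
          \<exists>t\<^sub>1 t\<^sub>2 t\<^sub>3 t\<^sub>4. t\<^sub>1 < t\<^sub>2 \<and> t\<^sub>2 < t\<^sub>3 \<and> t\<^sub>3 < t\<^sub>4 \<and> t\<^sub>4 < t\<^sub>1 + 2 * pi \<and>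
            w\<^sub>1 = b0 + rcis r t\<^sub>1 \<and> w\<^sub>2 = b0 + rcis r t\<^sub>2 \<and> w\<^sub>3 = b0 + rcis r t\<^sub>3 \<and> w\<^sub>4 = b0 + rcis r t\<^sub>4)"
    using ccw[unfolded counterclockwise_at_def eventually_at_right_field] by (elim exE conjE) (rule that)
  have "open (- (\<Union>j. cball (sing a j) (rad \<Gamma> j)))" by (intro open_Compl closed_UN) auto
  moreover have "b0 \<in> - (\<Union>j. cball (sing a j) (rad \<Gamma> j))" using base_cball by blast
  ultimately obtain rb where rb: "0 < rb" "ball b0 rb \<subseteq> - (\<Union>j. cball (sing a j) (rad \<Gamma> j))" by (rule openE)
  \<comment> \<open>Within this radius every circle around the base point meets each arc once and in
    the prescribed cyclic order, the closed discs are absent, and of \<open>ell_inf\<close> only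
    parameters above -1 occur.\<close>
  define R where "R = min (min (rr 1) (min (rr 2) (rr 3))) (min ri (min rc rb))"
  have R: "0 < R" "R \<le> rr 1" "R \<le> rr 2" "R \<le> rr 3" "R \<le> ri" "R \<le> rc" "R \<le> rb"
    using rr(1) ri(1) rc(1) rb(1) by (auto simp: R_def)
  have nocball: "z \<notin> cball (sing a j) (rad \<Gamma> j)" if "z \<in> ball b0 R" for z j
    using subsetD[OF subset_ball[OF R(7)] that] rb(2) by blast
  have noinf: "z \<notin> ell_inf \<Gamma> ` {..-1}" if "z \<in> ball b0 R" for z
    using subsetD[OF subset_ball[OF R(5)] that] ri(3) by blast
  have "\<exists>g. g holomorphic_on ball b0 R \<and> (\<forall>z\<in>ball b0 R. exp (g z) = sing a j - z)" for j
  proof -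
    have ne: "sing a j - z \<noteq> 0" if "z \<in> ball b0 R" for z
      using nocball[OF that, of j] rad_pos[of j] by auto
    have "(\<lambda>z. sing a j - z) holomorphic_on ball b0 R" by (intro holomorphic_intros)
    from log_on_ball[OF this ne] show ?thesis by metis
  qed
  then obtain l where l: "\<And>j. l j holomorphic_on ball b0 R" "\<And>j z. z \<in> ball b0 R \<Longrightarrow> exp (l j z) = sing a j - z" by metis
  have "\<exists>g. g holomorphic_on ball b0 R \<and> (\<forall>z\<in>ball b0 R. exp (g z) = inf_end - z)"
  proof -
    have ne: "inf_end - z \<noteq> 0" if "z \<in> ball b0 R" for z using noinf[OF that] by auto
    have "(\<lambda>z. inf_end - z) holomorphic_on ball b0 R" by (intro holomorphic_intros)
    from log_on_ball[OF this ne] show ?thesis by metis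
  qed
  then obtain li where li: "li holomorphic_on ball b0 R" "\<And>z. z \<in> ball b0 R \<Longrightarrow> exp (li z) = inf_end - z" by metis
  \<comment> \<open>\<open>A j\<close> is a branch of \<open>- log (b0 - z)\<close> cut along
    \<open>ell j\<close>, and \<open>Ai\<close> one of \<open>log (b0 - z)\<close> cut along
    \<open>ell_inf\<close>; the factors belonging to the other end points are removed by logarithms
    holomorphic in the ball.\<close>
  define A where "A = (\<lambda>j z. \<Lambda> j z + - l j z)"
  define Ai where "Ai = (\<lambda>z. \<Lambda>i z + li z)"
  \<comment> \<open>Since \<open>1 + 2 + 4 = 7\<close>, the powers of \<open>b0 - z\<close> cancel
    and \<open>exp F\<close> is 1. With these weights each of the jumps 1, 2, 4 and 7 is the
    difference of only one pair among the values 0, 1, 3, 7, so the jump alone identifies the two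
    sectors; equal weights would leave this ambiguous.\<close>
  define F where "F = (\<lambda>z. ((A 1 z + 2 * A 2 z) + 4 * A 3 z) + 7 * Ai z)"
  let ?W = "ball b0 R - C - {b0}"
  have subC: "ell_img \<Gamma> j \<subseteq> C" "ell_inf_img \<Gamma> \<subseteq> C" for j unfolding gamma_def by blast+
  have expA: "exp (A j z) = 1 / (b0 - z)" if "z \<in> ball b0 R" "z \<notin> ell_img \<Gamma> j" for j z
  proof -
    have "sing a j - z \<noteq> 0" using l(2)[OF that(1), of j] by (metis exp_not_eq_zero)
    moreover have "exp (A j z) = exp (\<Lambda> j z) * inverse (exp (l j z))" unfolding A_def exp_add exp_minus ..
    ultimately show ?thesis unfolding exp_\<Lambda>[OF that(2)] l(2)[OF that(1)] by (simp add: divide_inverse)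
  qed
  have expAi: "exp (Ai z) = b0 - z" if "z \<in> ball b0 R" "z \<notin> ell_inf_img \<Gamma>" for z
  proof -
    have "inf_end - z \<noteq> 0" using li(2)[OF that(1)] by (metis exp_not_eq_zero)
    moreover have "exp (Ai z) = exp (\<Lambda>i z) * exp (li z)" unfolding Ai_def exp_add ..
    ultimately show ?thesis unfolding exp_\<Lambda>i[OF that(2)] li(2)[OF that(1)] by (simp add: divide_inverse)
  qed
  have cl: "continuous_on S (l j)" "continuous_on S li" if "S \<subseteq> ball b0 R" for S j
    using l(1) li(1) that holomorphic_on_imp_continuous_on continuous_on_subset by metis+
  have contA: "continuous_on S (A j)" if "S \<subseteq> ball b0 R" "S \<inter> ell_img \<Gamma> j = {}" for S j
    unfolding A_def using that by (intro continuous_intros cl continuous_on_subset[OF cont_\<Lambda>]) auto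
  have contAi: "continuous_on S Ai" if "S \<subseteq> ball b0 R" "S \<inter> ell_inf_img \<Gamma> = {}" for S
    unfolding Ai_def using that inf_arc_sub by (intro continuous_intros cl continuous_on_subset[OF cont_\<Lambda>i]) auto
  have contF: "continuous_on ?W F"
    unfolding F_def using subC by (intro continuous_intros contA contAi) auto
  have expF: "exp (F z) = 1" if z: "z \<in> ?W" for z
  proof -
    have zs: "z \<in> ball b0 R" "z \<notin> ell_img \<Gamma> j" "z \<notin> ell_inf_img \<Gamma>" "z \<noteq> b0" for j using z subC by auto
    define d where "d = b0 - z"
    have d: "d \<noteq> 0" using zs(4) by (simp add: d_def)
    have "exp (F z) = exp (A 1 z) * exp (of_nat 2 * A 2 z) * exp (of_nat 4 * A 3 z) * exp (of_nat 7 * Ai z)"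
      unfolding F_def exp_add of_nat_numeral ..
    also have "\<dots> = (1 / d) * (1 / d) ^ 2 * (1 / d) ^ 4 * d ^ 7"
      unfolding exp_of_nat_power expA[OF zs(1,2)] expAi[OF zs(1,3)] d_def ..
    also have "\<dots> = 1" using d by (simp add: field_simps flip: power_add power_Suc)
    finally show ?thesis .
  qed
  \<comment> \<open>On a single circle the angles make everything explicit, but \<open>K\<close> may
    still depend on \<open>r\<close>; \<open>sphere_values_const\<close> removes this dependence
    afterwards.\<close>
  have V: "\<exists>K. F ` (sphere b0 r - C) = (\<lambda>d. K + 2 * of_real pi * \<i> * d) ` {0, 1, 3, 7}" if r: "r \<in> {0<..<R}" for r
  proof -
    have r0: "0 < r" "r < R" using r by auto
    have sb: "sphere b0 r \<subseteq> ball b0 R" using r0 by auto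
    obtain w1 where w1: "ell_img \<Gamma> 1 \<inter> sphere b0 r = {w1}" using rr(2)[of r 1] r0 R by auto
    obtain w2 where w2: "ell_img \<Gamma> 2 \<inter> sphere b0 r = {w2}" using rr(2)[of r 2] r0 R by auto
    obtain w3 where w3: "ell_img \<Gamma> 3 \<inter> sphere b0 r = {w3}" using rr(2)[of r 3] r0 R by auto
    obtain w4 where w4: "ell_inf_img \<Gamma> \<inter> sphere b0 r = {w4}" using ri(2)[of r] r0 R by auto
    have "r < rc" using r0 R by simp
    then obtain t1 t2 t3 t4 where t: "t1 < t2" "t2 < t3" "t3 < t4" "t4 < t1 + 2 * pi"
      and tw: "w1 = b0 + rcis r t1" "w2 = b0 + rcis r t2" "w3 = b0 + rcis r t3" "w4 = b0 + rcis r t4"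
    proof -
      have "w1 \<in> ell_img \<Gamma> 1 \<inter> sphere b0 r" "w2 \<in> ell_img \<Gamma> 2 \<inter> sphere b0 r"
        "w3 \<in> ell_img \<Gamma> 3 \<inter> sphere b0 r" "w4 \<in> ell_inf_img \<Gamma> \<inter> sphere b0 r" unfolding w1 w2 w3 w4 by simp_all
      from rc(2)[rule_format, OF r0(1) \<open>r < rc\<close> this] show ?thesis using that by blast
    qed
    have Arg: "z - b0 = of_real r * exp (\<i> * of_real (Arg (z - b0)))" if "z \<in> sphere b0 r" for z
      using rcis_cmod_Arg[of "z - b0"] that by (simp add: rcis_def dist_norm norm_minus_commute cis_conv_exp)
    have HA: "\<exists>c. \<forall>\<theta>. t < \<theta> \<longrightarrow> \<theta> < t + 2 * pi \<longrightarrow> A j (b0 + rcis r \<theta>) = c - \<i> * of_real \<theta>"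
      if w: "ell_img \<Gamma> j \<inter> sphere b0 r = {w}" "w = b0 + rcis r t" for j w t
    proof -
      have c: "continuous_on (sphere b0 r - {w}) (A j)" using sb w(1) by (intro contA) auto
      have "exp (A j z) = (- 1 / of_real r) * exp (\<i> * of_real (-1) * of_real (Arg (z - b0)))" if z: "z \<in> sphere b0 r - {w}" for z
      proof -
        have "exp (A j z) = 1 / (b0 - z)" using z w(1) sb by (intro expA) auto
        also have "b0 - z = - (of_real r * exp (\<i> * of_real (Arg (z - b0))))" using Arg[of z] z by (simp add: algebra_simps)
        finally show ?thesis by (simp add: exp_minus field_simps)
      qed
      from log_on_sphere[OF r0(1) c w(2) this] obtain c where
        "\<And>\<theta>. t < \<theta> \<Longrightarrow> \<theta> < t + 2 * pi \<Longrightarrow> A j (b0 + rcis r \<theta>) = c + \<i> * of_real ((-1) * \<theta>)" by auto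
      then show ?thesis by (intro exI[of _ c]) simp
    qed
    have HAi: "\<exists>c. \<forall>\<theta>. t4 < \<theta> \<longrightarrow> \<theta> < t4 + 2 * pi \<longrightarrow> Ai (b0 + rcis r \<theta>) = c + \<i> * of_real \<theta>"
    proof -
      have c: "continuous_on (sphere b0 r - {w4}) Ai" using sb w4 by (intro contAi) auto
      have "exp (Ai z) = (- of_real r) * exp (\<i> * of_real 1 * of_real (Arg (z - b0)))" if z: "z \<in> sphere b0 r - {w4}" for z
      proof -
        have "exp (Ai z) = b0 - z" using z w4 sb by (intro expAi) auto
        also have "b0 - z = - (of_real r * exp (\<i> * of_real (Arg (z - b0))))" using Arg[of z] z by (simp add: algebra_simps)
        finally show ?thesis by simp
      qed
      from log_on_sphere[OF r0(1) c tw(4) this] obtain c where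
        "\<And>\<theta>. t4 < \<theta> \<Longrightarrow> \<theta> < t4 + 2 * pi \<Longrightarrow> Ai (b0 + rcis r \<theta>) = c + \<i> * of_real (1 * \<theta>)" by auto
      then show ?thesis by (intro exI[of _ c]) simp
    qed
    obtain c1 where c1: "\<And>\<theta>. t1 < \<theta> \<Longrightarrow> \<theta> < t1 + 2 * pi \<Longrightarrow> A 1 (b0 + rcis r \<theta>) = c1 - \<i> * of_real \<theta>" using HA[OF w1 tw(1)] by blast
    obtain c2 where c2: "\<And>\<theta>. t2 < \<theta> \<Longrightarrow> \<theta> < t2 + 2 * pi \<Longrightarrow> A 2 (b0 + rcis r \<theta>) = c2 - \<i> * of_real \<theta>" using HA[OF w2 tw(2)] by blast
    obtain c3 where c3: "\<And>\<theta>. t3 < \<theta> \<Longrightarrow> \<theta> < t3 + 2 * pi \<Longrightarrow> A 3 (b0 + rcis r \<theta>) = c3 - \<i> * of_real \<theta>" using HA[OF w3 tw(3)] by blast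
    obtain c4 where c4: "\<And>\<theta>. t4 < \<theta> \<Longrightarrow> \<theta> < t4 + 2 * pi \<Longrightarrow> Ai (b0 + rcis r \<theta>) = c4 + \<i> * of_real \<theta>" using HAi by blast
    define K where "K = c1 + 2 * c2 + 4 * c3 + 7 * c4"
    \<comment> \<open>Angles run from \<open>t1\<close> to \<open>t1 + 2 * pi\<close>. Before the
      slit of a branch is passed, its formula applies to the angle increased by
      \<open>2 * pi\<close>.\<close>
    have s2: "A 2 (b0 + rcis r \<theta>) = c2 - \<i> * of_real (\<theta> + 2 * pi)" if "t2 < \<theta> + 2 * pi" "\<theta> < t2" for \<theta>
      using c2[of "\<theta> + 2 * pi"] that unfolding rcis_shift by simp
    have s3: "A 3 (b0 + rcis r \<theta>) = c3 - \<i> * of_real (\<theta> + 2 * pi)" if "t3 < \<theta> + 2 * pi" "\<theta> < t3" for \<theta>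
      using c3[of "\<theta> + 2 * pi"] that unfolding rcis_shift by simp
    have s4: "Ai (b0 + rcis r \<theta>) = c4 + \<i> * of_real (\<theta> + 2 * pi)" if "t4 < \<theta> + 2 * pi" "\<theta> < t4" for \<theta>
      using c4[of "\<theta> + 2 * pi"] that unfolding rcis_shift by simp
    have v1: "F (b0 + rcis r \<theta>) = K + 2 * of_real pi * \<i> * 1" if "t1 < \<theta>" "\<theta> < t2" for \<theta>
    proof -
      have e1: "A 1 (b0 + rcis r \<theta>) = c1 - \<i> * of_real \<theta>"
        by (rule c1) (use t that in linarith)+
      have e2: "A 2 (b0 + rcis r \<theta>) = c2 - \<i> * of_real (\<theta> + 2 * pi)"
        by (rule s2) (use t that in linarith)+
      have e3: "A 3 (b0 + rcis r \<theta>) = c3 - \<i> * of_real (\<theta> + 2 * pi)"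
        by (rule s3) (use t that in linarith)+
      have e4: "Ai (b0 + rcis r \<theta>) = c4 + \<i> * of_real (\<theta> + 2 * pi)"
        by (rule s4) (use t that in linarith)+
      show ?thesis unfolding F_def e1 e2 e3 e4 K_def by (simp add: algebra_simps)
    qed
    have v3: "F (b0 + rcis r \<theta>) = K + 2 * of_real pi * \<i> * 3" if "t2 < \<theta>" "\<theta> < t3" for \<theta>
    proof -
      have e1: "A 1 (b0 + rcis r \<theta>) = c1 - \<i> * of_real \<theta>"
        by (rule c1) (use t that in linarith)+
      have e2: "A 2 (b0 + rcis r \<theta>) = c2 - \<i> * of_real \<theta>"
        by (rule c2) (use t that in linarith)+
      have e3: "A 3 (b0 + rcis r \<theta>) = c3 - \<i> * of_real (\<theta> + 2 * pi)"
        by (rule s3) (use t that in linarith)+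
      have e4: "Ai (b0 + rcis r \<theta>) = c4 + \<i> * of_real (\<theta> + 2 * pi)"
        by (rule s4) (use t that in linarith)+
      show ?thesis unfolding F_def e1 e2 e3 e4 K_def by (simp add: algebra_simps)
    qed
    have v7: "F (b0 + rcis r \<theta>) = K + 2 * of_real pi * \<i> * 7" if "t3 < \<theta>" "\<theta> < t4" for \<theta>
    proof -
      have e1: "A 1 (b0 + rcis r \<theta>) = c1 - \<i> * of_real \<theta>"
        by (rule c1) (use t that in linarith)+
      have e2: "A 2 (b0 + rcis r \<theta>) = c2 - \<i> * of_real \<theta>"
        by (rule c2) (use t that in linarith)+
      have e3: "A 3 (b0 + rcis r \<theta>) = c3 - \<i> * of_real \<theta>"
        by (rule c3) (use t that in linarith)+
      have e4: "Ai (b0 + rcis r \<theta>) = c4 + \<i> * of_real (\<theta> + 2 * pi)"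
        by (rule s4) (use t that in linarith)+
      show ?thesis unfolding F_def e1 e2 e3 e4 K_def by (simp add: algebra_simps)
    qed
    have v0: "F (b0 + rcis r \<theta>) = K + 2 * of_real pi * \<i> * 0" if "t4 < \<theta>" "\<theta> < t1 + 2 * pi" for \<theta>
    proof -
      have e1: "A 1 (b0 + rcis r \<theta>) = c1 - \<i> * of_real \<theta>"
        by (rule c1) (use t that in linarith)+
      have e2: "A 2 (b0 + rcis r \<theta>) = c2 - \<i> * of_real \<theta>"
        by (rule c2) (use t that in linarith)+
      have e3: "A 3 (b0 + rcis r \<theta>) = c3 - \<i> * of_real \<theta>"
        by (rule c3) (use t that in linarith)+
      have e4: "Ai (b0 + rcis r \<theta>) = c4 + \<i> * of_real \<theta>"
        by (rule c4) (use t that in linarith)+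
      show ?thesis unfolding F_def e1 e2 e3 e4 K_def by (simp add: algebra_simps)
    qed
    have sC: "sphere b0 r \<inter> C \<subseteq> {w1, w2, w3, w4}"
    proof
      fix z assume z: "z \<in> sphere b0 r \<inter> C"
      then have "z \<notin> circ a \<Gamma> j" for j using nocball[of z j] sb circ_sub_cball[of j] by blast
      then consider j where "z \<in> ell_img \<Gamma> j" | "z \<in> ell_inf_img \<Gamma>" using z unfolding gamma_def by blast
      then show "z \<in> {w1, w2, w3, w4}"
      proof cases
        case (1 j)
        then show ?thesis using exhaust_3[of j] w1 w2 w3 z by blast
      next
        case 2 then show ?thesis using w4 z by blast
      qed
    qed
    have wC: "w1 \<in> C" "w2 \<in> C" "w3 \<in> C" "w4 \<in> C" using w1 w2 w3 w4 subC by blast+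
    have neq: "b0 + rcis r \<theta> \<noteq> b0 + rcis r s" if "\<theta> \<noteq> s" "\<bar>\<theta> - s\<bar> < 2 * pi" for \<theta> s
    proof (cases "\<theta> < s")
      case True then show ?thesis using rcis_neq[OF r0(1), of \<theta> s b0] that by force
    next
      case False then show ?thesis using rcis_neq[OF r0(1), of s \<theta> b0] that by force
    qed
    have off: "b0 + rcis r \<theta> \<in> sphere b0 r - C" if "t1 < \<theta>" "\<theta> < t1 + 2 * pi" "\<theta> \<notin> {t2, t3, t4}" for \<theta>
    proof -
      have "b0 + rcis r \<theta> \<in> sphere b0 r" using r0 by (simp add: dist_norm)
      moreover have "b0 + rcis r \<theta> \<notin> {w1, w2, w3, w4}"
        unfolding tw using neq[of \<theta> t1] neq[of \<theta> t2] neq[of \<theta> t3] neq[of \<theta> t4] that t by (auto simp: abs_less_iff)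
      ultimately show ?thesis using sC by blast
    qed
    have "F ` (sphere b0 r - C) = (\<lambda>d. K + 2 * of_real pi * \<i> * d) ` {0, 1, 3, 7}"
    proof (intro equalityI subsetI)
      fix y assume "y \<in> F ` (sphere b0 r - C)"
      then obtain z where z: "z \<in> sphere b0 r" "z \<notin> C" "y = F z" by blast
      obtain \<theta> where th: "t1 \<le> \<theta>" "\<theta> < t1 + 2 * pi" "z = b0 + rcis r \<theta>" using rcis_param[OF z(1), of t1] by blast
      have "\<theta> \<notin> {t1, t2, t3, t4}" using z(2) wC th(3) tw by auto
      then consider "t1 < \<theta>" "\<theta> < t2" | "t2 < \<theta>" "\<theta> < t3" | "t3 < \<theta>" "\<theta> < t4" | "t4 < \<theta>" using th(1) by force
      then show "y \<in> (\<lambda>d. K + 2 * of_real pi * \<i> * d) ` {0, 1, 3, 7}"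
      proof cases
        case 1 from v1[OF this] show ?thesis unfolding z(3) th(3) by blast
      next
        case 2 from v3[OF this] show ?thesis unfolding z(3) th(3) by blast
      next
        case 3 from v7[OF this] show ?thesis unfolding z(3) th(3) by blast
      next
        case 4 from v0[OF this th(2)] show ?thesis unfolding z(3) th(3) by blast
      qed
    next
      have in_img: "F (b0 + rcis r \<theta>) \<in> F ` (sphere b0 r - C)" if "t1 < \<theta>" "\<theta> < t1 + 2 * pi" "\<theta> \<notin> {t2, t3, t4}" for \<theta>
        using off[OF that] by (rule imageI)
      have m1: "K + 2 * of_real pi * \<i> * 1 \<in> F ` (sphere b0 r - C)"
        using in_img[of "(t1 + t2) / 2"] v1[of "(t1 + t2) / 2"] t by simp
      have m3: "K + 2 * of_real pi * \<i> * 3 \<in> F ` (sphere b0 r - C)"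
        using in_img[of "(t2 + t3) / 2"] v3[of "(t2 + t3) / 2"] t by simp
      have m7: "K + 2 * of_real pi * \<i> * 7 \<in> F ` (sphere b0 r - C)"
        using in_img[of "(t3 + t4) / 2"] v7[of "(t3 + t4) / 2"] t by simp
      have m0: "K + 2 * of_real pi * \<i> * 0 \<in> F ` (sphere b0 r - C)"
        using in_img[of "(t4 + (t1 + 2 * pi)) / 2"] v0[of "(t4 + (t1 + 2 * pi)) / 2"] t by simp
      fix y assume "y \<in> (\<lambda>d. K + 2 * of_real pi * \<i> * d) ` {0, 1, 3, 7}"
      then show "y \<in> F ` (sphere b0 r - C)" using m0 m1 m3 m7 by blast
    qed
    then show ?thesis by blast
  qed
  have Vcard: "finite (F ` (sphere b0 r - C)) \<and> card (F ` (sphere b0 r - C)) = 4" if r: "r \<in> {0<..<R}" for r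
  proof -
    obtain K where K: "F ` (sphere b0 r - C) = (\<lambda>d. K + 2 * of_real pi * \<i> * d) ` {0, 1, 3, 7}" using V[OF r] by blast
    have "inj_on (\<lambda>d. K + 2 * of_real pi * \<i> * d) {0, 1, 3, 7}" by (auto simp: inj_on_def)
    then show ?thesis unfolding K by (simp only: card_image finite_imageI) simp
  qed
  have half: "R / 2 \<in> {0<..<R}" using R(1) by simp
  obtain K where K: "F ` (sphere b0 (R/2) - C) = (\<lambda>d. K + 2 * of_real pi * \<i> * d) ` {0, 1, 3, 7}" using V[OF half] by blast
  define m where "m = (\<lambda>z. (F z - K) / (2 * of_real pi * \<i>))"
  have mval: "m z \<in> {0, 1, 3, 7}" if z: "z \<in> ?W" for z
  proof -
    have r: "dist b0 z \<in> {0<..<R}" using z by auto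
    have "F z \<in> F ` (sphere b0 (dist b0 z) - C)" using z by auto
    then have "F z \<in> (\<lambda>d. K + 2 * of_real pi * \<i> * d) ` {0, 1, 3, 7}"
      using sphere_values_const[OF closed_C contF expF Vcard r half] K by simp
    then obtain d where d: "d \<in> {0, 1, 3, 7}" "F z = K + 2 * of_real pi * \<i> * d" by blast
    then have "m z = d" by (simp add: m_def)
    then show ?thesis using d(1) by simp
  qed
  \<comment> \<open>Inverses of the products of the jumps, in the order in which the arcs are
    crossed counterclockwise from the sector with number 0.\<close>
  define Nf where "Nf = (\<lambda>d::complex. if d = 1 then adj2 (M 1) else if d = 3 then adj2 (M 1 ** M 2)
      else if d = 7 then adj2 (M 1 ** M 2 ** M 3) else mat 1)"
  define N where "N = (\<lambda>z. Nf (m z))"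
  have Nf: "Nf 0 = mat 1" "Nf 1 = adj2 (M 1)" "Nf 3 = adj2 (M 1 ** M 2)" "Nf 7 = adj2 (M 1 ** M 2 ** M 3)" by (simp_all add: Nf_def)
  have detN: "det (N z) = 1" for z by (simp add: N_def Nf_def det_mul det_M)
  have fin: "finite (range N)"
    by (rule finite_subset[of _ "{adj2 (M 1), adj2 (M 1 ** M 2), adj2 (M 1 ** M 2 ** M 3), mat 1}"]) (auto simp: N_def Nf_def)
  have oW: "open ?W" using closed_C by (intro open_delete open_Diff open_ball)
  have lc: "\<forall>\<^sub>F y in nhds z. N y = N z" if z: "z \<in> ball b0 R - C" for z
  proof -
    have zW: "z \<in> ?W" using z b0_in_C by auto
    then obtain e where e: "e > 0" "ball z e \<subseteq> ?W" using oW open_contains_ball by blast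
    obtain c where c: "\<And>x. x \<in> ball z e \<Longrightarrow> F x = c"
      using continuous_exp_constant[OF connected_ball continuous_on_subset[OF contF e(2)] expF[OF subsetD[OF e(2)]]] by blast
    have "\<forall>\<^sub>F y in nhds z. y \<in> ball z e" using e(1) by (intro eventually_nhds_in_open) auto
    then show ?thesis
    proof eventually_elim
      case (elim y)
      have "F y = F z" using c[OF elim] c[of z] e(1) by simp
      then show ?case unfolding N_def m_def by simp
    qed
  qed
  \<comment> \<open>On each side of a small box \<open>F\<close> is constant, so its jump is the
    difference of two sector numbers; \<open>alg\<close> turns this into the matching condition for
    the factors.\<close>
  have arc_case: "mext_at C (\<lambda>z. \<Psi> z ** N z) (p t)"
    if arc: "arc_at C p t" "0 < e0" and pt: "p t \<in> ball b0 R - {b0}"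
      and jump: "\<And>s. \<bar>s - t\<bar> < e0 \<Longrightarrow> p s \<in> ball b0 R - {b0} \<Longrightarrow> has_jump \<Psi> p s G"
      and nj: "normal_jump (p t) (vector_derivative p (at t)) F (2 * of_real pi * \<i> * wt)"
      and alg: "\<And>u d. u \<in> {0,1,3,7} \<Longrightarrow> d \<in> {0,1,3,7} \<Longrightarrow> u - d = wt \<Longrightarrow> G ** Nf u = Nf d"
    for p t e0 G wt
  proof (rule arc_mext[OF arc(1,2) open_delete[OF open_ball] pt jump])
    fix \<epsilon> U Up Um assume b: "arc_box p t \<epsilon> U Up Um" "U \<subseteq> ball b0 R - {b0}" "U - C = Up \<union> Um"
    have sub: "Up \<subseteq> ?W" "Um \<subseteq> ?W" using b(2,3) by blast+
    obtain cu where cu: "\<And>x. x \<in> Up \<Longrightarrow> F x = cu"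
      using continuous_exp_constant[OF arc_boxD(5)[OF b(1)] continuous_on_subset[OF contF sub(1)] expF[OF subsetD[OF sub(1)]]] by blast
    obtain cd where cd: "\<And>x. x \<in> Um \<Longrightarrow> F x = cd"
      using continuous_exp_constant[OF arc_boxD(6)[OF b(1)] continuous_on_subset[OF contF sub(2)] expF[OF subsetD[OF sub(2)]]] by blast
    obtain zu zd where z: "zu \<in> Up" "zd \<in> Um" using box_points[OF b(1)] by blast
    have tI: "t \<in> {t-\<epsilon><..<t+\<epsilon>}" using arc_boxD(1)[OF b(1)] by simp
    have "normal_jump (p t) (vector_derivative p (at t)) F (cu - cd)"
      by (rule normal_jump_box[OF b(1) tI, of "\<lambda>_. 0"]) (simp_all add: cu cd)
    from normal_jump_unique[OF this nj] have "cu - cd = 2 * of_real pi * \<i> * wt" .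
    then have "m zu - m zd = wt" unfolding m_def cu[OF z(1)] cd[OF z(2)] by (simp add: diff_divide_distrib[symmetric])
    from alg[OF mval[OF subsetD[OF sub(1) z(1)]] mval[OF subsetD[OF sub(2) z(2)]] this]
    have G: "G ** Nf (m zu) = Nf (m zd)" .
    have "\<forall>z\<in>Up. N z = Nf (m zu)" "\<forall>z\<in>Um. N z = Nf (m zd)" unfolding N_def m_def using cu cd z by simp_all
    then show "\<exists>Np Nm. mholo U Np \<and> mholo U Nm \<and> (\<forall>z\<in>Up. N z = Np z) \<and> (\<forall>z\<in>Um. N z = Nm z) \<and> (\<forall>z\<in>U. G ** Np z = Nm z)"
      using G by (intro exI[of _ "\<lambda>_. Nf (m zu)"] exI[of _ "\<lambda>_. Nf (m zd)"] conjI mholo_const) auto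
  qed
  have contl: "isCont (l j) w" "isCont li w" if "w \<in> ball b0 R" for w j
    using l(1) li(1) that holomorphic_on_imp_continuous_on continuous_on_eq_continuous_at open_ball by metis+
  have jA0: "normal_jump w v (A k) 0" if "w \<in> ball b0 R" "w \<notin> ell_img \<Gamma> k" for w v k
    unfolding A_def by (intro normal_jump_cont continuous_intros isCont_\<Lambda> contl that)
  have jAi0: "normal_jump w v Ai 0" if "w \<in> ball b0 R" "w \<notin> ell_inf_img \<Gamma>" for w v
    unfolding Ai_def by (intro normal_jump_cont continuous_intros isCont_\<Lambda>i contl that)
  have jA1: "normal_jump (ell \<Gamma> k t) (vector_derivative (ell \<Gamma> k) (at t)) (A k) (2 * of_real pi * \<i>)"
    if "t \<in> {0<..<1}" "ell \<Gamma> k t \<in> ball b0 R" for k t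
  proof -
    have "normal_jump (ell \<Gamma> k t) (vector_derivative (ell \<Gamma> k) (at t)) (\<lambda>z. - l k z) 0"
      by (intro normal_jump_cont continuous_intros contl that)
    from normal_jump_add[OF \<Lambda>_jump[OF that(1)] this] show ?thesis unfolding A_def by simp
  qed
  have jAi1: "normal_jump (ell_inf \<Gamma> t) (vector_derivative (ell_inf \<Gamma>) (at t)) Ai (2 * of_real pi * \<i>)"
    if "t \<in> {-1<..<0}" "ell_inf \<Gamma> t \<in> ball b0 R" for t
  proof -
    have "normal_jump (ell_inf \<Gamma> t) (vector_derivative (ell_inf \<Gamma>) (at t)) li 0"
      by (intro normal_jump_cont contl that)
    from normal_jump_add[OF \<Lambda>i_jump[OF that(1)] this] show ?thesis unfolding Ai_def by simp
  qed
  have jF: "normal_jump w v F (((x1 + 2 * x2) + 4 * x3) + 7 * x4)"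
    if "normal_jump w v (A 1) x1" "normal_jump w v (A 2) x2" "normal_jump w v (A 3) x3" "normal_jump w v Ai x4" for w v x1 x2 x3 x4
    unfolding F_def by (intro normal_jump_add normal_jump_mult that)
  have adjM: "X ** adj2 X = mat 1" if "det X = 1" for X by (rule adj2_inverse(1)[OF that])
  have ext: "mext_at C (\<lambda>z. \<Psi> z ** N z) z" if z: "z \<in> ball b0 R" "z \<noteq> b0" for z
  proof (cases "z \<in> C")
    case False then show ?thesis using lc z by (intro mext_const) auto
  next
    case True
    then show ?thesis
    proof (cases rule: in_C_cases)
      case 1 then show ?thesis using z by simp
    next
      case (2 j) then show ?thesis using nocball[OF z(1), of j] rad_pos[of j] by auto
    next
      case (3 j t)
      have tb: "ell \<Gamma> j t \<in> ball b0 R" using z 3 by simp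
      have "mext_at C (\<lambda>z. \<Psi> z ** N z) (ell \<Gamma> j t)"
      proof (rule arc_case[of "ell \<Gamma> j" t "min t (1 - t)" "M j" "if j = 1 then 1 else if j = 2 then 2 else 4"])
        show "arc_at C (ell \<Gamma> j) t" using 3 by (intro arc_at_ell) auto
        show "0 < min t (1 - t)" using 3 by auto
        show "ell \<Gamma> j t \<in> ball b0 R - {b0}" using z 3 by auto
        show "has_jump \<Psi> (ell \<Gamma> j) s (M j)" if "\<bar>s - t\<bar> < min t (1 - t)" "ell \<Gamma> j s \<in> ball b0 R - {b0}" for s
          using that 3(1) nocball[of "ell \<Gamma> j s" j] by (intro jump_outer) (auto simp: abs_less_iff)
        have j1: "normal_jump (ell \<Gamma> j t) (vector_derivative (ell \<Gamma> j) (at t)) (A k) (if k = j then 2 * of_real pi * \<i> else 0)" for k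
          using jA1[OF 3(1) tb] jA0[OF tb ell_param(4)[OF 3(1)]] by (cases "k = j") auto
        have j2: "normal_jump (ell \<Gamma> j t) (vector_derivative (ell \<Gamma> j) (at t)) Ai 0"
          by (rule jAi0[OF tb ell_param(5)[OF 3(1)]])
        show "normal_jump (ell \<Gamma> j t) (vector_derivative (ell \<Gamma> j) (at t)) F (2 * of_real pi * \<i> * (if j = 1 then 1 else if j = 2 then 2 else 4))"
          using jF[OF j1[of 1] j1[of 2] j1[of 3] j2] exhaust_3[of j] by auto
        fix u d :: complex assume "u \<in> {0,1,3,7}" "d \<in> {0,1,3,7}" "u - d = (if j = 1 then 1 else if j = 2 then 2 else 4)"
        then have "(j = 1 \<and> u = 1 \<and> d = 0) \<or> (j = 2 \<and> u = 3 \<and> d = 1) \<or> (j = 3 \<and> u = 7 \<and> d = 3)"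
          using exhaust_3[of j] by auto
        moreover have "M 1 ** Nf 1 = Nf 0" unfolding Nf by (rule adjM[OF det_M])
        moreover have "M 2 ** Nf 3 = Nf 1" unfolding Nf adj2_mult matrix_mul_assoc adjM[OF det_M] by simp
        moreover have "M 3 ** Nf 7 = Nf 3" unfolding Nf adj2_mult[of "M 1 ** M 2"] matrix_mul_assoc adjM[OF det_M] by simp
        ultimately show "M j ** Nf u = Nf d" by metis
      qed
      then show ?thesis using 3 by simp
    next
      case (4 j t) then show ?thesis using nocball[OF z(1), of j] circ_sub_cball[of j] by auto
    next
      case (5 t)
      have t1: "t \<in> {-1<..<0}" using 5 noinf[OF z(1)] by force
      have tb: "ell_inf \<Gamma> t \<in> ball b0 R" using z 5 by simp
      have "mext_at C (\<lambda>z. \<Psi> z ** N z) (ell_inf \<Gamma> t)"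
      proof (rule arc_case[of "ell_inf \<Gamma>" t "- t" "M_inf \<delta>" 7])
        show "arc_at C (ell_inf \<Gamma>) t" using 5 by (intro arc_at_inf)
        show "0 < - t" using 5 by simp
        show "ell_inf \<Gamma> t \<in> ball b0 R - {b0}" using z 5 by auto
        show "has_jump \<Psi> (ell_inf \<Gamma>) s (M_inf \<delta>)" if "\<bar>s - t\<bar> < - t" for s using that by (intro jump_inf) (simp add: abs_less_iff)
        have j1: "normal_jump (ell_inf \<Gamma> t) (vector_derivative (ell_inf \<Gamma>) (at t)) (A k) 0" for k
          by (rule jA0[OF tb inf_param(3)[OF 5(1)]])
        show "normal_jump (ell_inf \<Gamma> t) (vector_derivative (ell_inf \<Gamma>) (at t)) F (2 * of_real pi * \<i> * 7)"
          using jF[OF j1[of 1] j1[of 2] j1[of 3] jAi1[OF t1 tb]] by (simp add: mult_ac)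
        fix u d :: complex assume "u \<in> {0,1,3,7}" "d \<in> {0,1,3,7}" "u - d = 7"
        then have "u = 7 \<and> d = 0" by auto
        moreover have "M_inf \<delta> ** Nf 7 = Nf 0"
          unfolding Nf cyclic by (rule adjM) (simp add: M_inf_def)
        ultimately show "M_inf \<delta> ** Nf u = Nf d" by simp
      qed
      then show ?thesis using 5 by simp
    next
      case (6 j) then show ?thesis using nocball[OF z(1), of j] circ_sub_cball[of j] by auto
    qed
  qed
  have "b0 \<in> nodes a \<Gamma>" unfolding nodes_def by simp
  then show ?thesis
    by (rule node_reg[OF _ open_ball _ fin lc detN ext]) (use R(1) in auto)
qed

lemma reg_all: assumes "w \<notin> range (sing a)" shows "reg w"
proof (cases "w \<in> C")
  case True
  then show ?thesis
  proof (cases rule: in_C_cases)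
    case 1 then show ?thesis using reg_base by simp
  next
    case (2 j) then show ?thesis using assms by blast
  next
    case (3 j t) then show ?thesis using reg_ell by blast
  next
    case (4 j t) then show ?thesis using reg_node by blast
  next
    case (5 t) then show ?thesis using reg_inf by blast
  next
    case (6 j) then show ?thesis using reg_circ by blast
  qed
qed (rule reg_off)

end

subsection \<open>The singular points and infinity\<close>

context heun_rh
begin

text \<open>The power absorbs the inner jump if \<open>Lj\<close> jumps by 2 pi i across the arc.
  This is found by comparing \<open>Lj\<close> with \<open>\<Lambda> j\<close> plus a logarithm of
  \<open>z - b0\<close>, a branch whose jump is known and which differs from \<open>Lj\<close> by
  one constant near the point. Boundedness then removes the singularity at the point itself.\<close>

lemma sing_local:
  obtains U A l where "open U" "sing a j \<in> U" "mholo U A" "l holomorphic_on U - C"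
    "\<And>z. z \<in> U - C \<Longrightarrow> exp (l z) = z - sing a j" "\<And>z. z \<in> U - C \<Longrightarrow> \<Psi> z = A z ** exp_sigma3 (\<alpha> j * l z)"
proof -
  let ?s = "sing a j" and ?p = "ell \<Gamma> j"
  obtain Lj B where Lj: "log_branch (disc a \<Gamma> j - ell_img \<Gamma> j) ?s Lj"
    and B: "\<forall>\<^sub>F z in at ?s within - C. norm (\<Psi> z ** exp_sigma3 (- \<alpha> j * Lj z)) \<le> B"
    using rh_sing[of j] by blast
  have "\<exists>r0>0. \<forall>r. 0 < r \<and> r < r0 \<longrightarrow> (\<exists>w. ell_img \<Gamma> j \<inter> sphere ?s r = {w})"
    by (rule ell_sphere_sing[of j]) blast
  then obtain r0 where r0: "0 < r0" "\<And>r. 0 < r \<Longrightarrow> r < r0 \<Longrightarrow> \<exists>w. ell_img \<Gamma> j \<inter> sphere ?s r = {w}" by metis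
  define R where "R = min r0 (rad \<Gamma> j)"
  have R: "0 < R" "R \<le> r0" "R \<le> rad \<Gamma> j" using r0(1) rad_pos[of j] by (auto simp: R_def)
  have bd: "ball ?s R \<subseteq> disc a \<Gamma> j" unfolding disc_def by (rule subset_ball[OF R(3)])
  have elC: "ell_img \<Gamma> j \<subseteq> C" unfolding gamma_def by blast
  have sC: "?s \<in> C" using sing_in_ell elC by blast
  have Cd: "z \<in> ell_img \<Gamma> j" if "z \<in> ball ?s R" "z \<in> C" for z using C_disc[of j] bd that by blast
  have b0n: "z \<noteq> b0" if "z \<in> ball ?s R" for z
    using that bd base_cball[of j] unfolding disc_def by (metis ball_subset_cball subsetD)
  let ?W = "ball ?s R - C - {?s}"
  have oW: "open ?W" using closed_C by (intro open_delete open_Diff open_ball)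
  have WL: "?W \<subseteq> disc a \<Gamma> j - ell_img \<Gamma> j" using bd elC by blast
  have hL: "Lj holomorphic_on ?W" and eL: "\<And>z. z \<in> ?W \<Longrightarrow> exp (Lj z) = z - ?s"
    using Lj WL unfolding log_branch_def by (blast intro: holomorphic_on_subset)+
  have "(\<lambda>z. z - b0) holomorphic_on ball ?s R" by (intro holomorphic_intros)
  moreover have "z - b0 \<noteq> 0" if "z \<in> ball ?s R" for z using b0n[OF that] by simp
  ultimately obtain q where q: "q holomorphic_on ball ?s R" "\<And>z. z \<in> ball ?s R \<Longrightarrow> exp (q z) = z - b0"
    using log_on_ball[of "\<lambda>z. z - b0"] by metis
  define H where "H = (\<lambda>z. \<Lambda> j z + q z)"
  define F where "F = (\<lambda>z. H z - Lj z)"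
  have cH: "continuous_on ?W H" unfolding H_def
    using elC by (intro continuous_intros continuous_on_subset[OF cont_\<Lambda>] continuous_on_subset[OF holomorphic_on_imp_continuous_on[OF q(1)]]) auto
  have cF: "continuous_on ?W F" unfolding F_def
    by (intro continuous_intros cH holomorphic_on_imp_continuous_on[OF hL])
  have eF: "exp (F z) = 1" if z: "z \<in> ?W" for z
  proof -
    have zs: "z \<notin> ell_img \<Gamma> j" "z \<in> ball ?s R" "z - ?s \<noteq> 0" using z elC by auto
    have "z - b0 \<noteq> 0" using b0n[OF zs(2)] by simp
    moreover have "exp (F z) = exp (\<Lambda> j z) * exp (q z) / exp (Lj z)" unfolding F_def H_def exp_diff exp_add ..
    moreover have "((- x) / (- y)) * y / x = 1" if "x \<noteq> 0" "y \<noteq> 0" for x y :: complex using that by simp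
    ultimately show ?thesis unfolding exp_\<Lambda>[OF zs(1)] q(2)[OF zs(2)] eL[OF z] using zs(3) by (metis minus_diff_eq)
  qed
  \<comment> \<open>A circle minus its single point on the arc is connected, so \<open>F\<close>
    takes one value on it.\<close>
  have V: "finite (F ` (sphere ?s r - C)) \<and> card (F ` (sphere ?s r - C)) = 1" if r: "r \<in> {0<..<R}" for r
  proof -
    have rr: "0 < r" "r < R" using r by auto
    obtain w where w: "ell_img \<Gamma> j \<inter> sphere ?s r = {w}" using r0(2)[of r] rr R by auto
    obtain t where t: "w = ?s + rcis r t" using rcis_param[of w ?s r 0] w by blast
    have sb: "sphere ?s r \<subseteq> ball ?s R" using rr by auto
    have sph: "sphere ?s r - C = sphere ?s r - {w}" using w sb Cd elC by blast
    let ?I = "{t<..<t + 2 * pi}"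
    have im: "(\<lambda>\<theta>. ?s + rcis r \<theta>) ` ?I = sphere ?s r - {w}"
    proof (intro equalityI subsetI)
      fix z assume "z \<in> (\<lambda>\<theta>. ?s + rcis r \<theta>) ` ?I"
      then show "z \<in> sphere ?s r - {w}" using rcis_neq[OF rr(1)] rr(1) t by (auto simp: dist_norm)
    next
      fix z assume z: "z \<in> sphere ?s r - {w}"
      then obtain \<theta> where th: "t \<le> \<theta>" "\<theta> < t + 2 * pi" "z = ?s + rcis r \<theta>" using rcis_param[of z ?s r t] by blast
      then have "\<theta> \<noteq> t" using z t by auto
      then show "z \<in> (\<lambda>\<theta>. ?s + rcis r \<theta>) ` ?I" using th by (intro image_eqI[of _ _ \<theta>]) auto
    qed
    have "connected (sphere ?s r - C)" unfolding sph im[symmetric] rcis_def cis_conv_exp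
      by (intro connected_continuous_image continuous_intros convex_connected convex_real_interval)
    moreover have sW: "sphere ?s r - C \<subseteq> ?W" using sb sC by auto
    ultimately obtain c where c: "\<And>x. x \<in> sphere ?s r - C \<Longrightarrow> F x = c"
      using continuous_exp_constant[OF _ continuous_on_subset[OF cF sW] eF[OF subsetD[OF sW]]] by blast
    have "sphere ?s r - C \<noteq> {}"
    proof -
      have "?s + rcis r (t + pi) \<in> sphere ?s r - C" unfolding sph im[symmetric] by (intro imageI) auto
      then show ?thesis by blast
    qed
    then have "F ` (sphere ?s r - C) = {c}" using c by auto
    then show ?thesis by simp
  qed
  have half: "R / 2 \<in> {0<..<R}" using R(1) by simp
  obtain K where K: "F ` (sphere ?s (R/2) - C) = {K}" using V[OF half] card_1_singletonE by metis
  have FK: "F z = K" if z: "z \<in> ?W" for z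
  proof -
    have r: "dist ?s z \<in> {0<..<R}" using z by auto
    have "F z \<in> F ` (sphere ?s (dist ?s z) - C)" using z by auto
    then show ?thesis using sphere_values_const[OF closed_C cF eF V r half] K by simp
  qed
  have LH: "H z = Lj z + K" if "z \<in> ?W" for z using FK[OF that] by (simp add: F_def algebra_simps)
  define N where "N = (\<lambda>z. exp_sigma3 (- \<alpha> j * Lj z))"
  have mN: "mholo ?W N" unfolding N_def by (intro mholo_exp_sigma3 holomorphic_intros hL)
  have ext: "mext_at C (\<lambda>z. \<Psi> z ** N z) z" if z: "z \<in> ball ?s R - {?s}" for z
  proof (cases "z \<in> C")
    case False
    have "mholo ?W (\<lambda>z. \<Psi> z ** N z)" by (intro mholo_mult mN mholo_subset[OF mholo_\<Psi>]) auto
    then show ?thesis unfolding mext_at_def using oW z False by (intro exI[of _ ?W] exI[of _ "\<lambda>z. \<Psi> z ** N z"]) simp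
  next
    case True
    then have "z \<in> ell_img \<Gamma> j" using Cd z by blast
    then obtain t where t: "t \<in> {0..1}" "z = ?p t" by (auto simp: ell_img_def)
    have "t \<noteq> 0" using t b0n[of z] z ell_0 by auto
    moreover have "t \<noteq> 1" using t z ell_1 by auto
    ultimately have t01: "t \<in> {0<..<1}" using t by auto
    have "dist ?s z < rad \<Gamma> j" using z R(3) by auto
    then have nc: "?p t \<notin> circ a \<Gamma> j" using t(2) by (simp add: circ_def)
    have "mext_at C (\<lambda>z. \<Psi> z ** N z) (?p t)"
    \<comment> \<open>The second ball leaves out the singular point, so the box carries a
      holomorphic logarithm of \<open>z - ?s\<close> with which \<open>Lj\<close> is compared on
      both sides.\<close>
    proof (rule arc_mext[OF arc_at_ell[OF t01 nc], of "min t (1 - t)" "ball ?s R \<inter> ball z (dist z ?s)" "eM j"])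
      show "0 < min t (1 - t)" using t01 by auto
      show "open (ball ?s R \<inter> ball z (dist z ?s))" by auto
      show "?p t \<in> ball ?s R \<inter> ball z (dist z ?s)" using z t by auto
      show "has_jump \<Psi> ?p s (eM j)" if "\<bar>s - t\<bar> < min t (1 - t)" "?p s \<in> ball ?s R \<inter> ball z (dist z ?s)" for s
        using that t01 bd by (intro jump_inner) (auto simp: abs_less_iff)
      fix \<epsilon> U Up Um assume b: "arc_box ?p t \<epsilon> U Up Um" "U \<subseteq> ball ?s R \<inter> ball z (dist z ?s)" "U - C = Up \<union> Um"
      have Ub: "U \<subseteq> ball z (dist z ?s)" using b(2) by blast
      have sub: "Up \<subseteq> ?W" "Um \<subseteq> ?W" using b(2,3) sC by blast+
      have "(\<lambda>w. w - ?s) holomorphic_on ball z (dist z ?s)" by (intro holomorphic_intros)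
      moreover have "w - ?s \<noteq> 0" if "w \<in> ball z (dist z ?s)" for w using that by auto
      ultimately obtain g where g: "g holomorphic_on ball z (dist z ?s)" "\<And>w. w \<in> ball z (dist z ?s) \<Longrightarrow> exp (g w) = w - ?s"
        using log_on_ball[of "\<lambda>w. w - ?s"] by metis
      have gU: "g holomorphic_on U" using g(1) Ub holomorphic_on_subset by blast
      have UpU: "Up \<subseteq> U" "Um \<subseteq> U" using b(3) by blast+
      have cL: "continuous_on Up Lj" "continuous_on Um Lj" "continuous_on Up g" "continuous_on Um g"
        using sub UpU hL gU by (meson continuous_on_subset holomorphic_on_imp_continuous_on)+
      have ex: "exp (Lj x) = exp (g x)" if "x \<in> Up \<union> Um" for x
      proof -
        have "x \<in> ?W" "x \<in> ball z (dist z ?s)" using that sub UpU Ub by blast+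
        then show ?thesis using eL g(2) by simp
      qed
      obtain nu :: int where nu: "\<And>x. x \<in> Up \<Longrightarrow> Lj x = g x + 2 * of_real pi * \<i> * of_int nu"
        using log_branches_differ[OF arc_boxD(5)[OF b(1)] cL(1,3) ex] by blast
      obtain nd :: int where nd: "\<And>x. x \<in> Um \<Longrightarrow> Lj x = g x + 2 * of_real pi * \<i> * of_int nd"
        using log_branches_differ[OF arc_boxD(6)[OF b(1)] cL(2,4) ex] by blast
      have tI: "t \<in> {t-\<epsilon><..<t+\<epsilon>}" using arc_boxD(1)[OF b(1)] by simp
      then have ptU: "?p t \<in> U" using arc_boxD(8)[OF b(1)] by blast
      then have ig: "isCont g (?p t)"
        using gU arc_boxD(2)[OF b(1)] holomorphic_on_imp_continuous_on continuous_on_eq_continuous_at by blast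
      have j1: "normal_jump (?p t) (vector_derivative ?p (at t)) H
          ((2 * of_real pi * \<i> * of_int nu + K) - (2 * of_real pi * \<i> * of_int nd + K))"
        by (rule normal_jump_box[OF b(1) tI ig]) (use LH sub nu nd in \<open>auto simp: subset_iff\<close>)
      have "isCont q (?p t)"
        using q(1) z t by (metis DiffD1 continuous_on_eq_continuous_at holomorphic_on_imp_continuous_on open_ball)
      then have j2: "normal_jump (?p t) (vector_derivative ?p (at t)) H (2 * of_real pi * \<i> + 0)"
        unfolding H_def by (intro normal_jump_add \<Lambda>_jump[OF t01] normal_jump_cont)
      from normal_jump_unique[OF j1 j2] have "2 * of_real pi * \<i> * (of_int nu - of_int nd - 1) = 0"
        by (simp add: algebra_simps)
      then have "of_int nu - of_int nd = (1::complex)" by simp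
      then have nud: "of_int nu = (of_int nd + 1 :: complex)" by (simp only: diff_eq_eq add.commute)
      have "eM j ** exp_sigma3 (- \<alpha> j * (g x + 2 * of_real pi * \<i> * of_int nu)) = exp_sigma3 (- \<alpha> j * (g x + 2 * of_real pi * \<i> * of_int nd))" for x
        unfolding exp_sigma3_add nud by (rule arg_cong[of _ _ exp_sigma3]) (simp add: algebra_simps)
      then show "\<exists>Np Nm. mholo U Np \<and> mholo U Nm \<and> (\<forall>z\<in>Up. N z = Np z) \<and> (\<forall>z\<in>Um. N z = Nm z) \<and> (\<forall>z\<in>U. eM j ** Np z = Nm z)"
        by (intro exI[of _ "\<lambda>x. exp_sigma3 (- \<alpha> j * (g x + 2 * of_real pi * \<i> * of_int nu))"]
            exI[of _ "\<lambda>x. exp_sigma3 (- \<alpha> j * (g x + 2 * of_real pi * \<i> * of_int nd))"] conjI mholo_exp_sigma3 holomorphic_intros gU)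
           (auto simp: N_def nu nd)
    qed
    then show ?thesis using t by simp
  qed
  have sV: "?s \<in> ball ?s R" using R(1) by simp
  have nn: "norm (X $ i $ k) \<le> norm X" for X :: "complex^2^2" and i k
    using order_trans[OF Finite_Cartesian_Product.norm_nth_le Finite_Cartesian_Product.norm_nth_le] .
  have "ext_at C (\<lambda>z. (\<Psi> z ** N z) $ i $ k) ?s" for i k
  proof (rule ext_at_removable[OF interior_C sC open_ball sV])
    fix z assume "z \<in> ball ?s R - {?s}"
    then show "ext_at C (\<lambda>z. (\<Psi> z ** N z) $ i $ k) z" using ext unfolding mext_at_iff by blast
  next
    show "\<forall>\<^sub>F z in at ?s within - C. norm ((\<Psi> z ** N z) $ i $ k) \<le> B"
      using B unfolding N_def by eventually_elim (rule order_trans[OF nn])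
  qed
  then have "mext_at C (\<lambda>z. \<Psi> z ** N z) ?s" unfolding mext_at_iff by blast
  then obtain U0 A where U0: "open U0" "?s \<in> U0" "mholo U0 A" "\<And>z. z \<in> U0 - C \<Longrightarrow> \<Psi> z ** N z = A z"
    unfolding mext_at_def by blast
  let ?U = "U0 \<inter> ball ?s R"
  have UW: "?U - C \<subseteq> ?W" using sC by blast
  show ?thesis
  proof (rule that[of ?U A Lj])
    show "open ?U" "?s \<in> ?U" "mholo ?U A" using U0 R(1) by (auto intro: mholo_subset)
    show "Lj holomorphic_on ?U - C" using hL UW holomorphic_on_subset by blast
    fix z assume z: "z \<in> ?U - C"
    then show "exp (Lj z) = z - ?s" using eL UW by blast
    have "A z ** exp_sigma3 (\<alpha> j * Lj z) = \<Psi> z ** (N z ** exp_sigma3 (\<alpha> j * Lj z))"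
      using U0(4)[of z] z by (simp add: matrix_mul_assoc)
    also have "N z ** exp_sigma3 (\<alpha> j * Lj z) = mat 1" unfolding N_def exp_sigma3_add by simp
    finally show "\<Psi> z = A z ** exp_sigma3 (\<alpha> j * Lj z)" by simp
  qed
qed

text \<open>How \<open>L\<close> jumps across the far part of \<open>ell_inf\<close> is not computed
  from the geometry. The jump is some constant \<open>c0\<close> along that part, and so one
  boundary value of \<open>\<Psi>\<close> times the power arises from the other by a fixed diagonal
  factor \<open>D\<close>. As both tend to the identity, \<open>D\<close> is the identity and the
  product continues across the arc.\<close>

lemma inf_local:
  obtains R B Z where "0 < R" "mholo {z. R < norm z} Z" "\<And>z. R < norm z \<Longrightarrow> z \<notin> C \<Longrightarrow> Z z = \<Psi> z ** exp_sigma3 (\<delta> * L z)"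
    "\<And>z. R < norm z \<Longrightarrow> z \<notin> C \<Longrightarrow> exp (L z) = z" "L holomorphic_on {z. R < norm z} - C"
    "\<And>z i k. R < norm z \<Longrightarrow> norm (Z z $ i $ k - mat 1 $ i $ k) \<le> B / norm z" "{z. R < norm z} - C \<subseteq> D_inf a \<Gamma>"
proof -
  let ?p = "ell_inf \<Gamma>"
  obtain R0 where R0: "log_branch ({z. R0 < norm z} - ell_inf_img \<Gamma>) 0 L"
    using L unfolding log_branch_at_infinity_def by blast
  have hL0: "L holomorphic_on ({z. R0 < norm z} - ell_inf_img \<Gamma>)" and eL0: "\<And>z. R0 < norm z \<Longrightarrow> z \<notin> ell_inf_img \<Gamma> \<Longrightarrow> exp (L z) = z"
    using R0 unfolding log_branch_def by auto
  have "\<exists>B. \<forall>\<^sub>F z in infinity_off a \<Gamma>. norm (infinity_defect \<delta> L \<Psi> z) \<le> B / norm z" by (rule rh_inf)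
  then obtain B b where b: "\<And>z. b \<le> norm z \<Longrightarrow> z \<notin> C \<Longrightarrow> norm (infinity_defect \<delta> L \<Psi> z) \<le> B / norm z"
    unfolding infinity_off_def eventually_inf_principal eventually_at_infinity by auto
  have c1: "compact (?p ` {-1..0})" by (intro compact_continuous_image continuous_on_subset[OF inf_cont]) auto
  have c2: "compact (\<Union>j. ell_img \<Gamma> j)" by (rule compact_UN) (simp_all add: compact_ell)
  have c3: "compact (\<Union>j. cball (sing a j) (rad \<Gamma> j))" by (rule compact_UN) simp_all
  have "compact (?p ` {-1..0} \<union> (\<Union>j. ell_img \<Gamma> j) \<union> (\<Union>j. cball (sing a j) (rad \<Gamma> j)))"
    by (rule compact_Un[OF compact_Un[OF c1 c2] c3])
  from compact_imp_bounded[OF this, unfolded bounded_iff]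
  obtain R1 where R1': "\<forall>z\<in>?p ` {-1..0} \<union> (\<Union>j. ell_img \<Gamma> j) \<union> (\<Union>j. cball (sing a j) (rad \<Gamma> j)). norm z \<le> R1" by (rule exE)
  note R1 = R1'[rule_format]
  \<comment> \<open>Beyond \<open>R'\<close> the estimates hold. Then \<open>T\<close> and
    \<open>R\<close> are chosen so that beyond \<open>R\<close> the graph consists of points of
    \<open>ell_inf\<close> with parameter below \<open>T\<close>, where the arc stays beyond
    \<open>R'\<close>.\<close>
  define R' where "R' = max (max R0 b) (max R1 1)"
  have "\<exists>T. \<forall>t\<le>T. R' < norm (?p t)" by (rule inf_escapes[of R']) blast
  then obtain T0 where T0: "\<And>t. t \<le> T0 \<Longrightarrow> R' < norm (?p t)" by blast
  define T where "T = min T0 (-1)"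
  have "compact (?p ` {T..0})" by (intro compact_continuous_image continuous_on_subset[OF inf_cont]) auto
  from compact_imp_bounded[OF this, unfolded bounded_iff]
  obtain R2 where R2': "\<forall>z\<in>?p ` {T..0}. norm z \<le> R2" by (rule exE)
  note R2 = R2'[rule_format]
  define R where "R = max R' R2"
  have R: "R0 \<le> R" "b \<le> R" "R1 \<le> R" "1 \<le> R" "R2 \<le> R" "R' \<le> R" by (auto simp: R_def R'_def)
  have T: "T < 0" "\<And>t. t \<le> T \<Longrightarrow> R' < norm (?p t)" using T0 by (auto simp: T_def)
  let ?O = "{z. R < norm z}"
  have oO: "open ?O" by (intro open_Collect_less continuous_intros)
  have CO: "\<exists>t<T. z = ?p t" if "z \<in> C" "z \<in> ?O" for z
  proof -
    have n1: "z \<notin> ell_img \<Gamma> j" "z \<notin> cball (sing a j) (rad \<Gamma> j)" for j using R1[of z] that(2) R(3) by auto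
    then have "z \<notin> circ a \<Gamma> j" for j using circ_sub_cball[of j] by blast
    then have "z \<in> ell_inf_img \<Gamma>" using n1 that(1) unfolding gamma_def by blast
    then obtain t where t: "t \<le> 0" "z = ?p t" by (auto simp: ell_inf_img_def)
    have "\<not> T \<le> t" using R2[of z] t that(2) R(5) by auto
    then show ?thesis using t by (intro exI[of _ t]) auto
  qed
  have infC: "ell_inf_img \<Gamma> \<subseteq> C" unfolding gamma_def by blast
  have OD: "?O - C \<subseteq> D_inf a \<Gamma>"
  proof
    fix z assume z: "z \<in> ?O - C"
    have "z \<notin> disc a \<Gamma> j" for j
    proof
      assume "z \<in> disc a \<Gamma> j"
      then have "z \<in> cball (sing a j) (rad \<Gamma> j)" by (simp add: disc_def)
      then have "norm z \<le> R1" using R1[of z] by blast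
      then show False using z R(3) by auto
    qed
    then show "z \<in> D_inf a \<Gamma>" using z unfolding D_inf_def by blast
  qed
  let ?O' = "{z. R' < norm z}"
  have oO': "open ?O'" by (intro open_Collect_less continuous_intros)
  have sub0: "?O' - C \<subseteq> {z. R0 < norm z} - ell_inf_img \<Gamma>" using infC by (auto simp: R'_def)
  have hL: "L holomorphic_on ?O' - C" using hL0 sub0 holomorphic_on_subset by blast
  have eL: "exp (L z) = z" if "z \<in> ?O' - C" for z using eL0 sub0 that by blast
  have box_log: "\<exists>g (nu::int) (nd::int). g holomorphic_on U \<and> (\<forall>x\<in>Up. L x = g x + 2 * of_real pi * \<i> * of_int nu) \<and>
      (\<forall>x\<in>Um. L x = g x + 2 * of_real pi * \<i> * of_int nd)"
    if b: "arc_box ?p t \<epsilon> U Up Um" "U \<subseteq> ?O' \<inter> ball w (norm w)" "U - C = Up \<union> Um" for t \<epsilon> U Up Um w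
  proof -
    have "(\<lambda>x. x) holomorphic_on ball w (norm w)" by (intro holomorphic_intros)
    moreover have "x \<noteq> 0" if "x \<in> ball w (norm w)" for x using that by auto
    ultimately obtain g where g: "g holomorphic_on ball w (norm w)" "\<And>x. x \<in> ball w (norm w) \<Longrightarrow> exp (g x) = x"
      using log_on_ball[of "\<lambda>x. x"] by metis
    have Ub: "U \<subseteq> ball w (norm w)" using b(2) by blast
    have gU: "g holomorphic_on U" using g(1) Ub holomorphic_on_subset by blast
    have UpU: "Up \<subseteq> U" "Um \<subseteq> U" "Up \<subseteq> ?O' - C" "Um \<subseteq> ?O' - C" using b(2,3) by blast+
    have cL: "continuous_on Up L" "continuous_on Um L" "continuous_on Up g" "continuous_on Um g"
      using UpU hL gU by (meson continuous_on_subset holomorphic_on_imp_continuous_on)+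
    have ex: "exp (L x) = exp (g x)" if "x \<in> Up \<union> Um" for x
    proof -
      have "x \<in> ?O' - C" "x \<in> ball w (norm w)" using that UpU Ub by blast+
      then show ?thesis using eL g(2) by simp
    qed
    obtain nu :: int where nu: "\<And>x. x \<in> Up \<Longrightarrow> L x = g x + 2 * of_real pi * \<i> * of_int nu"
      using log_branches_differ[OF arc_boxD(5)[OF b(1)] cL(1,3) ex] by blast
    obtain nd :: int where nd: "\<And>x. x \<in> Um \<Longrightarrow> L x = g x + 2 * of_real pi * \<i> * of_int nd"
      using log_branches_differ[OF arc_boxD(6)[OF b(1)] cL(2,4) ex] by blast
    show ?thesis using gU nu nd by blast
  qed
  have box_jump: "normal_jump (?p s) (vector_derivative ?p (at s)) L (2 * of_real pi * \<i> * of_int nu - 2 * of_real pi * \<i> * of_int nd)"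
    if b: "arc_box ?p t \<epsilon> U Up Um" and s: "s \<in> {t-\<epsilon><..<t+\<epsilon>}" and g: "g holomorphic_on U"
      and nu: "\<forall>x\<in>Up. L x = g x + 2 * of_real pi * \<i> * of_int nu" and nd: "\<forall>x\<in>Um. L x = g x + 2 * of_real pi * \<i> * of_int nd"
    for s t \<epsilon> U Up Um g and nu nd :: int
  proof -
    have "?p s \<in> U" using arc_boxD(8)[OF b] s by blast
    then have "isCont g (?p s)"
      using g arc_boxD(2)[OF b] holomorphic_on_imp_continuous_on continuous_on_eq_continuous_at by blast
    then show ?thesis by (rule normal_jump_box[OF b s]) (use nu nd in auto)
  qed
  have pO': "?p t \<in> ?O' \<inter> ball (?p t) (norm (?p t))" if "t \<le> T" for t
  proof -
    have "R' < norm (?p t)" using T(2)[OF that] .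
    moreover have "1 \<le> R'" by (simp add: R'_def)
    ultimately show ?thesis by auto
  qed
  have getbox: "\<exists>\<epsilon> U Up Um. arc_box ?p t \<epsilon> U Up Um \<and> \<epsilon> < e \<and> U \<subseteq> ?O' \<inter> ball (?p t) (norm (?p t)) \<and> U - C = Up \<union> Um"
    if "t \<le> T" "0 < e" for t e
  proof -
    have "arc_at C ?p t" using that T(1) by (intro arc_at_inf) simp
    moreover have "open (?O' \<inter> ball (?p t) (norm (?p t)))" using oO' by auto
    ultimately show ?thesis using pO'[OF that(1)] that(2) unfolding arc_at_def by meson
  qed
  \<comment> \<open>Jumps are unique, so the description is meaningful wherever a jump exists; the
    boxes show that it does and is locally constant in \<open>t\<close>.\<close>
  define cj where "cj = (\<lambda>t. THE c. normal_jump (?p t) (vector_derivative ?p (at t)) L c)"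
  have cj: "cj t = c" if "normal_jump (?p t) (vector_derivative ?p (at t)) L c" for t c
    unfolding cj_def using that normal_jump_unique by (intro the_equality) blast+
  have cconst: "cj t = cj T'" if "t < T" "T' < T" for t T'
  proof (rule connected_local_const[of "{..<T}"])
    show "connected {..<T}" by (intro convex_connected convex_real_interval)
    show "\<forall>x\<in>{..<T}. \<forall>\<^sub>F y in at x within {..<T}. cj x = cj y"
    proof
      fix x assume "x \<in> {..<T}"
      then obtain \<epsilon> U Up Um where bx: "arc_box ?p x \<epsilon> U Up Um" "U \<subseteq> ?O' \<inter> ball (?p x) (norm (?p x))" "U - C = Up \<union> Um"
        using getbox[of x 1] by auto
      obtain g and nu nd :: int where g: "g holomorphic_on U" "\<forall>x\<in>Up. L x = g x + 2 * of_real pi * \<i> * of_int nu"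
        "\<forall>x\<in>Um. L x = g x + 2 * of_real pi * \<i> * of_int nd" using box_log[OF bx] by blast
      have c: "cj s = 2 * of_real pi * \<i> * of_int nu - 2 * of_real pi * \<i> * of_int nd" if "s \<in> {x-\<epsilon><..<x+\<epsilon>}" for s
        by (rule cj[OF box_jump[OF bx(1) that g]])
      have xI: "x \<in> {x-\<epsilon><..<x+\<epsilon>}" using arc_boxD(1)[OF bx(1)] by simp
      have "\<forall>\<^sub>F y in nhds x. y \<in> {x-\<epsilon><..<x+\<epsilon>}" using xI by (intro eventually_nhds_in_open) auto
      then have "\<forall>\<^sub>F y in nhds x. cj x = cj y" by eventually_elim (simp add: c[OF xI] c)
      then show "\<forall>\<^sub>F y in at x within {..<T}. cj x = cj y" by (simp add: eventually_at_filter eventually_mono)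
    qed
  qed (use that in auto)
  define c0 where "c0 = cj (T - 1)"
  \<comment> \<open>\<open>\<delta> * c0\<close> is the jump in the exponent of the power, the other
    term comes from \<open>M_inf \<delta>\<close>; \<open>D\<close> is what they leave over.\<close>
  define D where "D = exp_sigma3 (\<delta> * c0 - 2 * of_real pi * \<i> * \<delta>)"
  have box_c0: "2 * of_real pi * \<i> * of_int nu - 2 * of_real pi * \<i> * of_int nd = c0"
    if b: "arc_box ?p t \<epsilon> U Up Um" and t: "t < T" and g: "g holomorphic_on U"
      and nu: "\<forall>x\<in>Up. L x = g x + 2 * of_real pi * \<i> * of_int nu" and nd: "\<forall>x\<in>Um. L x = g x + 2 * of_real pi * \<i> * of_int nd"
    for t \<epsilon> U Up Um g and nu nd :: int
  proof -
    have "t \<in> {t-\<epsilon><..<t+\<epsilon>}" using arc_boxD(1)[OF b] by simp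
    from cj[OF box_jump[OF b this g nu nd]] show ?thesis using cconst[OF t, of "T - 1"] by (simp add: c0_def)
  qed
  have MD: "M_inf \<delta> ** exp_sigma3 (\<delta> * (y + u)) = exp_sigma3 (\<delta> * (y + d)) ** D" if "u - d = c0" for y u d
  proof -
    have "u = c0 + d" using that by (metis diff_add_cancel)
    then show ?thesis unfolding M_inf_def D_def exp_sigma3_add by (intro arg_cong[of _ _ exp_sigma3]) (simp add: algebra_simps)
  qed
  define Z0 where "Z0 = (\<lambda>z. \<Psi> z ** exp_sigma3 (\<delta> * L z))"
  have nn: "norm (X $ i $ k) \<le> norm X" for X :: "complex^2^2" and i k
    using order_trans[OF Finite_Cartesian_Product.norm_nth_le Finite_Cartesian_Product.norm_nth_le] .
  have Zb: "norm (Z0 z $ i $ k - mat 1 $ i $ k) \<le> B / norm z" if "z \<in> ?O' - C" for z i k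
  proof -
    have "norm (infinity_defect \<delta> L \<Psi> z $ i $ k) \<le> norm (infinity_defect \<delta> L \<Psi> z)" by (rule nn)
    also have "\<dots> \<le> B / norm z" using that by (intro b) (auto simp: R'_def)
    finally show ?thesis unfolding infinity_defect_def Z0_def by simp
  qed
  define e where "e = exp (\<delta> * c0 - 2 * of_real pi * \<i> * \<delta>)"
  \<comment> \<open>\<open>x\<close> and \<open>y\<close> are the (1,1) entries of the left and the
    right boundary value at \<open>?p t\<close>.\<close>
  have sides: "\<exists>x y. x = y * e \<and> norm (x - 1) \<le> B / norm (?p t) \<and> norm (y - 1) \<le> B / norm (?p t)" if t: "t < T" for t
  proof -
    obtain \<epsilon> U Up Um where bx: "arc_box ?p t \<epsilon> U Up Um" "U \<subseteq> ?O' \<inter> ball (?p t) (norm (?p t))" "U - C = Up \<union> Um"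
      using getbox[of t 1] t by auto
    obtain g and nu nd :: int where g: "g holomorphic_on U" "\<forall>x\<in>Up. L x = g x + 2 * of_real pi * \<i> * of_int nu"
      "\<forall>x\<in>Um. L x = g x + 2 * of_real pi * \<i> * of_int nd" using box_log[OF bx] by blast
    have tI: "t \<in> {t-\<epsilon><..<t+\<epsilon>}" using arc_boxD(1)[OF bx(1)] by simp
    note s = arc_box_sides[OF bx(1) tI]
    have "t < 0" using t T(1) by simp
    then obtain Lp Lm where Ls: "(\<Psi> \<longlongrightarrow> Lp) (left_side ?p t)" "(\<Psi> \<longlongrightarrow> Lm) (right_side ?p t)" "Lp = Lm ** M_inf \<delta>"
      using jump_inf[of t] unfolding has_jump_def by blast
    have ptU: "?p t \<in> U" using arc_boxD(8)[OF bx(1)] tI by blast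
    define Ep where "Ep = (\<lambda>x. exp_sigma3 (\<delta> * (g x + 2 * of_real pi * \<i> * of_int nu)))"
    define Em where "Em = (\<lambda>x. exp_sigma3 (\<delta> * (g x + 2 * of_real pi * \<i> * of_int nd)))"
    have mE: "mholo U Ep" "mholo U Em" unfolding Ep_def Em_def by (intro mholo_exp_sigma3 holomorphic_intros g(1))+
    have lE: "(Ep \<longlongrightarrow> Ep (?p t)) (left_side ?p t)" "(Em \<longlongrightarrow> Em (?p t)) (right_side ?p t)"
      unfolding s using mholo_tendsto[OF mE(1) arc_boxD(2)[OF bx(1)] ptU] mholo_tendsto[OF mE(2) arc_boxD(2)[OF bx(1)] ptU]
      by (auto intro: tendsto_mono[OF at_within_le_nhds])
    have ev: "\<forall>\<^sub>F z in left_side ?p t. z \<in> Up" "\<forall>\<^sub>F z in right_side ?p t. z \<in> Um" unfolding s by (simp_all add: eventually_at_filter)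
    have 1: "(Z0 \<longlongrightarrow> Lp ** Ep (?p t)) (left_side ?p t)"
      by (rule Lim_transform_eventually[OF tendsto_mm[OF Ls(1) lE(1)]])
         (use ev(1) g(2) in \<open>auto simp: Z0_def Ep_def elim!: eventually_mono\<close>)
    have 2: "(Z0 \<longlongrightarrow> Lm ** Em (?p t)) (right_side ?p t)"
      by (rule Lim_transform_eventually[OF tendsto_mm[OF Ls(2) lE(2)]])
         (use ev(2) g(3) in \<open>auto simp: Z0_def Em_def elim!: eventually_mono\<close>)
    have pn: "?p t \<noteq> 0" using pO'[of t] t by auto
    have nrm: "((\<lambda>z. B / norm z) \<longlongrightarrow> B / norm (?p t)) (at (?p t) within S)" for S
      by (intro tendsto_intros) (use pn in auto)
    have bnd: "norm (l $ 1 $ 1 - 1) \<le> B / norm (?p t)"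
      if l: "(Z0 \<longlongrightarrow> l) (at (?p t) within S)" and nb: "at (?p t) within S \<noteq> bot" and ev: "\<forall>\<^sub>F z in at (?p t) within S. z \<in> ?O' - C" for S l
    proof (rule tendsto_le[OF nb nrm])
      show "((\<lambda>z. norm (Z0 z $ 1 $ 1 - 1)) \<longlongrightarrow> norm (l $ 1 $ 1 - 1)) (at (?p t) within S)"
        by (intro tendsto_intros tendsto_vec_nth l)
      show "\<forall>\<^sub>F z in at (?p t) within S. norm (Z0 z $ 1 $ 1 - 1) \<le> B / norm z"
        using ev by eventually_elim (use Zb[of _ 1 1] in simp)
    qed
    have OC: "Up \<subseteq> ?O' - C" "Um \<subseteq> ?O' - C" using bx(2,3) by blast+
    have evO: "\<forall>\<^sub>F z in at (?p t) within Up. z \<in> ?O' - C" "\<forall>\<^sub>F z in at (?p t) within Um. z \<in> ?O' - C"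
      unfolding eventually_at_filter using OC by (intro always_eventually; blast)+
    have b1: "norm ((Lp ** Ep (?p t)) $ 1 $ 1 - 1) \<le> B / norm (?p t)"
      using bnd[of "Lp ** Ep (?p t)" Up] 1 left_side_neq_bot[of ?p t] evO(1) unfolding s by blast
    have b2: "norm ((Lm ** Em (?p t)) $ 1 $ 1 - 1) \<le> B / norm (?p t)"
      using bnd[of "Lm ** Em (?p t)" Um] 2 right_side_neq_bot[of ?p t] evO(2) unfolding s by blast
    have "M_inf \<delta> ** Ep (?p t) = Em (?p t) ** D"
      unfolding Ep_def Em_def by (rule MD[OF box_c0[OF bx(1) t g]])
    then have "Lp ** Ep (?p t) = (Lm ** Em (?p t)) ** D" unfolding Ls(3) by (simp add: matrix_mul_assoc[symmetric])
    moreover have "(X ** D) $ 1 $ 1 = X $ 1 $ 1 * e" for X :: "complex^2^2" by (simp add: mm2 D_def e_def)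
    ultimately have "(Lp ** Ep (?p t)) $ 1 $ 1 = (Lm ** Em (?p t)) $ 1 $ 1 * e" by metis
    then show ?thesis using b1 b2 by blast
  qed
  have e1: "e = 1"
  proof (rule ccontr)
    assume "e \<noteq> 1"
    define d where "d = norm (e - 1)"
    have d: "0 < d" using \<open>e \<noteq> 1\<close> by (simp add: d_def)
    \<comment> \<open>Chosen such that \<open>\<eta> + \<eta> + \<eta> * d\<close> is
      \<open>d / 2\<close>. With \<open>x\<close> and \<open>y\<close> within \<open>\<eta>\<close>
      of 1, the relation \<open>x = y * e\<close> then contradicts
      \<open>norm (e - 1) = d\<close>.\<close>
    define \<eta> where "\<eta> = d / (2 * (2 + d))"
    have eta: "0 < \<eta>" using d by (simp add: \<eta>_def)
    have "\<exists>T1. \<forall>t\<le>T1. \<bar>B\<bar> / \<eta> < norm (?p t)" by (rule inf_escapes[of "\<bar>B\<bar> / \<eta>"]) blast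
    then obtain T1 where T1: "\<And>t. t \<le> T1 \<Longrightarrow> \<bar>B\<bar> / \<eta> < norm (?p t)" by blast
    define t where "t = min T1 (T - 1)"
    have tT: "t < T" "t \<le> T1" by (auto simp: t_def)
    have "\<bar>B\<bar> / \<eta> < norm (?p t)" by (rule T1[OF tT(2)])
    then have "\<bar>B\<bar> < norm (?p t) * \<eta>" using eta by (simp add: pos_divide_less_eq)
    moreover have "0 < norm (?p t)" using pO'[of t] tT by auto
    ultimately have le: "B / norm (?p t) \<le> \<eta>" by (simp add: pos_divide_le_eq mult.commute)
    obtain x y where xy0: "x = y * e" "norm (x - 1) \<le> B / norm (?p t)" "norm (y - 1) \<le> B / norm (?p t)"
      using sides[OF tT(1)] by blast
    note xy = xy0(1) order_trans[OF xy0(2) le] order_trans[OF xy0(3) le]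
    have eq: "(x - 1) - (y - 1) - (y - 1) * (e - 1) = e - 1" unfolding xy(1) by (simp add: algebra_simps)
    have "norm ((x - 1) - (y - 1) - (y - 1) * (e - 1)) \<le> norm (x - 1) + norm (y - 1) + norm ((y - 1) * (e - 1))"
      using norm_triangle_ineq4[of "(x - 1) - (y - 1)" "(y - 1) * (e - 1)"] norm_triangle_ineq4[of "x - 1" "y - 1"] by linarith
    then have "d \<le> norm (x - 1) + norm (y - 1) + norm (y - 1) * d" unfolding eq norm_mult d_def .
    also have "\<dots> \<le> \<eta> + \<eta> + \<eta> * d" using xy d by (intro add_mono mult_right_mono) auto
    also have "\<dots> = \<eta> * (2 + d)" by (simp add: algebra_simps)
    also have "\<dots> = d / 2" using d by (simp add: \<eta>_def field_simps)
    finally show False using d by simp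
  qed
  have "exp_sigma3 x = mat 1" if "exp x = 1" for x using that by (simp add: mat2_eq_iff exp_minus)
  then have D1: "D = mat 1" using e1 unfolding D_def e_def by blast
  have ext: "mext_at C Z0 w" if w: "w \<in> ?O" for w
  proof (cases "w \<in> C")
    case False
    have OO: "?O - C \<subseteq> ?O' - C" using R(6) by auto
    have "mholo (?O - C) Z0" unfolding Z0_def
      by (intro mholo_mult mholo_exp_sigma3 holomorphic_intros mholo_subset[OF mholo_\<Psi>] holomorphic_on_subset[OF hL OO]) auto
    moreover have "open (?O - C)" using oO closed_C by (rule open_Diff)
    ultimately show ?thesis unfolding mext_at_def using w False by blast
  next
    case True
    then obtain t where t: "t < T" "w = ?p t" using CO w by blast
    have "mext_at C (\<lambda>z. \<Psi> z ** exp_sigma3 (\<delta> * L z)) (?p t)"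
    proof (rule arc_mext[OF arc_at_inf, of t "- t" "?O' \<inter> ball (?p t) (norm (?p t))" "M_inf \<delta>"])
      show "t < 0" "0 < - t" using t T(1) by auto
      show "open (?O' \<inter> ball (?p t) (norm (?p t)))" using oO' by auto
      show "?p t \<in> ?O' \<inter> ball (?p t) (norm (?p t))" using t by (intro pO') simp
      show "has_jump \<Psi> ?p s (M_inf \<delta>)" if "\<bar>s - t\<bar> < - t" for s using that by (intro jump_inf) (simp add: abs_less_iff)
      fix \<epsilon> U Up Um assume bx: "arc_box ?p t \<epsilon> U Up Um" "U \<subseteq> ?O' \<inter> ball (?p t) (norm (?p t))" "U - C = Up \<union> Um"
      obtain g and nu nd :: int where g: "g holomorphic_on U" "\<forall>x\<in>Up. L x = g x + 2 * of_real pi * \<i> * of_int nu"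
        "\<forall>x\<in>Um. L x = g x + 2 * of_real pi * \<i> * of_int nd" using box_log[OF bx] by blast
      have "M_inf \<delta> ** exp_sigma3 (\<delta> * (g x + 2 * of_real pi * \<i> * of_int nu)) = exp_sigma3 (\<delta> * (g x + 2 * of_real pi * \<i> * of_int nd))" for x
        using MD[OF box_c0[OF bx(1) t(1) g], of "g x"] unfolding D1 by simp
      then show "\<exists>Np Nm. mholo U Np \<and> mholo U Nm \<and> (\<forall>z\<in>Up. exp_sigma3 (\<delta> * L z) = Np z) \<and> (\<forall>z\<in>Um. exp_sigma3 (\<delta> * L z) = Nm z) \<and> (\<forall>z\<in>U. M_inf \<delta> ** Np z = Nm z)"
        by (intro exI[of _ "\<lambda>x. exp_sigma3 (\<delta> * (g x + 2 * of_real pi * \<i> * of_int nu))"]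
            exI[of _ "\<lambda>x. exp_sigma3 (\<delta> * (g x + 2 * of_real pi * \<i> * of_int nd))"] conjI mholo_exp_sigma3 holomorphic_intros g(1))
           (use g in auto)
    qed
    then show ?thesis using t unfolding Z0_def by simp
  qed
  have "\<exists>f. f holomorphic_on ?O \<and> (\<forall>z\<in>?O - C. f z = Z0 z $ i $ k)" for i k
  proof -
    have "ext_at C (\<lambda>z. Z0 z $ i $ k) w" if "w \<in> ?O" for w using ext[OF that] unfolding mext_at_iff by blast
    from ext_glue[OF interior_C oO this] show ?thesis by metis
  qed
  then obtain f where f: "\<And>i k. f i k holomorphic_on ?O" "\<And>i k z. z \<in> ?O - C \<Longrightarrow> f i k z = Z0 z $ i $ k" by metis
  define Z :: "complex \<Rightarrow> complex^2^2" where "Z = (\<lambda>z. \<chi> i k. f i k z)"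
  have Zn: "Z z $ i $ k = f i k z" for z i k by (simp add: Z_def)
  show ?thesis
  proof (rule that[of R Z B])
    show "0 < R" using R(4) by simp
    show "mholo ?O Z" unfolding mholo_def Zn using f(1) by blast
    show "Z z = \<Psi> z ** exp_sigma3 (\<delta> * L z)" if "R < norm z" "z \<notin> C" for z
      unfolding vec_eq_iff Zn using f(2)[of z] that by (simp add: Z0_def)
    show "exp (L z) = z" if "R < norm z" "z \<notin> C" for z using that R(6) by (intro eL) auto
    show "L holomorphic_on ?O - C" by (rule holomorphic_on_subset[OF hL]) (use R(6) in auto)
    show "?O - C \<subseteq> D_inf a \<Gamma>" by (rule OD)
    fix z :: complex and i k :: 2 assume z: "R < norm z"
    show "norm (Z z $ i $ k - mat 1 $ i $ k) \<le> B / norm z"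
    proof (rule ccontr)
      assume n: "\<not> norm (Z z $ i $ k - mat 1 $ i $ k) \<le> B / norm z"
      \<comment> \<open>The bound is known off the graph and passes to points of the graph by
        continuity, as the graph has no interior.\<close>
      have cf: "continuous_on ?O (\<lambda>z. norm (f i k z - mat 1 $ i $ k) - B / norm z)"
        by (intro continuous_intros holomorphic_on_imp_continuous_on f(1)) (use R(4) in auto)
      let ?E = "?O \<inter> (\<lambda>z. norm (f i k z - mat 1 $ i $ k) - B / norm z) -` {0<..}"
      have "open ?E" by (intro continuous_open_preimage cf oO open_greaterThan)
      moreover have "?E \<subseteq> C"
      proof
        fix x assume x: "x \<in> ?E"
        show "x \<in> C"
        proof (rule ccontr)
          assume "x \<notin> C"
          then have "norm (f i k x - mat 1 $ i $ k) \<le> B / norm x" using Zb[of x i k] f(2)[of x i k] x R(6) by auto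
          then show False using x by auto
        qed
      qed
      ultimately have "?E \<subseteq> interior C" by (rule interior_maximal[rotated])
      moreover have "z \<in> ?E" using z n by (simp add: Zn)
      ultimately show False using interior_C by blast
    qed
  qed
qed

end

subsection \<open>The logarithmic derivative\<close>

text \<open>The difference quotient at 0 is entire with a limit at infinity, so Liouville's theorem
  makes it constant.\<close>

lemma entire_linear_growth:
  assumes f: "f holomorphic_on UNIV" and lim: "((\<lambda>z. f z / z) \<longlongrightarrow> b) at_infinity"
  shows "f z = f 0 + b * z"
proof -
  define g where "g = (\<lambda>z. if z = 0 then deriv f 0 else (f z - f 0) / (z - 0))"
  have hg: "g holomorphic_on UNIV" unfolding g_def by (rule pole_lemma[OF f]) simp
  have 1: "((\<lambda>z. f z / z - f 0 * inverse z) \<longlongrightarrow> b - f 0 * 0) at_infinity"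
    by (intro tendsto_intros lim tendsto_inverse_0)
  have 2: "\<forall>\<^sub>F z in at_infinity. f z / z - f 0 * inverse z = g z"
    using eventually_not_equal_at_infinity[of 0] by eventually_elim (simp add: g_def field_simps)
  have "(g \<longlongrightarrow> b) at_infinity" using Lim_transform_eventually[OF 1 2] by simp
  then have "g z = b" by (rule Liouville_weak[OF hg])
  then show ?thesis by (cases "z = 0") (auto simp: g_def field_simps)
qed

text \<open>This is \<open>A ** \<sigma>\<^sub>3 ** adj2 A\<close>, the conjugate of
  \<open>\<sigma>\<^sub>3\<close> by \<open>A\<close> when the determinant is 1.\<close>

definition twist :: "complex^2^2 \<Rightarrow> complex^2^2" where
  "twist A = (\<chi> i k. A$i$1 * adj2 A$1$k - A$i$2 * adj2 A$2$k)"

lemma twist_nth: "twist A $ i $ k = A$i$1 * adj2 A$1$k - A$i$2 * adj2 A$2$k"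
  by (simp add: twist_def)

lemma adj2_exp_sigma3: "adj2 (exp_sigma3 x) = exp_sigma3 (- x)"
  by (simp add: mat2_eq_iff)

lemma logder_nth: "logder \<Phi> z $ i $ k =
    deriv (\<lambda>z. \<Phi> z$i$1) z * adj2 (\<Phi> z)$1$k + deriv (\<lambda>z. \<Phi> z$i$2) z * adj2 (\<Phi> z)$2$k"
  by (simp add: logder_def mm2)

text \<open>Product rule: the derivative of the power contributes \<open>c * l'\<close> times the
  conjugate of \<open>\<sigma>\<^sub>3\<close>, and otherwise the powers cancel. It serves at a
  singular point with exponent \<open>\<alpha> j\<close> and at infinity with
  \<open>- \<delta>\<close>.\<close>

lemma logder_mult_exp_sigma3:
  assumes A: "mholo S A" "open S" "z \<in> S" and l: "(l has_field_derivative l') (at z)"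
    and eq: "\<forall>\<^sub>F y in nhds z. \<Phi> y = A y ** exp_sigma3 (c * l y)"
  shows "deriv (\<lambda>y. \<Phi> y$i$1) z = (deriv (\<lambda>y. A y$i$1) z + c * l' * A z$i$1) * exp (c * l z)"
    and "deriv (\<lambda>y. \<Phi> y$i$2) z = (deriv (\<lambda>y. A y$i$2) z - c * l' * A z$i$2) * exp (- (c * l z))"
    and "logder \<Phi> z $ i $ k = logder A z $ i $ k + c * l' * twist (A z) $ i $ k"
proof -
  have dA: "((\<lambda>y. A y$i$m) has_field_derivative deriv (\<lambda>y. A y$i$m) z) (at z)" for i m
    using A unfolding mholo_def by (blast intro: holomorphic_derivI)
  have e1: "\<forall>\<^sub>F y in nhds z. \<Phi> y$i$1 = A y$i$1 * exp (c * l y)" for i using eq by eventually_elim (simp add: mm2)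
  have e2: "\<forall>\<^sub>F y in nhds z. \<Phi> y$i$2 = A y$i$2 * exp ((- c) * l y)" for i using eq by eventually_elim (simp add: mm2)
  have d1: "deriv (\<lambda>y. \<Phi> y$i$1) z = (deriv (\<lambda>y. A y$i$1) z + c * l' * A z$i$1) * exp (c * l z)" for i
    unfolding deriv_cong_ev[OF e1 refl]
    by (rule DERIV_imp_deriv, rule DERIV_cong[OF DERIV_mult[OF dA[of i 1] DERIV_chain2[OF DERIV_exp DERIV_cmult[OF l, of c]]]])
       (simp add: algebra_simps)
  have d2: "deriv (\<lambda>y. \<Phi> y$i$2) z = (deriv (\<lambda>y. A y$i$2) z - c * l' * A z$i$2) * exp (- (c * l z))" for i
    unfolding deriv_cong_ev[OF e2 refl]
    by (rule DERIV_imp_deriv, rule DERIV_cong[OF DERIV_mult[OF dA[of i 2] DERIV_chain2[OF DERIV_exp DERIV_cmult[OF l, of "- c"]]]])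
       (simp add: algebra_simps)
  have Phi: "\<Phi> z = A z ** exp_sigma3 (c * l z)" using eq by (rule eventually_nhds_x_imp_x)
  have a: "adj2 (\<Phi> z)$1$k = exp (- (c * l z)) * adj2 (A z)$1$k" "adj2 (\<Phi> z)$2$k = exp (c * l z) * adj2 (A z)$2$k"
    unfolding Phi adj2_mult adj2_exp_sigma3 by (simp_all add: mm2)
  have g: "X * exp (c * l z) * (exp (- (c * l z)) * Y) = X * Y" "X * exp (- (c * l z)) * (exp (c * l z) * Y) = X * Y" for X Y
    by (simp_all add: exp_minus field_simps)
  show "logder \<Phi> z $ i $ k = logder A z $ i $ k + c * l' * twist (A z) $ i $ k"
    unfolding logder_nth d1 d2 a g twist_nth by (simp add: algebra_simps)
  show "deriv (\<lambda>y. \<Phi> y$i$1) z = (deriv (\<lambda>y. A y$i$1) z + c * l' * A z$i$1) * exp (c * l z)"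
    "deriv (\<lambda>y. \<Phi> y$i$2) z = (deriv (\<lambda>y. A y$i$2) z - c * l' * A z$i$2) * exp (- (c * l z))" by (fact d1 d2)+
qed

text \<open>All three limits are read off in the variable \<open>inverse z\<close>; the factor
  \<open>z\<^sup>2\<close> compensates the derivative of \<open>inverse z\<close>.\<close>

lemma expansion_limits:
  assumes R: "0 < R" and F: "F holomorphic_on ball 0 (inverse R)"
    and f: "\<And>z. R < norm z \<Longrightarrow> f z = m + inverse z * F (inverse z)"
  shows "(f \<longlongrightarrow> m) at_infinity" "((\<lambda>z. z * (f z - m)) \<longlongrightarrow> F 0) at_infinity"
    "((\<lambda>z. z\<^sup>2 * deriv f z) \<longlongrightarrow> - F 0) at_infinity"
proof -
  have evR: "\<forall>\<^sub>F z::complex in at_infinity. R < norm z"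
    unfolding eventually_at_infinity by (intro exI[of _ "R + 1"]) auto
  have i0: "0 \<in> ball 0 (inverse R)" using R by simp
  have inv: "z \<noteq> 0" "inverse z \<in> ball 0 (inverse R)" if "R < norm z" for z :: complex
    using that R less_imp_inverse_less[OF that R] by (auto simp: norm_inverse)
  have lim: "((\<lambda>z. G (inverse z)) \<longlongrightarrow> G 0) at_infinity" if "G holomorphic_on ball 0 (inverse R)" for G :: "complex \<Rightarrow> complex"
    using holomorphic_on_imp_continuous_on[OF that] i0 continuous_on_eq_continuous_at[OF open_ball]
    by (intro isCont_tendsto_compose[OF _ tendsto_inverse_0]) blast
  have 1: "((\<lambda>z. m + inverse z * F (inverse z)) \<longlongrightarrow> m + 0 * F 0) at_infinity"
    by (intro tendsto_intros tendsto_inverse_0 lim F)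
  have "\<forall>\<^sub>F z in at_infinity. m + inverse z * F (inverse z) = f z" using evR by eventually_elim (simp add: f)
  then show "(f \<longlongrightarrow> m) at_infinity" using Lim_transform_eventually[OF 1] by simp
  have "\<forall>\<^sub>F z in at_infinity. F (inverse z) = z * (f z - m)" using evR by eventually_elim (use f inv in simp)
  then show "((\<lambda>z. z * (f z - m)) \<longlongrightarrow> F 0) at_infinity" by (rule Lim_transform_eventually[OF lim[OF F]])
  have 3: "((\<lambda>z. - F (inverse z) - inverse z * deriv F (inverse z)) \<longlongrightarrow> - F 0 - 0 * deriv F 0) at_infinity"
    by (intro tendsto_intros tendsto_inverse_0 lim F holomorphic_deriv) auto
  have "- F (inverse z) - inverse z * deriv F (inverse z) = z\<^sup>2 * deriv f z" if z: "R < norm z" for z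
  proof -
    have "open {y::complex. R < norm y}" by (intro open_Collect_less continuous_intros)
    then have "\<forall>\<^sub>F y in nhds z. R < norm y" using z by (auto simp: eventually_nhds)
    then have e: "\<forall>\<^sub>F y in nhds z. f y = m + inverse y * F (inverse y)" by eventually_elim (rule f)
    have dI: "(inverse has_field_derivative - (inverse z ^ Suc (Suc 0))) (at z)" by (rule DERIV_inverse[OF inv(1)[OF z]])
    have dF: "(F has_field_derivative deriv F (inverse z)) (at (inverse z))" by (rule holomorphic_derivI[OF F open_ball inv(2)[OF z]])
    have "deriv f z = (0 + (- (inverse z ^ Suc (Suc 0)) * F (inverse z) + deriv F (inverse z) * - (inverse z ^ Suc (Suc 0)) * inverse z))"
      unfolding deriv_cong_ev[OF e refl]
      by (rule DERIV_imp_deriv, rule DERIV_add[OF DERIV_const DERIV_mult[OF dI DERIV_chain2[OF dF dI]]])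
    then show ?thesis using inv(1)[OF z] by (simp add: field_simps power2_eq_square)
  qed
  then have "\<forall>\<^sub>F z in at_infinity. - F (inverse z) - inverse z * deriv F (inverse z) = z\<^sup>2 * deriv f z"
    using evR by (auto elim!: eventually_mono)
  from Lim_transform_eventually[OF 3 this] show "((\<lambda>z. z\<^sup>2 * deriv f z) \<longlongrightarrow> - F 0) at_infinity" by simp
qed

text \<open>\<open>heun_mu\<close> and \<open>heun_nu\<close> are the coefficients that make the
  terms of degree 4 and 3 agree. The difference of the two sides then has degree at most 2 and
  vanishes at 0, 1 and \<open>a\<close>, where the hypotheses give the values of the
  quartic.\<close>

lemma heun_accessory_identity:
  fixes a :: complex
  assumes a: "a \<noteq> 0" "a \<noteq> 1"
    and c0: "D = (\<alpha> 1 * a)\<^sup>2"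
    and c1: "\<delta>\<^sup>2 - 2 * \<delta> * b + A + B + D = (\<alpha> 3 * (1 - a))\<^sup>2"
    and ca: "\<delta>\<^sup>2 * a^4 - 2 * \<delta> * b * a^3 + A * a\<^sup>2 + B * a + D = (\<alpha> 2 * (a * (a - 1)))\<^sup>2"
  shows "(\<alpha> 1 * ((z - a) * (z - 1)) + \<alpha> 2 * (z * (z - 1)) + \<alpha> 3 * (z * (z - a)))\<^sup>2
      - z * (z - a) * (z - 1) * (\<alpha> 1 * (2 * z - a - 1) + \<alpha> 2 * (2 * z - 1) + \<alpha> 3 * (2 * z - a))
      - z * (z - a) * (z - 1) * (b - 2 * \<delta> * z)
      - (\<delta>\<^sup>2 * z^4 - 2 * \<delta> * b * z^3 + A * z\<^sup>2 + B * z + D)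
    = z * (z - a) * (z - 1) * (heun_mu \<alpha> \<delta> * z + heun_nu a \<alpha> \<delta> b)" (is "?L = ?R")
proof -
  define x y w where "x = \<alpha> 1" and "y = \<alpha> 2" and "w = \<alpha> 3"
  define e0 where "e0 = D - (x * a)\<^sup>2"
  define e1 where "e1 = \<delta>\<^sup>2 - 2 * \<delta> * b + A + B + D - (w * (1 - a))\<^sup>2"
  define ea where "ea = \<delta>\<^sup>2 * a^4 - 2 * \<delta> * b * a^3 + A * a\<^sup>2 + B * a + D - (y * (a * (a - 1)))\<^sup>2"
  \<comment> \<open>Lagrange interpolation of the difference at 0, 1 and \<open>a\<close>, with the
    denominators cleared by the factor \<open>a * (a - 1)\<close>.\<close>
  have "a * (a - 1) * (?L - ?R) = - (e0 * (a - 1) * (z - a) * (z - 1) - a * e1 * z * (z - a) + ea * z * (z - 1))"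
    unfolding heun_mu_def heun_nu_def e0_def e1_def ea_def x_def[symmetric] y_def[symmetric] w_def[symmetric]
    by (simp only: power2_eq_square power3_eq_cube power4_eq_xxxx) (simp add: algebra_simps)
  also have "\<dots> = 0" using c0 c1 ca by (simp add: e0_def e1_def ea_def x_def y_def w_def)
  finally show ?thesis using a by simp
qed

context heun_rh
begin

definition hq :: "complex \<Rightarrow> complex" where "hq z = z * (z - a) * (z - 1)"

definition hqj :: "3 \<Rightarrow> complex \<Rightarrow> complex" where
  "hqj j z = (if j = 1 then (z - a) * (z - 1) else if j = 2 then z * (z - 1) else z * (z - a))"

lemma hq_fac: "hq z = (z - sing a j) * hqj j z"
  using exhaust_3[of j] by (auto simp: hq_def hqj_def sing_def)

lemma holo_hq: "hq holomorphic_on S" "hqj j holomorphic_on S"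
  using exhaust_3[of j] unfolding hq_def[abs_def] hqj_def[abs_def] by (auto intro!: holomorphic_intros)

lemma hq_nz: "z \<notin> C \<Longrightarrow> hq z \<noteq> 0"
proof -
  assume "z \<notin> C"
  moreover have "sing a j \<in> C" for j using sing_in_ell[of j] unfolding gamma_def by blast
  ultimately have "z \<noteq> sing a j" for j by blast
  from this[of 1] this[of 2] this[of 3] show ?thesis by (simp add: hq_def sing_def)
qed

text \<open>Limits along this filter are unique because of it: a graph containing a neighbourhood of
  infinity would have interior points.\<close>

lemma infinity_off_nontrivial: "infinity_off a \<Gamma> \<noteq> bot"
proof
  assume "infinity_off a \<Gamma> = bot"
  then have "\<forall>\<^sub>F z in infinity_off a \<Gamma>. False" by simp
  then obtain b where b: "\<And>z. b \<le> norm z \<Longrightarrow> z \<in> C"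
    unfolding infinity_off_def eventually_inf_principal eventually_at_infinity by auto
  have "open {z::complex. b < norm z}" by (intro open_Collect_less continuous_intros)
  moreover have "{z. b < norm z} \<subseteq> C" using b by auto
  ultimately have "{z. b < norm z} \<subseteq> interior C" by (rule interior_maximal[rotated])
  moreover have "of_real (\<bar>b\<bar> + 1) \<in> {z::complex. b < norm z}" unfolding mem_Collect_eq norm_of_real by arith
  ultimately show False using interior_C by blast
qed

lemma eventually_infinity_off: "\<forall>\<^sub>F z in at_infinity. P z \<Longrightarrow> \<forall>\<^sub>F z in infinity_off a \<Gamma>. P z \<and> z \<notin> C"
  unfolding infinity_off_def eventually_inf_principal by (auto elim!: eventually_mono)

lemma tendsto_infinity_off: "(f \<longlongrightarrow> l) at_infinity \<Longrightarrow> (f \<longlongrightarrow> l) (infinity_off a \<Gamma>)"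
  unfolding infinity_off_def by (rule tendsto_mono[OF inf_le1])

text \<open>The decay makes \<open>z\<close> times the deviation from the identity bounded, so in
  the variable \<open>inverse z\<close> its singularity at 0 is removable.\<close>

lemma infinity_expansion:
  obtains R Z F where "0 < R" "mholo {z. R < norm z} Z" "\<And>z. R < norm z \<Longrightarrow> z \<notin> C \<Longrightarrow> Z z = \<Psi> z ** exp_sigma3 (\<delta> * L z)"
    "\<And>z. R < norm z \<Longrightarrow> z \<notin> C \<Longrightarrow> exp (L z) = z" "L holomorphic_on {z. R < norm z} - C" "{z. R < norm z} - C \<subseteq> D_inf a \<Gamma>"
    "\<And>i k. F i k holomorphic_on ball 0 (inverse R)"
    "\<And>z i k. R < norm z \<Longrightarrow> Z z $ i $ k = mat 1 $ i $ k + inverse z * F i k (inverse z)"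
proof -
  obtain R B Z where R: "0 < R" and Z: "mholo {z. R < norm z} Z" "\<And>z. R < norm z \<Longrightarrow> z \<notin> C \<Longrightarrow> Z z = \<Psi> z ** exp_sigma3 (\<delta> * L z)"
    and L: "\<And>z. R < norm z \<Longrightarrow> z \<notin> C \<Longrightarrow> exp (L z) = z" "L holomorphic_on {z. R < norm z} - C"
    and B: "\<And>z i k. R < norm z \<Longrightarrow> norm (Z z $ i $ k - mat 1 $ i $ k) \<le> B / norm z" and D: "{z. R < norm z} - C \<subseteq> D_inf a \<Gamma>"
    by (rule inf_local) blast
  define h where "h i k \<zeta> = (Z (inverse \<zeta>) $ i $ k - mat 1 $ i $ k) * inverse \<zeta>" for i k \<zeta>
  let ?b = "ball 0 (inverse R) :: complex set"
  have inv: "R < norm (inverse \<zeta>)" if "\<zeta> \<in> ?b - {0}" for \<zeta>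
    using that R less_imp_inverse_less[of "norm \<zeta>" "inverse R"] by (auto simp: norm_inverse)
  have "\<exists>g. g holomorphic_on ?b \<and> (\<forall>z\<in>?b - {0}. g z = h i k z)" for i k
  proof -
    have hZ: "(\<lambda>z. Z z $ i $ k) holomorphic_on {z. R < norm z}" using Z(1) unfolding mholo_def by blast
    have "((\<lambda>z. Z z $ i $ k) \<circ> inverse) holomorphic_on ?b - {0}"
      by (rule holomorphic_on_compose_gen[OF _ hZ]) (use inv in \<open>auto intro!: holomorphic_intros\<close>)
    then have hh: "h i k holomorphic_on ?b - {0}" unfolding h_def[abs_def] o_def by (intro holomorphic_intros) auto
    have "norm (h i k \<zeta>) \<le> B" if z: "\<zeta> \<in> ?b - {0}" for \<zeta>
    proof -
      have p: "0 < norm (inverse \<zeta>)" using inv[OF z] R by linarith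
      have "norm (h i k \<zeta>) \<le> B / norm (inverse \<zeta>) * norm (inverse \<zeta>)"
        unfolding h_def norm_mult by (intro mult_right_mono B inv z) simp
      then show ?thesis using p by simp
    qed
    moreover have "\<forall>\<^sub>F \<zeta> in at 0. \<zeta> \<in> ?b - {0}" using R by (intro eventually_at_in_open) auto
    ultimately have "\<exists>B. \<forall>\<^sub>F \<zeta> in at 0. norm (h i k \<zeta>) \<le> B" by (intro exI[of _ B]) (auto elim!: eventually_mono)
    moreover have "0 \<in> interior ?b" using R by simp
    ultimately show ?thesis using holomorphic_on_extend_bounded[OF hh] by blast
  qed
  then obtain F where F: "\<And>i k. F i k holomorphic_on ?b" "\<And>i k z. z \<in> ?b - {0} \<Longrightarrow> F i k z = h i k z" by metis
  have FF: "Z z $ i $ k = mat 1 $ i $ k + inverse z * F i k (inverse z)" if z: "R < norm z" for z i k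
  proof -
    have z0: "z \<noteq> 0" using z R by auto
    then have "inverse z \<in> ?b - {0}" using z R less_imp_inverse_less[OF z R] by (auto simp: norm_inverse)
    from F(2)[OF this] show ?thesis using z0 by (simp add: h_def field_simps)
  qed
  show ?thesis by (rule that[of R Z F]) (use R Z L D F(1) FF in blast)+
qed

text \<open>At the singular points and at infinity the powers have determinant 1 and drop out of the
  local forms.\<close>

lemma det_\<Psi>: "z \<notin> C \<Longrightarrow> det (\<Psi> z) = 1"
proof -
  assume z: "z \<notin> C"
  have ext: "ext_at C (\<lambda>z. det (\<Psi> z)) w" for w
  proof (cases "w \<in> range (sing a)")
    case False then show ?thesis using reg_all unfolding reg_def by blast
  next
    case True
    then obtain j where j: "w = sing a j" by blast
    obtain U A l where U: "open U" "sing a j \<in> U" "mholo U A" "\<And>z. z \<in> U - C \<Longrightarrow> \<Psi> z = A z ** exp_sigma3 (\<alpha> j * l z)"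
      by (rule sing_local[of j]) blast
    have "(\<lambda>z. det (A z)) holomorphic_on U" unfolding det_2 using U(3) unfolding mholo_def by (intro holomorphic_intros) auto
    moreover have "det (\<Psi> z) = det (A z)" if "z \<in> U - C" for z unfolding U(4)[OF that] by (simp add: det_mul)
    ultimately show ?thesis unfolding ext_at_def j using U(1,2) by blast
  qed
  obtain g where g: "g holomorphic_on UNIV" "\<And>z. z \<in> UNIV - C \<Longrightarrow> g z = det (\<Psi> z)"
    using ext_glue[OF interior_C open_UNIV ext] by blast
  obtain R Z F where R: "0 < R" and Z: "mholo {z. R < norm z} Z" "\<And>z. R < norm z \<Longrightarrow> z \<notin> C \<Longrightarrow> Z z = \<Psi> z ** exp_sigma3 (\<delta> * L z)"
    and F: "\<And>i k. F i k holomorphic_on ball 0 (inverse R)"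
      "\<And>z i k. R < norm z \<Longrightarrow> Z z $ i $ k = mat 1 $ i $ k + inverse z * F i k (inverse z)"
    by (rule infinity_expansion) blast
  have lim: "((\<lambda>z. Z z $ i $ k) \<longlongrightarrow> mat 1 $ i $ k) at_infinity" for i k by (rule expansion_limits(1)[OF R F])
  have "((\<lambda>z. det (Z z)) \<longlongrightarrow> det (mat 1 :: complex^2^2)) at_infinity" unfolding det_2 by (intro tendsto_intros lim)
  then have lim1: "((\<lambda>z. det (Z z)) \<longlongrightarrow> 1) at_infinity" by simp
  have gZ: "det (Z z) = g z" if "R < norm z" for z
  proof (rule continuous_eq_off[OF interior_C, of "{z. R < norm z}" "\<lambda>z. det (Z z)" g])
    show "open {z::complex. R < norm z}" by (intro open_Collect_less continuous_intros)
    show "continuous_on {z. R < norm z} (\<lambda>z. det (Z z))" unfolding det_2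
      using Z(1) unfolding mholo_def by (intro continuous_intros holomorphic_on_imp_continuous_on) auto
    show "continuous_on {z. R < norm z} g" using g(1) holomorphic_on_imp_continuous_on continuous_on_subset by blast
    show "det (Z z) = g z" if "z \<in> {z. R < norm z} - C" for z using that Z(2)[of z] g(2)[of z] by (simp add: det_mul)
  qed (use that in simp)
  have "\<forall>\<^sub>F z in at_infinity. det (Z z) = g z"
    unfolding eventually_at_infinity by (intro exI[of _ "R + 1"]) (use gZ in auto)
  from Lim_transform_eventually[OF lim1 this] have "g z = 1" by (rule Liouville_weak[OF g(1)])
  then show ?thesis using g(2)[of z] z by simp
qed

text \<open>The trace of the logarithmic derivative is the derivative of the determinant, which is
  constant.\<close>

lemma logder_trace: assumes "z \<notin> C" shows "logder \<Psi> z $ 2 $ 2 = - logder \<Psi> z $ 1 $ 1"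
proof -
  have o: "open (- C)" using closed_C by (rule open_Compl)
  have d: "((\<lambda>y. \<Psi> y$i$k) has_field_derivative deriv (\<lambda>y. \<Psi> y$i$k) z) (at z)" for i k
    using rh_holo[of i k] o assms by (intro holomorphic_derivI) auto
  have "\<forall>\<^sub>F y in nhds z. y \<in> - C" using o assms by (intro eventually_nhds_in_open) auto
  then have e: "\<forall>\<^sub>F y in nhds z. \<Psi> y$1$1 * \<Psi> y$2$2 - \<Psi> y$1$2 * \<Psi> y$2$1 = 1"
    by eventually_elim (use det_\<Psi> in \<open>simp add: det_2\<close>)
  have "deriv (\<lambda>y. \<Psi> y$1$1 * \<Psi> y$2$2 - \<Psi> y$1$2 * \<Psi> y$2$1) z = 0"
    unfolding deriv_cong_ev[OF e refl] by simp
  moreover note DERIV_imp_deriv[OF DERIV_diff[OF DERIV_mult[OF d[of 1 1] d[of 2 2]] DERIV_mult[OF d[of 1 2] d[of 2 1]]]]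
  ultimately show ?thesis unfolding logder_nth by (simp add: algebra_simps)
qed

text \<open>Near \<open>sing a j\<close> the numerator is \<open>hq\<close> times something
  holomorphic plus \<open>\<alpha> j * hqj j\<close> times a conjugate of
  \<open>\<sigma>\<^sub>3\<close>. At the point only the second term survives. The last clause
  computes minus the determinant of this traceless matrix; it expresses that the residue has the
  eigenvalues \<open>\<alpha> j\<close> and \<open>- \<alpha> j\<close>.\<close>

lemma connection_entire:
  obtains P where "\<And>i k. P i k holomorphic_on UNIV" "\<And>i k z. z \<notin> C \<Longrightarrow> P i k z = hq z * logder \<Psi> z $ i $ k"
    "\<And>j. (P 1 1 (sing a j))\<^sup>2 + P 1 2 (sing a j) * P 2 1 (sing a j) = (\<alpha> j * hqj j (sing a j))\<^sup>2"
proof -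
  have loc: "\<exists>U A. open U \<and> sing a j \<in> U \<and> mholo U A \<and> (\<forall>z\<in>U - C. \<forall>i k. hq z * logder \<Psi> z $ i $ k =
      hq z * logder A z $ i $ k + \<alpha> j * hqj j z * twist (A z) $ i $ k) \<and> det (A (sing a j)) = 1" for j
  proof -
    obtain U A l where U: "open U" "sing a j \<in> U" "mholo U A" "l holomorphic_on U - C"
      "\<And>z. z \<in> U - C \<Longrightarrow> exp (l z) = z - sing a j" "\<And>z. z \<in> U - C \<Longrightarrow> \<Psi> z = A z ** exp_sigma3 (\<alpha> j * l z)"
      by (rule sing_local[of j]) blast
    have oU: "open (U - C)" using U(1) closed_C by (rule open_Diff)
    have "hq z * logder \<Psi> z $ i $ k = hq z * logder A z $ i $ k + \<alpha> j * hqj j z * twist (A z) $ i $ k" if z: "z \<in> U - C" for z i k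
    proof -
      have ev: "\<forall>\<^sub>F y in nhds z. y \<in> U - C" using oU z by (rule eventually_nhds_in_open)
      have dl: "(l has_field_derivative deriv l z) (at z)" by (rule holomorphic_derivI[OF U(4) oU z])
      have e: "\<forall>\<^sub>F y in nhds z. exp (l y) = y - sing a j" using ev by eventually_elim (rule U(5))
      have "deriv (\<lambda>y. exp (l y)) z = 1" unfolding deriv_cong_ev[OF e refl] by simp
      then have dl1: "(z - sing a j) * deriv l z = 1"
        using DERIV_imp_deriv[OF DERIV_chain2[OF DERIV_exp dl]] U(5)[OF z] by simp
      have zU: "z \<in> U" using z by blast
      have "\<forall>\<^sub>F y in nhds z. \<Psi> y = A y ** exp_sigma3 (\<alpha> j * l y)" using ev by eventually_elim (rule U(6))
      from logder_mult_exp_sigma3(3)[OF U(3,1) zU dl this]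
      have "hq z * logder \<Psi> z $ i $ k = hq z * logder A z $ i $ k + \<alpha> j * ((z - sing a j) * deriv l z) * hqj j z * twist (A z) $ i $ k"
        unfolding hq_fac[of z j] by (simp add: algebra_simps)
      then show ?thesis unfolding dl1 by simp
    qed
    moreover have "det (A (sing a j)) = 1"
    proof (rule continuous_eq_off[OF interior_C U(1) _ _ _ U(2), of "\<lambda>z. det (A z)" "\<lambda>z. 1"])
      show "continuous_on U (\<lambda>z. det (A z))" unfolding det_2
        using U(3) unfolding mholo_def by (intro continuous_intros holomorphic_on_imp_continuous_on) auto
      show "continuous_on U (\<lambda>z. 1::complex)" by simp
      show "det (A z) = 1" if "z \<in> U - C" for z using det_\<Psi>[of z] U(6)[OF that] that by (simp add: det_mul)
    qed
    ultimately show ?thesis using U(1-3) by blast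
  qed
  have hloc: "(\<lambda>z. hq z * logder A z $ i $ k + \<alpha> j * hqj j z * twist (A z) $ i $ k) holomorphic_on U"
    if "open U" "mholo U A" for U A i j k
  proof -
    have 1: "(\<lambda>z. logder A z $ i $ k) holomorphic_on U" using mholo_logder[OF that(2,1)] unfolding mholo_def by blast
    have 2: "(\<lambda>z. twist (A z) $ i $ k) holomorphic_on U"
      using that(2) exhaust_2[of k] unfolding twist_nth mholo_def by (auto intro!: holomorphic_intros)
    show ?thesis by (intro holomorphic_intros 1 2 holo_hq)
  qed
  have "\<exists>p. p holomorphic_on UNIV \<and> (\<forall>z\<in>UNIV - C. p z = hq z * logder \<Psi> z $ i $ k)" for i k
  proof -
    have "ext_at C (\<lambda>z. hq z * logder \<Psi> z $ i $ k) w" for w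
    proof (cases "w \<in> range (sing a)")
      case False
      then have "ext_at C (\<lambda>z. logder \<Psi> z $ i $ k) w" using reg_all unfolding reg_def mext_at_iff by blast
      then obtain U G where "open U" "w \<in> U" "G holomorphic_on U" "\<forall>z\<in>U - C. logder \<Psi> z $ i $ k = G z"
        unfolding ext_at_def by blast
      then show ?thesis unfolding ext_at_def
        by (intro exI[of _ U] exI[of _ "\<lambda>z. hq z * G z"]) (auto intro!: holomorphic_intros holo_hq)
    next
      case True
      then obtain j where j: "w = sing a j" by blast
      obtain U A where "open U" "sing a j \<in> U" "mholo U A" "\<forall>z\<in>U - C. \<forall>i k. hq z * logder \<Psi> z $ i $ k =
        hq z * logder A z $ i $ k + \<alpha> j * hqj j z * twist (A z) $ i $ k" using loc[of j] by blast
      then show ?thesis unfolding ext_at_def j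
        by (intro exI[of _ U] exI[of _ "\<lambda>z. hq z * logder A z $ i $ k + \<alpha> j * hqj j z * twist (A z) $ i $ k"] conjI hloc) auto
    qed
    from ext_glue[OF interior_C open_UNIV this] show ?thesis by metis
  qed
  then obtain P where P: "\<And>i k. P i k holomorphic_on UNIV" "\<And>i k z. z \<in> UNIV - C \<Longrightarrow> P i k z = hq z * logder \<Psi> z $ i $ k" by metis
  show ?thesis
  proof (rule that[of P])
    show "P i k holomorphic_on UNIV" for i k by (rule P)
    show "P i k z = hq z * logder \<Psi> z $ i $ k" if "z \<notin> C" for i k z using P(2) that by blast
    fix j
    obtain U A where U: "open U" "sing a j \<in> U" "mholo U A" "\<And>z i k. z \<in> U - C \<Longrightarrow> hq z * logder \<Psi> z $ i $ k =
        hq z * logder A z $ i $ k + \<alpha> j * hqj j z * twist (A z) $ i $ k" "det (A (sing a j)) = 1" using loc[of j] by blast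
    have v: "P i k (sing a j) = \<alpha> j * hqj j (sing a j) * twist (A (sing a j)) $ i $ k" for i k
    proof -
      have "P i k (sing a j) = hq (sing a j) * logder A (sing a j) $ i $ k + \<alpha> j * hqj j (sing a j) * twist (A (sing a j)) $ i $ k"
      proof (rule continuous_eq_off[OF interior_C U(1) _ _ _ U(2), of "P i k"
            "\<lambda>z. hq z * logder A z $ i $ k + \<alpha> j * hqj j z * twist (A z) $ i $ k"])
        show "continuous_on U (P i k)" using P(1) holomorphic_on_imp_continuous_on continuous_on_subset by blast
        show "continuous_on U (\<lambda>z. hq z * logder A z $ i $ k + \<alpha> j * hqj j z * twist (A z) $ i $ k)"
          by (intro holomorphic_on_imp_continuous_on hloc U)
        show "P i k z = hq z * logder A z $ i $ k + \<alpha> j * hqj j z * twist (A z) $ i $ k" if "z \<in> U - C" for z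
          using P(2)[of z] U(4)[OF that] that by simp
      qed
      then show ?thesis by (simp add: hq_fac[of _ j])
    qed
    \<comment> \<open>The square of a conjugate of \<open>\<sigma>\<^sub>3\<close> is the identity;
      with the adjugate in place of the inverse, \<open>(det B)\<^sup>2\<close> times the
      identity.\<close>
    have "(x * twist B $ 1 $ 1)\<^sup>2 + (x * twist B $ 1 $ 2) * (x * twist B $ 2 $ 1) = x\<^sup>2 * (det B)\<^sup>2" for B and x :: complex
      unfolding twist_nth det_2 by (simp add: power2_eq_square algebra_simps)
    from this[of "\<alpha> j * hqj j (sing a j)" "A (sing a j)"]
    show "(P 1 1 (sing a j))\<^sup>2 + P 1 2 (sing a j) * P 2 1 (sing a j) = (\<alpha> j * hqj j (sing a j))\<^sup>2"
      unfolding v U(5) by simp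
  qed
qed

end

subsection \<open>The Heun equation\<close>

text \<open>To be read with \<open>h\<close> the cubic and \<open>h1\<close> its derivative,
  \<open>\<rho>\<close> the logarithmic derivative of the prefactor \<open>E\<close>,
  \<open>\<rho>1\<close> and \<open>p1\<close> the derivatives of \<open>\<rho>\<close> and of the
  (1,1) numerator, \<open>W\<close> the derivative of \<open>f\<close>, and \<open>Q\<close> minus
  the determinant of the numerators. The terms in \<open>W\<close> cancel, and the coefficient of
  \<open>f\<close> vanishes by the hypothesis \<open>id\<close>.\<close>

lemma heun_reduction:
  fixes h :: complex
  assumes h: "h \<noteq> 0" and id: "(h * \<rho>)\<^sup>2 - h * (h1 * \<rho> + h * \<rho>1) - h * p1 - Q = h * m"
  shows "\<rho> * E * (\<rho> * f + W) + E * (\<rho>1 * f + \<rho> * W + (p1 * f + Q * f / h - W * h1) / h)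
    + (h1 / h - 2 * \<rho>) * (E * (\<rho> * f + W)) + m / h * (E * f) = 0" (is "?L = 0")
proof -
  have "?L * h\<^sup>2 = E * f * (h * m - ((h * \<rho>)\<^sup>2 - h * (h1 * \<rho> + h * \<rho>1) - h * p1 - Q))"
    using h by (simp add: field_simps power2_eq_square)
  then show ?thesis using h id by simp
qed

text \<open>Here \<open>x\<close>, \<open>y\<close>, \<open>w\<close> stand for the linear factors
  of the cubic; the first two lines clear denominators, the third identifies the coefficient of the
  first derivative in the equation.\<close>

lemma heun_coefficients:
  fixes x y w A B D :: complex
  assumes "x \<noteq> 0" "y \<noteq> 0" "w \<noteq> 0"
  defines "h \<equiv> x * y * w" and "\<rho> \<equiv> A * inverse x + B * inverse y + D * inverse w"
    and "h1 \<equiv> y * w + x * w + x * y" and "\<rho>1 \<equiv> - (A * (inverse x)\<^sup>2) - B * (inverse y)\<^sup>2 - D * (inverse w)\<^sup>2"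
  shows "h * \<rho> = A * (y * w) + B * (x * w) + D * (x * y)"
    "h1 * \<rho> + h * \<rho>1 = A * (y + w) + B * (x + w) + D * (x + y)"
    "(1 - 2 * A) / x + (1 - 2 * B) / y + (1 - 2 * D) / w = h1 / h - 2 * \<rho>"
  using assms(1-3) unfolding h_def \<rho>_def h1_def \<rho>1_def by (simp_all add: field_simps power2_eq_square)

context heun_rh
begin

lemma log_derivative:
  assumes S: "open S" "l holomorphic_on S" "\<And>y. y \<in> S \<Longrightarrow> exp (l y) = y - s" and z: "z \<in> S"
  shows "(l has_field_derivative inverse (z - s)) (at z)"
proof -
  have ev: "\<forall>\<^sub>F y in nhds z. exp (l y) = y - s" using eventually_nhds_in_open[OF S(1) z] by eventually_elim (rule S(3))
  have dl: "(l has_field_derivative deriv l z) (at z)" by (rule holomorphic_derivI[OF S(2,1) z])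
  have "deriv (\<lambda>y. exp (l y)) z = 1" unfolding deriv_cong_ev[OF ev refl] by simp
  then have "(z - s) * deriv l z = 1" using DERIV_imp_deriv[OF DERIV_chain2[OF DERIV_exp dl]] S(3)[OF z] by simp
  then have "deriv l z = inverse (z - s)" by (metis inverse_unique)
  then show ?thesis using dl by simp
qed

lemma infinity_local_form:
  assumes Z: "\<And>z. R < norm z \<Longrightarrow> z \<notin> C \<Longrightarrow> Z z = \<Psi> z ** exp_sigma3 (\<delta> * L z)"
    and eL: "\<And>z. R < norm z \<Longrightarrow> z \<notin> C \<Longrightarrow> exp (L z) = z" and hL: "L holomorphic_on {z. R < norm z} - C"
    and z: "R < norm z" "z \<notin> C"
  shows "(L has_field_derivative inverse z) (at z)" "\<forall>\<^sub>F y in nhds z. \<Psi> y = Z y ** exp_sigma3 (- \<delta> * L y)"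
proof -
  have o: "open ({z. R < norm z} - C)" by (intro open_Diff closed_C open_Collect_less continuous_intros)
  have zz: "z \<in> {z. R < norm z} - C" using z by simp
  show "(L has_field_derivative inverse z) (at z)" using log_derivative[OF o hL _ zz, of 0] eL by simp
  show "\<forall>\<^sub>F y in nhds z. \<Psi> y = Z y ** exp_sigma3 (- \<delta> * L y)"
    using eventually_nhds_in_open[OF o zz]
  proof eventually_elim
    case (elim y)
    then have "Z y ** exp_sigma3 (- \<delta> * L y) = \<Psi> y ** (exp_sigma3 (\<delta> * L y) ** exp_sigma3 (- \<delta> * L y))"
      using Z[of y] by (simp add: matrix_mul_assoc)
    then show ?case unfolding exp_sigma3_add by simp
  qed
qed

lemma hq_limits:
  "((\<lambda>z. hq z / z^3) \<longlongrightarrow> 1) at_infinity" "((\<lambda>z. hq z / z\<^sup>2 - z) \<longlongrightarrow> - (1 + a)) at_infinity"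
proof -
  have 1: "((\<lambda>z. (1 - a * inverse z) * (1 - inverse z)) \<longlongrightarrow> (1 - a * 0) * (1 - 0)) at_infinity"
    by (intro tendsto_intros tendsto_inverse_0)
  have "\<forall>\<^sub>F z in at_infinity. (1 - a * inverse z) * (1 - inverse z) = hq z / z^3"
    using eventually_not_equal_at_infinity[of 0] by eventually_elim (simp add: hq_def field_simps power3_eq_cube)
  from Lim_transform_eventually[OF 1 this] show "((\<lambda>z. hq z / z^3) \<longlongrightarrow> 1) at_infinity" by simp
  have 2: "((\<lambda>z. a * inverse z - (1 + a)) \<longlongrightarrow> a * 0 - (1 + a)) at_infinity"
    by (intro tendsto_intros tendsto_inverse_0)
  have "\<forall>\<^sub>F z in at_infinity. a * inverse z - (1 + a) = hq z / z\<^sup>2 - z"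
    using eventually_not_equal_at_infinity[of 0] by eventually_elim (simp add: hq_def field_simps power2_eq_square)
  from Lim_transform_eventually[OF 2 this] show "((\<lambda>z. hq z / z\<^sup>2 - z) \<longlongrightarrow> - (1 + a)) at_infinity" by simp
qed

text \<open>Growth at infinity bounds the degrees. \<open>hq\<close> grows like the cube of
  \<open>z\<close>, derivatives of the expansion decay like the inverse square, and the power
  contributes \<open>- \<delta> / z\<close> times a matrix tending to
  \<open>\<sigma>\<^sub>3\<close>; so only diagonal entries can be quadratic. In the (1,2) entry the
  linear coefficient is a multiple of \<open>F 1 2 0\<close>, which is zero by the second
  normalization condition.\<close>

lemma connection_polynomials:
  obtains d1 c \<kappa> e s where "((\<lambda>z. z * infinity_defect \<delta> L \<Psi> z $ 1 $ 1) \<longlongrightarrow> d1) (infinity_off a \<Gamma>)"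
    "\<And>z. z \<notin> C \<Longrightarrow> hq z * logder \<Psi> z $ 1 $ 1 = - \<delta> * z\<^sup>2 + (\<delta> * (a + 1) - d1) * z + c"
    "\<And>z. z \<notin> C \<Longrightarrow> hq z * logder \<Psi> z $ 1 $ 2 = \<kappa>"
    "\<And>z. z \<notin> C \<Longrightarrow> hq z * logder \<Psi> z $ 2 $ 1 = e + s * z"
    "\<And>j z. z = sing a j \<Longrightarrow> (- \<delta> * z\<^sup>2 + (\<delta> * (a + 1) - d1) * z + c)\<^sup>2 + \<kappa> * (e + s * z) = (\<alpha> j * hqj j z)\<^sup>2"
proof -
  obtain P where P: "\<And>i k. P i k holomorphic_on UNIV" "\<And>i k z. z \<notin> C \<Longrightarrow> P i k z = hq z * logder \<Psi> z $ i $ k"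
    and Pj: "\<And>j. (P 1 1 (sing a j))\<^sup>2 + P 1 2 (sing a j) * P 2 1 (sing a j) = (\<alpha> j * hqj j (sing a j))\<^sup>2"
    by (rule connection_entire) blast
  obtain R Z F where R: "0 < R" and Z: "mholo {z. R < norm z} Z" "\<And>z. R < norm z \<Longrightarrow> z \<notin> C \<Longrightarrow> Z z = \<Psi> z ** exp_sigma3 (\<delta> * L z)"
    and L: "\<And>z. R < norm z \<Longrightarrow> z \<notin> C \<Longrightarrow> exp (L z) = z" "L holomorphic_on {z. R < norm z} - C"
    and F: "\<And>i k. F i k holomorphic_on ball 0 (inverse R)"
      "\<And>z i k. R < norm z \<Longrightarrow> Z z $ i $ k = mat 1 $ i $ k + inverse z * F i k (inverse z)"
    by (rule infinity_expansion) blast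
  let ?O = "{z::complex. R < norm z}"
  have oO: "open ?O" by (intro open_Collect_less continuous_intros)
  have evR: "\<forall>\<^sub>F z::complex in at_infinity. R < norm z"
    unfolding eventually_at_infinity by (intro exI[of _ "R + 1"]) auto
  note lim = expansion_limits[OF R F]
  have defect: "\<forall>\<^sub>F z in infinity_off a \<Gamma>. z * (Z z $ i $ k - mat 1 $ i $ k) = z * infinity_defect \<delta> L \<Psi> z $ i $ k" for i k
    using eventually_infinity_off[OF evR] by eventually_elim (simp add: infinity_defect_def Z(2))
  note dlim = Lim_transform_eventually[OF tendsto_infinity_off[OF lim(2)] defect]
  have F12: "F 1 2 0 = 0" by (rule tendsto_unique[OF infinity_off_nontrivial dlim rh_inf12])
  have detZ: "det (Z z) = 1" if "z \<in> ?O" for z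
  proof (rule continuous_eq_off[OF interior_C oO _ _ _ that, of "\<lambda>z. det (Z z)" "\<lambda>z. 1"])
    show "continuous_on ?O (\<lambda>z. det (Z z))" unfolding det_2
      using Z(1) unfolding mholo_def by (intro continuous_intros holomorphic_on_imp_continuous_on) auto
    show "det (Z z) = 1" if "z \<in> ?O - C" for z using that Z(2)[of z] det_\<Psi>[of z] by (simp add: det_mul)
  qed simp
  have PZ: "P i k z = hq z * (logder Z z $ i $ k - \<delta> * inverse z * twist (Z z) $ i $ k)" if "z \<in> ?O" for i k z
  proof (rule continuous_eq_off[OF interior_C oO _ _ _ that, of "P i k" "\<lambda>z. hq z * (logder Z z $ i $ k - \<delta> * inverse z * twist (Z z) $ i $ k)"])
    show "continuous_on ?O (P i k)" using P(1) holomorphic_on_imp_continuous_on continuous_on_subset by blast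
    have 1: "(\<lambda>z. logder Z z $ i $ k) holomorphic_on ?O" using mholo_logder[OF Z(1) oO] unfolding mholo_def by blast
    have 2: "(\<lambda>z. twist (Z z) $ i $ k) holomorphic_on ?O"
      using Z(1) exhaust_2[of k] unfolding twist_nth mholo_def by (auto intro!: holomorphic_intros)
    show "continuous_on ?O (\<lambda>z. hq z * (logder Z z $ i $ k - \<delta> * inverse z * twist (Z z) $ i $ k))"
      by (intro holomorphic_on_imp_continuous_on holomorphic_intros 1 2 holo_hq) (use R in auto)
    fix z assume z: "z \<in> ?O - C"
    then have zz: "R < norm z" "z \<notin> C" "z \<in> ?O" by auto
    note f = infinity_local_form[OF Z(2) L zz(1,2)]
    have "logder \<Psi> z $ i $ k = logder Z z $ i $ k + (- \<delta>) * inverse z * twist (Z z) $ i $ k"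
      by (rule logder_mult_exp_sigma3(3)[OF Z(1) oO zz(3) f])
    then show "P i k z = hq z * (logder Z z $ i $ k - \<delta> * inverse z * twist (Z z) $ i $ k)"
      unfolding P(2)[OF zz(2)] by simp
  qed
  define D where "D i k z = deriv (\<lambda>z. Z z $ i $ k) z" for i k z
  have lz: "((\<lambda>z. Z z $ 1 $ 1) \<longlongrightarrow> 1) at_infinity" "((\<lambda>z. Z z $ 1 $ 2) \<longlongrightarrow> 0) at_infinity"
    "((\<lambda>z. Z z $ 2 $ 1) \<longlongrightarrow> 0) at_infinity" "((\<lambda>z. Z z $ 2 $ 2) \<longlongrightarrow> 1) at_infinity"
    using lim(1)[of 1 1] lim(1)[of 1 2] lim(1)[of 2 1] lim(1)[of 2 2] by simp_all
  have l1: "((\<lambda>z. z * Z z $ 1 $ 2) \<longlongrightarrow> 0) at_infinity" "((\<lambda>z. z * Z z $ 2 $ 1) \<longlongrightarrow> F 2 1 0) at_infinity"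
    using lim(2)[of 1 2] lim(2)[of 2 1] F12 by simp_all
  have l2: "((\<lambda>z. z\<^sup>2 * D i k z) \<longlongrightarrow> - F i k 0) at_infinity" for i k unfolding D_def by (rule lim(3))
  have lD: "logder Z z $ i $ k = D i 1 z * adj2 (Z z)$1$k + D i 2 z * adj2 (Z z)$2$k" for z i k
    unfolding logder_nth D_def ..
  \<comment> \<open>The first term comes from the second coefficient of \<open>hq\<close>, the other
    from the derivative of the (1,1) expansion.\<close>
  define b where "b = \<delta> * (a + 1) - F 1 1 0"
  have hol11: "(\<lambda>z. P 1 1 z + \<delta> * z\<^sup>2) holomorphic_on UNIV" by (intro holomorphic_intros P)
  \<comment> \<open>The terms are grouped so that each factor has a limit at infinity.\<close>
  have "((\<lambda>z. (hq z / z^3) * ((z\<^sup>2 * D 1 1 z) * Z z $ 2 $ 2 - (z\<^sup>2 * D 1 2 z) * Z z $ 2 $ 1)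
      - \<delta> * ((hq z / z\<^sup>2 - z) + (hq z / z^3) * 2 * (z * Z z $ 1 $ 2) * Z z $ 2 $ 1)) \<longlongrightarrow>
      1 * (- F 1 1 0 * 1 - (- F 1 2 0) * 0) - \<delta> * (- (1 + a) + 1 * 2 * 0 * 0)) at_infinity"
    by (intro tendsto_intros hq_limits l1 l2 lz)
  moreover have "\<forall>\<^sub>F z in at_infinity. (hq z / z^3) * ((z\<^sup>2 * D 1 1 z) * Z z $ 2 $ 2 - (z\<^sup>2 * D 1 2 z) * Z z $ 2 $ 1)
      - \<delta> * ((hq z / z\<^sup>2 - z) + (hq z / z^3) * 2 * (z * Z z $ 1 $ 2) * Z z $ 2 $ 1) = (P 1 1 z + \<delta> * z\<^sup>2) / z"
    using evR
  proof eventually_elim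
    case (elim z)
    have z0: "z \<noteq> 0" using elim R by auto
    \<comment> \<open>Determinant 1 splits off the leading 1 exactly, so that the quadratic term
      cancels before the limit is taken.\<close>
    have "Z z $ 1 $ 1 * Z z $ 2 $ 2 = 1 + Z z $ 1 $ 2 * Z z $ 2 $ 1" using detZ[of z] elim by (simp add: det_2 algebra_simps)
    then have t: "twist (Z z) $ 1 $ 1 = 1 + 2 * (Z z $ 1 $ 2 * Z z $ 2 $ 1)" unfolding twist_nth by simp
    have eq: "P 1 1 z = hq z * (D 1 1 z * Z z $ 2 $ 2 - D 1 2 z * Z z $ 2 $ 1 - \<delta> * inverse z * (1 + 2 * (Z z $ 1 $ 2 * Z z $ 2 $ 1)))"
      using PZ[of z 1 1] elim unfolding lD t by simp
    show ?case unfolding eq using z0 by (simp add: field_simps power2_eq_square power3_eq_cube)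
  qed
  ultimately have "((\<lambda>z. (P 1 1 z + \<delta> * z\<^sup>2) / z) \<longlongrightarrow>
      1 * (- F 1 1 0 * 1 - (- F 1 2 0) * 0) - \<delta> * (- (1 + a) + 1 * 2 * 0 * 0)) at_infinity" by (rule Lim_transform_eventually)
  also have "1 * (- F 1 1 0 * 1 - (- F 1 2 0) * 0) - \<delta> * (- (1 + a) + 1 * 2 * 0 * 0) = b" by (simp add: b_def algebra_simps)
  finally have P11: "P 1 1 z = - \<delta> * z\<^sup>2 + b * z + P 1 1 0" for z using entire_linear_growth[OF hol11, of b z] by (simp add: algebra_simps)
  have "((\<lambda>z. (hq z / z^3) * ((z\<^sup>2 * D 1 2 z) * Z z $ 1 $ 1 - (z\<^sup>2 * D 1 1 z) * Z z $ 1 $ 2 + 2 * \<delta> * (z * Z z $ 1 $ 2) * Z z $ 1 $ 1)) \<longlongrightarrow>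
      1 * (- F 1 2 0 * 1 - (- F 1 1 0) * 0 + 2 * \<delta> * 0 * 1)) at_infinity"
    by (intro tendsto_intros hq_limits l1 l2 lz)
  moreover have "\<forall>\<^sub>F z in at_infinity. (hq z / z^3) * ((z\<^sup>2 * D 1 2 z) * Z z $ 1 $ 1 - (z\<^sup>2 * D 1 1 z) * Z z $ 1 $ 2 + 2 * \<delta> * (z * Z z $ 1 $ 2) * Z z $ 1 $ 1) = P 1 2 z / z"
    using evR
  proof eventually_elim
    case (elim z)
    have z0: "z \<noteq> 0" using elim R by auto
    have eq: "P 1 2 z = hq z * (D 1 2 z * Z z $ 1 $ 1 - D 1 1 z * Z z $ 1 $ 2 + \<delta> * inverse z * (2 * (Z z $ 1 $ 1 * Z z $ 1 $ 2)))"
      using PZ[of z 1 2] elim unfolding lD twist_nth by (simp add: algebra_simps)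
    show ?case unfolding eq using z0 by (simp add: field_simps power2_eq_square power3_eq_cube)
  qed
  ultimately have "((\<lambda>z. P 1 2 z / z) \<longlongrightarrow> 1 * (- F 1 2 0 * 1 - (- F 1 1 0) * 0 + 2 * \<delta> * 0 * 1)) at_infinity" by (rule Lim_transform_eventually)
  then have "((\<lambda>z. P 1 2 z / z) \<longlongrightarrow> 0) at_infinity" by (simp add: F12)
  from entire_linear_growth[OF P(1) this] have P12: "P 1 2 z = P 1 2 0" for z by simp
  define s where "s = 1 * (- F 2 1 0 * 1 - (- F 2 2 0) * 0 - 2 * \<delta> * F 2 1 0 * 1)"
  have "((\<lambda>z. (hq z / z^3) * ((z\<^sup>2 * D 2 1 z) * Z z $ 2 $ 2 - (z\<^sup>2 * D 2 2 z) * Z z $ 2 $ 1 - 2 * \<delta> * (z * Z z $ 2 $ 1) * Z z $ 2 $ 2)) \<longlongrightarrow> s) at_infinity"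
    unfolding s_def by (intro tendsto_intros hq_limits l1 l2 lz)
  moreover have "\<forall>\<^sub>F z in at_infinity. (hq z / z^3) * ((z\<^sup>2 * D 2 1 z) * Z z $ 2 $ 2 - (z\<^sup>2 * D 2 2 z) * Z z $ 2 $ 1 - 2 * \<delta> * (z * Z z $ 2 $ 1) * Z z $ 2 $ 2) = P 2 1 z / z"
    using evR
  proof eventually_elim
    case (elim z)
    have z0: "z \<noteq> 0" using elim R by auto
    have eq: "P 2 1 z = hq z * (D 2 1 z * Z z $ 2 $ 2 - D 2 2 z * Z z $ 2 $ 1 - \<delta> * inverse z * (2 * (Z z $ 2 $ 1 * Z z $ 2 $ 2)))"
      using PZ[of z 2 1] elim unfolding lD twist_nth by (simp add: algebra_simps)
    show ?case unfolding eq using z0 by (simp add: field_simps power2_eq_square power3_eq_cube)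
  qed
  ultimately have "((\<lambda>z. P 2 1 z / z) \<longlongrightarrow> s) at_infinity" by (rule Lim_transform_eventually)
  from entire_linear_growth[OF P(1) this] have P21: "P 2 1 z = P 2 1 0 + s * z" for z .
  show ?thesis
  proof (rule that[of "F 1 1 0" "P 1 1 0" "P 1 2 0" "P 2 1 0" s])
    show "((\<lambda>z. z * infinity_defect \<delta> L \<Psi> z $ 1 $ 1) \<longlongrightarrow> F 1 1 0) (infinity_off a \<Gamma>)" by (rule dlim)
    fix z
    show "hq z * logder \<Psi> z $ 1 $ 1 = - \<delta> * z\<^sup>2 + (\<delta> * (a + 1) - F 1 1 0) * z + P 1 1 0" if "z \<notin> C"
      using P(2)[OF that, of 1 1] P11[of z] by (simp add: b_def)
    show "hq z * logder \<Psi> z $ 1 $ 2 = P 1 2 0" if "z \<notin> C" using P(2)[OF that, of 1 2] P12[of z] by simp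
    show "hq z * logder \<Psi> z $ 2 $ 1 = P 2 1 0 + s * z" if "z \<notin> C" using P(2)[OF that, of 2 1] P21[of z] by simp
    fix j assume z: "z = sing a j"
    show "(- \<delta> * z\<^sup>2 + (\<delta> * (a + 1) - F 1 1 0) * z + P 1 1 0)\<^sup>2 + P 1 2 0 * (P 2 1 0 + s * z) = (\<alpha> j * hqj j z)\<^sup>2"
      using Pj[of j] unfolding z[symmetric] P11[of z] P12[of z] P21[of z] b_def .
  qed
qed

lemma \<Psi>_ode:
  assumes "z \<notin> C"
  shows "hq z * deriv (\<lambda>y. \<Psi> y $ i $ k) z = hq z * logder \<Psi> z $ i $ 1 * \<Psi> z $ 1 $ k + hq z * logder \<Psi> z $ i $ 2 * \<Psi> z $ 2 $ k"
proof -
  have "logder \<Psi> z ** \<Psi> z = (\<chi> i k. deriv (\<lambda>y. \<Psi> y $ i $ k) z)"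
    unfolding logder_def matrix_mul_assoc[symmetric] adj2_inverse(2)[OF det_\<Psi>[OF assms]] by simp
  then have "(logder \<Psi> z ** \<Psi> z) $ i $ k = deriv (\<lambda>y. \<Psi> y $ i $ k) z" by simp
  then show ?thesis unfolding mm2 by (simp add: algebra_simps flip: distrib_left)
qed

lemma \<Psi>_deriv: "z \<notin> C \<Longrightarrow> ((\<lambda>y. \<Psi> y $ i $ k) has_field_derivative deriv (\<lambda>y. \<Psi> y $ i $ k) z) (at z)"
  by (rule holomorphic_derivI[OF rh_holo open_Compl[OF closed_C]]) simp

text \<open>The second row \<open>g\<close> is eliminated. As the (1,2) numerator is a constant
  \<open>\<kappa>\<close>, differentiating \<open>hq * W\<close> produces \<open>g\<close> only
  through \<open>W\<close> and the derivative of \<open>g\<close>, and these terms cancel because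
  the trace is zero. Nothing is divided by \<open>\<kappa>\<close>, so \<open>\<kappa> = 0\<close>
  is covered.\<close>

lemma heun_solution_u_fun:
  assumes a: "a \<noteq> 0" "a \<noteq> 1"
    and K: "\<And>j. log_branch (D_inf a \<Gamma>) (sing a j) (K j)"
    and p11: "\<And>z. z \<notin> C \<Longrightarrow> hq z * logder \<Psi> z $ 1 $ 1 = - \<delta> * z\<^sup>2 + b * z + c"
    and p12: "\<And>z. z \<notin> C \<Longrightarrow> hq z * logder \<Psi> z $ 1 $ 2 = \<kappa>"
    and p21: "\<And>z. z \<notin> C \<Longrightarrow> hq z * logder \<Psi> z $ 2 $ 1 = e + s * z"
    and Q: "\<And>j z. z = sing a j \<Longrightarrow> (- \<delta> * z\<^sup>2 + b * z + c)\<^sup>2 + \<kappa> * (e + s * z) = (\<alpha> j * hqj j z)\<^sup>2"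
  shows "heun_solution a \<alpha> (heun_mu \<alpha> \<delta>) (heun_nu a \<alpha> \<delta> b) (D_inf a \<Gamma>) (u_fun \<alpha> K \<Psi> k)"
proof -
  define Ex where "Ex = (\<lambda>z. exp (\<alpha> 1 * K 1 z) * exp (\<alpha> 2 * K 2 z) * exp (\<alpha> 3 * K 3 z))"
  define \<rho> where "\<rho> = (\<lambda>z. \<alpha> 1 * inverse z + \<alpha> 2 * inverse (z - a) + \<alpha> 3 * inverse (z - 1))"
  define p where "p = (\<lambda>z. - \<delta> * z\<^sup>2 + b * z + c)"
  define f where "f = (\<lambda>z. \<Psi> z $ 1 $ k)"
  define g where "g = (\<lambda>z. \<Psi> z $ 2 $ k)"
  define W where "W = (\<lambda>z. (p z * f z + \<kappa> * g z) / hq z)"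
  define V where "V = (\<lambda>z. Ex z * (\<rho> z * f z + W z))"
  define h1 where "h1 = (\<lambda>z. (z - a) * (z - 1) + z * (z - 1) + z * (z - a))"
  define \<rho>1 where "\<rho>1 = (\<lambda>z. - (\<alpha> 1 * (inverse z)\<^sup>2) - \<alpha> 2 * (inverse (z - a))\<^sup>2 - \<alpha> 3 * (inverse (z - 1))\<^sup>2)"
  have u: "u_fun \<alpha> K \<Psi> k = (\<lambda>z. Ex z * f z)" by (simp add: fun_eq_iff u_fun_def Ex_def f_def)
  have nC: "z \<notin> C" if "z \<in> D_inf a \<Gamma>" for z using D_inf_subset that by blast
  have nz: "z \<noteq> 0" "z - a \<noteq> 0" "z - 1 \<noteq> 0" "hq z \<noteq> 0" if "z \<in> D_inf a \<Gamma>" for z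
    using hq_nz[OF nC[OF that]] by (auto simp: hq_def)
  have dE: "(Ex has_field_derivative \<rho> z * Ex z) (at z)" if z: "z \<in> D_inf a \<Gamma>" for z
  proof -
    have dK: "(K j has_field_derivative inverse (z - sing a j)) (at z)" for j
      using K[of j] unfolding log_branch_def by (intro log_derivative[OF open_D_inf _ _ z]) auto
    note x = DERIV_chain2[OF DERIV_exp DERIV_cmult[OF dK]]
    show ?thesis unfolding Ex_def
      by (rule DERIV_cong[OF DERIV_mult[OF DERIV_mult[OF x[of "\<alpha> 1" 1] x[of "\<alpha> 2" 2]] x[of "\<alpha> 3" 3]]])
         (simp add: \<rho>_def sing_def algebra_simps)
  qed
  have df: "(f has_field_derivative W z) (at z)" and dg: "(g has_field_derivative ((e + s * z) * f z - p z * g z) / hq z) (at z)"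
    if z: "z \<in> D_inf a \<Gamma>" for z
  proof -
    have "hq z * deriv f z = p z * f z + \<kappa> * g z"
      using \<Psi>_ode[OF nC[OF z], of 1 k] unfolding p11[OF nC[OF z]] p12[OF nC[OF z]] f_def g_def p_def .
    then have 1: "deriv f z = W z" using nz(4)[OF z] by (simp add: W_def field_simps)
    have "hq z * logder \<Psi> z $ 2 $ 2 = - p z" using p11[OF nC[OF z]] unfolding logder_trace[OF nC[OF z]] p_def by simp
    then have "hq z * deriv g z = (e + s * z) * f z - p z * g z"
      using \<Psi>_ode[OF nC[OF z], of 2 k] unfolding p21[OF nC[OF z]] f_def g_def by simp
    then have 2: "deriv g z = ((e + s * z) * f z - p z * g z) / hq z" using nz(4)[OF z] by (simp add: field_simps)
    show "(f has_field_derivative W z) (at z)" using \<Psi>_deriv[OF nC[OF z], of 1 k] unfolding f_def[symmetric] 1 .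
    show "(g has_field_derivative ((e + s * z) * f z - p z * g z) / hq z) (at z)"
      using \<Psi>_deriv[OF nC[OF z], of 2 k] unfolding g_def[symmetric] 2 .
  qed
  have du: "(u_fun \<alpha> K \<Psi> k has_field_derivative V z) (at z)" if z: "z \<in> D_inf a \<Gamma>" for z
    unfolding u by (rule DERIV_cong[OF DERIV_mult[OF dE[OF z] df[OF z]]]) (simp add: V_def algebra_simps)
  have dV: "(V has_field_derivative \<rho> z * Ex z * (\<rho> z * f z + W z)
      + Ex z * (\<rho>1 z * f z + \<rho> z * W z + ((b - 2 * \<delta> * z) * f z + ((p z)\<^sup>2 + \<kappa> * (e + s * z)) * f z / hq z - W z * h1 z) / hq z)) (at z)"
    if z: "z \<in> D_inf a \<Gamma>" for z
  proof -
    have d\<rho>: "(\<rho> has_field_derivative \<rho>1 z) (at z)"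
      unfolding \<rho>_def \<rho>1_def using nz[OF z] by (auto intro!: derivative_eq_intros simp: power2_eq_square algebra_simps)
    have dp: "(p has_field_derivative b - 2 * \<delta> * z) (at z)"
      unfolding p_def by (auto intro!: derivative_eq_intros simp: algebra_simps)
    have dq: "(hq has_field_derivative h1 z) (at z)"
      unfolding hq_def[abs_def] h1_def by (auto intro!: derivative_eq_intros simp: algebra_simps)
    have dW: "(W has_field_derivative ((b - 2 * \<delta> * z) * f z + ((p z)\<^sup>2 + \<kappa> * (e + s * z)) * f z / hq z - W z * h1 z) / hq z) (at z)"
      unfolding W_def
      by (rule DERIV_cong[OF DERIV_divide[OF DERIV_add[OF DERIV_mult[OF dp df[OF z]] DERIV_cmult[OF dg[OF z], of \<kappa>]] dq nz(4)[OF z]]])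
         (use nz(4)[OF z] in \<open>simp add: W_def field_simps power2_eq_square\<close>)
    show ?thesis unfolding V_def
      by (rule DERIV_cong[OF DERIV_mult[OF dE[OF z] DERIV_add[OF DERIV_mult[OF d\<rho> df[OF z]] dW]]]) (simp add: algebra_simps)
  qed
  have Qj: "(p z)\<^sup>2 + \<kappa> * (e + s * z) = (\<alpha> j * hqj j z)\<^sup>2" if "z = sing a j" for j z using Q[OF that] unfolding p_def .
  \<comment> \<open>The two top coefficients of this quartic are known from infinity; the three
    lower ones involve unknown constants, but are tied down by the exponents at 0, 1 and
    \<open>a\<close>.\<close>
  let ?A = "b\<^sup>2 - 2 * \<delta> * c" and ?B = "2 * b * c + \<kappa> * s" and ?D = "c\<^sup>2 + \<kappa> * e"
  have Qz: "(p z)\<^sup>2 + \<kappa> * (e + s * z) = \<delta>\<^sup>2 * z^4 - 2 * \<delta> * b * z^3 + ?A * z\<^sup>2 + ?B * z + ?D" for z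
    unfolding p_def by (simp add: algebra_simps power2_eq_square power3_eq_cube power4_eq_xxxx)
  have id: "(\<alpha> 1 * ((z - a) * (z - 1)) + \<alpha> 2 * (z * (z - 1)) + \<alpha> 3 * (z * (z - a)))\<^sup>2
      - z * (z - a) * (z - 1) * (\<alpha> 1 * (2 * z - a - 1) + \<alpha> 2 * (2 * z - 1) + \<alpha> 3 * (2 * z - a))
      - z * (z - a) * (z - 1) * (b - 2 * \<delta> * z) - ((p z)\<^sup>2 + \<kappa> * (e + s * z))
    = z * (z - a) * (z - 1) * (heun_mu \<alpha> \<delta> * z + heun_nu a \<alpha> \<delta> b)" for z
    unfolding Qz
  proof (rule heun_accessory_identity[OF a])
    have "?D = (\<alpha> 1 * hqj 1 0)\<^sup>2" using Qj[of 0 1] unfolding Qz by (simp add: sing_def)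
    then show "?D = (\<alpha> 1 * a)\<^sup>2" by (simp add: hqj_def)
    have "\<delta>\<^sup>2 - 2 * \<delta> * b + ?A + ?B + ?D = (\<alpha> 3 * hqj 3 1)\<^sup>2" using Qj[of 1 3] unfolding Qz by (simp add: sing_def)
    then show "\<delta>\<^sup>2 - 2 * \<delta> * b + ?A + ?B + ?D = (\<alpha> 3 * (1 - a))\<^sup>2" by (simp add: hqj_def)
    have "\<delta>\<^sup>2 * a^4 - 2 * \<delta> * b * a^3 + ?A * a\<^sup>2 + ?B * a + ?D = (\<alpha> 2 * hqj 2 a)\<^sup>2" using Qj[of a 2] unfolding Qz by (simp add: sing_def)
    then show "\<delta>\<^sup>2 * a^4 - 2 * \<delta> * b * a^3 + ?A * a\<^sup>2 + ?B * a + ?D = (\<alpha> 2 * (a * (a - 1)))\<^sup>2" by (simp add: hqj_def)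
  qed
  have "deriv (deriv (u_fun \<alpha> K \<Psi> k)) z
      + ((1 - 2 * \<alpha> 1) / z + (1 - 2 * \<alpha> 2) / (z - a) + (1 - 2 * \<alpha> 3) / (z - 1)) * deriv (u_fun \<alpha> K \<Psi> k) z
      + (heun_mu \<alpha> \<delta> * z + heun_nu a \<alpha> \<delta> b) / (z * (z - a) * (z - 1)) * u_fun \<alpha> K \<Psi> k z = 0" if z: "z \<in> D_inf a \<Gamma>" for z
  proof -
    have ev: "\<forall>\<^sub>F y in nhds z. deriv (u_fun \<alpha> K \<Psi> k) y = V y"
      using eventually_nhds_in_open[OF open_D_inf z] by eventually_elim (rule DERIV_imp_deriv[OF du])
    have d1: "deriv (u_fun \<alpha> K \<Psi> k) z = Ex z * (\<rho> z * f z + W z)" using DERIV_imp_deriv[OF du[OF z]] by (simp add: V_def)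
    have d2: "deriv (deriv (u_fun \<alpha> K \<Psi> k)) z = \<rho> z * Ex z * (\<rho> z * f z + W z)
      + Ex z * (\<rho>1 z * f z + \<rho> z * W z + ((b - 2 * \<delta> * z) * f z + ((p z)\<^sup>2 + \<kappa> * (e + s * z)) * f z / hq z - W z * h1 z) / hq z)"
      unfolding deriv_cong_ev[OF ev refl] by (rule DERIV_imp_deriv[OF dV[OF z]])
    note hc = heun_coefficients[OF nz(1-3)[OF z], of "\<alpha> 1" "\<alpha> 2" "\<alpha> 3"]
    have hc1: "hq z * \<rho> z = \<alpha> 1 * ((z - a) * (z - 1)) + \<alpha> 2 * (z * (z - 1)) + \<alpha> 3 * (z * (z - a))"
      unfolding hq_def \<rho>_def by (rule hc(1))
    have "h1 z * \<rho> z + hq z * \<rho>1 z = \<alpha> 1 * ((z - a) + (z - 1)) + \<alpha> 2 * (z + (z - 1)) + \<alpha> 3 * (z + (z - a))"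
      unfolding hq_def \<rho>_def h1_def \<rho>1_def by (rule hc(2))
    also have "\<dots> = \<alpha> 1 * (2 * z - a - 1) + \<alpha> 2 * (2 * z - 1) + \<alpha> 3 * (2 * z - a)" by (simp add: algebra_simps)
    finally have hc2: "h1 z * \<rho> z + hq z * \<rho>1 z = \<alpha> 1 * (2 * z - a - 1) + \<alpha> 2 * (2 * z - 1) + \<alpha> 3 * (2 * z - a)" .
    have hc3: "(1 - 2 * \<alpha> 1) / z + (1 - 2 * \<alpha> 2) / (z - a) + (1 - 2 * \<alpha> 3) / (z - 1) = h1 z / hq z - 2 * \<rho> z"
      unfolding hq_def \<rho>_def h1_def by (rule hc(3))
    have "(hq z * \<rho> z)\<^sup>2 - hq z * (h1 z * \<rho> z + hq z * \<rho>1 z) - hq z * (b - 2 * \<delta> * z) - ((p z)\<^sup>2 + \<kappa> * (e + s * z))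
        = hq z * (heun_mu \<alpha> \<delta> * z + heun_nu a \<alpha> \<delta> b)"
      unfolding hc1 hc2 unfolding hq_def by (rule id)
    from heun_reduction[OF nz(4)[OF z] this, of "Ex z" "f z" "W z"]
    show ?thesis unfolding d1 d2 hc3 unfolding u hq_def .
  qed
  moreover have "u_fun \<alpha> K \<Psi> k holomorphic_on D_inf a \<Gamma>"
    unfolding holomorphic_on_open[OF open_D_inf] using du by blast
  ultimately show ?thesis unfolding heun_solution_def by blast
qed

section \<open>Linear independence of the two solutions\<close>

text \<open>With a zero (1,2) numerator, \<open>\<Psi>\<^sub>1\<^sub>2\<close> satisfies a first
  order equation with logarithmic derivative asymptotic to \<open>- \<delta> / z\<close>. By the
  normalization it behaves like a power with exponent \<open>\<delta> - n\<close> for a positive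
  integer \<open>n\<close>, unless it vanishes near infinity. So \<open>2 * \<delta> = n\<close>,
  which is excluded.\<close>

lemma \<Psi>12_vanishes_at_infinity:
  assumes \<delta>: "2 * \<delta> \<notin> \<int>" and p11: "\<And>z. z \<notin> C \<Longrightarrow> hq z * logder \<Psi> z $ 1 $ 1 = - \<delta> * z\<^sup>2 + b * z + c"
    and p12: "\<And>z. z \<notin> C \<Longrightarrow> hq z * logder \<Psi> z $ 1 $ 2 = 0"
  shows "\<exists>z\<in>D_inf a \<Gamma>. \<Psi> z $ 1 $ 1 \<noteq> 0 \<and> \<Psi> z $ 1 $ 2 = 0"
proof -
  obtain R Z F where R: "0 < R" and Z: "mholo {z. R < norm z} Z" "\<And>z. R < norm z \<Longrightarrow> z \<notin> C \<Longrightarrow> Z z = \<Psi> z ** exp_sigma3 (\<delta> * L z)"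
    and L: "\<And>z. R < norm z \<Longrightarrow> z \<notin> C \<Longrightarrow> exp (L z) = z" "L holomorphic_on {z. R < norm z} - C"
    and D: "{z. R < norm z} - C \<subseteq> D_inf a \<Gamma>" and F: "\<And>i k. F i k holomorphic_on ball 0 (inverse R)"
      "\<And>z i k. R < norm z \<Longrightarrow> Z z $ i $ k = mat 1 $ i $ k + inverse z * F i k (inverse z)"
    by (rule infinity_expansion) blast
  let ?O = "{z::complex. R < norm z}" and ?b = "ball 0 (inverse R) :: complex set"
  have oO: "open ?O" by (intro open_Collect_less continuous_intros)
  have evr: "\<forall>\<^sub>F z::complex in at_infinity. r < norm z" for r
    unfolding eventually_at_infinity by (intro exI[of _ "r + 1"]) auto
  define f where "f = (\<lambda>\<zeta>. \<zeta> * F 1 2 \<zeta>)"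
  have hf: "f holomorphic_on ?b" unfolding f_def by (intro holomorphic_intros F)
  have fZ: "Z z $ 1 $ 2 = f (inverse z)" if "R < norm z" for z using F(2)[OF that, of 1 2] by (simp add: f_def)
  have inb: "inverse z \<in> ball 0 (inverse r)" if "r < norm z" "0 < r" for z :: complex and r
    using less_imp_inverse_less[OF that] by (simp add: norm_inverse)
  have cst: "f constant_on ?b"
  proof (rule ccontr)
    assume n: "\<not> f constant_on ?b"
    obtain g r n where g: "0 < n" "0 < r" "ball 0 r \<subseteq> ?b" "g holomorphic_on ball 0 r"
      "\<And>w. w \<in> ball 0 r \<Longrightarrow> f w = (w - 0)^n * g w" "\<And>w. w \<in> ball 0 r \<Longrightarrow> g w \<noteq> 0"
      by (rule holomorphic_factor_zero_nonconstant[OF hf open_ball connected_ball _ _ n, of 0]) (use R in \<open>auto simp: f_def\<close>)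
    obtain m where m: "n = Suc m" using g(1) gr0_implies_Suc by blast
    define r' where "r' = max R (inverse r)"
    have rr: "R < norm z" "inverse z \<in> ball 0 r" "z \<noteq> 0" if "r' < norm z" for z :: complex
      using that R inb[of "inverse r" z] g(2) by (auto simp: r'_def)
    have lim: "((\<lambda>z. G (inverse z)) \<longlongrightarrow> G 0) at_infinity" if "G holomorphic_on ball 0 r" for G :: "complex \<Rightarrow> complex"
      using holomorphic_on_imp_continuous_on[OF that] centre_in_ball[THEN iffD2, OF g(2)] continuous_on_eq_continuous_at[OF open_ball]
      by (intro isCont_tendsto_compose[OF _ tendsto_inverse_0]) blast
    have g0: "g 0 \<noteq> 0" using g(2,6) by simp
    \<comment> \<open>Two expressions for \<open>z\<close> times the logarithmic derivative of
      \<open>Z z $ 1 $ 2\<close> are compared: one from the zero of order \<open>n\<close> at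
      infinity, the other from the differential equation.\<close>
    have 1: "((\<lambda>z. - of_nat n - inverse z * deriv g (inverse z) / g (inverse z)) \<longlongrightarrow> - of_nat n - 0 * deriv g 0 / g 0) (infinity_off a \<Gamma>)"
      by (intro tendsto_infinity_off tendsto_intros tendsto_inverse_0 lim g(4) holomorphic_deriv g0) auto
    have 2: "((\<lambda>z. (- \<delta> + b * inverse z + c * inverse z * inverse z) / (hq z / z^3) - \<delta>) \<longlongrightarrow>
        (- \<delta> + b * 0 + c * 0 * 0) / 1 - \<delta>) (infinity_off a \<Gamma>)"
      by (intro tendsto_infinity_off tendsto_intros tendsto_inverse_0 hq_limits) auto
    have "\<forall>\<^sub>F z in infinity_off a \<Gamma>. - of_nat n - inverse z * deriv g (inverse z) / g (inverse z) =
        (- \<delta> + b * inverse z + c * inverse z * inverse z) / (hq z / z^3) - \<delta>"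
      using eventually_infinity_off[OF evr[of r']]
    proof eventually_elim
      case (elim z)
      then have z: "r' < norm z" "z \<notin> C" by auto
      note q = rr[OF z(1)]
      have gz: "g (inverse z) \<noteq> 0" by (rule g(6)[OF q(2)])
      have "open {y::complex. r' < norm y}" by (intro open_Collect_less continuous_intros)
      then have "\<forall>\<^sub>F y in nhds z. r' < norm y" using z by (auto simp: eventually_nhds)
      then have ev: "\<forall>\<^sub>F y in nhds z. Z y $ 1 $ 2 = inverse y ^ Suc m * g (inverse y)"
        by eventually_elim (use fZ rr g(5) m in simp)
      have dI: "(inverse has_field_derivative - (inverse z ^ Suc (Suc 0))) (at z)" by (rule DERIV_inverse[OF q(3)])
      have dg: "(g has_field_derivative deriv g (inverse z)) (at (inverse z))" by (rule holomorphic_derivI[OF g(4) open_ball q(2)])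
      have d0: "deriv (\<lambda>y. Z y $ 1 $ 2) z = (1 + of_nat m) * (- (inverse z ^ Suc (Suc 0)) * inverse z ^ m) * g (inverse z)
          + deriv g (inverse z) * - (inverse z ^ Suc (Suc 0)) * inverse z ^ Suc m"
        unfolding deriv_cong_ev[OF ev refl]
        by (rule DERIV_imp_deriv, rule DERIV_mult[OF DERIV_power_Suc[OF dI] DERIV_chain2[OF dg dI]])
      then have d1: "deriv (\<lambda>y. Z y $ 1 $ 2) z = (1 + of_nat m) * (- (inverse z ^ Suc (Suc 0)) * inverse z ^ m) * g (inverse z)
          + deriv g (inverse z) * - (inverse z ^ Suc (Suc 0)) * (inverse z * inverse z ^ m)"
        by (simp only: power_Suc[of _ m])
      have gen: "(1 + x) * (- (v ^ Suc (Suc 0)) * V) * G + G' * - (v ^ Suc (Suc 0)) * (v * V) = (v * V * G) * v * (- (1 + x) - v * G' / G)"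
        if "G \<noteq> 0" for x v V G G' :: complex using that by (simp add: field_simps)
      from trans[OF d1 gen[OF gz]]
      have dZ: "deriv (\<lambda>y. Z y $ 1 $ 2) z = (inverse z ^ Suc m * g (inverse z)) * inverse z * (- of_nat n - inverse z * deriv g (inverse z) / g (inverse z))"
        by (simp only: m of_nat_Suc power_Suc[of _ m])
      have Zz: "Z z $ 1 $ 2 = inverse z ^ Suc m * g (inverse z)" using ev by (rule eventually_nhds_x_imp_x)
      have zO: "z \<in> ?O" using q by simp
      note lf = infinity_local_form[OF Z(2) L q(1) z(2)]
      have Pz: "\<Psi> z $ 1 $ 2 = Z z $ 1 $ 2 * exp (\<delta> * L z)" using eventually_nhds_x_imp_x[OF lf(2)] by (simp add: mm2)
      have dP: "deriv (\<lambda>y. \<Psi> y $ 1 $ 2) z = (deriv (\<lambda>y. Z y $ 1 $ 2) z + \<delta> * inverse z * Z z $ 1 $ 2) * exp (\<delta> * L z)"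
        using logder_mult_exp_sigma3(2)[OF Z(1) oO zO lf, of 1] by simp
      have "hq z * ((deriv (\<lambda>y. Z y $ 1 $ 2) z + \<delta> * inverse z * Z z $ 1 $ 2) * exp (\<delta> * L z)) = (- \<delta> * z\<^sup>2 + b * z + c) * (Z z $ 1 $ 2 * exp (\<delta> * L z))"
        using \<Psi>_ode[OF z(2), of 1 2] unfolding p11[OF z(2)] p12[OF z(2)] dP Pz by simp
      then have eq: "hq z * (deriv (\<lambda>y. Z y $ 1 $ 2) z + \<delta> * inverse z * Z z $ 1 $ 2) = (- \<delta> * z\<^sup>2 + b * z + c) * Z z $ 1 $ 2"
        by (simp add: mult.assoc[symmetric])
      define X where "X = inverse z ^ Suc m * g (inverse z)"
      define Y where "Y = - of_nat n - inverse z * deriv g (inverse z) / g (inverse z)"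
      have X0: "X \<noteq> 0" using gz q(3) by (simp add: X_def)
      have "hq z * (X * inverse z * Y + \<delta> * inverse z * X) = (- \<delta> * z\<^sup>2 + b * z + c) * X"
        using eq unfolding dZ Zz X_def[symmetric] Y_def[symmetric] .
      then have "X * (hq z * inverse z * (Y + \<delta>)) = X * (- \<delta> * z\<^sup>2 + b * z + c)" by (simp add: algebra_simps)
      then have "hq z * inverse z * (Y + \<delta>) = - \<delta> * z\<^sup>2 + b * z + c" using X0 by simp
      then have "Y + \<delta> = z * (- \<delta> * z\<^sup>2 + b * z + c) / hq z" using hq_nz[OF z(2)] q(3) by (simp add: field_simps)
      also have "\<dots> = (- \<delta> + b * inverse z + c * inverse z * inverse z) / (hq z / z^3)"
        using q(3) hq_nz[OF z(2)] by (simp add: field_simps power2_eq_square power3_eq_cube)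
      finally show ?case unfolding Y_def[symmetric] by (simp add: algebra_simps)
    qed
    from tendsto_unique[OF infinity_off_nontrivial Lim_transform_eventually[OF 1 this] 2]
    have "2 * \<delta> = of_nat n" by (simp add: algebra_simps)
    then show False using \<delta> by simp
  qed
  then obtain y where y: "\<And>w. w \<in> ?b \<Longrightarrow> f w = y" unfolding constant_on_def by blast
  have "y = 0" using y[of 0] R by (simp add: f_def)
  then have Z12: "Z z $ 1 $ 2 = 0" if "R < norm z" for z using fZ[OF that] y inb[OF that R] by simp
  have "((\<lambda>z. Z z $ 1 $ 1) \<longlongrightarrow> 1) at_infinity" using expansion_limits(1)[OF R F, of 1 1] by simp
  then have "\<forall>\<^sub>F z in at_infinity. Z z $ 1 $ 1 \<noteq> 0" by (rule tendsto_imp_eventually_ne) simp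
  from eventually_happens'[OF infinity_off_nontrivial eventually_infinity_off[OF eventually_conj[OF this evr[of R]]]]
  obtain z where z: "Z z $ 1 $ 1 \<noteq> 0" "R < norm z" "z \<notin> C" by (elim exE conjE)
  have "\<Psi> z = Z z ** exp_sigma3 (- \<delta> * L z)"
    using infinity_local_form(2)[OF Z(2) L z(2,3)] by (rule eventually_nhds_x_imp_x)
  then have "\<Psi> z $ 1 $ 1 \<noteq> 0" "\<Psi> z $ 1 $ 2 = 0" using z(1) Z12[OF z(2)] by (simp_all add: mm2)
  then show ?thesis using D z(2,3) by blast
qed

text \<open>For \<open>\<kappa> \<noteq> 0\<close> a linear relation in the first row can be
  differentiated into one in the second row, and determinant 1 kills both coefficients. For
  \<open>\<kappa> = 0\<close> a point where \<open>\<Psi>\<^sub>1\<^sub>2\<close> vanishes and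
  \<open>\<Psi>\<^sub>1\<^sub>1\<close> does not gives the first coefficient, and the point
  \<open>z0\<close> the second.\<close>

lemma u_fun_independent:
  assumes \<delta>: "2 * \<delta> \<notin> \<int>" and p11: "\<And>z. z \<notin> C \<Longrightarrow> hq z * logder \<Psi> z $ 1 $ 1 = - \<delta> * z\<^sup>2 + b * z + c"
    and p12: "\<And>z. z \<notin> C \<Longrightarrow> hq z * logder \<Psi> z $ 1 $ 2 = \<kappa>"
    and nz: "z0 \<in> D_inf a \<Gamma>" "\<Psi> z0 $ 1 $ 2 \<noteq> 0"
    and zero: "\<forall>z\<in>D_inf a \<Gamma>. x * u_fun \<alpha> K \<Psi> 1 z + y * u_fun \<alpha> K \<Psi> 2 z = 0"
  shows "x = 0 \<and> y = 0"
proof -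
  have comb: "x * \<Psi> z $ 1 $ 1 + y * \<Psi> z $ 1 $ 2 = 0" if "z \<in> D_inf a \<Gamma>" for z
  proof -
    define e where "e = exp (\<alpha> 1 * K 1 z) * exp (\<alpha> 2 * K 2 z) * exp (\<alpha> 3 * K 3 z)"
    have "e * (x * \<Psi> z $ 1 $ 1 + y * \<Psi> z $ 1 $ 2) = 0"
      using bspec[OF zero that] unfolding u_fun_def e_def[symmetric] by (simp add: algebra_simps)
    then show ?thesis by (simp add: e_def)
  qed
  show ?thesis
  proof (cases "\<kappa> = 0")
    case True
    obtain z where z: "z \<in> D_inf a \<Gamma>" "\<Psi> z $ 1 $ 1 \<noteq> 0" "\<Psi> z $ 1 $ 2 = 0"
      using \<Psi>12_vanishes_at_infinity[OF \<delta> p11] p12 True by blast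
    have "x = 0" using comb[OF z(1)] z by simp
    then show ?thesis using comb[OF nz(1)] nz(2) by simp
  next
    case False
    have n: "z0 \<notin> C" using nz(1) D_inf_subset by blast
    have ev: "\<forall>\<^sub>F w in nhds z0. x * \<Psi> w $ 1 $ 1 + y * \<Psi> w $ 1 $ 2 = 0"
      using eventually_nhds_in_open[OF open_D_inf nz(1)] by eventually_elim (rule comb)
    have "deriv (\<lambda>w. x * \<Psi> w $ 1 $ 1 + y * \<Psi> w $ 1 $ 2) z0 = 0" unfolding deriv_cong_ev[OF ev refl] by simp
    then have d: "x * deriv (\<lambda>w. \<Psi> w $ 1 $ 1) z0 + y * deriv (\<lambda>w. \<Psi> w $ 1 $ 2) z0 = 0"
      using DERIV_imp_deriv[OF DERIV_add[OF DERIV_cmult[OF \<Psi>_deriv[OF n, of 1 1], of x] DERIV_cmult[OF \<Psi>_deriv[OF n, of 1 2], of y]]] by simp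
    define p where "p = - \<delta> * z0\<^sup>2 + b * z0 + c"
    have o: "hq z0 * deriv (\<lambda>w. \<Psi> w $ 1 $ k) z0 = p * \<Psi> z0 $ 1 $ k + \<kappa> * \<Psi> z0 $ 2 $ k" for k
      using \<Psi>_ode[OF n, of 1 k] unfolding p11[OF n] p12[OF n] p_def .
    have "x * (hq z0 * deriv (\<lambda>w. \<Psi> w $ 1 $ 1) z0) + y * (hq z0 * deriv (\<lambda>w. \<Psi> w $ 1 $ 2) z0) = 0"
      using arg_cong[OF d, of "\<lambda>v. hq z0 * v"] by (simp add: algebra_simps)
    then have "p * (x * \<Psi> z0 $ 1 $ 1 + y * \<Psi> z0 $ 1 $ 2) + \<kappa> * (x * \<Psi> z0 $ 2 $ 1 + y * \<Psi> z0 $ 2 $ 2) = 0"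
      unfolding o by (simp add: algebra_simps)
    then have c2: "x * \<Psi> z0 $ 2 $ 1 + y * \<Psi> z0 $ 2 $ 2 = 0" using False comb[OF nz(1)] by simp
    have det: "\<Psi> z0 $ 1 $ 1 * \<Psi> z0 $ 2 $ 2 - \<Psi> z0 $ 1 $ 2 * \<Psi> z0 $ 2 $ 1 = 1" using det_\<Psi>[OF n] by (simp add: det_2)
    have "x * (\<Psi> z0 $ 1 $ 1 * \<Psi> z0 $ 2 $ 2 - \<Psi> z0 $ 1 $ 2 * \<Psi> z0 $ 2 $ 1) =
        \<Psi> z0 $ 2 $ 2 * (x * \<Psi> z0 $ 1 $ 1 + y * \<Psi> z0 $ 1 $ 2) - \<Psi> z0 $ 1 $ 2 * (x * \<Psi> z0 $ 2 $ 1 + y * \<Psi> z0 $ 2 $ 2)"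
      by (simp add: algebra_simps)
    moreover have "y * (\<Psi> z0 $ 1 $ 1 * \<Psi> z0 $ 2 $ 2 - \<Psi> z0 $ 1 $ 2 * \<Psi> z0 $ 2 $ 1) =
        \<Psi> z0 $ 1 $ 1 * (x * \<Psi> z0 $ 2 $ 1 + y * \<Psi> z0 $ 2 $ 2) - \<Psi> z0 $ 2 $ 1 * (x * \<Psi> z0 $ 1 $ 1 + y * \<Psi> z0 $ 1 $ 2)"
      by (simp add: algebra_simps)
    ultimately show ?thesis unfolding det comb[OF nz(1)] c2 by simp
  qed
qed

end

subsection \<open>Continuation along loops\<close>

text \<open>Along the loop \<open>h\<close> and the continuous logarithm \<open>q\<close> differ by
  one constant before \<open>t\<close> and another after it. Both are compared with
  \<open>l\<close>, which is continuous at the crossing, so the jump of \<open>h\<close> there makes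
  up for the period of \<open>q\<close>.\<close>

lemma loop_log_change:
  fixes g q :: "real \<Rightarrow> complex"
  assumes g: "continuous_on {0..1} g" "g 1 = g 0" and t: "0 < t" "t < 1" and q: "continuous_on {0..1} q"
    and h: "continuous_on S h" "\<And>s. s \<in> {0..1} - {t} \<Longrightarrow> g s \<in> S" "\<And>s. s \<in> {0..1} - {t} \<Longrightarrow> exp (h (g s)) = exp (q s)"
    and l: "isCont l (g t)" and \<eta>: "0 < \<eta>"
    and x: "\<And>s. t - \<eta> < s \<Longrightarrow> s < t \<Longrightarrow> h (g s) = l (g s) + cx"
    and y: "\<And>s. t < s \<Longrightarrow> s < t + \<eta> \<Longrightarrow> h (g s) = l (g s) + cy"
  shows "cx - cy = q 1 - q 0"
proof -
  have hq: "continuous_on T (\<lambda>s. h (g s) - q s)" if T: "T \<subseteq> {0..1} - {t}" for T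
  proof -
    have T': "T \<subseteq> {0..1}" using T by blast
    show ?thesis
      by (rule continuous_on_diff[OF continuous_on_compose2[OF h(1) continuous_on_subset[OF g(1) T']] continuous_on_subset[OF q T']])
         (use h(2) T in blast)
  qed
  have ex: "exp (h (g s) - q s) = 1" if "s \<in> {0..1} - {t}" for s using h(3)[OF that] by (simp add: exp_diff)
  have s1: "{0..<t} \<subseteq> {0..1} - {t}" "{t<..1} \<subseteq> {0..1} - {t}" using t by auto
  have co: "connected {0..<t}" "connected {t<..1}" by (intro convex_connected convex_real_interval)+
  obtain C1 where C1: "\<And>s. s \<in> {0..<t} \<Longrightarrow> h (g s) - q s = C1"
    using continuous_exp_constant[OF co(1) hq[OF s1(1)] ex[OF subsetD[OF s1(1)]]] by blast
  obtain C2 where C2: "\<And>s. s \<in> {t<..1} \<Longrightarrow> h (g s) - q s = C2"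
    using continuous_exp_constant[OF co(2) hq[OF s1(2)] ex[OF subsetD[OF s1(2)]]] by blast
  have ti: "t \<in> interior {0..1}" using t by simp
  have ct: "isCont g t" "isCont q t" using continuous_on_interior[OF g(1) ti] continuous_on_interior[OF q ti] by auto
  have lim: "((\<lambda>s. l (g s) - q s) \<longlongrightarrow> l (g t) - q t) (at t within A)" for A
    using isCont_tendsto_compose[OF l isContD[OF ct(1)]] isContD[OF ct(2)]
    by (intro tendsto_diff) (blast intro: tendsto_mono[OF at_le[OF subset_UNIV]])+
  have "\<forall>\<^sub>F s in at_left t. s \<in> {max 0 (t - \<eta>)<..<t}" using t \<eta> by (intro eventually_at_left_real) auto
  then have "\<forall>\<^sub>F s in at_left t. l (g s) - q s = C1 - cx"
  proof eventually_elim
    case (elim s) then show ?case using C1[of s] x[of s] by (auto simp: algebra_simps)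
  qed
  from tendsto_unique[OF trivial_limit_at_left_real lim tendsto_eventually[OF this]] have 1: "l (g t) - q t = C1 - cx" .
  have "\<forall>\<^sub>F s in at_right t. s \<in> {t<..<min 1 (t + \<eta>)}" using t \<eta> by (intro eventually_at_right_real) auto
  then have "\<forall>\<^sub>F s in at_right t. l (g s) - q s = C2 - cy"
  proof eventually_elim
    case (elim s) then show ?case using C2[of s] y[of s] by (auto simp: algebra_simps)
  qed
  from tendsto_unique[OF trivial_limit_at_right_real lim tendsto_eventually[OF this]] have 2: "l (g t) - q t = C2 - cy" .
  have "C1 = h (g 0) - q 0" "C2 = h (g 0) - q 1" using C1[of 0] C2[of 1] t g(2) by simp_all
  moreover have "cx - cy = C1 - C2" using 1 2 by (simp add: algebra_simps)
  ultimately show ?thesis by simp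
qed

context heun_rh
begin

text \<open>A set that avoids the loop leads from \<open>z\<close> to the base point and
  \<open>ell_inf\<close> on to infinity, where the winding number is 0.\<close>

lemma winding_number_off_loop:
  assumes g: "path g" "pathfinish g = pathstart g" and S: "connected S" "b0 \<in> S" "S \<inter> path_image g = {}"
    and inf: "ell_inf_img \<Gamma> \<inter> path_image g = {}" and z: "z \<in> S"
  shows "winding_number g z = 0"
proof -
  obtain B where B: "\<And>z. B \<le> norm z \<Longrightarrow> winding_number g z = 0" using winding_number_zero_at_infinity[OF g] by blast
  obtain T where T: "\<And>t. t \<le> T \<Longrightarrow> B < norm (ell_inf \<Gamma> t)" by (rule inf_escapes[of B]) blast
  define w where "w = ell_inf \<Gamma> (min T 0)"
  have w: "w \<in> ell_inf_img \<Gamma>" "winding_number g w = 0"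
    using T[of "min T 0"] B[of w] by (auto simp: w_def ell_inf_img_def)
  have "connected (ell_inf_img \<Gamma>)" unfolding ell_inf_img_def
    by (intro connected_continuous_image inf_cont convex_connected convex_real_interval)
  then have c: "connected (S \<union> ell_inf_img \<Gamma>)" using S(1,2) base_in_inf by (intro connected_Un) auto
  have "(S \<union> ell_inf_img \<Gamma>) \<inter> path_image g = {}" using S(3) inf by blast
  from winding_number_eq[OF g _ _ c this, of z w] show ?thesis using z w by simp
qed

text \<open>\<open>loop_around\<close> does not say in which direction the arc is crossed. The
  change of a logarithm along the loop is 2 pi i times a winding number, and this forces the
  crossing to go from left to right. There \<open>\<Psi>\<close> continues by its jump relation, and
  the continuation of \<open>K j\<close> exceeds \<open>K j\<close> by 2 pi i, which produces the
  scalar factor.\<close>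

lemma loop_continuation:
  assumes K: "\<And>j. log_branch (D_inf a \<Gamma>) (sing a j) (K j)" and loop: "loop_around a \<Gamma> j g"
  shows "continues_along g (u_fun \<alpha> K \<Psi> k)
    (\<lambda>z. exp (2 * of_real pi * \<i> * \<alpha> j) * (u_fun \<alpha> K \<Psi> 1 z * M j $ 1 $ k + u_fun \<alpha> K \<Psi> 2 z * M j $ 2 $ k))"
proof -
  have g: "path g" "pathfinish g = pathstart g" using loop unfolding loop_around_def by blast+
  obtain t where t: "0 < t" "t < 1" and gt: "g t \<in> ell_img \<Gamma> j" "g t \<noteq> b0" "g t \<notin> cball (sing a j) (rad \<Gamma> j)"
    and gD: "\<And>s. s \<in> {0..1} - {t} \<Longrightarrow> g s \<in> D_inf a \<Gamma>" using loop unfolding loop_around_def by auto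
  have wind: "\<And>z. z \<in> disc a \<Gamma> j \<Longrightarrow> winding_number g z = 1" using loop unfolding loop_around_def by blast
  define w where "w = g t"
  have subC: "ell_img \<Gamma> i \<subseteq> C" "ell_inf_img \<Gamma> \<subseteq> C" for i unfolding gamma_def by blast+
  have DC: "z \<notin> C" if "z \<in> D_inf a \<Gamma>" for z using D_inf_subset that by blast
  have pim: "path_image g \<subseteq> insert w (D_inf a \<Gamma>)"
  proof
    fix x assume "x \<in> path_image g"
    then obtain s where s: "s \<in> {0..1}" "x = g s" unfolding path_image_def by blast
    then show "x \<in> insert w (D_inf a \<Gamma>)" using gD[of s] unfolding w_def by (cases "s = t") auto
  qed
  have wk: "w \<notin> ell_img \<Gamma> i" if "i \<noteq> j" for i using ell_Int[OF that] gt(1,2) unfolding w_def by blast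
  have wi: "w \<notin> ell_inf_img \<Gamma>" using ell_inf_Int[of j] gt(1,2) unfolding w_def by blast
  have offk: "ell_img \<Gamma> i \<inter> path_image g = {}" if "i \<noteq> j" for i using pim wk[OF that] subC(1) DC by blast
  have offi: "ell_inf_img \<Gamma> \<inter> path_image g = {}" using pim wi subC(2) DC by blast
  have w_cb: "w \<notin> cball (sing a i) (rad \<Gamma> i)" for i
    using gt(1,3) ell_not_in_cball[of i j] unfolding w_def by (cases "i = j") auto
  have w_s: "w \<noteq> sing a i" for i using w_cb[of i] rad_pos[of i] by (metis centre_in_cball less_imp_le)
  have s_off: "sing a i \<notin> path_image g" for i using pim w_s[of i] DC sing_in_ell[of i] subC(1)[of i] by blast
  have b_off: "b0 \<notin> path_image g" using offi base_in_inf by blast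
  have wb: "winding_number g b0 = 0"
    by (rule winding_number_off_loop[OF g, of "{b0}"]) (use b_off offi in auto)
  have ws: "winding_number g (sing a i) = (if i = j then 1 else 0)" for i
  proof (cases "i = j")
    case True
    then show ?thesis using wind[of "sing a j"] rad_pos[of j] by (simp add: disc_def)
  next
    case False
    have "connected (ell_img \<Gamma> i)" unfolding ell_img_def
      by (intro connected_continuous_image ell_cont convex_connected convex_real_interval)
    then have "winding_number g (sing a i) = 0"
      by (rule winding_number_off_loop[OF g _ base_in_ell offk[OF False] offi sing_in_ell])
    then show ?thesis using False by simp
  qed
  obtain \<tau> where \<tau>: "\<tau> \<in> {0..1}" "w = ell \<Gamma> j \<tau>" using gt(1) unfolding w_def ell_img_def by blast
  have "\<tau> \<noteq> 0" using \<tau>(2) gt(2) ell_0 unfolding w_def by auto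
  moreover have "\<tau> \<noteq> 1" using \<tau>(2) w_s[of j] ell_1 by auto
  ultimately have \<tau>1: "\<tau> \<in> {0<..<1}" using \<tau>(1) by auto
  \<comment> \<open>A ball of this radius contains neither the base point nor a singular point, so
    all the logarithms exist in it.\<close>
  define r where "r = Min (insert (dist w b0) (range (\<lambda>i. dist w (sing a i))))"
  have r: "0 < r" unfolding r_def using gt(2) w_s by (subst Min_gr_iff) (auto simp: w_def)
  have rb: "z \<noteq> b0" "z \<noteq> sing a i" if "z \<in> ball w r" for z i
  proof -
    have "r \<le> dist w b0" "r \<le> dist w (sing a i)" unfolding r_def by (intro Min_le; simp)+
    then show "z \<noteq> b0" "z \<noteq> sing a i" using that by auto
  qed
  define V where "V = ball w r \<inter> (\<Inter>i. - cball (sing a i) (rad \<Gamma> i))"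
  have oV: "open V" unfolding V_def by (intro open_Int open_ball open_INT) (auto simp: open_Compl)
  have wV: "ell \<Gamma> j \<tau> \<in> V" unfolding V_def \<tau>(2)[symmetric] using r w_cb by auto
  have nc: "ell \<Gamma> j \<tau> \<notin> circ a \<Gamma> j" using w_cb[of j] circ_sub_cball[of j] unfolding \<tau>(2) by blast
  have "0 < min \<tau> (1 - \<tau>)" using \<tau>1 by auto
  then obtain \<epsilon> U Up Um where box: "arc_box (ell \<Gamma> j) \<tau> \<epsilon> U Up Um" "\<epsilon> < min \<tau> (1 - \<tau>)" "U \<subseteq> V" "U - C = Up \<union> Um"
    using arc_at_ell[OF \<tau>1 nc] oV wV unfolding arc_at_def by meson
  note bD = arc_boxD[OF box(1)]
  have UD: "U - C \<subseteq> D_inf a \<Gamma>"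
  proof
    fix z assume z: "z \<in> U - C"
    then have "z \<notin> cball (sing a i) (rad \<Gamma> i)" for i using box(3) unfolding V_def by blast
    then have "z \<notin> disc a \<Gamma> i" for i unfolding disc_def using ball_subset_cball by blast
    then show "z \<in> D_inf a \<Gamma>" using z unfolding D_inf_def by blast
  qed
  have UpD: "Up \<subseteq> D_inf a \<Gamma>" "Um \<subseteq> D_inf a \<Gamma>" using UD box(4) by blast+
  have Ub: "U \<subseteq> ball w r" using box(3) unfolding V_def by blast
  have UpU: "Up \<subseteq> U" "Um \<subseteq> U" using box(4) by blast+
  have \<tau>I: "\<tau> \<in> {\<tau>-\<epsilon><..<\<tau>+\<epsilon>}" using bD(1) by simp
  then have wU: "w \<in> U" using bD(8) unfolding \<tau>(2) by blast
  have logs: "\<exists>l. l holomorphic_on ball w r \<and> (\<forall>z\<in>ball w r. exp (l z) = z - s)" if "\<And>z. z \<in> ball w r \<Longrightarrow> z \<noteq> s" for s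
  proof -
    have "(\<lambda>z. z - s) holomorphic_on ball w r" by (intro holomorphic_intros)
    moreover have "z - s \<noteq> 0" if "z \<in> ball w r" for z using \<open>\<And>z. z \<in> ball w r \<Longrightarrow> z \<noteq> s\<close>[OF that] by simp
    ultimately obtain l where "l holomorphic_on ball w r" "\<And>z. z \<in> ball w r \<Longrightarrow> exp (l z) = z - s"
      using log_on_ball[of "\<lambda>z. z - s" w r] by metis
    then show ?thesis by blast
  qed
  obtain lb where lb: "lb holomorphic_on ball w r" "\<And>z. z \<in> ball w r \<Longrightarrow> exp (lb z) = z - b0" using logs[OF rb(1)] by blast
  have "\<exists>l. l holomorphic_on ball w r \<and> (\<forall>z\<in>ball w r. exp (l z) = z - sing a i)" for i by (rule logs[OF rb(2)])
  then obtain l where l: "\<And>i. l i holomorphic_on ball w r" "\<And>i z. z \<in> ball w r \<Longrightarrow> exp (l i z) = z - sing a i" by metis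
  have wr: "w \<in> ball w r" using r by simp
  have cont: "isCont f w" if "f holomorphic_on ball w r" for f
    using holomorphic_on_imp_continuous_on[OF that] wr continuous_on_eq_continuous_at[OF open_ball] by blast
  obtain \<eta> where \<eta>: "0 < \<eta>" "\<eta> \<le> t" "\<eta> \<le> 1 - t" and gU: "\<And>s. \<bar>s - t\<bar> < \<eta> \<Longrightarrow> g s \<in> U"
  proof -
    have gc: "continuous_on {0..1} g" using g(1) unfolding path_def .
    have "t \<in> interior {0..1}" using t by simp
    then have "isCont g t" using continuous_on_interior[OF gc] by blast
    then have "\<forall>\<^sub>F s in nhds t. g s \<in> U"
      using topological_tendstoD[OF _ bD(2)] wU unfolding isCont_def w_def tendsto_at_iff_tendsto_nhds by blast
    then obtain d where d: "d > 0" "\<And>s. dist s t < d \<Longrightarrow> g s \<in> U" unfolding eventually_nhds_metric by blast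
    define e where "e = min d (min t (1 - t))"
    have e: "0 < e" "e \<le> t" "e \<le> 1 - t" "e \<le> d" using d(1) t by (auto simp: e_def)
    show ?thesis
    proof (rule that[of e])
      show "g s \<in> U" if "\<bar>s - t\<bar> < e" for s using that e(4) by (intro d(2)) (simp add: dist_real_def)
    qed (use e in auto)
  qed
  have side: "g ` I \<subseteq> Up \<or> g ` I \<subseteq> Um" if I: "connected I" "I \<subseteq> {t-\<eta><..<t+\<eta>} - {t}" for I
  proof -
    have I1: "I \<subseteq> {0..1} - {t}" using I(2) \<eta> by auto
    have "continuous_on I g" using g(1) I1 unfolding path_def by (meson Diff_subset continuous_on_subset order_trans)
    then have c: "connected (g ` I)" using I(1) by (rule connected_continuous_image)
    have "g ` I \<subseteq> Up \<union> Um" using gU gD I(2) I1 DC unfolding box(4)[symmetric] by (force simp: abs_less_iff)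
    then show ?thesis using connectedD[OF c bD(3,4)] bD(7) by blast
  qed
  have ci: "connected {t-\<eta><..<t}" "connected {t<..<t+\<eta>}" by (intro convex_connected convex_real_interval)+
  have sl: "g ` {t-\<eta><..<t} \<subseteq> Up \<or> g ` {t-\<eta><..<t} \<subseteq> Um" using ci(1) \<eta> by (intro side) auto
  have sr: "g ` {t<..<t+\<eta>} \<subseteq> Up \<or> g ` {t<..<t+\<eta>} \<subseteq> Um" using ci(2) \<eta> by (intro side) auto
  have gc: "continuous_on {0..1} g" "g 1 = g 0" using g unfolding path_def pathfinish_def pathstart_def by auto
  have qex: "\<exists>q. continuous_on {0..1} q \<and> q 1 - q 0 = 2 * of_real pi * \<i> * winding_number g s \<and> (\<forall>x\<in>{0..1}. g x = s + exp (q x))"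
    if off: "s \<notin> path_image g" for s
  proof -
    obtain q where "path q" "pathfinish q - pathstart q = 2 * of_real pi * \<i> * winding_number g s" "\<And>x. x \<in> {0..1} \<Longrightarrow> g x = s + exp (q x)"
      using winding_number_as_continuous_log[OF g(1) off] by blast
    then show ?thesis unfolding path_def pathfinish_def pathstart_def by blast
  qed
  obtain qb where qb: "continuous_on {0..1} qb" "qb 1 - qb 0 = 0" "\<And>x. x \<in> {0..1} \<Longrightarrow> g x = b0 + exp (qb x)"
    using qex[OF b_off] unfolding wb by auto
  obtain q where q: "\<And>i. continuous_on {0..1} (q i)" "\<And>i. q i 1 - q i 0 = 2 * of_real pi * \<i> * (if i = j then 1 else 0)"
    "\<And>i x. x \<in> {0..1} \<Longrightarrow> g x = sing a i + exp (q i x)"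
    using qex[OF s_off] unfolding ws by metis
  have locconst: "\<exists>c. \<forall>z\<in>X. h z = f z + c"
    if "connected X" "continuous_on X h" "continuous_on X f" "\<And>z. z \<in> X \<Longrightarrow> exp (h z) = exp (f z)" for X and h f :: "complex \<Rightarrow> complex"
    using log_branches_differ[OF that] by metis
  have cl: "continuous_on Up f" "continuous_on Um f" if "f holomorphic_on ball w r" for f
    using UpU Ub holomorphic_on_imp_continuous_on[OF that] by (meson continuous_on_subset order_trans)+
  have UpE: "z \<in> ball w r" "z \<notin> ell_img \<Gamma> j" "z \<in> D_inf a \<Gamma>" if "z \<in> Up \<union> Um" for z
    using that UpU Ub UpD DC subC(1) by blast+
  have lj: "(\<lambda>z. l j z - lb z) holomorphic_on ball w r" by (intro holomorphic_intros l lb)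
  have eL: "exp (\<Lambda> j z) = exp (l j z - lb z)" if z: "z \<in> Up \<union> Um" for z
    unfolding exp_diff exp_\<Lambda>[OF UpE(2)[OF z]] l(2)[OF UpE(1)[OF z]] lb(2)[OF UpE(1)[OF z]]
    by (metis minus_diff_eq minus_divide_divide)
  have cLj: "continuous_on Up (\<Lambda> j)" "continuous_on Um (\<Lambda> j)"
    using UpE(2) by (auto intro!: continuous_on_subset[OF cont_\<Lambda>])
  obtain cu where cu: "\<And>z. z \<in> Up \<Longrightarrow> \<Lambda> j z = (l j z - lb z) + cu"
    using locconst[OF bD(5) cLj(1) cl(1)[OF lj]] eL by blast
  obtain cd where cd: "\<And>z. z \<in> Um \<Longrightarrow> \<Lambda> j z = (l j z - lb z) + cd"
    using locconst[OF bD(6) cLj(2) cl(2)[OF lj]] eL by blast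
  have jump: "cu - cd = 2 * of_real pi * \<i>"
  proof (rule normal_jump_unique[OF _ \<Lambda>_jump[OF \<tau>1]])
    show "normal_jump (ell \<Gamma> j \<tau>) (vector_derivative (ell \<Gamma> j) (at \<tau>)) (\<Lambda> j) (cu - cd)"
      by (rule normal_jump_box[OF box(1) \<tau>I cont[OF lj, unfolded \<tau>(2)] cu cd])
  qed
  have gDs: "g s \<in> - ell_img \<Gamma> j" if "s \<in> {0..1} - {t}" for s using gD[OF that] DC subC(1) by blast
  have eLg: "exp (\<Lambda> j (g s)) = exp (q j s - qb s)" if s: "s \<in> {0..1} - {t}" for s
  proof -
    have "exp (q j s) = g s - sing a j" "exp (qb s) = g s - b0" using q(3)[of s j] qb(3)[of s] s by (auto simp: algebra_simps)
    then show ?thesis unfolding exp_diff using exp_\<Lambda>[of "g s" j] gDs[OF s] by (metis ComplD minus_diff_eq minus_divide_divide)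
  qed
  \<comment> \<open>\<open>\<Lambda> j\<close> is a logarithm of a quotient, so its change along the
    loop comes from the difference of the winding numbers around \<open>sing a j\<close> and the
    base point, 1 and 0.\<close>
  have change: "cx - cy = 2 * of_real pi * \<i>"
    if "\<And>z. z \<in> g ` {t-\<eta><..<t} \<Longrightarrow> \<Lambda> j z = (l j z - lb z) + cx" "\<And>z. z \<in> g ` {t<..<t+\<eta>} \<Longrightarrow> \<Lambda> j z = (l j z - lb z) + cy" for cx cy
  proof -
    have "cx - cy = (q j 1 - qb 1) - (q j 0 - qb 0)"
      by (rule loop_log_change[OF gc t continuous_on_diff[OF q(1) qb(1)] cont_\<Lambda> gDs eLg cont[OF lj, unfolded w_def] \<eta>(1)]) (use that in auto)
    also have "\<dots> = (q j 1 - q j 0) - (qb 1 - qb 0)" by simp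
    finally show ?thesis unfolding q(2) qb(2) by simp
  qed
  \<comment> \<open>Being on one side before and after gives the change 0, crossing from right to
    left gives minus 2 pi i; only crossing from left to right agrees with
    \<open>change\<close>.\<close>
  have X: "g ` {t-\<eta><..<t} \<subseteq> Up" "g ` {t<..<t+\<eta>} \<subseteq> Um"
  proof -
    have p: "2 * of_real pi * \<i> \<noteq> (0::complex)" "2 * of_real pi * \<i> \<noteq> - (2 * of_real pi * \<i> :: complex)" by auto
    have 1: "\<not> (g ` {t-\<eta><..<t} \<subseteq> Um \<and> g ` {t<..<t+\<eta>} \<subseteq> Um)"
    proof
      assume "g ` {t-\<eta><..<t} \<subseteq> Um \<and> g ` {t<..<t+\<eta>} \<subseteq> Um"
      then have "cd - cd = 2 * of_real pi * \<i>" using cd by (intro change) auto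
      then show False using p(1) by simp
    qed
    have 2: "\<not> (g ` {t-\<eta><..<t} \<subseteq> Up \<and> g ` {t<..<t+\<eta>} \<subseteq> Up)"
    proof
      assume "g ` {t-\<eta><..<t} \<subseteq> Up \<and> g ` {t<..<t+\<eta>} \<subseteq> Up"
      then have "cu - cu = 2 * of_real pi * \<i>" using cu by (intro change) auto
      then show False using p(1) by simp
    qed
    have 3: "\<not> (g ` {t-\<eta><..<t} \<subseteq> Um \<and> g ` {t<..<t+\<eta>} \<subseteq> Up)"
    proof
      assume "g ` {t-\<eta><..<t} \<subseteq> Um \<and> g ` {t<..<t+\<eta>} \<subseteq> Up"
      then have "cd - cu = 2 * of_real pi * \<i>" using cu cd by (intro change) auto
      then show False using jump p(2) by (metis minus_diff_eq)
    qed
    show "g ` {t-\<eta><..<t} \<subseteq> Up" "g ` {t<..<t+\<eta>} \<subseteq> Um" using sl sr 1 2 3 by blast+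
  qed
  have Kh: "K i holomorphic_on D_inf a \<Gamma>" and Ke: "\<And>z. z \<in> D_inf a \<Gamma> \<Longrightarrow> exp (K i z) = z - sing a i" for i
    using K[of i] unfolding log_branch_def by blast+
  have cK: "continuous_on (D_inf a \<Gamma>) (K i)" for i by (rule holomorphic_on_imp_continuous_on[OF Kh])
  have eK: "exp (K i z) = exp (l i z)" if z: "z \<in> Up \<union> Um" for z i
    using Ke[OF UpE(3)[OF z]] l(2)[OF UpE(1)[OF z]] by simp
  have "\<exists>c. \<forall>z\<in>Up. K i z = l i z + c" for i
    using locconst[OF bD(5) continuous_on_subset[OF cK UpD(1)] cl(1)[OF l(1)]] eK by blast
  then obtain ku where ku: "\<And>i z. z \<in> Up \<Longrightarrow> K i z = l i z + ku i" by metis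
  have "\<exists>c. \<forall>z\<in>Um. K i z = l i z + c" for i
    using locconst[OF bD(6) continuous_on_subset[OF cK UpD(2)] cl(2)[OF l(1)]] eK by blast
  then obtain kd where kd: "\<And>i z. z \<in> Um \<Longrightarrow> K i z = l i z + kd i" by metis
  have kk: "ku i = kd i + (if i = j then 2 * of_real pi * \<i> else 0)" for i
  proof -
    have e: "exp (K i (g s)) = exp (q i s)" if "s \<in> {0..1} - {t}" for s using Ke[OF gD[OF that], of i] q(3)[of s i] that by simp
    have "ku i - kd i = q i 1 - q i 0"
    proof (rule loop_log_change[OF gc t q(1) cK gD e cont[OF l(1)[of i], unfolded w_def] \<eta>(1)])
      show "K i (g s) = l i (g s) + ku i" if "t - \<eta> < s" "s < t" for s using X(1) that by (intro ku) auto
      show "K i (g s) = l i (g s) + kd i" if "t < s" "s < t + \<eta>" for s using X(2) that by (intro kd) auto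
    qed
    then show ?thesis unfolding q(2) by (auto simp: algebra_simps)
  qed
  define Ex where "Ex = (\<lambda>z. exp (\<alpha> 1 * K 1 z) * exp (\<alpha> 2 * K 2 z) * exp (\<alpha> 3 * K 3 z))"
  \<comment> \<open>The continuation of the prefactor \<open>Ex\<close> from the left side to the
    whole ball.\<close>
  define Eu where "Eu = (\<lambda>z. exp (\<alpha> 1 * (l 1 z + ku 1)) * exp (\<alpha> 2 * (l 2 z + ku 2)) * exp (\<alpha> 3 * (l 3 z + ku 3)))"
  have EuUp: "Eu z = Ex z" if "z \<in> Up" for z unfolding Eu_def Ex_def ku[OF that] ..
  have EuUm: "Eu z = exp (2 * of_real pi * \<i> * \<alpha> j) * Ex z" if "z \<in> Um" for z
  proof -
    have "Eu z = exp ((\<alpha> 1 * (l 1 z + ku 1) + \<alpha> 2 * (l 2 z + ku 2)) + \<alpha> 3 * (l 3 z + ku 3))" unfolding Eu_def exp_add ..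
    also have "(\<alpha> 1 * (l 1 z + ku 1) + \<alpha> 2 * (l 2 z + ku 2)) + \<alpha> 3 * (l 3 z + ku 3) =
        2 * of_real pi * \<i> * \<alpha> j + ((\<alpha> 1 * (l 1 z + kd 1) + \<alpha> 2 * (l 2 z + kd 2)) + \<alpha> 3 * (l 3 z + kd 3))"
      unfolding kk using exhaust_3[of j] by (auto simp: algebra_simps)
    finally show ?thesis unfolding Ex_def kd[OF that] exp_add .
  qed
  have jumps: "has_jump \<Psi> (ell \<Gamma> j) s (M j)" if s: "s \<in> {\<tau>-\<epsilon><..<\<tau>+\<epsilon>}" for s
  proof (rule jump_outer)
    show "s \<in> {0<..<1}" using s box(2) by auto
    have "ell \<Gamma> j s \<in> U" using bD(8) s by blast
    then show "ell \<Gamma> j s \<notin> cball (sing a j) (rad \<Gamma> j)" using box(3) unfolding V_def by blast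
  qed
  define N where "N z = (if z \<in> Up then mat 1 else M j)" for z
  have NUm: "N z = M j" if "z \<in> Um" for z using that bD(7) unfolding N_def by auto
  obtain A where A: "mholo U A" "\<And>z. z \<in> Up \<union> Um \<Longrightarrow> \<Psi> z ** N z = A z"
    by (rule arc_box_jump_extension[OF box(1) box_holo[OF box(4)] jumps, of "\<lambda>_. mat 1" "\<lambda>_. M j" N])
       (use NUm in \<open>auto simp: N_def mholo_const\<close>)
  define H where "H = (\<lambda>z. exp (2 * of_real pi * \<i> * \<alpha> j) * (u_fun \<alpha> K \<Psi> 1 z * M j $ 1 $ k + u_fun \<alpha> K \<Psi> 2 z * M j $ 2 $ k))"
  have uE: "u_fun \<alpha> K \<Psi> i z = Ex z * \<Psi> z $ 1 $ i" for i z unfolding u_fun_def Ex_def ..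
  define G where "G = (\<lambda>z. Eu z * A z $ 1 $ k)"
  have GUp: "G z = u_fun \<alpha> K \<Psi> k z" if "z \<in> Up" for z
    using A(2)[of z] that by (simp add: G_def uE EuUp N_def)
  have GUm: "G z = H z" if "z \<in> Um" for z
  proof -
    have "A z = \<Psi> z ** M j" using A(2)[of z] that NUm by simp
    then show ?thesis by (simp add: G_def H_def uE EuUm[OF that] mm2 algebra_simps)
  qed
  have hu: "u_fun \<alpha> K \<Psi> i holomorphic_on D_inf a \<Gamma>" for i
    unfolding u_fun_def[abs_def] by (intro holomorphic_intros Kh holomorphic_on_subset[OF rh_holo D_inf_subset])
  have hH: "H holomorphic_on D_inf a \<Gamma>" unfolding H_def by (intro holomorphic_intros hu)
  have hG: "G holomorphic_on U" unfolding G_def Eu_def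
    using A(1) unfolding mholo_def by (intro holomorphic_intros holomorphic_on_subset[OF l(1) Ub]) auto
  \<comment> \<open>Three functions represent all germs: the original before the crossing, the local
    continuation \<open>G\<close> at it, and the target \<open>H\<close> after it.\<close>
  define F where "F s = (if s < t then u_fun \<alpha> K \<Psi> k else if s = t then G else H)" for s :: real
  show ?thesis unfolding continues_along_def H_def[symmetric]
  proof (intro exI[of _ F] conjI ballI)
    fix s :: real assume s: "s \<in> {0..1}"
    show "F s analytic_on {g s}"
    proof (cases "s = t")
      case True
      have "G analytic_on {g t}" using holomorphic_on_imp_analytic_at[OF hG bD(2)] wU unfolding w_def by blast
      then show ?thesis using True by (simp add: F_def)
    next
      case False
      then have "g s \<in> D_inf a \<Gamma>" using s gD by blast
      then have "u_fun \<alpha> K \<Psi> k analytic_on {g s}" "H analytic_on {g s}"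
        using holomorphic_on_imp_analytic_at[OF hu open_D_inf] holomorphic_on_imp_analytic_at[OF hH open_D_inf] by blast+
      then show ?thesis using False by (simp add: F_def)
    qed
    consider "s < t" | "s = t" | "t < s" by linarith
    then show "\<forall>\<^sub>F s' in at s within {0..1}. \<forall>\<^sub>F z in nhds (g s'). F s' z = F s z"
    proof cases
      case 1
      have "\<forall>\<^sub>F s' in nhds s. s' < t" using 1 by (intro eventually_nhds_in_open[of "{..<t}", simplified]) auto
      then have "\<forall>\<^sub>F s' in at s within {0..1}. s' < t" by (simp add: eventually_at_filter eventually_mono)
      then show ?thesis by eventually_elim (use 1 in \<open>simp add: F_def\<close>)
    next
      case 3
      have "\<forall>\<^sub>F s' in nhds s. t < s'" using 3 by (intro eventually_nhds_in_open[of "{t<..}", simplified]) auto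
      then have "\<forall>\<^sub>F s' in at s within {0..1}. t < s'" by (simp add: eventually_at_filter eventually_mono)
      then show ?thesis by eventually_elim (use 3 in \<open>simp add: F_def\<close>)
    next
      case 2
      have "\<forall>\<^sub>F s' in nhds t. s' \<in> {t-\<eta><..<t+\<eta>}" using \<eta>(1) by (intro eventually_nhds_in_open) auto
      then have "\<forall>\<^sub>F s' in at s within {0..1}. s' \<in> {t-\<eta><..<t+\<eta>}" unfolding 2 by (simp add: eventually_at_filter eventually_mono)
      then show ?thesis
      proof eventually_elim
        case (elim s')
        consider "s' < t" | "s' = t" | "t < s'" by linarith
        then show ?case
        proof cases
          case 1
          then have "g s' \<in> Up" using X(1) elim by auto
          from eventually_nhds_in_open[OF bD(3) this] show ?thesis
            by eventually_elim (use 1 2 GUp in \<open>simp add: F_def\<close>)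
        next
          case 3
          then have "g s' \<in> Um" using X(2) elim by auto
          from eventually_nhds_in_open[OF bD(4) this] show ?thesis
            by eventually_elim (use 3 2 GUm in \<open>simp add: F_def\<close>)
        qed (use 2 in simp)
      qed
    qed
  qed (use t in \<open>simp_all add: F_def\<close>)
qed

end

theorem proposition3p6:
  fixes a \<delta> :: complex and \<alpha> :: "3 \<Rightarrow> complex"
    and \<Gamma> :: graph_data and E :: "3 \<Rightarrow> complex^2^2"
    and L :: "complex \<Rightarrow> complex" and K :: "3 \<Rightarrow> complex \<Rightarrow> complex"
    and \<Psi> :: "complex \<Rightarrow> complex^2^2"
  assumes "a \<notin> {0, 1}"
    and "2 * \<delta> \<notin> \<int>" and "\<And>j. 2 * \<alpha> j \<notin> \<int>"
    and "rh_graph a \<Gamma>"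
    and "\<And>j. det (E j) = 1"
    and "M_mat \<alpha> E 1 ** M_mat \<alpha> E 2 ** M_mat \<alpha> E 3 = M_inf \<delta>"
    and "log_branch_at_infinity \<Gamma> L"
    and "\<And>j. log_branch (D_inf a \<Gamma>) (sing a j) (K j)"
    and "rh_solution a \<Gamma> \<alpha> \<delta> E L \<Psi>"
  shows "\<exists>d\<^sub>1 b\<^sub>3 \<mu> \<nu>.
      ((\<lambda>z. z * infinity_defect \<delta> L \<Psi> z $ 1 $ 1) \<longlongrightarrow> d\<^sub>1) (infinity_off a \<Gamma>) \<and>
      b\<^sub>3 = \<delta> * (a + 1) - d\<^sub>1 \<and> \<mu> = heun_mu \<alpha> \<delta> \<and> \<nu> = heun_nu a \<alpha> \<delta> b\<^sub>3 \<and>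
      (\<forall>k. heun_solution a \<alpha> \<mu> \<nu> (D_inf a \<Gamma>) (u_fun \<alpha> K \<Psi> k)) \<and>
      ((\<exists>z\<in>D_inf a \<Gamma>. \<Psi> z $ 1 $ 2 \<noteq> 0) \<longrightarrow>
        heun_fundamental_system a \<alpha> \<mu> \<nu> (D_inf a \<Gamma>) (u_fun \<alpha> K \<Psi> 1) (u_fun \<alpha> K \<Psi> 2)) \<and>
      (\<forall>j g k. loop_around a \<Gamma> j g \<longrightarrow>
        continues_along g (u_fun \<alpha> K \<Psi> k)
          (\<lambda>z. exp (2 * of_real pi * \<i> * \<alpha> j) *
            (u_fun \<alpha> K \<Psi> 1 z * M_mat \<alpha> E j $ 1 $ k + u_fun \<alpha> K \<Psi> 2 z * M_mat \<alpha> E j $ 2 $ k)))"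
proof -
  interpret heun_rh a \<Gamma> \<delta> \<alpha> E L \<Psi>
    using assms by unfold_locales auto
  have a: "a \<noteq> 0" "a \<noteq> 1" using assms(1) by auto
  obtain d1 c \<kappa> e s where d1: "((\<lambda>z. z * infinity_defect \<delta> L \<Psi> z $ 1 $ 1) \<longlongrightarrow> d1) (infinity_off a \<Gamma>)"
    and p11: "\<And>z. z \<notin> gamma a \<Gamma> \<Longrightarrow> hq z * logder \<Psi> z $ 1 $ 1 = - \<delta> * z\<^sup>2 + (\<delta> * (a + 1) - d1) * z + c"
    and p12: "\<And>z. z \<notin> gamma a \<Gamma> \<Longrightarrow> hq z * logder \<Psi> z $ 1 $ 2 = \<kappa>"
    and p21: "\<And>z. z \<notin> gamma a \<Gamma> \<Longrightarrow> hq z * logder \<Psi> z $ 2 $ 1 = e + s * z"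
    and Q: "\<And>j z. z = sing a j \<Longrightarrow> (- \<delta> * z\<^sup>2 + (\<delta> * (a + 1) - d1) * z + c)\<^sup>2 + \<kappa> * (e + s * z) = (\<alpha> j * hqj j z)\<^sup>2"
    by (rule connection_polynomials) blast
  let ?b = "\<delta> * (a + 1) - d1"
  have sol: "heun_solution a \<alpha> (heun_mu \<alpha> \<delta>) (heun_nu a \<alpha> \<delta> ?b) (D_inf a \<Gamma>) (u_fun \<alpha> K \<Psi> k)" for k
    by (rule heun_solution_u_fun[OF a assms(8) p11 p12 p21 Q])
  have "heun_fundamental_system a \<alpha> (heun_mu \<alpha> \<delta>) (heun_nu a \<alpha> \<delta> ?b) (D_inf a \<Gamma>) (u_fun \<alpha> K \<Psi> 1) (u_fun \<alpha> K \<Psi> 2)"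
    if "z0 \<in> D_inf a \<Gamma>" "\<Psi> z0 $ 1 $ 2 \<noteq> 0" for z0
    unfolding heun_fundamental_system_def using sol u_fun_independent[OF assms(2) p11 p12 that] by blast
  then show ?thesis using d1 sol loop_continuation[OF assms(8)]
    by (intro exI[of _ d1] exI[of _ ?b] exI[of _ "heun_mu \<alpha> \<delta>"] exI[of _ "heun_nu a \<alpha> \<delta> ?b"]) blast
qed

end
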